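(* Let $k\in\{0,1,\ldots,d\}$ and let $F\subset\mathbb{R}^d$ be the self-similar set generated by contracting similarities $S_1,\ldots,S_N$ with contraction ratios $r_1,\ldots,r_N$, with Hausdorff dimension $D$, satisfying the strong open set condition with respect to $\operatorname{int} J$. If $k\le d-2$, suppose additionally that $F$ is neighborhood regular. Let $\{A_F(x,\varepsilon): x\in F,\ 0<\varepsilon<\varepsilon_0\}$ be a locally homogeneous neighborhood net in $F$ with constants $a>1$ and $\varepsilon_0>0$, and let $b=\max\big(2a,\varepsilon_0^{-1}|J|\big)$. Then for $\mathcal{H}^D$-almost all $x\in F$ the average limit $$D_{C_k^{\rm frac}|F}(x):=\lim_{\delta\to 0}\frac{1}{|\ln\delta|}\int_\delta^{b^{-1}d(x,J^c)}\varepsilon^{-k}\,C_k\big(F(\varepsilon),A_F(x,\varepsilon)\big)\,\varepsilon^{-1}\,d\varepsilon$$ exists and equals the constant $$\mathcal{H}^D(F)^{-1}\Big(\sum_{j=1}^N r_j^D|\ln r_j|\Big)^{-1}\int_F\int_{b^{-1}d(y,(S_{y_1}J)^c)}^{b^{-1}d(y,J^c)}\varepsilon^{-k}\,C_k\big(F(\varepsilon),A_F(y,\varepsilon)\big)\,\varepsilon^{-1}\,d\varepsilon\,\mathcal{H}^D(dy),$$ provided, if $k\le d-2$, that the last integral converges absolutely; for $k\in\{d-1,d\}$ this absolute convergence always holds.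
   Context: **Basic notation.** $d(x,E)=\inf_{y\in E}|x-y|$, $|E|=\operatorname{diam}E$, $E^c$ is the complement of $E$ in $\mathbb{R}^d$, $B(x,r)$ is the closed ball, $\mathcal{H}^s$ is $s$-dimensional Hausdorff measure. **Self-similar sets.** $N\ge 2$; $S_1,\ldots,S_N$ are contracting similarities of $\mathbb{R}^d$ with ratios $r_1,\dots,r_N\in(0,1)$; $F$ is the unique nonempty compact set with $F=\bigcup_{j=1}^N S_j(F)$; $F_j:=S_j(F)$. The strong open set condition with respect to $\operatorname{int}J$ means: $J\subset\mathbb{R}^d$ is compact with $J=\overline{\operatorname{int}J}$, $\bigcup_j S_j(J)\subset J$, $S_j(\operatorname{int}J)\cap S_l(\operatorname{int}J)=\emptyset$ for $j\ne l$, and $F\cap\operatorname{int}J\neq\emptyset$. Then $D$ is determined by $\sum_{j=1}^N r_j^D=1$ and $0<\mathcal{H}^D(F)<\infty$. For $\mathcal{H}^D$-a.a. $y\in F$ there is exactly one $j$ with $y\in S_j(F)$, and this $j$ is denoted $y_1$. **Parallel sets and neighborhood regularity.** $K(\varepsilon):=\{x\in\mathbb{R}^d: d(x,K)\le\varepsilon\}$ and $\widetilde{K(\varepsilon)}:=\overline{K(\varepsilon)^c}$. $F$ is neighborhood regular if for Lebesgue-almost all $\varepsilon>0$ the set $\widetilde{F(\varepsilon)}$ has positive reach (in Federer's sense) and $\partial F(\varepsilon)$ is a Lipschitz manifold. **Curvature measures.** For a closed set $X$ of positive reach with metric projection $\Pi_X$, the (Lipschitz-Killing/Federer) curvature measures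 $C_0(X,\cdot),\dots,C_{d-1}(X,\cdot)$ are determined by the local Steiner formula: for bounded Borel $B$ and $0<r<\operatorname{reach}X$, $\mathcal{H}^d(\{z: 0<d(z,X)\le r,\ \Pi_X(z)\in B\})=\sum_{i=1}^d\omega_i r^i C_{d-i}(X,B)$, where $\omega_i$ is the volume of the unit ball of $\mathbb{R}^i$. For $k\le d-2$ and $\varepsilon$ as in the neighborhood regularity condition (almost all $\varepsilon$), $C_k(F(\varepsilon),\cdot):=(-1)^{d-1-k}C_k(\widetilde{F(\varepsilon)},\cdot)$, a finite signed measure. For all $\varepsilon>0$, $C_{d-1}(F(\varepsilon),\cdot):=\frac12\mathcal{H}^{d-1}(\partial F(\varepsilon)\cap\cdot)$, and $C_d(F(\varepsilon),\cdot)$ is Lebesgue measure restricted to $F(\varepsilon)$. **Locally homogeneous neighborhood net.** Given $a>1$, $\varepsilon_0>0$ and $b:=\max(2a,\varepsilon_0^{-1}|J|)$, this is a family of sets $\{A_F(x,\varepsilon):x\in F,\ 0<\varepsilon<\varepsilon_0\}$ such that (i) $A_F(x,\varepsilon)\subset\partial F(\varepsilon)\cap B(x,a\varepsilon)$; (ii) $A_F(x,\varepsilon)=S_j\big(A_F(S_j^{-1}x,r_j^{-1}\varepsilon)\big)$ whenever $1\le j\le N$, $x\in F_j$ and $\varepsilon<b^{-1}d(x,(S_jJ)^c)$ (this inequality implies $r_j^{-1}\varepsilon<\varepsilon_0$).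
   Formalization: It is additionally assumed, so that the integrals are defined, that every A_F(x,ε) is a Borel set and that (x,ε) ↦ C_k(F(ε),A_F(x,ε)) is jointly measurable (up to null sets) on F×(0,ε_0). *)

theory Defs
  imports "HOL-Analysis.Analysis"
begin

section \<open>Hausdorff measure and dimension\<close>

text \<open>
  Federer's normalisation: coverings are weighted by \<open>\<omega>\<^sub>s (|U|/2)\<^sup>s\<close>, so that the measure of dimension
  \<open>DIM('a)\<close> is Lebesgue measure and the one of dimension \<open>DIM('a) - 1\<close> is surface area.
  The case \<open>s = 0\<close> is separated because \<open>0 powr 0 = 0\<close>; diameters are only meaningful for
  bounded sets, hence the boundedness requirement on the coverings.
\<close>

definition hausdorff_weight :: "real \<Rightarrow> 'a::metric_space set \<Rightarrow> ennreal" where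
  "hausdorff_weight s U =
     (if U = {} then 0
      else ennreal (unit_ball_vol s * (if s = 0 then 1 else (diameter U / 2) powr s)))"

definition hausdorff_pre :: "real \<Rightarrow> real \<Rightarrow> 'a::metric_space set \<Rightarrow> ennreal" where
  "hausdorff_pre s \<delta> E =
     (INF U \<in> {U :: nat \<Rightarrow> 'a set. E \<subseteq> (\<Union>i. U i) \<and> (\<forall>i. bounded (U i) \<and> diameter (U i) \<le> \<delta>)}.
        \<Sum>i. hausdorff_weight s (U i))"

definition hausdorff_outer :: "real \<Rightarrow> 'a::metric_space set \<Rightarrow> ennreal" where
  "hausdorff_outer s E = (SUP \<delta>\<in>{0<..}. hausdorff_pre s \<delta> E)"

text \<open>The measurable sets are all Caratheodory measurable sets, so this measure is complete.\<close>

definition hausdorff_measure :: "real \<Rightarrow> 'a::metric_space measure" where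
  "hausdorff_measure s =
     measure_of UNIV (lambda_system UNIV (Pow UNIV) (hausdorff_outer s)) (hausdorff_outer s)"

definition hausdorff_dim :: "'a::metric_space set \<Rightarrow> real" where
  "hausdorff_dim E = Inf {s. 0 \<le> s \<and> hausdorff_outer s E = 0}"

lemma hausdorff_pre_empty: "0 < \<delta> \<Longrightarrow> hausdorff_pre s \<delta> {} = 0"
  unfolding hausdorff_pre_def
  by (intro antisym INF_lower2[of "\<lambda>_. {}"]) (auto simp: hausdorff_weight_def)

lemma hausdorff_pre_mono: "A \<subseteq> B \<Longrightarrow> hausdorff_pre s \<delta> A \<le> hausdorff_pre s \<delta> B"
  unfolding hausdorff_pre_def by (rule INF_superset_mono) auto

lemma hausdorff_pre_UN: "hausdorff_pre s \<delta> (\<Union>i. A i) \<le> (\<Sum>i. hausdorff_pre s \<delta> (A i :: 'a::metric_space set))"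
proof (rule ennreal_le_epsilon)
  fix e :: real
  assume "0 < e" and fin: "(\<Sum>i. hausdorff_pre s \<delta> (A i)) < top"
  then have lt: "hausdorff_pre s \<delta> (A n) < hausdorff_pre s \<delta> (A n) + e * (1/2) ^ Suc n" for n
    by (auto simp add: less_top dest!: ennreal_suminf_lessD)
  have "\<exists>U :: nat \<Rightarrow> 'a set. A n \<subseteq> (\<Union>i. U i) \<and> (\<forall>i. bounded (U i) \<and> diameter (U i) \<le> \<delta>)
      \<and> (\<Sum>i. hausdorff_weight s (U i)) \<le> hausdorff_pre s \<delta> (A n) + e * (1/2) ^ Suc n" for n
    using lt[of n] less_imp_le unfolding hausdorff_pre_def[of s \<delta> "A n"] INF_less_iff by blast
  then obtain U :: "nat \<Rightarrow> nat \<Rightarrow> 'a set" where U: "\<And>n. A n \<subseteq> (\<Union>i. U n i)"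
      "\<And>n i. bounded (U n i) \<and> diameter (U n i) \<le> \<delta>"
      "\<And>n. (\<Sum>i. hausdorff_weight s (U n i)) \<le> hausdorff_pre s \<delta> (A n) + e * (1/2) ^ Suc n"
    by metis
  define V where "V = case_prod U \<circ> prod_decode"
  have "x \<in> (\<Union>i. V i)" if x: "x \<in> A n" for x n
  proof -
    obtain i where "x \<in> U n i" using U(1) x by blast
    then have "x \<in> V (prod_encode (n, i))" by (simp add: V_def)
    then show ?thesis by blast
  qed
  then have "hausdorff_pre s \<delta> (\<Union>i. A i) \<le> (\<Sum>i. hausdorff_weight s (V i))"
    unfolding hausdorff_pre_def
    by (intro INF_lower) (auto simp: V_def U(2) split: prod.split)
  also have "\<dots> = (\<Sum>n. \<Sum>i. hausdorff_weight s (U n i))"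
    using suminf_ennreal_2dimen[of "\<lambda>n. \<Sum>i. hausdorff_weight s (U n i)"
        "\<lambda>(n, i). hausdorff_weight s (U n i)"]
    by (simp add: V_def comp_def split_def)
  also have "\<dots> \<le> (\<Sum>n. hausdorff_pre s \<delta> (A n) + e * (1/2) ^ Suc n)"
    by (intro suminf_le U(3)) auto
  also have "\<dots> = (\<Sum>n. hausdorff_pre s \<delta> (A n)) + (\<Sum>n. ennreal e * ennreal ((1/2) ^ Suc n))"
    using \<open>0 < e\<close> by (subst suminf_add[symmetric])
      (auto simp del: ennreal_suminf_cmult simp add: ennreal_mult[symmetric])
  also have "\<dots> = (\<Sum>n. hausdorff_pre s \<delta> (A n)) + e"
    unfolding ennreal_suminf_cmult
    by (subst suminf_ennreal_eq[OF zero_le_power power_half_series]) auto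
  finally show "hausdorff_pre s \<delta> (\<Union>i. A i) \<le> (\<Sum>i. hausdorff_pre s \<delta> (A i)) + ennreal e" .
qed

lemma outer_measure_space_hausdorff_outer:
  "outer_measure_space (Pow UNIV) (hausdorff_outer s :: 'a::metric_space set \<Rightarrow> ennreal)"
  unfolding outer_measure_space_def
proof (intro conjI)
  show "positive (Pow UNIV) (hausdorff_outer s :: 'a set \<Rightarrow> ennreal)"
    by (simp add: positive_def hausdorff_outer_def hausdorff_pre_empty)
  show "increasing (Pow UNIV) (hausdorff_outer s :: 'a set \<Rightarrow> ennreal)"
    unfolding increasing_def hausdorff_outer_def
    by (auto intro!: SUP_mono' hausdorff_pre_mono)
  show "countably_subadditive (Pow UNIV) (hausdorff_outer s :: 'a set \<Rightarrow> ennreal)"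
    unfolding countably_subadditive_def hausdorff_outer_def
    by (auto intro!: SUP_least order_trans[OF hausdorff_pre_UN] suminf_le SUP_upper)
qed

lemma measure_space_hausdorff:
  "measure_space UNIV (lambda_system UNIV (Pow UNIV) (hausdorff_outer s))
     (hausdorff_outer s :: 'a::metric_space set \<Rightarrow> ennreal)"
  using sigma_algebra.caratheodory_lemma[OF sigma_algebra_Pow outer_measure_space_hausdorff_outer]
  by simp

lemma sets_hausdorff_measure:
  "sets (hausdorff_measure s :: 'a::metric_space measure) =
     lambda_system UNIV (Pow UNIV) (hausdorff_outer s)"
  unfolding hausdorff_measure_def using measure_space_hausdorff[where 'a='a and s=s]
  by (intro sigma_algebra.sets_measure_of_eq) (simp only: measure_space_def)

lemma emeasure_hausdorff_measure:
  fixes A :: "'a::metric_space set"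
  assumes "A \<in> sets (hausdorff_measure s)"
  shows "emeasure (hausdorff_measure s) A = hausdorff_outer s A"
  using measure_space_hausdorff[where 'a='a and s=s] assms[unfolded sets_hausdorff_measure]
  unfolding hausdorff_measure_def
  by (intro emeasure_measure_of_sigma) (simp_all only: measure_space_def)


section \<open>Self-similar sets\<close>

definition contracting_similarity :: "real \<Rightarrow> ('a::metric_space \<Rightarrow> 'a) \<Rightarrow> bool" where
  "contracting_similarity \<rho> f \<longleftrightarrow> 0 < \<rho> \<and> \<rho> < 1 \<and> (\<forall>x y. dist (f x) (f y) = \<rho> * dist x y)"

definition self_similar_set :: "nat \<Rightarrow> (nat \<Rightarrow> 'a::metric_space \<Rightarrow> 'a) \<Rightarrow> 'a set \<Rightarrow> bool" where
  "self_similar_set N S F \<longleftrightarrow> compact F \<and> F \<noteq> {} \<and> F = (\<Union>j\<in>{1..N}. S j ` F)"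

definition strong_open_set_condition ::
    "nat \<Rightarrow> (nat \<Rightarrow> 'a::metric_space \<Rightarrow> 'a) \<Rightarrow> 'a set \<Rightarrow> 'a set \<Rightarrow> bool" where
  "strong_open_set_condition N S F J \<longleftrightarrow>
     compact J \<and> J = closure (interior J) \<and> (\<Union>j\<in>{1..N}. S j ` J) \<subseteq> J \<and>
     (\<forall>j\<in>{1..N}. \<forall>l\<in>{1..N}. j \<noteq> l \<longrightarrow> S j ` interior J \<inter> S l ` interior J = {}) \<and>
     F \<inter> interior J \<noteq> {}"

text \<open>The index \<open>y\<^sub>1\<close>; it is well defined for almost all points of \<open>F\<close> only.\<close>

definition first_index :: "nat \<Rightarrow> (nat \<Rightarrow> 'a \<Rightarrow> 'a) \<Rightarrow> 'a set \<Rightarrow> 'a \<Rightarrow> nat" where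
  "first_index N S F y = (THE j. j \<in> {1..N} \<and> y \<in> S j ` F)"


section \<open>Parallel sets, reach and neighborhood regularity\<close>

definition parallel_set :: "'a::metric_space set \<Rightarrow> real \<Rightarrow> 'a set" where
  "parallel_set K \<epsilon> = {x. infdist x K \<le> \<epsilon>}"

definition parallel_complement :: "'a::metric_space set \<Rightarrow> real \<Rightarrow> 'a set" where
  "parallel_complement K \<epsilon> = closure (- parallel_set K \<epsilon>)"

definition unique_nearest :: "'a::metric_space set \<Rightarrow> 'a set" where
  "unique_nearest X = {z. \<exists>!p. p \<in> X \<and> dist z p = infdist z X}"

definition reach_at :: "'a::metric_space set \<Rightarrow> 'a \<Rightarrow> ereal" where
  "reach_at X p = Sup {ereal \<rho> | \<rho>. ball p \<rho> \<subseteq> unique_nearest X}"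

definition reach :: "'a::metric_space set \<Rightarrow> ereal" where
  "reach X = (INF p\<in>X. reach_at X p)"

definition positive_reach :: "'a::metric_space set \<Rightarrow> bool" where
  "positive_reach X \<longleftrightarrow> closed X \<and> 0 < reach X"

text \<open>
  \<open>M\<close> is locally bi-Lipschitz homeomorphic to \<open>\<real>\<^sup>m\<close>; an \<open>m\<close>-dimensional
  linear subspace of the ambient space serves as the model of \<open>\<real>\<^sup>m\<close>.
\<close>

definition lipschitz_manifold :: "nat \<Rightarrow> 'a::euclidean_space set \<Rightarrow> bool" where
  "lipschitz_manifold m M \<longleftrightarrow>
     (\<forall>p\<in>M. \<exists>U V W f g L.
        openin (top_of_set M) U \<and> p \<in> U \<and>
        subspace (V :: 'a set) \<and> dim V = m \<and> openin (top_of_set V) W \<and>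
        homeomorphism U W f g \<and> L-lipschitz_on U f \<and> L-lipschitz_on W g)"

definition neighborhood_regular :: "'a::euclidean_space set \<Rightarrow> bool" where
  "neighborhood_regular F \<longleftrightarrow>
     (AE \<epsilon> in lborel. 0 < \<epsilon> \<longrightarrow>
        positive_reach (parallel_complement F \<epsilon>) \<and>
        lipschitz_manifold (DIM('a) - 1) (frontier (parallel_set F \<epsilon>)))"


section \<open>Curvature measures\<close>

definition local_parallel_set :: "'a::euclidean_space set \<Rightarrow> real \<Rightarrow> 'a set \<Rightarrow> 'a set" where
  "local_parallel_set X \<rho> B = {z. 0 < infdist z X \<and> infdist z X \<le> \<rho> \<and> closest_point X z \<in> B}"

definition local_steiner_formula ::
    "'a::euclidean_space set \<Rightarrow> 'a set \<Rightarrow> (nat \<Rightarrow> real) \<Rightarrow> bool" where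
  "local_steiner_formula X B c \<longleftrightarrow>
     (\<forall>\<rho>. 0 < \<rho> \<and> ereal \<rho> < reach X \<longrightarrow>
        measure (hausdorff_measure (real DIM('a))) (local_parallel_set X \<rho> B) =
          (\<Sum>i=1..DIM('a). unit_ball_vol (real i) * \<rho> ^ i * c (DIM('a) - i)))"

text \<open>
  \<open>C\<^sub>k(X, B)\<close> for \<open>k < DIM('a)\<close>, \<open>X\<close> of positive reach and \<open>B\<close> bounded Borel, where the
  coefficients in the local Steiner formula are unique.
\<close>

definition curvature_measure :: "nat \<Rightarrow> 'a::euclidean_space set \<Rightarrow> 'a set \<Rightarrow> real" where
  "curvature_measure k X B = (THE t. \<exists>c. local_steiner_formula X B c \<and> c k = t)"

text \<open>\<open>C\<^sub>k(F(\<epsilon>), B)\<close>\<close>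

definition parallel_curvature ::
    "nat \<Rightarrow> 'a::euclidean_space set \<Rightarrow> real \<Rightarrow> 'a set \<Rightarrow> real" where
  "parallel_curvature k F \<epsilon> B =
     (if k = DIM('a) then measure lebesgue (parallel_set F \<epsilon> \<inter> B)
      else if k + 1 = DIM('a) then
        measure (hausdorff_measure (real (DIM('a) - 1))) (frontier (parallel_set F \<epsilon>) \<inter> B) / 2
      else (- 1) ^ (DIM('a) - 1 - k) * curvature_measure k (parallel_complement F \<epsilon>) B)"


section \<open>Locally homogeneous neighborhood nets\<close>

definition net_const :: "real \<Rightarrow> real \<Rightarrow> 'a::metric_space set \<Rightarrow> real" where
  "net_const a \<epsilon>0 J = max (2 * a) (inverse \<epsilon>0 * diameter J)"

definition locally_homogeneous_net ::
    "nat \<Rightarrow> (nat \<Rightarrow> 'a::metric_space \<Rightarrow> 'a) \<Rightarrow> (nat \<Rightarrow> real) \<Rightarrow> 'a set \<Rightarrow> 'a set \<Rightarrow>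
     real \<Rightarrow> real \<Rightarrow> ('a \<Rightarrow> real \<Rightarrow> 'a set) \<Rightarrow> bool" where
  "locally_homogeneous_net N S r F J a \<epsilon>0 A \<longleftrightarrow>
     (\<forall>x\<in>F. \<forall>\<epsilon>. 0 < \<epsilon> \<and> \<epsilon> < \<epsilon>0 \<longrightarrow>
        A x \<epsilon> \<subseteq> frontier (parallel_set F \<epsilon>) \<inter> cball x (a * \<epsilon>)) \<and>
     (\<forall>j\<in>{1..N}. \<forall>x\<in>S j ` F. \<forall>\<epsilon>.
        0 < \<epsilon> \<and> \<epsilon> < inverse (net_const a \<epsilon>0 J) * infdist x (- (S j ` J)) \<longrightarrow>
        A x \<epsilon> = S j ` A (inv (S j) x) (inverse (r j) * \<epsilon>))"

text \<open>
  Measurability of the net with respect to \<open>C\<^sub>k\<close>, without which the iterated integrals of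
  \<open>C\<^sub>k(F(\<epsilon>), A(x, \<epsilon>))\<close> have no meaning.  The completion is used since for
  \<open>k \<le> DIM('a) - 2\<close> the curvature measures are only given for almost all \<open>\<epsilon>\<close>.
\<close>

definition measurable_net ::
    "nat \<Rightarrow> real \<Rightarrow> 'a::euclidean_space set \<Rightarrow> real \<Rightarrow> ('a \<Rightarrow> real \<Rightarrow> 'a set) \<Rightarrow> bool" where
  "measurable_net k D F \<epsilon>0 A \<longleftrightarrow>
     (\<forall>x\<in>F. \<forall>\<epsilon>. 0 < \<epsilon> \<and> \<epsilon> < \<epsilon>0 \<longrightarrow> A x \<epsilon> \<in> sets borel) \<and>
     (\<lambda>(x, \<epsilon>). parallel_curvature k F \<epsilon> (A x \<epsilon>)) \<in> borel_measurable
       (completion (restrict_space (hausdorff_measure D) F \<Otimes>\<^sub>M restrict_space lborel {0<..<\<epsilon>0}))"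

definition scaled_curvature ::
    "nat \<Rightarrow> 'a::euclidean_space set \<Rightarrow> ('a \<Rightarrow> real \<Rightarrow> 'a set) \<Rightarrow> 'a \<Rightarrow> real \<Rightarrow> real" where
  "scaled_curvature k F A x \<epsilon> = inverse (\<epsilon> ^ k) * parallel_curvature k F \<epsilon> (A x \<epsilon>) * inverse \<epsilon>"

end

theory Submission
  imports Defs
begin

text \<open>
  For \<open>x \<in> F\<close> let \<open>j\<close> be the first index of \<open>x\<close> and \<open>T x\<close> the preimage of \<open>x\<close> under \<open>S j\<close>.  The Hausdorff
  measure on \<open>F\<close> is invariant and ergodic under \<open>T\<close>.  By local homogeneity of the net and the scaling of
  the curvature measures, the rescaled intervals \<open>(lower (T\<^sup>n x), upper (T\<^sup>n x)]\<close> tile \<open>(0, upper x]\<close>, and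
  the integral over \<open>(\<delta>, upper x]\<close> is a Birkhoff sum of the inner integral up to an error bounded by one
  term of a Birkhoff sum of its absolute value.  The endpoints decrease like \<open>exp (- n \<Lambda>)\<close>, where
  \<open>\<Lambda>\<close> is the mean of \<open>\<bar>ln r\<bar>\<close>, because \<open>ln (upper (T\<^sup>n x)) = o(n)\<close> for almost all \<open>x\<close>.  Birkhoff's
  theorem thus gives the limit as a quotient of two means.

  For \<open>k \<le> DIM('a) - 2\<close> the scaling of \<open>C\<^sub>k\<close> requires that local Steiner polynomials exist.  On a set of
  unique nearest points, moving along normals is a Lipschitz map, so Rademacher's theorem and the area
  formula express the volume of local parallel sets through Jacobians that are polynomials in the
  distance.  For \<open>k \<ge> DIM('a) - 1\<close> the curvature of the net is at most of order \<open>\<epsilon>\<^sup>k\<close>, and the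
  integral of \<open>1 / \<epsilon>\<close> from \<open>lower\<close> to \<open>upper\<close> is a coboundary plus an integrable function; as
  \<open>ln \<circ> upper\<close> is bounded above, that is integrable.
\<close>

section \<open>Rademacher's theorem\<close>

text \<open>The dimension enters only as \<open>hausdorff_dim F\<close>, whereas invariance of the
  Hausdorff measure under \<open>T\<close> rests on Moran's equation \<Sum> r_j^D = 1; so
  \<open>F\<close> must first be shown to have positive finite measure in its similarity dimension.
  Moran's equation also makes the overlaps of the copies of \<open>F\<close> null, and
  \<open>T\<close> may use the least admissible index there.

  The obstacle in the dynamics is that \<open>upper\<close> can be arbitrarily small and its
  logarithm is not known to be integrable. Available are an upper bound for
  \<open>ln \<circ> upper\<close> and the inequality \<open>lower x \<le> upper x\<close>, which
  bounds the coboundary of \<open>ln \<circ> upper\<close> from below by an integrable function.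
  That \<open>upper\<close> is positive almost everywhere is itself a consequence of ergodicity and
  of \<open>F\<close> meeting the interior of \<open>J\<close>.

  Curvatures are measurable only with respect to a completion, and homogeneity holds only for almost
  all \<epsilon>. The tiling of (0, upper x] is therefore carried out with Borel representatives,
  one for each point of a single orbit.\<close>

lemma continuous_on_if_lipschitz:
  fixes f :: "'a::real_normed_vector \<Rightarrow> real"
  assumes lip: "\<And>x y. \<bar>f x - f y\<bar> \<le> L * norm (x - y)"
  shows "continuous_on UNIV f"
proof (rule lipschitz_on_continuous_on)
  show "\<bar>L\<bar>-lipschitz_on UNIV f"
  proof (rule lipschitz_onI)
    fix x y :: 'a
    have "L * norm (x - y) \<le> \<bar>L\<bar> * norm (x - y)" by (intro mult_right_mono) auto
    then show "dist (f x) (f y) \<le> \<bar>L\<bar> * dist x y"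
      using lip[of x y] by (simp add: dist_norm)
  qed simp
qed

text \<open>Where bounded difference quotients along \<open>v\<close> have no limit, this holds for
  some rational p < q, so countably many such sets contain all exceptional points.\<close>

definition oscillates :: "('a::real_normed_vector \<Rightarrow> real) \<Rightarrow> 'a \<Rightarrow> real \<Rightarrow> real \<Rightarrow> 'a \<Rightarrow> bool" where
  "oscillates f v p q x \<longleftrightarrow>
     (\<forall>d>0. \<exists>h. 0 < \<bar>h\<bar> \<and> \<bar>h\<bar> < d \<and> (f (x + h *\<^sub>R v) - f x) / h < p) \<and>
     (\<forall>d>0. \<exists>h. 0 < \<bar>h\<bar> \<and> \<bar>h\<bar> < d \<and> q < (f (x + h *\<^sub>R v) - f x) / h)"

text \<open>Small intervals on which \<open>g\<close> has mean slope below \<open>p\<close> form a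
  Vitali cover of \<open>E\<close>, and the image of such an interval under \<open>g\<close> is
  shorter than \<open>p\<close> times its length. Disjoint ones inside an open set slightly larger
  than \<open>E\<close> exhaust \<open>E\<close> up to a null set, which the Lipschitz map
  \<open>g\<close> keeps null. The preimage under \<open>k\<close> is the image under
  \<open>g\<close>.\<close>

lemma distr_inverse_le_slope:
  fixes g k :: "real \<Rightarrow> real"
  assumes mono: "\<And>x y. x < y \<Longrightarrow> g x < g y" and inv: "\<And>y. g (k y) = y" "\<And>x. k (g x) = x"
    and lip: "\<And>x y. \<bar>g x - g y\<bar> \<le> K * \<bar>x - y\<bar>"
    and k[measurable]: "k \<in> borel_measurable borel" and E[measurable]: "E \<in> sets borel" and "0 < p"
    and slope: "\<And>x d. x \<in> E \<Longrightarrow> 0 < d \<Longrightarrow> \<exists>h. 0 < \<bar>h\<bar> \<and> \<bar>h\<bar> < d \<and> (g (x + h) - g x) / h < p"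
  shows "emeasure lborel (k -` E) \<le> p * emeasure lborel E"
proof (cases "emeasure lborel E = top")
  case True
  then show ?thesis using \<open>0 < p\<close> by (simp add: ennreal_mult_top)
next
  case False
  define \<nu> where "\<nu> = distr lborel borel k"
  have s\<nu>[simp]: "sets \<nu> = sets borel" by (simp add: \<nu>_def)
  have \<nu>: "emeasure \<nu> X = emeasure lborel (k -` X)" if "X \<in> sets borel" for X
    using that by (simp add: \<nu>_def emeasure_distr)
  have "emeasure \<nu> E \<le> p * emeasure lborel E + ennreal e" if "0 < e" for e
  proof -
    have "0 < e / p" using that \<open>0 < p\<close> by simp
    moreover have "E \<in> sets lebesgue" by simp
    ultimately obtain U where U: "open U" "E \<subseteq> U" "emeasure lebesgue (U - E) < ennreal (e / p)"
      using sets_lebesgue_outer_open by metis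
    have [measurable]: "U \<in> sets borel" using U by auto
    define I where "I = {(c, \<rho>) | c \<rho>. 0 < \<rho> \<and> cball c \<rho> \<subseteq> U \<and> g (c + \<rho>) - g (c - \<rho>) < p * (2 * \<rho>)}"
    have ex: "\<exists>i. i \<in> I \<and> x \<in> cball (fst i) (snd i) \<and> snd i < d" if x: "x \<in> E" and "0 < d" for x d
    proof -
      obtain d' where d': "d' > 0" "ball x d' \<subseteq> U" using U x open_contains_ball by (metis subsetD)
      obtain h where h: "0 < \<bar>h\<bar>" "\<bar>h\<bar> < min d d'" "(g (x + h) - g x) / h < p"
        using slope[OF x, of "min d d'"] \<open>0 < d\<close> d' by auto
      \<comment> \<open>Centre x + h/2 and radius \<bar>h\<bar>/2 describe the interval between x
        and x + h for either sign of h.\<close>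
      have "g (x + h/2 + \<bar>h\<bar>/2) - g (x + h/2 - \<bar>h\<bar>/2) < p * \<bar>h\<bar>"
      proof (cases "h > 0")
        case True
        then have e: "x + h/2 + \<bar>h\<bar>/2 = x + h" "x + h/2 - \<bar>h\<bar>/2 = x" by auto
        show ?thesis unfolding e using h True by (auto simp: field_simps)
      next
        case False
        then have e: "x + h/2 + \<bar>h\<bar>/2 = x" "x + h/2 - \<bar>h\<bar>/2 = x + h" by auto
        show ?thesis unfolding e using h False by (auto simp: field_simps)
      qed
      moreover have "cball (x + h/2) (\<bar>h\<bar>/2) \<subseteq> ball x d'"
      proof
        fix y assume "y \<in> cball (x + h/2) (\<bar>h\<bar>/2)"
        then have "\<bar>x + h/2 - y\<bar> \<le> \<bar>h\<bar>/2" by (simp add: dist_real_def)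
        then have "\<bar>x - y\<bar> \<le> \<bar>h\<bar>" by linarith
        then show "y \<in> ball x d'" using h by (simp add: dist_real_def)
      qed
      ultimately have "(x + h/2, \<bar>h\<bar>/2) \<in> I" using h d' by (auto simp: I_def)
      moreover have "x \<in> cball (x + h/2) (\<bar>h\<bar>/2)" by (simp add: dist_real_def)
      ultimately show ?thesis using h by (intro exI[of _ "(x + h/2, \<bar>h\<bar>/2)"]) auto
    qed
    have pos: "0 < snd i" if "i \<in> I" for i using that by (auto simp: I_def)
    obtain C where C: "countable C" "C \<subseteq> I"
      "pairwise (\<lambda>i j. disjnt (cball (fst i) (snd i)) (cball (fst j) (snd j))) C"
      "negligible (E - (\<Union>i\<in>C. cball (fst i) (snd i)))"
      by (rule Vitali_covering_theorem_cballs[of I snd E fst, OF pos ex])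
    define W where "W = (\<Union>i\<in>C. cball (fst i) (snd i))"
    have [measurable]: "W \<in> sets borel" unfolding W_def using C(1) by (intro sets.countable_UN'') auto
    have disj: "disjoint_family_on (\<lambda>i. cball (fst i) (snd i)) C"
      using C(3) by (auto simp: disjoint_family_on_def pairwise_def disjnt_def)
    have ball: "emeasure \<nu> (cball c \<rho>) \<le> p * emeasure lborel (cball c \<rho>)" if "(c, \<rho>) \<in> C" for c \<rho>
    proof -
      have i: "0 < \<rho>" "g (c + \<rho>) - g (c - \<rho>) < p * (2 * \<rho>)" using that C(2) by (auto simp: I_def)
      have "k -` cball c \<rho> \<subseteq> {g (c - \<rho>)..g (c + \<rho>)}"
      proof
        fix y assume "y \<in> k -` cball c \<rho>"
        then have "c - \<rho> \<le> k y" "k y \<le> c + \<rho>" by (auto simp: dist_real_def)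
        then show "y \<in> {g (c - \<rho>)..g (c + \<rho>)}"
          using mono[of "k y" "c + \<rho>"] mono[of "c - \<rho>" "k y"] inv(1)[of y] by (auto simp: le_less)
      qed
      then have "emeasure \<nu> (cball c \<rho>) \<le> emeasure lborel {g (c - \<rho>)..g (c + \<rho>)}"
        by (subst \<nu>) (auto intro!: emeasure_mono)
      also have "\<dots> = ennreal (g (c + \<rho>) - g (c - \<rho>))" using mono[of "c - \<rho>" "c + \<rho>"] i by simp
      also have "\<dots> \<le> ennreal (p * (2 * \<rho>))" using i by (intro ennreal_leI) simp
      also have "\<dots> = p * emeasure lborel (cball c \<rho>)"
        using i \<open>0 < p\<close> by (subst cball_eq_atLeastAtMost) (simp add: ennreal_mult)
      finally show ?thesis .
    qed
    have "emeasure \<nu> W = (\<integral>\<^sup>+i. emeasure \<nu> (cball (fst i) (snd i)) \<partial>count_space C)"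
      unfolding W_def by (rule emeasure_UN_countable) (use C(1) disj in auto)
    also have "\<dots> \<le> (\<integral>\<^sup>+i. p * emeasure lborel (cball (fst i) (snd i)) \<partial>count_space C)"
      by (intro nn_integral_mono) (auto intro: ball)
    also have "\<dots> = p * emeasure lborel W"
      unfolding W_def
      by (subst nn_integral_cmult, simp, subst emeasure_UN_countable) (use C(1) disj in auto)
    finally have W: "emeasure \<nu> W \<le> p * emeasure lborel W" .
    have "negligible (g ` (E - W))"
      using C(4) lip by (intro negligible_locally_Lipschitz_image)
        (auto simp: W_def intro!: exI[of _ UNIV] exI[of _ K])
    moreover have "g ` (E - W) = k -` (E - W)" using inv by (auto simp: image_iff intro!: bexI[of _ "k _"])
    ultimately have "emeasure lebesgue (k -` (E - W)) = 0"
      by (auto simp: negligible_iff_null_sets)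
    moreover have "k -` (E - W) \<in> sets borel" using measurable_sets[OF k, of "E - W"] by simp
    ultimately have N: "emeasure \<nu> (E - W) = 0" by (subst \<nu>) auto
    have "emeasure \<nu> E \<le> emeasure \<nu> (E - W) + emeasure \<nu> W"
      by (rule order_trans[OF emeasure_mono emeasure_subadditive]) auto
    also have "\<dots> \<le> p * emeasure lborel W" using W N by simp
    also have "\<dots> \<le> p * emeasure lborel (E \<union> (U - E))"
    proof -
      have "W \<subseteq> U" proof
        fix x assume "x \<in> W"
        then obtain i where "i \<in> C" "x \<in> cball (fst i) (snd i)" by (auto simp: W_def)
        moreover from this C(2) have "i \<in> I" by auto
        then have "cball (fst i) (snd i) \<subseteq> U" by (cases i) (simp add: I_def)
        ultimately show "x \<in> U" by blast
      qed
      then show ?thesis by (intro mult_left_mono emeasure_mono) auto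
    qed
    also have "\<dots> \<le> p * (emeasure lborel E + emeasure lborel (U - E))"
      by (intro mult_left_mono emeasure_subadditive) auto
    also have "\<dots> \<le> p * (emeasure lborel E + ennreal (e / p))"
      using U(3) by (intro mult_left_mono add_left_mono) auto
    also have "\<dots> = p * emeasure lborel E + ennreal e"
    proof -
      have "ennreal p * ennreal (e / p) = ennreal e"
        using \<open>0 < p\<close> \<open>0 < e\<close> by (subst ennreal_mult[symmetric]) auto
      then show ?thesis by (simp add: distrib_left)
    qed
    finally show ?thesis .
  qed
  then have "emeasure \<nu> E \<le> p * emeasure lborel E" by (rule ennreal_le_epsilon)
  then show ?thesis by (simp add: \<nu>)
qed

text \<open>For fixed h the condition on the quotient is open in x, so the union over all admissible
  h is open as well; only the quantifier over d has to be made countable.\<close>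

lemma sets_oscillates:
  fixes f :: "'a::euclidean_space \<Rightarrow> real"
  assumes f: "continuous_on UNIV f"
  shows "{x. oscillates f v p q x} \<in> sets borel"
proof -
  have o: "open {x. \<exists>h. 0 < \<bar>h\<bar> \<and> \<bar>h\<bar> < d \<and> P h ((f (x + h *\<^sub>R v) - f x) / h)}"
    if P: "\<And>h. open {s. P h s}" for d and P :: "real \<Rightarrow> real \<Rightarrow> bool"
  proof -
    have "open {x. P h ((f (x + h *\<^sub>R v) - f x) / h)}" if "h \<noteq> 0" for h
    proof -
      have "continuous_on UNIV (\<lambda>x. (f (x + h *\<^sub>R v) - f x) / h)"
        using that by (auto intro!: continuous_intros continuous_on_compose2[OF f])
      then show ?thesis using open_vimage[OF P[of h]] by (simp add: vimage_def)
    qed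
    moreover have "{x. \<exists>h. 0 < \<bar>h\<bar> \<and> \<bar>h\<bar> < d \<and> P h ((f (x + h *\<^sub>R v) - f x) / h)} =
       (\<Union>h\<in>{h. 0 < \<bar>h\<bar> \<and> \<bar>h\<bar> < d}. {x. P h ((f (x + h *\<^sub>R v) - f x) / h)})" by auto
    ultimately show ?thesis by auto
  qed
  have nat: "(\<forall>d>0. \<exists>h. 0 < \<bar>h\<bar> \<and> \<bar>h\<bar> < d \<and> P h) \<longleftrightarrow> (\<forall>n. \<exists>h. 0 < \<bar>h\<bar> \<and> \<bar>h\<bar> < 1 / real (Suc n) \<and> P h)"
    for P :: "real \<Rightarrow> bool"
  proof
    assume *: "\<forall>n. \<exists>h. 0 < \<bar>h\<bar> \<and> \<bar>h\<bar> < 1 / real (Suc n) \<and> P h"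
    show "\<forall>d>0. \<exists>h. 0 < \<bar>h\<bar> \<and> \<bar>h\<bar> < d \<and> P h"
    proof (intro allI impI)
      fix d :: real assume "d > 0"
      then obtain n where "1 / real (Suc n) < d" using nat_approx_posE by metis
      then show "\<exists>h. 0 < \<bar>h\<bar> \<and> \<bar>h\<bar> < d \<and> P h" using * by (meson less_trans)
    qed
  qed auto
  have "{x. oscillates f v p q x} =
    (\<Inter>n. {x. \<exists>h. 0 < \<bar>h\<bar> \<and> \<bar>h\<bar> < 1 / real (Suc n) \<and> (f (x + h *\<^sub>R v) - f x) / h < p}) \<inter>
    (\<Inter>n. {x. \<exists>h. 0 < \<bar>h\<bar> \<and> \<bar>h\<bar> < 1 / real (Suc n) \<and> q < (f (x + h *\<^sub>R v) - f x) / h})"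
    unfolding oscillates_def nat by auto
  also have "\<dots> \<in> sets borel"
    by (intro sets.Int sets.countable_INT'' borel_open o[of "\<lambda>h s. s < p"] o[of "\<lambda>h s. q < s"])
       (auto simp flip: lessThan_def greaterThan_def)
  finally show ?thesis .
qed

text \<open>After adding a multiple of the identity, f becomes an increasing bi-Lipschitz bijection
  \<open>g\<close>. At every point of the exceptional set there are arbitrarily short chords of
  \<open>g\<close> flatter than p' and others steeper than q', the latter being chords of the
  inverse flatter than 1/q'. Two applications of the covering estimate bound the measure of the set
  by p'/q' < 1 times itself.\<close>

lemma emeasure_oscillates_real:
  fixes f :: "real \<Rightarrow> real"
  assumes lip: "\<And>x y. \<bar>f x - f y\<bar> \<le> L * \<bar>x - y\<bar>" and "p < q"
  shows "emeasure lborel {x. oscillates f 1 p q x} = 0"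
proof -
  have "0 \<le> L" using order_trans[OF abs_ge_zero lip[of 1 0]] by simp
  define g where "g x = f x + (L + 1) * x" for x
  have g1: "g y - g x \<ge> y - x" if "x \<le> y" for x y
    using lip[of y x] that by (auto simp: g_def algebra_simps)
  have g2: "\<bar>g x - g y\<bar> \<le> (2 * L + 1) * \<bar>x - y\<bar>" for x y
  proof -
    have "\<bar>g x - g y\<bar> = \<bar>(f x - f y) + (L + 1) * (x - y)\<bar>" by (simp add: g_def algebra_simps)
    also have "\<dots> \<le> \<bar>f x - f y\<bar> + \<bar>(L + 1) * (x - y)\<bar>" by (rule abs_triangle_ineq)
    also have "\<dots> \<le> L * \<bar>x - y\<bar> + (L + 1) * \<bar>x - y\<bar>" using lip \<open>0 \<le> L\<close> by (auto simp: abs_mult)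
    finally show ?thesis by (simp add: algebra_simps)
  qed
  have mono: "g x < g y" if "x < y" for x y using g1[of x y] that by simp
  have contg: "continuous_on UNIV g"
  proof (rule lipschitz_on_continuous_on)
    show "(2 * L + 1)-lipschitz_on UNIV g"
      using g2 \<open>0 \<le> L\<close> by (intro lipschitz_onI) (auto simp: dist_real_def)
  qed
  have surj: "\<exists>x. g x = y" for y
  proof -
    define r where "r = \<bar>y - g 0\<bar>"
    have "g (-r) \<le> y" "y \<le> g r" using g1[of "-r" 0] g1[of 0 r] by (auto simp: r_def)
    then show ?thesis
      using IVT'[of g "-r" y r] continuous_on_subset[OF contg] by (auto simp: r_def)
  qed
  then obtain k where k: "\<And>y. g (k y) = y" by metis
  have k2: "k (g x) = x" for x using mono[of x "k (g x)"] mono[of "k (g x)" x] k[of "g x"] by (cases x "k (g x)" rule: linorder_cases) auto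
  have klip: "\<bar>k x - k y\<bar> \<le> 1 * \<bar>x - y\<bar>" for x y
    using g1[of "k x" "k y"] g1[of "k y" "k x"] k by (cases "k x \<le> k y") auto
  have contk: "continuous_on UNIV k"
    by (rule lipschitz_on_continuous_on[of 1]) (use klip in \<open>auto intro!: lipschitz_onI simp: dist_real_def\<close>)
  have [measurable]: "g \<in> borel_measurable borel" "k \<in> borel_measurable borel"
    using contg contk by (auto intro: borel_measurable_continuous_onI)
  have kmono: "k x < k y" if "x < y" for x y using that mono[of "k y" "k x"] k[of x] k[of y] by (cases "k x" "k y" rule: linorder_cases) auto
  have contf: "continuous_on UNIV f"
    by (rule lipschitz_on_continuous_on[of L]) (use lip \<open>0 \<le> L\<close> in \<open>auto intro!: lipschitz_onI simp: dist_real_def\<close>)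
  define E0 where "E0 = {x. oscillates f 1 p q x}"
  have E0[measurable]: "E0 \<in> sets borel" unfolding E0_def by (rule sets_oscillates[OF contf])
  \<comment> \<open>Truncation makes the measure finite, so that it can be cancelled in an estimate
    by a factor below 1 times itself.\<close>
  have "emeasure lborel (E0 \<inter> {-real n..real n}) = 0" for n
  proof -
    define E where "E = E0 \<inter> {-real n..real n}"
    have [measurable]: "E \<in> sets borel" by (simp add: E_def)
    define p' q' where "p' = p + L + 1" and "q' = q + L + 1"
    have slope: "(g (x + h) - g x) / h = (f (x + h) - f x) / h + L + 1" if "h \<noteq> 0" for x h
      using that by (simp add: g_def field_simps)
    have oscD: "\<exists>h. 0 < \<bar>h\<bar> \<and> \<bar>h\<bar> < d \<and> (f (x + h) - f x) / h < p"
        "\<exists>h. 0 < \<bar>h\<bar> \<and> \<bar>h\<bar> < d \<and> q < (f (x + h) - f x) / h" if "x \<in> E" "0 < d" for x d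
      using that by (simp_all add: E_def E0_def oscillates_def)
    have lo: "\<exists>h. 0 < \<bar>h\<bar> \<and> \<bar>h\<bar> < d \<and> (g (x + h) - g x) / h < p'" if xd: "x \<in> E" "0 < d" for x d
    proof -
      obtain h where "0 < \<bar>h\<bar>" "\<bar>h\<bar> < d" "(f (x + h) - f x) / h < p" using oscD(1)[OF xd] by auto
      then show ?thesis using slope[of h x] by (intro exI[of _ h]) (auto simp: p'_def)
    qed
    \<comment> \<open>A steep chord of \<open>g\<close> is a flat chord of its inverse over the
      image interval; the bound d / (2 L + 1) keeps that image shorter than d.\<close>
    have hi: "\<exists>h. 0 < \<bar>h\<bar> \<and> \<bar>h\<bar> < d \<and> (k (y + h) - k y) / h < 1 / q'" if y: "y \<in> k -` E" and "0 < d" for y d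
    proof -
      define x where "x = k y"
      have "0 < d / (2 * L + 1)" using \<open>0 < d\<close> \<open>0 \<le> L\<close> by simp
      then obtain h where h: "0 < \<bar>h\<bar>" "\<bar>h\<bar> < d / (2 * L + 1)" "q < (f (x + h) - f x) / h"
        using oscD(2)[of x "d / (2 * L + 1)"] y by (auto simp: x_def)
      define h' where "h' = g (x + h) - g x"
      have "h' \<noteq> 0" using mono[of x "x + h"] mono[of "x + h" x] h by (cases "h > 0") (auto simp: h'_def)
      have "q' < h' / h" using slope[of h x] h by (auto simp: h'_def q'_def)
      have "1 \<le> h' / h" 
        using g1[of x "x + h"] g1[of "x + h" x] h by (cases "h > 0") (auto simp: h'_def field_simps)
      have "\<bar>h'\<bar> \<le> (2 * L + 1) * \<bar>h\<bar>" using g2[of "x + h" x] by (simp add: h'_def)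
      also have "\<dots> < d" using h \<open>0 \<le> L\<close> by (simp add: field_simps)
      finally have "\<bar>h'\<bar> < d" .
      have "g x = y" by (simp add: x_def k)
      have "k (y + h') = x + h" using \<open>g x = y\<close> k2[of "x + h"] by (simp add: h'_def)
      then have "(k (y + h') - k y) / h' = h / h'" by (simp add: x_def)
      moreover have "q' > 0" 
      proof -
        have "(f (x + h) - f x) / h \<ge> - L" if "h \<noteq> 0" for x h
          using lip[of "x + h" x] that by (cases "h > 0") (auto simp: field_simps)
        moreover have "p < q" by fact
        moreover obtain h2 where "h2 \<noteq> 0" "(f (x + h2) - f x) / h2 < p"
          using oscD(1)[of x 1] y by (auto simp: x_def)
        ultimately show ?thesis unfolding q'_def by (smt (verit))
      qed
      moreover have "h / h' < 1 / q'" 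
      proof -
        have "h / h' = 1 / (h' / h)" by simp
        also have "\<dots> < 1 / q'" using \<open>q' < h' / h\<close> \<open>q' > 0\<close> by (intro divide_strict_left_mono mult_pos_pos) linarith+
        finally show ?thesis .
      qed
      ultimately show ?thesis using \<open>h' \<noteq> 0\<close> \<open>\<bar>h'\<bar> < d\<close> by (intro exI[of _ h']) auto
    qed
    show ?thesis
    proof (cases "E = {}")
      case True then show ?thesis by (simp add: E_def)
    next
      case False
      then obtain x where "x \<in> E" by auto
      have "p' > 0"
      proof -
        obtain h where "h \<noteq> 0" "(g (x + h) - g x) / h < p'" using lo[OF \<open>x \<in> E\<close>, of 1] by auto
        moreover have "(g (x + h) - g x) / h \<ge> 0" if "h \<noteq> 0"
          using g1[of x "x + h"] g1[of "x + h" x] that by (cases "h > 0") (auto simp: field_simps)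
        ultimately show ?thesis by linarith
      qed
      then have "q' > 0" using \<open>p < q\<close> by (simp add: p'_def q'_def)
      have 1: "emeasure lborel (k -` E) \<le> ennreal p' * emeasure lborel E"
        by (rule distr_inverse_le_slope[of g k "2 * L + 1"]) (use mono k k2 g2 lo \<open>p' > 0\<close> in auto)
      have kE: "k -` E \<in> sets borel" using measurable_sets[of k borel borel E] by simp
      have "emeasure lborel (g -` (k -` E)) \<le> ennreal (1 / q') * emeasure lborel (k -` E)"
        by (rule distr_inverse_le_slope[of k g 1]) (use kmono k k2 klip hi kE \<open>q' > 0\<close> in auto)
      moreover have "g -` (k -` E) = E" using k2 by auto
      ultimately have le: "emeasure lborel E \<le> ennreal (1 / q') * (ennreal p' * emeasure lborel E)"
        using 1 mult_left_mono[OF 1 zero_le, of "ennreal (1 / q')"] by (auto intro: order_trans)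
      have fin: "emeasure lborel E < top"
        by (rule le_less_trans[OF emeasure_mono[of _ "{-real n..real n}"]]) (auto simp: E_def)
      then have Em: "emeasure lborel E = ennreal (measure lborel E)"
        by (intro emeasure_eq_ennreal_measure) simp
      have "ennreal (1 / q' * (p' * measure lborel E)) = ennreal (1 / q') * (ennreal p' * ennreal (measure lborel E))"
        using \<open>p' > 0\<close> \<open>q' > 0\<close> by (subst ennreal_mult, simp, simp)+ simp
      then have "ennreal (measure lborel E) \<le> ennreal (1 / q' * (p' * measure lborel E))"
        using le unfolding Em by simp
      then have "measure lborel E \<le> p' / q' * measure lborel E"
        using \<open>p' > 0\<close> \<open>q' > 0\<close> by (subst (asm) ennreal_le_iff) auto
      moreover have "p' / q' < 1" using \<open>p < q\<close> \<open>p' > 0\<close> \<open>q' > 0\<close> by (simp add: p'_def q'_def)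
      ultimately have "measure lborel E \<le> 0"
        by (metis mult_le_cancel_right1 not_less measure_nonneg)
      then have "measure lborel E = 0" using measure_nonneg[of lborel E] by linarith
      then show ?thesis using fin by (simp add: E_def emeasure_eq_ennreal_measure)
    qed
  qed
  then have "emeasure lborel (\<Union>n. E0 \<inter> {-real n..real n}) = 0"
    by (intro emeasure_UN_eq_0) auto
  moreover have "(\<Union>n. E0 \<inter> {-real n..real n}) = E0"
    proof (intro equalityI subsetI)
    fix x assume "x \<in> E0"
    obtain n where "\<bar>x\<bar> \<le> real n" using real_arch_simple by blast
    with \<open>x \<in> E0\<close> show "x \<in> (\<Union>n. E0 \<inter> {-real n..real n})" by (auto intro!: exI[of _ n])
  qed auto
  ultimately show ?thesis by (simp add: E0_def)
qed


text \<open>On each line parallel to \<open>v\<close> the one-dimensional result applies.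
  Translation invariance allows the measure of the set to be averaged over its translates by t v
  with t in [0, 1], and Fubini turns the average into an integral of null slices.\<close>

lemma emeasure_oscillates:
  fixes f :: "'a::euclidean_space \<Rightarrow> real"
  assumes lip: "\<And>x y. \<bar>f x - f y\<bar> \<le> L * norm (x - y)" and "p < q"
  shows "emeasure lborel {x. oscillates f v p q x} = 0"
proof -
  define N where "N = {x. oscillates f v p q x}"
  have [measurable]: "N \<in> sets borel"
    unfolding N_def by (intro sets_oscillates continuous_on_if_lipschitz[OF lip])
  have slice: "(\<integral>\<^sup>+t. indicator {0..1} t * indicator N (t *\<^sub>R v + x) \<partial>lborel) = (0::ennreal)" for x
  proof -
    have "{t. t *\<^sub>R v + x \<in> N} = {t. oscillates (\<lambda>s. f (s *\<^sub>R v + x)) 1 p q t}"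
      by (simp add: N_def oscillates_def algebra_simps)
    also have "emeasure lborel \<dots> = 0"
    proof (rule emeasure_oscillates_real)
      show "\<bar>f (s *\<^sub>R v + x) - f (t *\<^sub>R v + x)\<bar> \<le> (L * norm v) * \<bar>s - t\<bar>" for s t
        using lip[of "s *\<^sub>R v + x" "t *\<^sub>R v + x"]
        by (simp add: algebra_simps flip: scaleR_diff_left)
    qed fact
    finally have 0: "emeasure lborel {t. t *\<^sub>R v + x \<in> N} = 0" .
    have m: "{t. t *\<^sub>R v + x \<in> N} \<in> sets borel" by measurable
    have "(\<integral>\<^sup>+t. indicator {0..1} t * indicator N (t *\<^sub>R v + x) \<partial>lborel)
        \<le> (\<integral>\<^sup>+t. indicator {t. t *\<^sub>R v + x \<in> N} t \<partial>lborel)"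
      by (intro nn_integral_mono) (auto split: split_indicator)
    also have "\<dots> = 0" using 0 m by simp
    finally show ?thesis by simp
  qed
  have "emeasure lborel N = (\<integral>\<^sup>+t. indicator {0..1::real} t * emeasure lborel N \<partial>lborel)"
    by (subst nn_integral_multc) auto
  also have "\<dots> = (\<integral>\<^sup>+t. \<integral>\<^sup>+x. indicator {0..1} t * indicator N (t *\<^sub>R v + x) \<partial>lborel \<partial>lborel)"
  proof (intro nn_integral_cong)
    fix t :: real
    have "emeasure lborel N = (\<integral>\<^sup>+x. indicator N x \<partial>distr lborel borel ((+) (t *\<^sub>R v)))"
      unfolding lborel_distr_plus by simp
    also have "\<dots> = (\<integral>\<^sup>+x. indicator N (t *\<^sub>R v + x) \<partial>lborel)" by (subst nn_integral_distr) auto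
    finally show "indicator {0..1} t * emeasure lborel N =
        (\<integral>\<^sup>+x. indicator {0..1} t * indicator N (t *\<^sub>R v + x) \<partial>lborel)"
      by (subst nn_integral_cmult) auto
  qed
  also have "\<dots> = (\<integral>\<^sup>+x. \<integral>\<^sup>+t. indicator {0..1} t * indicator N (t *\<^sub>R v + x) \<partial>lborel \<partial>lborel)"
    by (rule lborel_pair.Fubini') measurable
  also have "\<dots> = 0" by (simp add: slice)
  finally show ?thesis by (simp add: N_def)
qed

text \<open>Boundedness keeps the lower and the upper limit finite; were they different, two
  rationals between them would witness oscillation.\<close>

lemma limit_if_not_oscillates:
  fixes f :: "'a::real_normed_vector \<Rightarrow> real"
  assumes bd: "\<And>t. t \<noteq> 0 \<Longrightarrow> \<bar>(f (x + t *\<^sub>R v) - f x) / t\<bar> \<le> C"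
    and no: "\<And>p q. p \<in> \<rat> \<Longrightarrow> q \<in> \<rat> \<Longrightarrow> p < q \<Longrightarrow> \<not> oscillates f v p q x"
  shows "\<exists>l. ((\<lambda>t. (f (x + t *\<^sub>R v) - f x) / t) \<longlongrightarrow> l) (at 0)"
proof -
  define u where "u t = (f (x + t *\<^sub>R v) - f x) / t" for t
  have "\<not> Liminf (at 0) (\<lambda>t. ereal (u t)) < Limsup (at 0) (\<lambda>t. ereal (u t))"
  proof
    assume "Liminf (at 0) (\<lambda>t. ereal (u t)) < Limsup (at 0) (\<lambda>t. ereal (u t))"
    then obtain p where p: "Liminf (at 0) (\<lambda>t. ereal (u t)) < ereal (real_of_rat p)"
        "ereal (real_of_rat p) < Limsup (at 0) (\<lambda>t. ereal (u t))" using ereal_dense3 by blast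
    then obtain q where q: "ereal (real_of_rat p) < ereal (real_of_rat q)"
        "ereal (real_of_rat q) < Limsup (at 0) (\<lambda>t. ereal (u t))" using ereal_dense3 by blast
    have fr: "\<forall>d>0. \<exists>h. 0 < \<bar>h\<bar> \<and> \<bar>h\<bar> < d \<and> P (u h)" if "\<not> eventually (\<lambda>t. \<not> P (u t)) (at 0)" for P
      using that unfolding eventually_at by (auto simp: dist_real_def)
    have "\<not> eventually (\<lambda>t. \<not> u t < real_of_rat p) (at 0)"
    proof
      assume "eventually (\<lambda>t. \<not> u t < real_of_rat p) (at 0)"
      then have "ereal (real_of_rat p) \<le> Liminf (at 0) (\<lambda>t. ereal (u t))"
        by (intro Liminf_bounded) (auto elim: eventually_mono)
      with p show False by simp
    qed
    moreover have "\<not> eventually (\<lambda>t. \<not> real_of_rat q < u t) (at 0)"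
    proof
      assume "eventually (\<lambda>t. \<not> real_of_rat q < u t) (at 0)"
      then have "Limsup (at 0) (\<lambda>t. ereal (u t)) \<le> ereal (real_of_rat q)"
        by (intro Limsup_bounded) (auto elim: eventually_mono)
      with q show False by simp
    qed
    ultimately have "oscillates f v (real_of_rat p) (real_of_rat q) x"
      using fr[of "\<lambda>s. s < real_of_rat p"] fr[of "\<lambda>s. real_of_rat q < s"]
      unfolding oscillates_def u_def by auto
    with no[of "real_of_rat p" "real_of_rat q"] q show False by auto
  qed
  then have eq: "Liminf (at 0) (\<lambda>t. ereal (u t)) = Limsup (at 0) (\<lambda>t. ereal (u t))"
    by (intro antisym Liminf_le_Limsup) auto
  define a where "a = Limsup (at 0) (\<lambda>t. ereal (u t))"
  have t: "((\<lambda>t. ereal (u t)) \<longlongrightarrow> a) (at 0)"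
    using eq by (subst tendsto_iff_Liminf_eq_Limsup) (auto simp: a_def)
  have ev: "\<forall>\<^sub>F t in at 0. ereal (- C) \<le> ereal (u t) \<and> ereal (u t) \<le> ereal C"
    unfolding eventually_at
  proof (intro exI[of _ 1] conjI ballI impI)
    fix t :: real assume "t \<noteq> 0 \<and> dist t 0 < 1"
    then have "\<bar>u t\<bar> \<le> C" using bd[of t] by (simp add: u_def)
    then show "ereal (- C) \<le> ereal (u t)" "ereal (u t) \<le> ereal C" by (auto simp: abs_le_iff)
  qed simp
  have "a \<le> ereal C" by (rule tendsto_upperbound[OF t]) (use ev in \<open>auto elim: eventually_mono\<close>)
  moreover have "ereal (- C) \<le> a" by (rule tendsto_lowerbound[OF t]) (use ev in \<open>auto elim: eventually_mono\<close>)
  ultimately obtain l where "a = ereal l" by (cases a) auto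
  then show ?thesis using t by (auto simp: u_def)
qed

section \<open>Directional derivatives in several variables and their linearity\<close>

lemma AE_directional_limit:
  fixes f :: "'a::euclidean_space \<Rightarrow> real"
  assumes lip: "\<And>x y. \<bar>f x - f y\<bar> \<le> L * norm (x - y)"
  shows "AE x in lborel. \<exists>l. ((\<lambda>t. (f (x + t *\<^sub>R v) - f x) / t) \<longlongrightarrow> l) (at 0)"
proof -
  have "AE x in lborel. \<forall>pq\<in>{(p, q). p \<in> \<rat> \<and> q \<in> \<rat> \<and> p < q}. \<not> oscillates f v (fst pq) (snd pq) x"
  proof (subst AE_ball_countable)
    show "countable {(p, q). p \<in> \<rat> \<and> q \<in> \<rat> \<and> p < (q::real)}"
      by (rule countable_subset[of _ "\<rat> \<times> \<rat>"]) (auto simp: countable_rat)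
    show "\<forall>pq\<in>{(p, q). p \<in> \<rat> \<and> q \<in> \<rat> \<and> p < q}. AE x in lborel. \<not> oscillates f v (fst pq) (snd pq) x"
    proof safe
      fix p q :: real assume "p < q"
      have "emeasure lborel {x. oscillates f v p q x} = 0" by (rule emeasure_oscillates[OF lip \<open>p < q\<close>])
      moreover have "{x. oscillates f v p q x} \<in> sets borel"
        by (intro sets_oscillates continuous_on_if_lipschitz[OF lip])
      ultimately show "AE x in lborel. \<not> oscillates f v (fst (p, q)) (snd (p, q)) x"
        by (intro AE_I'[of "{x. oscillates f v p q x}"]) (auto simp: null_sets_def)
    qed
  qed
  then show ?thesis
  proof eventually_elim
    case (elim x)
    show ?case
    proof (rule limit_if_not_oscillates)
      show "\<bar>(f (x + t *\<^sub>R v) - f x) / t\<bar> \<le> L * norm v" if "t \<noteq> 0" for t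
        using lip[of "x + t *\<^sub>R v" x] that by (simp add: field_simps)
    qed (use elim in auto)
  qed
qed

text \<open>The density 1 + g/(C + 1) is nonnegative and gives every box its Lebesgue measure, so it
  defines Lebesgue measure and equals 1 almost everywhere. The denominator C + 1 is positive even if
  C = 0.\<close>

lemma AE_zero_if_box_integrals_zero:
  fixes g :: "'a::euclidean_space \<Rightarrow> real"
  assumes [measurable]: "g \<in> borel_measurable borel" and bd: "\<And>x. \<bar>g x\<bar> \<le> C"
    and int0: "\<And>l u. (LINT x|lborel. indicator (box l u) x * g x) = 0"
  shows "AE x in lborel. g x = 0"
proof -
  have "0 \<le> C" using bd[of undefined] by linarith
  define h where "h x = 1 + g x / (C + 1)" for x
  have h0: "0 \<le> h x" for x using bd[of x] by (auto simp: h_def field_simps abs_le_iff)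
  have [measurable]: "h \<in> borel_measurable borel" by (simp add: h_def[abs_def])
  have "lborel = density lborel (\<lambda>x. ennreal (h x))"
  proof (rule lborel_eqI)
    fix l u :: 'a assume lu: "\<And>b. b \<in> Basis \<Longrightarrow> l \<bullet> b \<le> u \<bullet> b"
    have i1: "integrable lborel (indicator (box l u) :: 'a \<Rightarrow> real)"
      by (intro integrable_real_indicator) (auto intro: emeasure_bounded_finite[unfolded infinity_ennreal_def])
    have i2: "integrable lborel (\<lambda>x. indicator (box l u) x * g x)"
      by (rule Bochner_Integration.integrable_bound[of _ "\<lambda>x. C * indicator (box l u) x"])
        (use integrable_mult_right[OF i1, of C] bd \<open>0 \<le> C\<close> in \<open>auto simp: abs_mult split: split_indicator\<close>)
    have "emeasure (density lborel (\<lambda>x. ennreal (h x))) (box l u) = (\<integral>\<^sup>+x. ennreal (indicator (box l u) x * h x) \<partial>lborel)"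
      by (subst emeasure_density) (auto intro!: nn_integral_cong simp: indicator_def)
    also have "\<dots> = ennreal (LINT x|lborel. indicator (box l u) x * h x)"
    proof (rule nn_integral_eq_integral)
      show "integrable lborel (\<lambda>x. indicat_real (box l u) x * h x)"
        using Bochner_Integration.integrable_add[OF i1 integrable_divide_zero[OF i2, of "C + 1"]]
        by (simp add: h_def algebra_simps)
    qed (use h0 in auto)
    also have "(LINT x|lborel. indicator (box l u) x * h x) =
       (LINT x|lborel. indicator (box l u) x + (indicator (box l u) x * g x) / (C + 1))"
      by (simp add: h_def algebra_simps)
    also have "\<dots> = measure lborel (box l u) + 0 / (C + 1)"
      using i1 integrable_divide_zero[OF i2, of "C + 1"] int0[of l u]
      by (subst Bochner_Integration.integral_add) auto
    finally show "emeasure (density lborel (\<lambda>x. ennreal (h x))) (box l u) = ennreal (\<Prod>b\<in>Basis. (u - l) \<bullet> b)"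
      using lu by (simp add: measure_lborel_box_eq)
  qed simp
  then have "density lborel (\<lambda>x. ennreal (h x)) = density lborel (\<lambda>x. 1)" by (simp add: density_1)
  moreover have "sigma_finite_measure (density lborel (\<lambda>x::'a. 1 :: ennreal))"
    by (simp add: density_1 lborel.sigma_finite_measure_axioms)
  ultimately have "AE x in lborel. ennreal (h x) = 1"
    by (subst sigma_finite_density_unique[symmetric]) auto
  then show ?thesis
    by eventually_elim (use h0 \<open>0 \<le> C\<close> in \<open>auto simp: h_def ennreal_eq_1\<close>)
qed

text \<open>The additivity defect of the difference quotients is a translation difference of the
  quotient along \<open>w\<close>. Under the integral over a box the translation passes to the
  indicator of the box, and the integral tends to 0; so the limit of the defect has zero integral
  over every box. The existence of the three limits is established separately, hence the conditional
  form.\<close>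

lemma AE_directional_limit_add:
  fixes f :: "'a::euclidean_space \<Rightarrow> real"
  assumes lip: "\<And>x y. \<bar>f x - f y\<bar> \<le> L * norm (x - y)"
  shows "AE x in lborel. \<forall>a b c. ((\<lambda>t. (f (x + t *\<^sub>R v) - f x) / t) \<longlongrightarrow> a) (at 0) \<longrightarrow>
     ((\<lambda>t. (f (x + t *\<^sub>R w) - f x) / t) \<longlongrightarrow> b) (at 0) \<longrightarrow>
     ((\<lambda>t. (f (x + t *\<^sub>R (v + w)) - f x) / t) \<longlongrightarrow> c) (at 0) \<longrightarrow> c = a + b"
proof -
  have contf: "continuous_on UNIV f"
    by (rule continuous_on_if_lipschitz[OF lip])
  have [measurable]: "f \<in> borel_measurable borel" by (rule borel_measurable_continuous_onI[OF contf])
  define e where "e n = 1 / real (Suc n)" for n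
  have e0: "e n > 0" "e n \<le> 1" for n by (auto simp: e_def)
  have elim0: "e \<longlonglongrightarrow> 0" unfolding e_def by (rule LIMSEQ_Suc[OF lim_1_over_n])
  have eat: "filterlim e (at 0) sequentially"
    using elim0 e0 by (intro filterlim_atI) (auto simp: less_imp_neq[symmetric])
  define dq where "dq n u x = (f (x + e n *\<^sub>R u) - f x) / e n" for n u x
  have dq_bd: "\<bar>dq n u x\<bar> \<le> L * norm u" for n u x
    using lip[of "x + e n *\<^sub>R u" x] e0[of n] by (simp add: dq_def field_simps)
  have [measurable]: "dq n u \<in> borel_measurable borel" for n u unfolding dq_def[abs_def] by measurable
  define C where "C = L * norm (v + w) + L * norm v + L * norm w"
  have "0 \<le> C" using dq_bd[of 0 v 0] dq_bd[of 0 w 0] dq_bd[of 0 "v + w" 0] by (simp add: C_def)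
  define E where "E n x = dq n (v + w) x - dq n v x - dq n w x" for n x
  have E_bd: "\<bar>E n x\<bar> \<le> C" for n x
    using dq_bd[of n v x] dq_bd[of n w x] dq_bd[of n "v + w" x] by (simp add: E_def C_def)
  have E_eq: "E n x = dq n w (x + e n *\<^sub>R v) - dq n w x" for n x
    using e0[of n] by (simp add: E_def dq_def field_simps scaleR_add_right)
  have [measurable]: "E n \<in> borel_measurable borel" for n unfolding E_def[abs_def] by measurable
  \<comment> \<open>Truncation to [-C, C] changes nothing where the defect converges and keeps
    \<open>g\<close> bounded where \<open>lim\<close> is an arbitrary value.\<close>
  define g where "g x = max (- C) (min C (lim (\<lambda>n. E n x)))" for x
  have [measurable]: "g \<in> borel_measurable borel" unfolding g_def[abs_def] by measurable
  have conv: "AE x in lborel. (\<lambda>n. E n x) \<longlonglongrightarrow> g x"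
    using AE_directional_limit[OF lip, of v] AE_directional_limit[OF lip, of w]
      AE_directional_limit[OF lip, of "v + w"]
  proof eventually_elim
    case (elim x)
    have "convergent (\<lambda>n. dq n u x)" if "\<exists>l. ((\<lambda>t. (f (x + t *\<^sub>R u) - f x) / t) \<longlongrightarrow> l) (at 0)" for u
      using that filterlim_compose[OF _ eat] unfolding convergent_def dq_def by blast
    then have "convergent (\<lambda>n. E n x)" unfolding E_def using elim by (intro convergent_diff) auto
    then have l: "(\<lambda>n. E n x) \<longlonglongrightarrow> lim (\<lambda>n. E n x)" by (simp add: convergent_LIMSEQ_iff)
    have "lim (\<lambda>n. E n x) \<le> C" by (rule LIMSEQ_le_const2[OF l]) (use E_bd in \<open>auto simp: abs_le_iff\<close>)
    moreover have "- C \<le> lim (\<lambda>n. E n x)"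
      by (rule LIMSEQ_le_const[OF l]) (use E_bd in \<open>auto simp: abs_le_iff minus_le_iff\<close>)
    ultimately show ?case using l by (simp add: g_def)
  qed
  have g_bd: "\<bar>g x\<bar> \<le> C" for x using \<open>0 \<le> C\<close> by (auto simp: g_def)
  have "(LINT x|lborel. indicator (box l u) x * g x) = 0" for l u
  proof -
    let ?\<chi> = "indicator (box l u) :: 'a \<Rightarrow> real"
    have i1: "integrable lborel ?\<chi>" by (intro integrable_real_indicator) (auto intro: emeasure_bounded_finite[unfolded infinity_ennreal_def])
    have lim1: "(\<lambda>n. LINT x|lborel. ?\<chi> x * E n x) \<longlonglongrightarrow> (LINT x|lborel. ?\<chi> x * g x)"
    proof (rule integral_dominated_convergence[where w = "\<lambda>x. C * ?\<chi> x"])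
      show "AE x in lborel. (\<lambda>n. ?\<chi> x * E n x) \<longlonglongrightarrow> ?\<chi> x * g x"
        using conv by eventually_elim (intro tendsto_intros)
    qed (use integrable_mult_right[OF i1, of C] E_bd \<open>0 \<le> C\<close> in \<open>auto simp: abs_mult split: split_indicator\<close>)
    have ib: "integrable lborel (\<lambda>x. ?\<chi> (x - y) * h x)"
      if [measurable]: "h \<in> borel_measurable borel" and "\<And>x. \<bar>h x\<bar> \<le> B" for y h and B :: real
    proof (rule Bochner_Integration.integrable_bound[of _ "\<lambda>x. B * indicator (box (l + y) (u + y)) x"])
      show "integrable lborel (\<lambda>x. B * indicator (box (l + y) (u + y)) x)"
        by (intro integrable_mult_right integrable_real_indicator) (auto intro: emeasure_bounded_finite[unfolded infinity_ennreal_def])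
      have "0 \<le> B" using that(2)[of 0] by linarith
      then show "AE x in lborel. norm (?\<chi> (x - y) * h x) \<le> norm (B * indicator (box (l + y) (u + y)) x)"
        using that(2) by (auto simp: indicator_def box_def algebra_simps abs_mult)
    qed measurable
    have eq: "(LINT x|lborel. ?\<chi> x * E n x) = (LINT x|lborel. (?\<chi> (x - e n *\<^sub>R v) - ?\<chi> x) * dq n w x)" for n
    proof -
      have "(LINT x|lborel. ?\<chi> x * dq n w (x + e n *\<^sub>R v)) =
          (LINT x|distr lborel borel ((+) (e n *\<^sub>R v)). ?\<chi> (x - e n *\<^sub>R v) * dq n w x)"
        by (subst integral_distr) (auto simp: add.commute)
      also have "\<dots> = (LINT x|lborel. ?\<chi> (x - e n *\<^sub>R v) * dq n w x)" unfolding lborel_distr_plus ..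
      finally have 1: "(LINT x|lborel. ?\<chi> x * dq n w (x + e n *\<^sub>R v)) = (LINT x|lborel. ?\<chi> (x - e n *\<^sub>R v) * dq n w x)" .
      have 2: "integrable lborel (\<lambda>x. ?\<chi> x * dq n w (x + y))" for y
        using ib[of "\<lambda>x. dq n w (x + y)" "L * norm w" 0] dq_bd by simp
      have "(LINT x|lborel. ?\<chi> x * E n x) =
         (LINT x|lborel. ?\<chi> x * dq n w (x + e n *\<^sub>R v)) - (LINT x|lborel. ?\<chi> x * dq n w x)"
        unfolding E_eq using 2[of "e n *\<^sub>R v"] 2[of 0] by (simp add: right_diff_distrib)
      then show ?thesis unfolding 1
        using ib[of "dq n w" "L * norm w" "e n *\<^sub>R v"] ib[of "dq n w" "L * norm w" 0] dq_bd
        by (simp add: left_diff_distrib)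
    qed
    obtain r where r: "\<And>x. x \<in> cbox l u \<Longrightarrow> norm x \<le> r"
      using bounded_cbox[of l u] by (auto simp: bounded_iff)
    have lim2: "(\<lambda>n. LINT x|lborel. (?\<chi> (x - e n *\<^sub>R v) - ?\<chi> x) * dq n w x) \<longlonglongrightarrow> integral\<^sup>L lborel (\<lambda>x::'a. 0)"
    proof (rule integral_dominated_convergence[where w = "\<lambda>x. (L * norm w) * indicator (cball 0 (r + norm v)) x"])
      have nw: "0 \<le> L * norm w" using dq_bd[of 0 w 0] by linarith
      show "integrable lborel (\<lambda>x. (L * norm w) * indicat_real (cball 0 (r + norm v)) x)"
        by (intro integrable_mult_right integrable_real_indicator) (auto intro: emeasure_bounded_finite[unfolded infinity_ennreal_def])
      show "AE x in lborel. norm ((?\<chi> (x - e n *\<^sub>R v) - ?\<chi> x) * dq n w x) \<le> (L * norm w) * indicat_real (cball 0 (r + norm v)) x" for n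
      proof (rule AE_I2)
        fix x
        show "norm ((?\<chi> (x - e n *\<^sub>R v) - ?\<chi> x) * dq n w x) \<le> (L * norm w) * indicat_real (cball 0 (r + norm v)) x"
        proof (cases "x \<in> cball 0 (r + norm v)")
          case True
          then show ?thesis using dq_bd[of n w x] nw by (auto simp: indicator_def)
        next
          case False
          then have nx: "norm x > r + norm v" by simp
          have "norm (e n *\<^sub>R v) \<le> norm v" using e0[of n] by (simp add: mult_left_le_one_le)
          then have "norm (x - e n *\<^sub>R v) > r" using nx norm_triangle_ineq2[of x "e n *\<^sub>R v"] by linarith
          then have "x - e n *\<^sub>R v \<notin> box l u" using r box_subset_cbox by force
          moreover have "x \<notin> box l u" using r[of x] nx box_subset_cbox[of l u] norm_ge_zero[of v] by auto
          ultimately show ?thesis using False by simp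
        qed
      qed
      \<comment> \<open>Off the boundary of the box, sufficiently small translations do not change
        the indicator.\<close>
      have "AE x in lborel. x \<notin> cbox l u - box l u"
        by (rule AE_not_in[OF null_sets_cbox_Diff_box])
      then show "AE x in lborel. (\<lambda>n. (?\<chi> (x - e n *\<^sub>R v) - ?\<chi> x) * dq n w x) \<longlonglongrightarrow> 0"
      proof eventually_elim
        case (elim x)
        have lim: "(\<lambda>n. x - e n *\<^sub>R v) \<longlonglongrightarrow> x"
          using tendsto_diff[OF tendsto_const tendsto_scaleR[OF elim0 tendsto_const], of x v] by simp
        have "\<forall>\<^sub>F n in sequentially. ?\<chi> (x - e n *\<^sub>R v) = ?\<chi> x"
        proof (cases "x \<in> box l u")
          case True
          from topological_tendstoD[OF lim open_box True] show ?thesis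
            using True by (auto elim: eventually_mono)
        next
          case False
          then have "x \<in> - cbox l u" using elim by auto
          from topological_tendstoD[OF lim _ this] show ?thesis
            using False box_subset_cbox[of l u]
            by (auto elim!: eventually_mono simp: closed_cbox open_Compl split: split_indicator)
        qed
        then have "\<forall>\<^sub>F n in sequentially. (?\<chi> (x - e n *\<^sub>R v) - ?\<chi> x) * dq n w x = 0"
          by eventually_elim simp
        then show ?case by (rule tendsto_eventually)
      qed
    qed auto
    show ?thesis using LIMSEQ_unique[OF lim1] lim2 unfolding eq by simp
  qed
  then have "AE x in lborel. g x = 0" by (intro AE_zero_if_box_integrals_zero[OF _ g_bd]) auto
  then show ?thesis using conv
  proof eventually_elim
    case (elim x)
    show ?case
    proof (intro allI impI)
      fix a b c
      assume lims: "((\<lambda>t. (f (x + t *\<^sub>R v) - f x) / t) \<longlongrightarrow> a) (at 0)" "((\<lambda>t. (f (x + t *\<^sub>R w) - f x) / t) \<longlongrightarrow> b) (at 0)"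
         "((\<lambda>t. (f (x + t *\<^sub>R (v + w)) - f x) / t) \<longlongrightarrow> c) (at 0)"
      have "(\<lambda>n. E n x) \<longlonglongrightarrow> c - a - b"
        unfolding E_def dq_def by (intro tendsto_diff filterlim_compose[OF _ eat] lims)
      then have "c - a - b = 0" using elim LIMSEQ_unique by metis
      then show "c = a + b" by simp
    qed
  qed
qed

lemma directional_limit_scaleR:
  fixes f :: "'a::real_normed_vector \<Rightarrow> real"
  assumes l: "((\<lambda>t. (f (x + t *\<^sub>R v) - f x) / t) \<longlongrightarrow> l) (at 0)"
  shows "((\<lambda>t. (f (x + t *\<^sub>R (c *\<^sub>R v)) - f x) / t) \<longlongrightarrow> c * l) (at 0)"
proof (cases "c = 0")
  case True
  then show ?thesis by simp
next
  case False
  have "filterlim (\<lambda>t. t * c) (at 0) (at 0)"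
    using False by (intro filterlim_atI tendsto_eq_intros) (auto simp: eventually_at_filter)
  from tendsto_mult_left[OF filterlim_compose[OF l this], of c]
  show ?thesis using False by simp
qed

lemma AE_directional_limit_linear:
  fixes f :: "'a::euclidean_space \<Rightarrow> real"
  assumes lip: "\<And>x y. \<bar>f x - f y\<bar> \<le> L * norm (x - y)"
  shows "AE x in lborel. ((\<lambda>t. (f (x + t *\<^sub>R v) - f x) / t) \<longlongrightarrow>
     (\<Sum>i\<in>Basis. (v \<bullet> i) * Lim (at 0) (\<lambda>t. (f (x + t *\<^sub>R i) - f x) / t))) (at 0)"
proof -
  define D where "D u x = Lim (at 0) (\<lambda>t. (f (x + t *\<^sub>R u) - f x) / t)" for u x
  have D: "AE x in lborel. ((\<lambda>t. (f (x + t *\<^sub>R u) - f x) / t) \<longlongrightarrow> D u x) (at 0)" for u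
    using AE_directional_limit[OF lip, of u]
    by eventually_elim (auto simp: D_def tendsto_Lim)
  have "AE x in lborel. ((\<lambda>t. (f (x + t *\<^sub>R (\<Sum>i\<in>B. (v \<bullet> i) *\<^sub>R i)) - f x) / t) \<longlongrightarrow>
     (\<Sum>i\<in>B. (v \<bullet> i) * D i x)) (at 0)" if "finite B" for B
    using that
  proof (induction B rule: finite_induct)
    case (insert j B)
    let ?s = "\<Sum>i\<in>B. (v \<bullet> i) *\<^sub>R i"
    show ?case
      using insert.IH AE_directional_limit_add[OF lip, of "(v \<bullet> j) *\<^sub>R j" ?s] D[of j]
        AE_directional_limit[OF lip, of "(v \<bullet> j) *\<^sub>R j + ?s"]
    proof eventually_elim
      case (elim x)
      from elim(4) obtain c where
        c: "((\<lambda>t. (f (x + t *\<^sub>R ((v \<bullet> j) *\<^sub>R j + ?s)) - f x) / t) \<longlongrightarrow> c) (at 0)" by auto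
      from elim(2) directional_limit_scaleR[OF elim(3), of "v \<bullet> j"] elim(1) c
      have "c = (v \<bullet> j) * D j x + (\<Sum>i\<in>B. (v \<bullet> i) * D i x)" by blast
      with c insert.hyps show ?case by simp
    qed
  qed simp
  from this[OF finite_Basis] show ?thesis by (simp add: euclidean_representation D_def)
qed

text \<open>At almost every x the derivatives along a countable dense set of directions exist and
  depend linearly on the direction. By compactness finitely many of these directions approximate the
  whole unit sphere, and the Lipschitz bound transfers their rates of convergence uniformly to all
  directions.\<close>

theorem AE_differentiable_if_lipschitz:
  fixes f :: "'a::euclidean_space \<Rightarrow> real"
  assumes lip: "\<And>x y. \<bar>f x - f y\<bar> \<le> L * norm (x - y)"
  shows "AE x in lborel. f differentiable (at x)"
proof -
  obtain Q :: "'a set" where Q: "countable Q" "\<And>X. open X \<Longrightarrow> X \<noteq> {} \<Longrightarrow> \<exists>q\<in>Q. q \<in> X"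
    using countable_dense_exists by metis
  define D where "D i x = Lim (at 0) (\<lambda>t. (f (x + t *\<^sub>R i) - f x) / t)" for i x
  have "0 \<le> L"
  proof -
    obtain b :: 'a where "b \<in> Basis" by fastforce
    then show ?thesis using order_trans[OF abs_ge_zero lip[of b 0]] by simp
  qed
  have "AE x in lborel. \<forall>q\<in>Q. ((\<lambda>t. (f (x + t *\<^sub>R q) - f x) / t) \<longlongrightarrow> (\<Sum>i\<in>Basis. (q \<bullet> i) * D i x)) (at 0)"
    unfolding D_def by (subst AE_ball_countable[OF Q(1)]) (use AE_directional_limit_linear[OF lip] in auto)
  then show ?thesis
  proof eventually_elim
    case (elim x)
    define G where "G v = (\<Sum>i\<in>Basis. (v \<bullet> i) * D i x)" for v
    have blG: "bounded_linear G" unfolding G_def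
      by (intro bounded_linear_sum bounded_linear_mult_const bounded_linear_inner_left)
    then obtain K where K: "K > 0" "\<And>v. \<bar>G v\<bar> \<le> norm v * K"
      using bounded_linear.pos_bounded by (metis real_norm_def)
    have Gdiff: "G (u - w) = G u - G w" "G (c *\<^sub>R u) = c * G u" for u w c
      using blG by (auto simp: linear_simps)
    have "(f has_derivative G) (at x)"
      unfolding has_derivative_at_alt
    proof (intro conjI blG allI impI)
      fix e :: real assume "0 < e"
      \<comment> \<open>Replacing a direction by one at distance \<eta> costs at most L \<eta> in
        \<open>f\<close> and K \<eta> in \<open>G\<close>, relative to the step length; together
        this is e/2, and the other e/2 is left for the quotient.\<close>
      define \<eta> where "\<eta> = e / (2 * (L + K))"
      have "\<eta> > 0" using \<open>0 < e\<close> \<open>0 \<le> L\<close> K by (simp add: \<eta>_def)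
      have "sphere (0::'a) 1 \<subseteq> (\<Union>q\<in>Q. ball q \<eta>)"
      proof
        fix u :: 'a
        obtain q where "q \<in> Q" "q \<in> ball u \<eta>" using Q(2)[of "ball u \<eta>"] \<open>\<eta> > 0\<close> by auto
        then show "u \<in> (\<Union>q\<in>Q. ball q \<eta>)" by (auto simp: dist_commute)
      qed
      then obtain P where P: "P \<subseteq> Q" "finite P" "sphere (0::'a) 1 \<subseteq> (\<Union>q\<in>P. ball q \<eta>)"
        using compactE_image[of "sphere (0::'a) 1" Q "\<lambda>q. ball q \<eta>"] by auto
      have "\<exists>d>0. \<forall>t. 0 < \<bar>t\<bar> \<and> \<bar>t\<bar> < d \<longrightarrow> \<bar>(f (x + t *\<^sub>R q) - f x) / t - G q\<bar> < e / 2" if "q \<in> P" for q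
      proof -
        have "((\<lambda>t. (f (x + t *\<^sub>R q) - f x) / t) \<longlongrightarrow> G q) (at 0)"
          using elim P(1) that unfolding G_def by auto
        from tendstoD[OF this, of "e / 2"] \<open>0 < e\<close> show ?thesis
          unfolding eventually_at by (auto simp: dist_real_def)
      qed
      then obtain d where d: "\<And>q. q \<in> P \<Longrightarrow> d q > 0"
        "\<And>q t. q \<in> P \<Longrightarrow> 0 < \<bar>t\<bar> \<Longrightarrow> \<bar>t\<bar> < d q \<Longrightarrow> \<bar>(f (x + t *\<^sub>R q) - f x) / t - G q\<bar> < e / 2" by metis
      have "P \<noteq> {}"
      proof -
        obtain b :: 'a where "b \<in> Basis" by fastforce
        then have "b \<in> sphere 0 1" by simp
        then show ?thesis using P(3) by auto
      qed
      define d0 where "d0 = Min (d ` P)"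
      have d0: "d0 > 0" "\<And>q. q \<in> P \<Longrightarrow> d0 \<le> d q"
        using d(1) P(2) \<open>P \<noteq> {}\<close> by (auto simp: d0_def)
      show "\<exists>d>0. \<forall>y. norm (y - x) < d \<longrightarrow> norm (f y - f x - G (y - x)) \<le> e * norm (y - x)"
      proof (intro exI[of _ d0] conjI allI impI d0)
        fix y assume y: "norm (y - x) < d0"
        show "norm (f y - f x - G (y - x)) \<le> e * norm (y - x)"
        proof (cases "y = x")
          case True then show ?thesis using Gdiff(2)[of 0 0] by simp
        next
          case False
          define t where "t = norm (y - x)"
          define u where "u = (1 / t) *\<^sub>R (y - x)"
          have t: "0 < t" "t < d0" using False y by (auto simp: t_def)
          have yx: "y = x + t *\<^sub>R u" "y - x = t *\<^sub>R u" using t by (auto simp: u_def)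
          have "u \<in> sphere 0 1" using t by (simp add: u_def t_def)
          then obtain q where q: "q \<in> P" "norm (u - q) < \<eta>" using P(3) by (auto simp: dist_norm norm_minus_commute)
          have 1: "\<bar>f y - f (x + t *\<^sub>R q)\<bar> \<le> t * (L * \<eta>)"
          proof -
            have "\<bar>f y - f (x + t *\<^sub>R q)\<bar> \<le> L * norm (t *\<^sub>R (u - q))"
              using lip[of y "x + t *\<^sub>R q"] yx by (simp add: scaleR_diff_right)
            also have "\<dots> = t * (L * norm (u - q))" using t by simp
            also have "\<dots> \<le> t * (L * \<eta>)" using t q \<open>0 \<le> L\<close> by (intro mult_left_mono) auto
            finally show ?thesis .
          qed
          have 2: "\<bar>f (x + t *\<^sub>R q) - f x - t * G q\<bar> \<le> t * (e / 2)"
          proof -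
            have "\<bar>(f (x + t *\<^sub>R q) - f x) / t - G q\<bar> \<le> e / 2" using d(2)[OF q(1), of t] d0(2)[OF q(1)] t by simp
            then have "t * \<bar>(f (x + t *\<^sub>R q) - f x) / t - G q\<bar> \<le> t * (e / 2)" using t by (intro mult_left_mono) auto
            moreover have "f (x + t *\<^sub>R q) - f x - t * G q = t * ((f (x + t *\<^sub>R q) - f x) / t - G q)"
              using t by (simp add: field_simps)
            ultimately show ?thesis using t by (simp only: abs_mult abs_of_pos)
          qed
          have 3: "\<bar>t * G q - G (y - x)\<bar> \<le> t * (K * \<eta>)"
          proof -
            have "t * G q - G (y - x) = - t * G (u - q)" by (simp add: yx Gdiff right_diff_distrib)
            then have "\<bar>t * G q - G (y - x)\<bar> = t * \<bar>G (u - q)\<bar>" using t by (simp add: abs_mult)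
            also have "\<dots> \<le> t * (norm (u - q) * K)" using t K by (intro mult_left_mono) auto
            also have "\<dots> \<le> t * (\<eta> * K)" using t K q by (intro mult_left_mono mult_right_mono) auto
            finally show ?thesis by (simp add: mult.commute)
          qed
          have "t * (L * \<eta>) + t * (e / 2) + t * (K * \<eta>) = t * ((L + K) * \<eta> + e / 2)" by (simp add: algebra_simps)
          also have "(L + K) * \<eta> = e / 2"
          proof -
            have "L + K \<noteq> 0" using \<open>0 \<le> L\<close> K by linarith
            then show ?thesis by (simp add: \<eta>_def field_simps)
          qed
          finally have "t * (L * \<eta>) + t * (e / 2) + t * (K * \<eta>) = e * t" by simp
          with 1 2 3 have "\<bar>f y - f x - G (y - x)\<bar> \<le> e * t" by linarith
          then show ?thesis by (simp add: t_def)
        qed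
      qed
    qed
    then show ?case by (auto simp: differentiable_def)
  qed
qed

text \<open>McShane's extension: the infimum of the cones f s + L dist x s over s in
  \<open>S\<close>.\<close>

lemma lipschitz_extension_real:
  fixes f :: "'a::metric_space \<Rightarrow> real"
  assumes lip: "\<And>x y. x \<in> S \<Longrightarrow> y \<in> S \<Longrightarrow> \<bar>f x - f y\<bar> \<le> L * dist x y" and "0 \<le> L"
  obtains g where "\<And>x y. \<bar>g x - g y\<bar> \<le> L * dist x y" "\<And>x. x \<in> S \<Longrightarrow> g x = f x"
proof (cases "S = {}")
  case True
  show ?thesis by (rule that[of "\<lambda>_. 0"]) (use True \<open>0 \<le> L\<close> in auto)
next
  case False
  then obtain s0 where s0: "s0 \<in> S" by auto
  define g where "g x = (INF s\<in>S. f s + L * dist x s)" for x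
  have bdd: "bdd_below ((\<lambda>s. f s + L * dist x s) ` S)" for x
  proof (rule bdd_belowI2)
    fix s assume s: "s \<in> S"
    have "L * dist s s0 \<le> L * (dist x s + dist x s0)"
      using dist_triangle3[of s s0 x] \<open>0 \<le> L\<close> by (intro mult_left_mono) auto
    then show "f s0 - L * dist x s0 \<le> f s + L * dist x s"
      using lip[OF s s0] by (simp add: algebra_simps abs_le_iff)
  qed
  have le: "g x \<le> g y + L * dist x y" for x y
  proof -
    have "g x - L * dist x y \<le> f s + L * dist y s" if "s \<in> S" for s
    proof -
      have "g x \<le> f s + L * dist x s" unfolding g_def by (rule cINF_lower[OF bdd that])
      moreover have "L * dist x s \<le> L * (dist x y + dist y s)"
        using dist_triangle[of x s y] \<open>0 \<le> L\<close> by (intro mult_left_mono) auto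
      ultimately show ?thesis by (simp add: algebra_simps)
    qed
    then have "g x - L * dist x y \<le> g y" unfolding g_def[of y] by (intro cINF_greatest False)
    then show ?thesis by simp
  qed
  have "g x = f x" if x: "x \<in> S" for x
  proof (rule antisym)
    show "g x \<le> f x" unfolding g_def using cINF_lower[OF bdd x, of x] by simp
    show "f x \<le> g x" unfolding g_def
    proof (rule cINF_greatest[OF False])
      fix s assume "s \<in> S"
      then show "f x \<le> f s + L * dist x s" using lip[OF x] by (auto simp: abs_le_iff algebra_simps)
    qed
  qed
  moreover have "\<bar>g x - g y\<bar> \<le> L * dist x y" for x y
    using le[of x y] le[of y x] by (auto simp: abs_le_iff dist_commute)
  ultimately show ?thesis by (intro that)
qed

text \<open>The coordinates are extended to the whole space before Rademacher's theorem is applied;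
  near each point of the open set the extension agrees with \<open>f\<close>, hence so does its
  derivative.\<close>

corollary AE_differentiable_if_lipschitz_on_open:
  fixes f :: "'a::euclidean_space \<Rightarrow> 'a"
  assumes "open S" and lip: "\<And>x y. x \<in> S \<Longrightarrow> y \<in> S \<Longrightarrow> dist (f x) (f y) \<le> L * dist x y" and "0 \<le> L"
  shows "AE x in lborel. x \<in> S \<longrightarrow> f differentiable (at x)"
proof -
  have "\<exists>g. (\<forall>x y. \<bar>g x - g y\<bar> \<le> L * dist x y) \<and> (\<forall>x\<in>S. g x = f x \<bullet> i)" if "i \<in> Basis" for i
  proof -
    have "\<bar>f x \<bullet> i - f y \<bullet> i\<bar> \<le> L * dist x y" if xy: "x \<in> S" "y \<in> S" for x y
      using lip[OF xy] Basis_le_norm[OF \<open>i \<in> Basis\<close>, of "f x - f y"]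
      by (simp add: inner_diff_left dist_norm)
    from lipschitz_extension_real[OF this \<open>0 \<le> L\<close>] show ?thesis by metis
  qed
  then obtain g where g: "\<And>i x y. i \<in> Basis \<Longrightarrow> \<bar>g i x - g i y\<bar> \<le> L * dist x y"
    "\<And>i x. i \<in> Basis \<Longrightarrow> x \<in> S \<Longrightarrow> g i x = f x \<bullet> i" by metis
  have "AE x in lborel. \<forall>i\<in>Basis. g i differentiable (at x)"
    by (subst AE_ball_countable)
      (use AE_differentiable_if_lipschitz[of "g _" L] g(1) in \<open>auto simp: countable_finite dist_norm\<close>)
  then show ?thesis
  proof eventually_elim
    case x1: (elim x)
    show ?case
    proof (rule impI)
    assume xS: "x \<in> S"
    note x = x1 xS
    have "(\<lambda>y. \<Sum>i\<in>Basis. g i y *\<^sub>R i) differentiable (at x)"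
      using x(1) by (intro differentiable_sum differentiable_scaleR) auto
    moreover have "(\<Sum>i\<in>Basis. g i y *\<^sub>R i) = f y" if "y \<in> S" for y
      using g(2) that by (simp add: euclidean_representation)
    ultimately show "f differentiable (at x)"
      using \<open>open S\<close> x(2) unfolding differentiable_def
      by (metis (no_types, lifting) has_derivative_transform_within_open)
    qed
  qed
qed

section \<open>Determinants of derivatives\<close>

text \<open>The basis vectors index a Cartesian power that is a coordinate copy of the given
  Euclidean space and carries matrices, determinants and the change of variables formula.\<close>

typedef (overloaded) 'a basis_index = "Basis :: 'a::euclidean_space set"
  using nonempty_Basis by blast

instance basis_index :: (euclidean_space) finite
proof
  have "(UNIV :: 'a basis_index set) = Abs_basis_index ` Basis"
    by (metis type_definition.Abs_image type_definition_basis_index)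
  then show "finite (UNIV :: 'a basis_index set)" by (metis finite_Basis finite_imageI)
qed

text \<open>The order comes from an enumeration of the finite basis; the change of variables formula
  is stated for well-ordered finite index types.\<close>

instantiation basis_index :: (euclidean_space) wellorder
begin
definition "less_eq_basis_index (i :: 'a basis_index) j \<longleftrightarrow>
  to_nat_on (Basis :: 'a set) (Rep_basis_index i) \<le> to_nat_on (Basis :: 'a set) (Rep_basis_index j)"
definition "less_basis_index (i :: 'a basis_index) j \<longleftrightarrow>
  to_nat_on (Basis :: 'a set) (Rep_basis_index i) < to_nat_on (Basis :: 'a set) (Rep_basis_index j)"
instance
proof
  fix x y :: "'a basis_index"
  assume "x \<le> y" "y \<le> x"
  then show "x = y"
    using inj_onD[OF inj_on_to_nat_on[of "Basis :: 'a set"], of "Rep_basis_index x" "Rep_basis_index y"]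
      Rep_basis_index[of x] Rep_basis_index[of y]
    unfolding less_eq_basis_index_def by (simp add: countable_finite Rep_basis_index_inject)
next
  fix P :: "'a basis_index \<Rightarrow> bool" and a
  assume "\<And>x. (\<And>y. y < x \<Longrightarrow> P y) \<Longrightarrow> P x"
  then show "P a"
    unfolding less_basis_index_def
    using measure_induct_rule[of "\<lambda>i. to_nat_on (Basis :: 'a set) (Rep_basis_index i)" P a] by metis
qed (auto simp: less_eq_basis_index_def less_basis_index_def)
end

section \<open>Orthonormal coordinates and Jacobian determinants\<close>

definition to_cart :: "'a::euclidean_space \<Rightarrow> real ^ 'a basis_index" where
  "to_cart x = (\<chi> i. x \<bullet> Rep_basis_index i)"

definition of_cart :: "real ^ 'a basis_index \<Rightarrow> 'a::euclidean_space" where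
  "of_cart v = (\<Sum>b\<in>Basis. (v $ Abs_basis_index b) *\<^sub>R b)"

lemma of_cart_to_cart [simp]: "of_cart (to_cart x) = x"
  by (simp add: of_cart_def to_cart_def Abs_basis_index_inverse euclidean_representation)

lemma to_cart_of_cart [simp]: "to_cart (of_cart v) = v"
  by (simp add: of_cart_def to_cart_def vec_eq_iff inner_sum_left_Basis Rep_basis_index
      Rep_basis_index_inverse)

lemma linear_to_cart: "linear to_cart"
  by (rule linearI) (auto simp: to_cart_def vec_eq_iff inner_add_left)

lemma linear_of_cart: "linear of_cart"
  by (rule linearI) (auto simp: of_cart_def algebra_simps sum.distrib scaleR_sum_right)

lemma measurable_of_cart [measurable]: "of_cart \<in> borel_measurable borel"
  by (intro borel_measurable_continuous_onI linear_continuous_on)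
    (simp add: linear_of_cart flip: linear_conv_bounded_linear)

lemma distr_lborel_of_cart: "distr lborel borel of_cart = (lborel :: 'a::euclidean_space measure)"
proof (rule lborel_eqI[symmetric])
  fix l u :: 'a assume lu: "\<And>b. b \<in> Basis \<Longrightarrow> l \<bullet> b \<le> u \<bullet> b"
  have "of_cart -` box l u = box (to_cart l) (to_cart u)"
  proof (intro set_eqI)
    fix v :: "real ^ 'a basis_index"
    have "v \<in> of_cart -` box l u \<longleftrightarrow> (\<forall>b\<in>Basis. l \<bullet> b < v $ Abs_basis_index b \<and> v $ Abs_basis_index b < u \<bullet> b)"
      by (simp add: box_def of_cart_def inner_sum_left_Basis)
    also have "\<dots> \<longleftrightarrow> (\<forall>i. l \<bullet> Rep_basis_index i < v $ i \<and> v $ i < u \<bullet> Rep_basis_index i)"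
      by (metis Rep_basis_index Rep_basis_index_inverse Abs_basis_index_inverse)
    finally show "v \<in> of_cart -` box l u \<longleftrightarrow> v \<in> box (to_cart l) (to_cart u)"
      by (simp add: mem_box_cart to_cart_def)
  qed
  then have "emeasure (distr lborel borel of_cart) (box l u) = emeasure lborel (box (to_cart l) (to_cart u))"
    by (subst emeasure_distr) auto
  also have "\<dots> = ennreal (\<Prod>b\<in>Basis. (to_cart u - to_cart l) \<bullet> b)"
    using lu[OF Rep_basis_index] by (intro emeasure_lborel_box) (auto simp: Basis_vec_def inner_axis to_cart_def)
  also have "(\<Prod>b\<in>Basis. (to_cart u - to_cart l) \<bullet> b) = (\<Prod>i\<in>UNIV. (u - l) \<bullet> Rep_basis_index i)"
  proof -
    have B: "(Basis :: (real ^ 'a basis_index) set) = (\<lambda>i. axis i 1) ` UNIV" by (auto simp: Basis_vec_def)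
    have "inj (\<lambda>i. axis i 1 :: real ^ 'a basis_index)" by (auto simp: inj_on_def axis_eq_axis)
    then show ?thesis
      unfolding B by (subst prod.reindex) (auto simp: inner_axis to_cart_def inner_diff_left)
  qed
  also have "\<dots> = (\<Prod>b\<in>Basis. (u - l) \<bullet> b)"
    by (rule prod.reindex_bij_betw)
      (auto simp: bij_betw_def inj_on_def Rep_basis_index_inject type_definition.Rep_range[OF type_definition_basis_index])
  finally show "emeasure (distr lborel borel of_cart) (box l u) = ennreal (\<Prod>b\<in>Basis. (u - l) \<bullet> b)" .
qed simp

lemma to_cart_image_eq_vimage: "to_cart ` A = of_cart -` A"
  by (auto simp: image_iff intro!: bexI[of _ "of_cart _"])

lemma emeasure_to_cart_image:
  "A \<in> sets borel \<Longrightarrow> emeasure lborel (to_cart ` A) = emeasure lborel A"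
  by (subst (2) distr_lborel_of_cart[symmetric]) (simp add: emeasure_distr to_cart_image_eq_vimage)

lemma sets_to_cart_image: "A \<in> sets borel \<Longrightarrow> to_cart ` A \<in> sets borel"
  using measurable_sets[OF measurable_of_cart, of A] by (simp add: to_cart_image_eq_vimage)

definition jacobian_det :: "('a::euclidean_space \<Rightarrow> 'a) \<Rightarrow> real" where
  "jacobian_det L = det (matrix (to_cart \<circ> L \<circ> of_cart))"

lemma jacobian_det_ident: "jacobian_det (\<lambda>x. x) = 1"
proof -
  have "to_cart \<circ> (\<lambda>x. x) \<circ> of_cart = (id :: real ^ 'a basis_index \<Rightarrow> _)" by (auto simp: fun_eq_iff)
  then show ?thesis unfolding jacobian_det_def by (simp only: matrix_id_mat_1 det_I)
qed

lemma jacobian_det_nonzero: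
  assumes "linear L" and "inj L"
  shows "jacobian_det (L :: 'a::euclidean_space \<Rightarrow> 'a) \<noteq> 0"
proof -
  have l: "linear (to_cart \<circ> L \<circ> of_cart)"
    using assms(1) by (intro linear_compose linear_to_cart linear_of_cart)
  have "inj (to_cart :: 'a \<Rightarrow> _)" by (metis inj_on_inverseI of_cart_to_cart)
  moreover have "inj (of_cart :: _ \<Rightarrow> 'a)" by (metis inj_on_inverseI to_cart_of_cart)
  ultimately have "inj (to_cart \<circ> L \<circ> of_cart)" using assms(2) by (intro inj_compose)
  then show ?thesis using l det_nz_iff_inj unfolding jacobian_det_def by blast
qed

text \<open>In the Leibniz formula each summand is a product of \<open>DIM('a)\<close> matrix
  entries, each of degree at most one in t.\<close>

lemma jacobian_det_segment_poly:
  fixes A B :: "'a::euclidean_space \<Rightarrow> 'a"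
  assumes "linear A" "linear B"
  shows "\<exists>P. degree P \<le> DIM('a) \<and> (\<forall>t. jacobian_det (\<lambda>x. (1 - t) *\<^sub>R A x + t *\<^sub>R B x) = poly P t)"
proof -
  let ?M = "matrix (to_cart \<circ> A \<circ> of_cart)" and ?N = "matrix (to_cart \<circ> B \<circ> of_cart)"
  define P where "P = (\<Sum>p\<in>{p. p permutes (UNIV :: 'a basis_index set)}.
     smult (of_int (sign p)) (\<Prod>i\<in>UNIV. [:?M $ i $ p i, ?N $ i $ p i - ?M $ i $ p i:]))"
  have "CARD('a basis_index) = DIM('a)" by (rule type_definition.card[OF type_definition_basis_index])
  then have "degree P \<le> DIM('a)"
    unfolding P_def
    by (intro degree_sum_le order_trans[OF degree_smult_le] order_trans[OF degree_prod_sum_le]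
        order_trans[OF sum_bounded_above[where K = 1]]) (auto simp: finite_permutations degree_pCons_eq_if)
  moreover have "jacobian_det (\<lambda>x. (1 - t) *\<^sub>R A x + t *\<^sub>R B x) = poly P t" for t
  proof -
    have e: "to_cart (a *\<^sub>R x + c *\<^sub>R y) $ i = a * to_cart x $ i + c * to_cart y $ i" for a c x and y :: 'a and i
      by (simp add: to_cart_def inner_add_left)
    have "matrix (to_cart \<circ> (\<lambda>x. (1 - t) *\<^sub>R A x + t *\<^sub>R B x) \<circ> of_cart) =
        (\<chi> i j. ?M $ i $ j + t * (?N $ i $ j - ?M $ i $ j))"
      by (simp add: matrix_def vec_eq_iff e) (simp add: algebra_simps)
    then show ?thesis
      by (simp add: jacobian_det_def det_def P_def poly_sum poly_prod)
  qed
  ultimately show ?thesis by blast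
qed

text \<open>The change of variables formula transported to coordinates. Boundedness of the image
  makes its measure finite, so that the integral exists with a real value.\<close>

lemma has_integral_jacobian_det:
  fixes g :: "'a::euclidean_space \<Rightarrow> 'a"
  assumes S: "S \<in> sets borel" and gS: "g ` S \<in> sets borel" "bounded (g ` S)" and inj: "inj_on g S"
    and der: "\<And>x. x \<in> S \<Longrightarrow> (g has_derivative g' x) (at x within S)"
  shows "((\<lambda>y. \<bar>jacobian_det (g' (of_cart y))\<bar>) has_integral measure lborel (g ` S)) (to_cart ` S)"
proof -
  define f where "f = to_cart \<circ> g \<circ> (of_cart :: _ \<Rightarrow> 'a)"
  have img: "f ` (to_cart ` S) = to_cart ` (g ` S)" by (auto simp: f_def image_comp)
  have bl: "bounded_linear (to_cart :: 'a \<Rightarrow> _)" "bounded_linear (of_cart :: _ \<Rightarrow> 'a)"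
    using linear_to_cart linear_of_cart by (simp_all add: linear_conv_bounded_linear)
  have "(f has_derivative (to_cart \<circ> g' (of_cart y) \<circ> of_cart)) (at y within to_cart ` S)"
    if "y \<in> to_cart ` S" for y
  proof -
    have x: "of_cart y \<in> S" using that by auto
    have "of_cart ` (to_cart ` S) = S" by (auto simp: image_comp)
    then have "(g has_derivative g' (of_cart y)) (at (of_cart y) within of_cart ` (to_cart ` S))"
      using der[OF x] by simp
    then have "(g \<circ> of_cart has_derivative g' (of_cart y) \<circ> of_cart) (at y within to_cart ` S)"
      by (rule diff_chain_within[OF bounded_linear_imp_has_derivative[OF bl(2)]])
    from diff_chain_within[OF this bounded_linear_imp_has_derivative[OF bl(1)]] show ?thesis
      unfolding f_def comp_assoc .
  qed
  moreover have "inj_on f (to_cart ` S)"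
  proof (rule inj_onI)
    fix x y assume "x \<in> to_cart ` S" "y \<in> to_cart ` S" "f x = f y"
    moreover have "of_cart (f x) = g (of_cart x)" "of_cart (f y) = g (of_cart y)" by (auto simp: f_def)
    ultimately show "x = y" using inj by (auto dest!: inj_onD)
  qed
  moreover have "to_cart ` S \<in> sets lebesgue" using sets_to_cart_image[OF S] by simp
  ultimately have *: "f ` (to_cart ` S) \<in> lmeasurable \<and> measure lebesgue (f ` (to_cart ` S)) = measure lborel (g ` S)
     \<longleftrightarrow> ((\<lambda>y. \<bar>det (matrix (to_cart \<circ> g' (of_cart y) \<circ> of_cart))\<bar>) has_integral measure lborel (g ` S)) (to_cart ` S)"
    by (intro has_measure_differentiable_image) auto
  have b: "to_cart ` (g ` S) \<in> sets borel" by (rule sets_to_cart_image[OF gS(1)])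
  have fin: "emeasure lborel (g ` S) < \<infinity>" by (rule emeasure_bounded_finite[OF gS(2)])
  have e: "emeasure lborel (to_cart ` (g ` S)) = emeasure lborel (g ` S)" by (rule emeasure_to_cart_image[OF gS(1)])
  have "to_cart ` (g ` S) \<in> lmeasurable"
    using b fin e by (intro fmeasurableI) auto
  moreover have "measure lebesgue (to_cart ` (g ` S)) = measure lborel (g ` S)"
    using b e by (simp add: measure_def)
  ultimately show ?thesis using * unfolding img jacobian_det_def by simp
qed

text \<open>The same weights \<open>l s\<close> reproduce every polynomial of degree at most d from
  its values at the nodes. Applied pointwise to Jacobians and then integrated, this shows that an
  integral of polynomials depending on a point is again a polynomial.\<close>

lemma lagrange_interpolation:
  fixes T :: "real set"
  assumes "finite T" and "d < card T"
  obtains l :: "real \<Rightarrow> real poly" where "\<And>s. degree (l s) < card T"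
    "\<And>P x. degree P \<le> d \<Longrightarrow> poly P x = (\<Sum>s\<in>T. poly (l s) x * poly P s)"
proof -
  define l where "l s = (if s \<in> T then \<Prod>u\<in>T - {s}. smult (1 / (s - u)) [:- u, 1:] else 0)" for s
  have deg: "degree (l s) < card T" for s
  proof (cases "s \<in> T")
    case True
    have "degree (l s) \<le> (\<Sum>u\<in>T - {s}. degree (smult (1 / (s - u)) [:- u, 1:]))"
      unfolding l_def if_P[OF True] using assms by (intro degree_prod_sum_le[unfolded o_def]) simp
    also have "\<dots> \<le> of_nat (card (T - {s})) * 1"
      by (intro sum_bounded_above order_trans[OF degree_smult_le]) auto
    also have "\<dots> < card T" using True assms by (simp add: card_gt_0_iff)
    finally show ?thesis .
  qed (use assms in \<open>auto simp: l_def\<close>)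
  have val: "poly (l s) u = (if u = s then 1 else 0)" if "s \<in> T" "u \<in> T" for s u
  proof (cases "u = s")
    case True
    have "poly (smult (1 / (s - v)) [:- v, 1:]) s = 1" if "v \<in> T - {s}" for v
      using that by (auto simp flip: diff_divide_distrib)
    then have "(\<Prod>v\<in>T - {s}. poly (smult (1 / (s - v)) [:- v, 1:]) s) = 1" by (intro prod.neutral) blast
    then show ?thesis using True \<open>s \<in> T\<close> by (simp only: l_def poly_prod if_True simp_thms)
  next
    case False
    then show ?thesis unfolding l_def using that assms by (auto simp: poly_prod intro!: prod_zero bexI[of _ u])
  qed
  have "P = (\<Sum>s\<in>T. smult (poly P s) (l s))" if "degree P \<le> d" for P
  proof (rule poly_eqI_degree[of T])
    fix u assume "u \<in> T"
    then have "(\<Sum>s\<in>T. poly P s * poly (l s) u) = (\<Sum>s\<in>T. if s = u then poly P s else 0)"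
      by (intro sum.cong) (auto simp: val)
    then show "poly P u = poly (\<Sum>s\<in>T. smult (poly P s) (l s)) u"
      using \<open>u \<in> T\<close> assms by (simp add: poly_sum)
  next
    show "degree (\<Sum>s\<in>T. smult (poly P s) (l s)) < card T"
      using assms(2) by (intro le_less_trans[OF degree_sum_le[where n = "card T - 1"]])
        (use assms deg in \<open>auto intro!: order_trans[OF degree_smult_le] simp: less_eq_Suc_le[symmetric] Suc_le_eq le_diff_conv2\<close>)
  qed (use that assms in auto)
  then have "poly P x = (\<Sum>s\<in>T. poly (l s) x * poly P s)" if "degree P \<le> d" for P x
    using that by (metis (no_types, lifting) poly_sum poly_smult mult.commute sum.cong)
  with deg show ?thesis by (rule that)
qed

text \<open>Uniqueness of Haar measure: the double integral of the indicator of \<open>A\<close> at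
  x times the indicator of the unit box at x + y is evaluated in both orders, using the invariance
  of Lebesgue measure and that of \<open>M\<close>.\<close>

lemma translation_invariant_measure_eq:
  fixes M :: "'a::euclidean_space measure"
  assumes sM[measurable_cong]: "sets M = sets borel"
    and inv: "\<And>c. distr M borel ((+) c) = M"
    and fin: "\<And>A. bounded A \<Longrightarrow> A \<in> sets borel \<Longrightarrow> emeasure M A < \<infinity>"
    and A[measurable]: "A \<in> sets borel"
  shows "emeasure M A = emeasure M (box 0 One) * emeasure lborel A"
proof -
  interpret M: sigma_finite_measure M
  proof
    show "\<exists>A. countable A \<and> A \<subseteq> sets M \<and> \<Union>A = space M \<and> (\<forall>a\<in>A. emeasure M a \<noteq> \<infinity>)"
    proof (intro exI[of _ "range (\<lambda>n::nat. cball (0::'a) n)"] conjI)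
      show "\<Union>(range (\<lambda>n::nat. cball (0::'a) n)) = space M"
        using sets_eq_imp_space_eq[OF sM] by (auto simp: real_arch_simple)
      have "emeasure M (cball 0 (real n)) \<noteq> \<infinity>" for n
        using fin[of "cball 0 (real n)"] by auto
      then show "\<forall>a\<in>range (\<lambda>n::nat. cball (0::'a) n). emeasure M a \<noteq> \<infinity>" by blast
    qed (auto simp: sM)
  qed
  interpret P: pair_sigma_finite M lborel ..
  let ?U = "box 0 One :: 'a set"
  have U1: "emeasure lborel ?U = 1" by (subst emeasure_lborel_box) auto
  have tr: "(\<integral>\<^sup>+x. f (c + x) \<partial>M) = (\<integral>\<^sup>+x. f x \<partial>M)" if [measurable]: "f \<in> borel_measurable borel" for f c
    by (subst (2) inv[of c, symmetric], subst nn_integral_distr) auto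
  have trl: "(\<integral>\<^sup>+x. f (c + x) \<partial>lborel) = (\<integral>\<^sup>+x. f x \<partial>lborel)" if [measurable]: "f \<in> borel_measurable borel"
    for f and c :: 'a
    by (subst (2) lborel_distr_plus[of c, symmetric], subst nn_integral_distr) auto
  have "emeasure M A = (\<integral>\<^sup>+x. indicator A x * (\<integral>\<^sup>+y. indicator ?U y \<partial>lborel) \<partial>M)"
    using U1 by simp
  also have "\<dots> = (\<integral>\<^sup>+x. (\<integral>\<^sup>+y. indicator A x * indicator ?U (x + y) \<partial>lborel) \<partial>M)"
    by (intro nn_integral_cong) (simp add: nn_integral_cmult trl[of "indicator ?U"])
  also have "\<dots> = (\<integral>\<^sup>+y. (\<integral>\<^sup>+x. indicator A x * indicator ?U (x + y) \<partial>M) \<partial>lborel)"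
    by (rule P.Fubini'[symmetric]) measurable
  also have "\<dots> = (\<integral>\<^sup>+y. (\<integral>\<^sup>+x. indicator A (x - y) * indicator ?U x \<partial>M) \<partial>lborel)"
  proof (rule nn_integral_cong)
    fix y
    show "(\<integral>\<^sup>+x. indicator A x * indicator ?U (x + y) \<partial>M) = (\<integral>\<^sup>+x. indicator A (x - y) * indicator ?U x \<partial>M)"
      using tr[of "\<lambda>x. indicator A (x - y) * indicator ?U x" y] by (simp add: add.commute)
  qed
  also have "\<dots> = (\<integral>\<^sup>+x. (\<integral>\<^sup>+y. indicator A (x - y) * indicator ?U x \<partial>lborel) \<partial>M)"
    by (rule P.Fubini') measurable
  also have "\<dots> = (\<integral>\<^sup>+x. emeasure lborel A * indicator ?U x \<partial>M)"
  proof (rule nn_integral_cong)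
    fix x
    have "(\<integral>\<^sup>+y. indicator A (x - y) \<partial>lborel) =
      (\<integral>\<^sup>+y. indicator A (x - y) \<partial>density (distr lborel borel (\<lambda>y. x + (-1) *\<^sub>R y)) (\<lambda>_. \<bar>-1::real\<bar> ^ DIM('a)))"
      by (subst lborel_affine[of "-1" x, symmetric]) auto
    also have "\<dots> = (\<integral>\<^sup>+y. indicator A y \<partial>lborel)"
      by (simp add: nn_integral_density nn_integral_distr density_1)
    finally show "(\<integral>\<^sup>+y. indicator A (x - y) * indicator ?U x \<partial>lborel) = emeasure lborel A * indicator ?U x"
      by (subst nn_integral_multc) auto
  qed
  also have "\<dots> = emeasure M ?U * emeasure lborel A"
    by (subst nn_integral_cmult) (auto simp: mult.commute sM)
  finally show ?thesis .
qed

section \<open>The local Steiner formula\<close>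

text \<open>A move from y towards a nearest point q reduces the distance to \<open>X\<close> by at
  most the length of the move, and the distance to q shows that it is reduced by exactly that
  length.\<close>

lemma infdist_segment:
  fixes X :: "'a::real_normed_vector set"
  assumes "q \<in> X" and y: "dist y q = infdist y X" and s: "0 \<le> s" "s \<le> 1"
  shows "infdist (q + s *\<^sub>R (y - q)) X = s * infdist y X"
proof (rule antisym)
  have w: "dist (q + s *\<^sub>R (y - q)) q = s * infdist y X"
    using s y by (simp add: dist_norm)
  then show "infdist (q + s *\<^sub>R (y - q)) X \<le> s * infdist y X"
    using infdist_le[OF \<open>q \<in> X\<close>, of "q + s *\<^sub>R (y - q)"] by simp
  have "y - (q + s *\<^sub>R (y - q)) = (1 - s) *\<^sub>R (y - q)" by (simp add: algebra_simps)
  then have "dist y (q + s *\<^sub>R (y - q)) = (1 - s) * infdist y X"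
    using s y by (simp add: dist_norm)
  then show "s * infdist y X \<le> infdist (q + s *\<^sub>R (y - q)) X"
    using infdist_triangle[of y X "q + s *\<^sub>R (y - q)"] by (simp add: algebra_simps)
qed

text \<open>An elementary form of reach at least R: the balls of radius R around points of
  \<open>X\<close> cover all points at distance less than R from \<open>X\<close>, so all of these
  have exactly one nearest point.\<close>

locale unique_projection =
  fixes X :: "'a::euclidean_space set" and R :: real
  assumes closed: "closed X" and nonempty: "X \<noteq> {}"
    and unique: "\<And>p. p \<in> X \<Longrightarrow> ball p R \<subseteq> unique_nearest X"
begin

lemma proj_in: "closest_point X z \<in> X"
  by (rule closest_point_in_set[OF closed nonempty])

lemma dist_proj: "dist z (closest_point X z) = infdist z X"
proof (rule antisym)
  obtain q where "q \<in> X" "infdist z X = dist z q" using infdist_attains_inf[OF closed nonempty] by metis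
  then show "dist z (closest_point X z) \<le> infdist z X" using closest_point_le[OF closed] by simp
qed (rule infdist_le[OF proj_in])

lemma proj_eqI:
  assumes "infdist z X < R" "p \<in> X" "dist z p = infdist z X"
  shows "closest_point X z = p"
proof -
  have "z \<in> ball (closest_point X z) R" using assms dist_proj[of z] by (simp add: dist_commute)
  then have "\<exists>!p. p \<in> X \<and> dist z p = infdist z X" using subsetD[OF unique[OF proj_in]] by (simp add: unique_nearest_def)
  then show ?thesis using assms proj_in dist_proj by blast
qed

text \<open>Points of \<open>X\<close> at distance at least e from the projection of z form a closed
  set; by uniqueness it is strictly farther from z than \<open>X\<close> is, and a small
  perturbation of z cannot close this gap.\<close>

lemma continuous_on_proj: "continuous_on {z. infdist z X < R} (closest_point X)"
  unfolding continuous_on_iff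
proof (intro ballI allI impI)
  fix z and e :: real assume z: "z \<in> {z. infdist z X < R}" and "0 < e"
  let ?p = "closest_point X z"
  define X' where "X' = X - ball ?p e"
  have cl: "closed X'" unfolding X'_def by (intro closed_Diff closed) simp
  have "\<exists>d>0. \<forall>y. dist y z < d \<longrightarrow> closest_point X y \<notin> X'"
  proof (cases "X' = {}")
    case False
    have lt: "infdist z X < infdist z X'"
    proof (rule ccontr)
      assume n: "\<not> infdist z X < infdist z X'"
      obtain q where q: "q \<in> X'" "infdist z X' = dist z q" using infdist_attains_inf[OF cl False] by metis
      then have "q \<in> X" by (simp add: X'_def)
      then have "dist z q = infdist z X" using n q infdist_le[of q X z] by auto
      then have "q = ?p" using proj_eqI[of z q] z \<open>q \<in> X\<close> by simp
      then show False using q(1) \<open>0 < e\<close> by (simp add: X'_def)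
    qed
    show ?thesis
    proof (intro exI[of _ "(infdist z X' - infdist z X) / 2"] conjI allI impI notI)
      fix y assume y: "dist y z < (infdist z X' - infdist z X) / 2" "closest_point X y \<in> X'"
      have "infdist z X' \<le> dist z (closest_point X y)" by (rule infdist_le[OF y(2)])
      also have "\<dots> \<le> dist z y + infdist y X" using dist_triangle[of z "closest_point X y" y] dist_proj[of y] by simp
      also have "\<dots> \<le> dist z y + (infdist z X + dist y z)" using infdist_triangle[of y X z] by simp
      finally show False using y(1) by (simp add: dist_commute)
    qed (use lt in simp)
  qed (auto intro: exI[of _ 1])
  then obtain d where "d > 0" "\<And>y. dist y z < d \<Longrightarrow> closest_point X y \<notin> X'" by blast
  then show "\<exists>d>0. \<forall>y\<in>{z. infdist z X < R}. dist y z < d \<longrightarrow> dist (closest_point X y) ?p < e"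
    using proj_in by (intro exI[of _ d]) (auto simp: X'_def dist_commute)
qed

text \<open>By Brouwer's theorem some \<open>y\<close> on a small sphere around \<open>z\<close> lies on the ray from its own
  projection through \<open>z\<close>; that projection must then be the one of \<open>z\<close>.\<close>

lemma extend_ray:
  assumes z: "0 < infdist z X" "infdist z X < R"
  shows "\<exists>\<eta>>0. infdist (z + \<eta> *\<^sub>R (z - closest_point X z)) X = (1 + \<eta>) * infdist z X"
proof -
  have "open {z. infdist z X < R}" by (intro open_Collect_less continuous_intros)
  then obtain \<rho> where \<rho>: "\<rho> > 0" "cball z \<rho> \<subseteq> {z. infdist z X < R}"
    using z open_contains_cball by (metis mem_Collect_eq)
  define \<phi> where "\<phi> y = z + (\<rho> / norm (z - closest_point X y)) *\<^sub>R (z - closest_point X y)" for y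
  have ne: "z - closest_point X y \<noteq> 0" for y using z proj_in[of y] by auto
  have "continuous_on (cball z \<rho>) \<phi>"
    unfolding \<phi>_def
    by (intro continuous_intros continuous_on_subset[OF continuous_on_proj \<rho>(2)]) (use ne in auto)
  moreover have "\<phi> \<in> cball z \<rho> \<rightarrow> cball z \<rho>"
    using ne \<rho>(1) by (auto simp: \<phi>_def dist_norm)
  ultimately obtain y where y: "y \<in> cball z \<rho>" "\<phi> y = y"
    using brouwer[of "cball z \<rho>" \<phi>] \<rho>(1) by auto
  define q c where "q = closest_point X y" and "c = \<rho> / norm (z - q)"
  have "c > 0" using ne[of y] \<rho>(1) by (simp add: c_def q_def)
  have yz: "y = z + c *\<^sub>R (z - q)" using y(2) by (simp add: \<phi>_def q_def c_def)
  then have yq: "y - q = (1 + c) *\<^sub>R (z - q)" by (simp add: algebra_simps)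
  have zs: "z = q + (1 / (1 + c)) *\<^sub>R (y - q)" using \<open>c > 0\<close> by (simp add: yq)
  have qX: "q \<in> X" and yX: "dist y q = infdist y X" by (simp_all add: q_def proj_in dist_proj)
  have "infdist z X = 1 / (1 + c) * infdist y X"
    using infdist_segment[OF qX yX, of "1 / (1 + c)"] zs \<open>c > 0\<close> by simp
  then have iy: "infdist y X = (1 + c) * infdist z X" using \<open>c > 0\<close> by simp
  moreover have "dist y q = (1 + c) * dist z q" using \<open>c > 0\<close> by (simp add: dist_norm yq)
  ultimately have "dist z q = infdist z X" using yX \<open>c > 0\<close> by simp
  then have "closest_point X z = q" using proj_eqI z qX by simp
  then show ?thesis using iy \<open>c > 0\<close> yz by (intro exI[of _ c]) auto
qed

text \<open>The parameters for which the projection remains a nearest point form a closed interval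
  starting at 0. By \<open>extend_ray\<close> it cannot end at a positive parameter below R, which
  its supremum would do if s were missing.\<close>

lemma infdist_on_ray:
  assumes z: "0 < infdist z X" "infdist z X < R" and s: "0 \<le> s" "s < R"
  shows "infdist (closest_point X z + (s / infdist z X) *\<^sub>R (z - closest_point X z)) X = s"
proof (rule ccontr)
  let ?p = "closest_point X z"
  define v where "v = (1 / infdist z X) *\<^sub>R (z - ?p)"
  have nv: "norm v = 1" using z dist_proj[of z] by (simp add: v_def dist_norm)
  define T where "T = {s. 0 \<le> s \<and> infdist (?p + s *\<^sub>R v) X = s}"
  assume "infdist (?p + (s / infdist z X) *\<^sub>R (z - ?p)) X \<noteq> s"
  then have sT: "s \<notin> T" by (simp add: T_def v_def)
  have d: "dist (?p + u *\<^sub>R v) ?p = u" if "0 \<le> u" for u using that nv by (simp add: dist_norm)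
  have down: "s' \<in> T" if "u \<in> T" "0 \<le> s'" "s' \<le> u" for s' u
  proof (cases "u = 0")
    case False
    then have u: "u > 0" "infdist (?p + u *\<^sub>R v) X = u" using that by (auto simp: T_def)
    have "infdist (?p + (s' / u) *\<^sub>R ((?p + u *\<^sub>R v) - ?p)) X = s' / u * infdist (?p + u *\<^sub>R v) X"
      by (rule infdist_segment[OF proj_in]) (use u d that in auto)
    then show ?thesis using u that by (simp add: T_def)
  qed (use that in auto)
  then have ub: "u \<le> s" if "u \<in> T" for u using sT s that by (meson linear)
  then have bdd: "bdd_above T" by (rule bdd_aboveI)
  have z_eq: "?p + infdist z X *\<^sub>R v = z" using z by (simp add: v_def)
  then have zT: "infdist z X \<in> T" using z by (simp add: T_def)
  have "closed T"
    unfolding T_def by (intro closed_Collect_conj closed_Collect_le closed_Collect_eq continuous_intros)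
  then have \<tau>T: "Sup T \<in> T" using zT ub bdd by (intro closed_contains_Sup) auto
  define \<tau> where "\<tau> = Sup T"
  have \<tau>: "\<tau> \<ge> infdist z X" "\<tau> \<le> s"
    using cSup_upper[OF zT bdd] ub \<tau>T by (auto simp: \<tau>_def)
  define z' where "z' = ?p + \<tau> *\<^sub>R v"
  have z': "infdist z' X = \<tau>" using \<tau>T by (simp add: z'_def T_def \<tau>_def)
  have "closest_point X z' = ?p"
    by (rule proj_eqI) (use z' \<tau> s z d[of \<tau>] proj_in in \<open>auto simp: z'_def\<close>)
  then obtain \<eta> where \<eta>: "\<eta> > 0" "infdist (z' + \<eta> *\<^sub>R (z' - ?p)) X = (1 + \<eta>) * \<tau>"
    using extend_ray[of z'] z' \<tau> s z by auto
  have "z' + \<eta> *\<^sub>R (z' - ?p) = ?p + ((1 + \<eta>) * \<tau>) *\<^sub>R v" by (simp add: z'_def algebra_simps)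
  then have "(1 + \<eta>) * \<tau> \<in> T" using \<eta> \<tau> z by (simp add: T_def)
  then have "(1 + \<eta>) * \<tau> \<le> \<tau>" unfolding \<tau>_def using bdd by (intro cSup_upper)
  then show False using \<eta>(1) \<tau> z by (simp add: algebra_simps mult_le_0_iff)
qed

text \<open>By \<open>infdist_on_ray\<close> the open ball of radius Q centred at distance Q on the
  normal ray through x misses \<open>X\<close>, so q lies outside it; expanding the square of the
  distance of q from the centre gives Federer's inequality.\<close>

lemma inner_proj_le:
  assumes x: "infdist x X < R" and "q \<in> X" and Q: "0 < Q" "Q < R"
  shows "2 * Q * ((x - closest_point X x) \<bullet> (q - closest_point X x))
      \<le> infdist x X * (norm (q - closest_point X x))\<^sup>2"
proof (cases "infdist x X = 0")
  case True
  then have "x - closest_point X x = 0" using dist_proj[of x] by simp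
  then show ?thesis using True by simp
next
  case False
  let ?p = "closest_point X x"
  define i where "i = infdist x X"
  have i: "i > 0" using False infdist_nonneg[of x X] by (simp add: i_def)
  define v where "v = (1 / i) *\<^sub>R (x - ?p)"
  have nv: "v \<bullet> v = 1"
    using i dist_proj[of x] by (simp add: v_def i_def dist_norm flip: power2_norm_eq_inner power2_eq_square)
  have "infdist (?p + Q *\<^sub>R v) X = Q"
    using infdist_on_ray[of x Q] i x Q by (simp add: i_def v_def)
  then have "Q \<le> norm (Q *\<^sub>R v - (q - ?p))"
    using infdist_le[OF \<open>q \<in> X\<close>, of "?p + Q *\<^sub>R v"] by (simp add: dist_norm algebra_simps)
  then have "Q\<^sup>2 \<le> (norm (Q *\<^sub>R v - (q - ?p)))\<^sup>2" using Q by (intro power_mono) auto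
  also have "\<dots> = Q\<^sup>2 - 2 * Q * (v \<bullet> (q - ?p)) + (norm (q - ?p))\<^sup>2"
    using nv unfolding power2_norm_eq_inner
    by (simp add: inner_diff_left inner_diff_right inner_commute power2_eq_square algebra_simps)
  finally have "2 * Q * (v \<bullet> (q - ?p)) \<le> (norm (q - ?p))\<^sup>2" by simp
  then have "i * (2 * Q * (v \<bullet> (q - ?p))) \<le> i * (norm (q - ?p))\<^sup>2" using i by (intro mult_left_mono) auto
  moreover have "x - ?p = i *\<^sub>R v" using i by (simp add: v_def)
  ultimately show ?thesis by (simp add: i_def[symmetric] ac_simps)
qed

text \<open>Federer's inequality for x against the projection of y is added to the one with x and y
  exchanged; the quadratic terms on the right are absorbed because s < Q.\<close>

lemma lipschitz_proj:
  assumes xy: "infdist x X \<le> s" "infdist y X \<le> s" and s: "s < Q" "Q < R" "0 < Q"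
  shows "dist (closest_point X x) (closest_point X y) \<le> Q / (Q - s) * dist x y"
proof -
  define a where "a = closest_point X y - closest_point X x"
  have 1: "2 * Q * ((x - closest_point X x) \<bullet> a) \<le> s * (norm a)\<^sup>2"
    using inner_proj_le[of x "closest_point X y" Q] proj_in xy s
      mult_right_mono[OF xy(1), of "(norm a)\<^sup>2"] by (simp add: a_def)
  have 2: "2 * Q * ((y - closest_point X y) \<bullet> (- a)) \<le> s * (norm a)\<^sup>2"
    using inner_proj_le[of y "closest_point X x" Q] proj_in xy s
      mult_right_mono[OF xy(2), of "(norm a)\<^sup>2"] by (simp add: a_def norm_minus_commute)
  have "(x - closest_point X x) \<bullet> a + (y - closest_point X y) \<bullet> (- a) = (x - y) \<bullet> a + (norm a)\<^sup>2"
    unfolding power2_norm_eq_inner a_def by (simp add: algebra_simps inner_diff_left inner_diff_right)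
  moreover have "2 * Q * ((x - closest_point X x) \<bullet> a + (y - closest_point X y) \<bullet> (- a)) \<le> 2 * (s * (norm a)\<^sup>2)"
    using 1 2 unfolding distrib_left by linarith
  ultimately have "2 * Q * ((x - y) \<bullet> a + (norm a)\<^sup>2) \<le> 2 * (s * (norm a)\<^sup>2)" by (simp only:)
  then have "Q * ((x - y) \<bullet> a + (norm a)\<^sup>2) \<le> s * (norm a)\<^sup>2" by simp
  then have "(Q - s) * (norm a)\<^sup>2 \<le> Q * (- ((x - y) \<bullet> a))" by (simp add: algebra_simps)
  also have "\<dots> \<le> Q * (dist x y * norm a)"
    using Cauchy_Schwarz_ineq2[of "x - y" a] s by (intro mult_left_mono) (auto simp: dist_norm abs_le_iff)
  finally have "((Q - s) * norm a) * norm a \<le> (Q * dist x y) * norm a" by (simp add: power2_eq_square ac_simps)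
  then have "(Q - s) * norm a \<le> Q * dist x y"
    using s by (cases "a = 0") (auto simp: mult_le_cancel_right)
  then show ?thesis using s by (simp add: a_def dist_norm norm_minus_commute field_simps)
qed

section \<open>Dilations along normals, which multiply the distance to \<open>X\<close> by a factor
  t\<close>

definition dilate :: "real \<Rightarrow> 'a \<Rightarrow> 'a" where
  "dilate t x = closest_point X x + t *\<^sub>R (x - closest_point X x)"

lemma
  assumes x: "infdist x X < R" and t: "0 < t" "t * infdist x X < R"
  shows infdist_dilate: "infdist (dilate t x) X = t * infdist x X"
    and proj_dilate: "closest_point X (dilate t x) = closest_point X x"
proof -
  have *: "infdist (dilate t x) X = t * infdist x X"
  proof (cases "infdist x X = 0")
    case True
    then have "x = closest_point X x" using dist_proj[of x] by simp
    then have "dilate t x = x" by (metis dilate_def add_diff_cancel_left' diff_self scaleR_zero_right add.right_neutral)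
    then show ?thesis using True by simp
  next
    case False
    then have "0 < infdist x X" using infdist_nonneg[of x X] by simp
    then show ?thesis using infdist_on_ray[of x "t * infdist x X"] x t by (simp add: dilate_def)
  qed
  show "infdist (dilate t x) X = t * infdist x X" by fact
  show "closest_point X (dilate t x) = closest_point X x"
    by (rule proj_eqI) (use * t proj_in dist_proj[of x] in \<open>auto simp: dilate_def dist_norm\<close>)
qed

lemma dilate_inverse:
  assumes "infdist x X < R" "0 < t" "t * infdist x X < R"
  shows "dilate (1 / t) (dilate t x) = x"
  using proj_dilate[OF assms] assms(2) by (simp add: dilate_def[of _ "dilate t x"]) (simp add: dilate_def)

lemma lipschitz_dilate:
  assumes "s < R" "0 \<le> s" "0 < t"
  obtains L where "0 \<le> L" "\<And>x y. infdist x X \<le> s \<Longrightarrow> infdist y X \<le> s \<Longrightarrow> dist (dilate t x) (dilate t y) \<le> L * dist x y"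
proof -
  obtain Q where Q: "s < Q" "Q < R" using dense[OF assms(1)] by blast
  define K where "K = Q / (Q - s)"
  have K: "0 \<le> K" using Q assms by (simp add: K_def)
  show ?thesis
  proof (rule that[of "\<bar>1 - t\<bar> * K + t"])
    fix x y assume xy: "infdist x X \<le> s" "infdist y X \<le> s"
    have "dilate t x - dilate t y = (1 - t) *\<^sub>R (closest_point X x - closest_point X y) + t *\<^sub>R (x - y)"
      by (simp add: dilate_def algebra_simps)
    then have "dist (dilate t x) (dilate t y) \<le> \<bar>1 - t\<bar> * dist (closest_point X x) (closest_point X y) + t * dist x y"
      using assms by (auto simp: dist_norm intro!: order_trans[OF norm_triangle_ineq])
    also have "\<dots> \<le> \<bar>1 - t\<bar> * (K * dist x y) + t * dist x y"
      using lipschitz_proj[OF xy Q] Q assms by (intro add_mono mult_left_mono) (auto simp: K_def)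
    finally show "dist (dilate t x) (dilate t y) \<le> (\<bar>1 - t\<bar> * K + t) * dist x y" by (simp add: algebra_simps)
  qed (use K assms in auto)
qed

text \<open>The inverse map is the dilation by 1/t, which is Lipschitz on the tube of radius t
  s.\<close>

lemma expanding_dilate:
  assumes "s < R" "0 \<le> s" "0 < t" "t * s < R"
  obtains c where "0 < c" "\<And>x y. infdist x X \<le> s \<Longrightarrow> infdist y X \<le> s \<Longrightarrow> c * dist x y \<le> dist (dilate t x) (dilate t y)"
proof -
  obtain L where L: "0 \<le> L" "\<And>x y. infdist x X \<le> t * s \<Longrightarrow> infdist y X \<le> t * s \<Longrightarrow>
      dist (dilate (1 / t) x) (dilate (1 / t) y) \<le> L * dist x y"
    using lipschitz_dilate[of "t * s" "1 / t"] assms by auto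
  show ?thesis
  proof (rule that[of "1 / (L + 1)"])
    fix x y assume xy: "infdist x X \<le> s" "infdist y X \<le> s"
    have ts: "t * infdist x X \<le> t * s" "t * infdist y X \<le> t * s" using xy assms by (auto intro: mult_left_mono)
    have "dist x y = dist (dilate (1 / t) (dilate t x)) (dilate (1 / t) (dilate t y))"
      using dilate_inverse[of x t] dilate_inverse[of y t] xy ts assms by simp
    also have "\<dots> \<le> L * dist (dilate t x) (dilate t y)"
      using infdist_dilate[of x t] infdist_dilate[of y t] xy ts assms by (intro L(2)) auto
    also have "\<dots> \<le> (L + 1) * dist (dilate t x) (dilate t y)" by (intro mult_right_mono) auto
    finally show "1 / (L + 1) * dist x y \<le> dist (dilate t x) (dilate t y)"
      using L(1) by (simp add: field_simps)
  qed (use L(1) in auto)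
qed

lemma dilate_local_parallel_set:
  assumes "0 < s" "s < R" "0 < t" "t * s < R"
  shows "dilate t ` local_parallel_set X s B = local_parallel_set X (t * s) B"
proof (intro equalityI subsetI)
  fix y assume "y \<in> dilate t ` local_parallel_set X s B"
  then obtain x where x: "x \<in> local_parallel_set X s B" "y = dilate t x" by auto
  then have i: "0 < infdist x X" "infdist x X \<le> s" "closest_point X x \<in> B" by (auto simp: local_parallel_set_def)
  then have ti: "t * infdist x X \<le> t * s" using assms by simp
  then have "t * infdist x X < R" using assms by linarith
  with ti show "y \<in> local_parallel_set X (t * s) B"
    using i assms infdist_dilate[of x t] proj_dilate[of x t] x(2) by (simp add: local_parallel_set_def)
next
  fix y assume "y \<in> local_parallel_set X (t * s) B"
  then have i: "0 < infdist y X" "infdist y X \<le> t * s" "closest_point X y \<in> B" by (auto simp: local_parallel_set_def)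
  then have ti: "1 / t * infdist y X \<le> s" using assms by (simp add: field_simps)
  have "dilate (1 / t) y \<in> local_parallel_set X s B"
    using i ti assms infdist_dilate[of y "1 / t"] proj_dilate[of y "1 / t"] by (simp add: local_parallel_set_def)
  moreover have "dilate t (dilate (1 / t) y) = y" using dilate_inverse[of y "1 / t"] i ti assms by simp
  ultimately show "y \<in> dilate t ` local_parallel_set X s B" by (metis imageI)
qed

lemma sets_vimage_tube:
  assumes "continuous_on {z. infdist z X \<le> s} f" "E \<in> sets borel"
  shows "{z. infdist z X \<le> s \<and> f z \<in> E} \<in> sets borel"
proof -
  have "closed {z. infdist z X \<le> s}" by (intro closed_Collect_le continuous_intros)
  then have c: "{z. infdist z X \<le> s} \<in> sets borel" by (rule borel_closed)
  have "f \<in> borel_measurable (restrict_space borel {z. infdist z X \<le> s})"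
    by (rule borel_measurable_continuous_on_restrict[OF assms(1)])
  from measurable_sets[OF this assms(2)]
  have "f -` E \<inter> {z. infdist z X \<le> s} \<in> sets borel"
    using c by (auto simp: space_restrict_space sets_restrict_space_iff)
  moreover have "f -` E \<inter> {z. infdist z X \<le> s} = {z. infdist z X \<le> s \<and> f z \<in> E}" by auto
  ultimately show ?thesis by simp
qed

lemma sets_local_parallel_set:
  assumes "s < R" "B \<in> sets borel"
  shows "local_parallel_set X s B \<in> sets borel"
proof -
  have "{z. infdist z X \<le> s \<and> closest_point X z \<in> B} \<in> sets borel"
    by (rule sets_vimage_tube[OF continuous_on_subset[OF continuous_on_proj] assms(2)]) (use assms in auto)
  moreover have "open {z. 0 < infdist z X}" by (intro open_Collect_less continuous_intros)
  then have "{z. 0 < infdist z X} \<in> sets borel" by (rule borel_open)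
  moreover have "local_parallel_set X s B = {z. 0 < infdist z X} \<inter> {z. infdist z X \<le> s \<and> closest_point X z \<in> B}"
    by (auto simp: local_parallel_set_def)
  ultimately show ?thesis by simp
qed

lemma bounded_local_parallel_set:
  assumes "bounded B"
  shows "bounded (local_parallel_set X s B)"
proof -
  obtain c where c: "\<And>x. x \<in> B \<Longrightarrow> norm x \<le> c" using assms by (auto simp: bounded_iff)
  have "norm z \<le> c + s" if "z \<in> local_parallel_set X s B" for z
  proof -
    have "norm z \<le> norm (closest_point X z) + dist z (closest_point X z)"
      by (metis dist_norm norm_triangle_sub)
    then show ?thesis using that c[of "closest_point X z"] dist_proj[of z] by (simp add: local_parallel_set_def)
  qed
  then show ?thesis by (auto simp: bounded_iff)
qed

text \<open>The Jacobian of \<open>dilate t\<close> is the determinant of a segment of linear maps, hence a polynomial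
  in \<open>t\<close>, and positive because \<open>dilate t\<close> is expanding up to a constant.\<close>

lemma local_parallel_volume_dilate:
  assumes "0 < R" and B: "B \<in> sets borel" "bounded B"
  obtains Q where "degree Q \<le> DIM('a)"
    "\<And>t. 0 < t \<Longrightarrow> t < 2 \<Longrightarrow> measure lborel (local_parallel_set X (t * (R / 2)) B) = poly Q t"
proof -
  \<comment> \<open>With s = R/2 all factors t in (0, 2) keep the dilated tube within R, and t = 1,
    where the dilation is the identity, is an inner point of this range.\<close>
  define s where "s = R / 2"
  have s: "0 < s" "s < R" using \<open>0 < R\<close> by (auto simp: s_def)
  have ts: "t * s < R" if "t < 2" for t using that s by (simp add: s_def)
  define E where "E = local_parallel_set X s B"
  have E[measurable]: "E \<in> sets borel" unfolding E_def by (rule sets_local_parallel_set[OF s(2) B(1)])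
  \<comment> \<open>A slightly larger open tube on which the projection is still Lipschitz, so that
    derivatives in the full sense exist at almost all points of \<open>E\<close>.\<close>
  define \<Omega> where "\<Omega> = {z. infdist z X < 3 * R / 4}"
  have o\<Omega>: "open \<Omega>" unfolding \<Omega>_def by (intro open_Collect_less continuous_intros)
  have sR: "s < 3 * R / 4" using \<open>0 < R\<close> by (simp add: s_def)
  then have E\<Omega>: "E \<subseteq> \<Omega>" by (auto simp: E_def \<Omega>_def local_parallel_set_def)
  define Q0 where "Q0 = 7 * R / 8"
  have Q0: "3 * R / 4 < Q0" "Q0 < R" "0 < Q0" using \<open>0 < R\<close> by (auto simp: Q0_def)
  have "AE x in lborel. x \<in> \<Omega> \<longrightarrow> closest_point X differentiable (at x)"
  proof (rule AE_differentiable_if_lipschitz_on_open[OF o\<Omega>])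
    show "dist (closest_point X x) (closest_point X y) \<le> Q0 / (Q0 - 3 * R / 4) * dist x y"
      if "x \<in> \<Omega>" "y \<in> \<Omega>" for x y
      using that by (intro lipschitz_proj Q0) (auto simp: \<Omega>_def)
  qed (use Q0 in auto)
  then obtain N0 where N0: "N0 \<in> null_sets lborel" "{x. \<not> (x \<in> \<Omega> \<longrightarrow> closest_point X differentiable (at x))} \<subseteq> N0"
    by (auto elim!: AE_E simp: null_sets_def)
  define D where "D x = frechet_derivative (closest_point X) (at x)" for x
  define E' where "E' = E - N0"
  have [measurable]: "N0 \<in> sets borel" using N0(1) by auto
  have E'[measurable]: "E' \<in> sets borel" unfolding E'_def by measurable
  have D: "(closest_point X has_derivative D x) (at x)" if "x \<in> E'" for x
    using that E\<Omega> N0(2) unfolding D_def E'_def by (auto simp flip: frechet_derivative_works)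
  have linD: "linear (D x)" if "x \<in> E'" for x using D[OF that] has_derivative_linear by blast
  have E'i: "0 < infdist x X" "infdist x X \<le> s" if "x \<in> E'" for x
    using that by (auto simp: E'_def E_def local_parallel_set_def)
  define G where "G t x v = (1 - t) *\<^sub>R D x v + t *\<^sub>R v" for t x v
  have G: "(dilate t has_derivative G t x) (at x)" if "x \<in> E'" for t x
    unfolding dilate_def[abs_def] G_def[abs_def]
    by (rule derivative_eq_intros D[OF that] | simp add: algebra_simps)+
  have linG: "linear (G t x)" if "x \<in> E'" for t x using G[OF that] has_derivative_linear by blast
  have "\<exists>P. degree P \<le> DIM('a) \<and> (\<forall>t. jacobian_det (G t x) = poly P t)" if "x \<in> E'" for x
    using jacobian_det_segment_poly[OF linD[OF that] linear_id] unfolding G_def[abs_def] by simp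
  then obtain P where P: "\<And>x. x \<in> E' \<Longrightarrow> degree (P x) \<le> DIM('a)"
    "\<And>x t. x \<in> E' \<Longrightarrow> jacobian_det (G t x) = poly (P x) t" by metis
  \<comment> \<open>A kernel vector of the derivative would contradict the lower bound for distances
    on a tube of radius u slightly larger than s, which contains a neighbourhood of x.\<close>
  have nz: "poly (P x) t \<noteq> 0" if x: "x \<in> E'" and t: "0 < t" "t < 2" for x t
  proof -
    obtain u where u: "s < u" "u < min R (R / t)"
      using dense[of s "min R (R / t)"] s ts[OF t(2)] t by (auto simp: field_simps)
    then obtain c where c: "0 < c" "\<And>x y. infdist x X \<le> u \<Longrightarrow> infdist y X \<le> u \<Longrightarrow> c * dist x y \<le> dist (dilate t x) (dilate t y)"
      using expanding_dilate[of u t] s t by (auto simp: field_simps)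
    have "G t x v \<noteq> 0" if "v \<noteq> 0" for v
    proof
      assume Gv: "G t x v = 0"
      have "open {z. infdist z X < u}" by (intro open_Collect_less continuous_intros)
      then obtain e where e: "e > 0" "ball x e \<subseteq> {z. infdist z X < u}"
        using E'i[OF x] u open_contains_ball by (metis (no_types, lifting) le_less_trans mem_Collect_eq)
      obtain d where d: "d > 0" "\<And>y. norm (y - x) < d \<Longrightarrow> norm (dilate t y - dilate t x - G t x (y - x)) \<le> c / 2 * norm (y - x)"
        using G[OF x, of t] c(1) unfolding has_derivative_at_alt by (meson half_gt_zero)
      define h where "h = min d e / 2 / norm v"
      have h: "h > 0" "h * norm v < d" "h * norm v < e" using d(1) e(1) that by (auto simp: h_def)
      define y where "y = x + h *\<^sub>R v"
      have "G t x (y - x) = 0" using Gv linG[OF x] by (simp add: y_def linear_cmul)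
      moreover have ny: "norm (y - x) = h * norm v" using h by (simp add: y_def)
      ultimately have "norm (dilate t y - dilate t x) \<le> c / 2 * (h * norm v)" using d(2)[of y] h by simp
      moreover have "y \<in> ball x e" using h ny by (simp add: dist_norm norm_minus_commute)
      then have "c * dist y x \<le> dist (dilate t y) (dilate t x)"
        using e E'i[OF x] u by (intro c(2)) auto
      then have "c * (h * norm v) \<le> norm (dilate t y - dilate t x)" using ny by (simp add: dist_norm)
      ultimately have "c * (h * norm v) \<le> c * (h * norm v) / 2" by simp
      moreover have "c * (h * norm v) > 0" using c h that by simp
      ultimately show False by simp
    qed
    then have "inj (G t x)" using linG[OF x] linear_injective_0 by metis
    then show ?thesis using jacobian_det_nonzero[OF linG[OF x]] P(2)[OF x] by metis
  qed
  have pos: "0 < poly (P x) t" if x: "x \<in> E'" and t: "0 < t" "t < 2" for x t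
  proof (rule ccontr)
    assume "\<not> 0 < poly (P x) t"
    then have neg: "poly (P x) t < 0" using nz[OF x t] by simp
    \<comment> \<open>The Jacobian is 1 at t = 1, so a negative value elsewhere would force a zero
      in between.\<close>
    have "G 1 x = (\<lambda>v. v)" by (simp add: G_def fun_eq_iff)
    then have one: "poly (P x) 1 = 1" using P(2)[OF x, of 1] by (simp add: jacobian_det_ident)
    have "\<exists>u. min t 1 \<le> u \<and> u \<le> max t 1 \<and> poly (P x) u = 0"
      using poly_IVT_pos[of t 1 "P x"] poly_IVT_neg[of 1 t "P x"] neg one
      by (cases t "1::real" rule: linorder_cases) (auto intro: less_imp_le)
    then show False using nz[OF x] t by (metis le_less_trans less_le_trans max_less_iff_conj min_less_iff_conj one_less_numeral_iff semiring_norm(76) zero_less_one)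
  qed
  define m where "m t = measure lborel (dilate t ` E')" for t
  have inj: "inj_on (dilate t) E" if t: "0 < t" "t < 2" for t
  proof (rule inj_on_inverseI[of _ "dilate (1 / t)"])
    fix x assume "x \<in> E"
    then have "infdist x X \<le> s" by (simp add: E_def local_parallel_set_def)
    then have "t * infdist x X < R" using mult_left_mono[of "infdist x X" s t] t ts[OF t(2)] by linarith
    then show "dilate (1 / t) (dilate t x) = x"
      using dilate_inverse[of x t] \<open>infdist x X \<le> s\<close> s t ts by simp
  qed
  have img: "dilate t ` E' \<in> sets borel" "bounded (dilate t ` E')"
    "m t = measure lborel (local_parallel_set X (t * s) B)" if t: "0 < t" "t < 2" for t
  proof -
    have eqE: "dilate t ` E = local_parallel_set X (t * s) B"
      unfolding E_def using s t ts by (intro dilate_local_parallel_set) auto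
    obtain L where L: "0 \<le> L" "\<And>x y. infdist x X \<le> t * s \<Longrightarrow> infdist y X \<le> t * s \<Longrightarrow>
       dist (dilate (1 / t) x) (dilate (1 / t) y) \<le> L * dist x y"
      using lipschitz_dilate[of "t * s" "1 / t"] s t ts by auto
    have "continuous_on {z. infdist z X \<le> t * s} (dilate (1 / t))"
      by (rule lipschitz_on_continuous_on[of L]) (use L in \<open>auto intro!: lipschitz_onI\<close>)
    from sets_vimage_tube[OF this E']
    have b: "{z. infdist z X \<le> t * s \<and> dilate (1 / t) z \<in> E'} \<in> sets borel" .
    have "dilate t ` E' = local_parallel_set X (t * s) B \<inter> {z. infdist z X \<le> t * s \<and> dilate (1 / t) z \<in> E'}"
    proof (intro equalityI subsetI)
      fix y assume "y \<in> dilate t ` E'"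
      then obtain x where x: "x \<in> E'" "y = dilate t x" by auto
      have "t * infdist x X < R"
        using mult_left_mono[of "infdist x X" s t] E'i[OF x(1)] t ts[OF t(2)] by linarith
      then have "dilate (1 / t) y = x" using dilate_inverse[of x t] x E'i[OF x(1)] s t ts by simp
      moreover have "y \<in> local_parallel_set X (t * s) B" using x by (auto simp: eqE[symmetric] E'_def)
      ultimately show "y \<in> local_parallel_set X (t * s) B \<inter> {z. infdist z X \<le> t * s \<and> dilate (1 / t) z \<in> E'}"
        using x by (auto simp: local_parallel_set_def)
    next
      fix y assume y: "y \<in> local_parallel_set X (t * s) B \<inter> {z. infdist z X \<le> t * s \<and> dilate (1 / t) z \<in> E'}"
      then have "infdist y X \<le> t * s" by simp
      then have "1 / t * infdist y X \<le> s" using t by (simp add: field_simps)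
      then have "1 / t * infdist y X < R" using s by linarith
      moreover have "infdist y X < R" using \<open>infdist y X \<le> t * s\<close> ts[OF t(2)] by linarith
      ultimately have "dilate t (dilate (1 / t) y) = y"
        using dilate_inverse[of y "1 / t"] \<open>infdist y X \<le> t * s\<close> s t ts[of t] by simp
      then show "y \<in> dilate t ` E'" using y by (metis (no_types, lifting) IntD2 imageI mem_Collect_eq)
    qed
    moreover have LPb: "local_parallel_set X (t * s) B \<in> sets borel"
      using s t ts B by (intro sets_local_parallel_set) auto
    ultimately show db: "dilate t ` E' \<in> sets borel" using b by simp
    have bd: "bounded (local_parallel_set X (t * s) B)" by (rule bounded_local_parallel_set[OF B(2)])
    moreover have sub: "dilate t ` E' \<subseteq> local_parallel_set X (t * s) B" by (auto simp: eqE[symmetric] E'_def)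
    ultimately show "bounded (dilate t ` E')" by (rule bounded_subset)
    obtain L' where L': "0 \<le> L'" "\<And>x y. infdist x X \<le> s \<Longrightarrow> infdist y X \<le> s \<Longrightarrow> dist (dilate t x) (dilate t y) \<le> L' * dist x y"
      using lipschitz_dilate[of s t] s t by auto
    \<comment> \<open>The points discarded for lack of differentiability are a null set, and the
      dilation, being Lipschitz on the tube, maps them to a null set.\<close>
    have "negligible (dilate t ` (E \<inter> N0))"
    proof (rule negligible_locally_Lipschitz_image)
      have "N0 \<in> null_sets lebesgue" using N0(1) by (auto intro: null_sets_completionI)
      then show "negligible (E \<inter> N0)" using negligible_subset negligible_iff_null_sets by blast
      fix x assume "x \<in> E \<inter> N0"
      then show "\<exists>T Ba. open T \<and> x \<in> T \<and> (\<forall>y\<in>E \<inter> N0 \<inter> T. norm (dilate t y - dilate t x) \<le> Ba * norm (y - x))"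
        using L'(2) by (intro exI[of _ UNIV] exI[of _ L']) (auto simp: E_def local_parallel_set_def dist_norm)
    qed simp
    moreover have "local_parallel_set X (t * s) B - dilate t ` E' \<subseteq> dilate t ` (E \<inter> N0)"
      unfolding eqE[symmetric] E'_def by auto
    ultimately have "negligible (local_parallel_set X (t * s) B - dilate t ` E')" using negligible_subset by blast
    then have "emeasure lborel (local_parallel_set X (t * s) B - dilate t ` E') = 0"
      using LPb db by (auto simp: negligible_iff_null_sets null_sets_def)
    then have "emeasure lborel (local_parallel_set X (t * s) B) = emeasure lborel (dilate t ` E')"
      using emeasure_Un_null_set[of "dilate t ` E'" lborel "local_parallel_set X (t * s) B - dilate t ` E'"] LPb db sub
      by (simp add: null_sets_def Un_absorb1 Un_Diff_cancel)
    then show "m t = measure lborel (local_parallel_set X (t * s) B)" by (simp add: m_def measure_def)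
  qed
  have hint: "((\<lambda>y. poly (P (of_cart y)) t) has_integral m t) (to_cart ` E')" if t: "0 < t" "t < 2" for t
  proof -
    have "((\<lambda>y. \<bar>jacobian_det (G t (of_cart y))\<bar>) has_integral m t) (to_cart ` E')"
      unfolding m_def
      by (rule has_integral_jacobian_det[OF E' img(1,2)[OF t]])
        (use inj[OF t] G t in \<open>auto intro: inj_on_subset has_derivative_at_withinI simp: E'_def\<close>)
    then show ?thesis
      by (rule has_integral_eq[rotated]) (use P(2) pos[OF _ t] in \<open>force simp: abs_of_pos\<close>)
  qed
  \<comment> \<open>These are \<open>DIM('a)\<close> + 1 nodes in (0, 1], inside the range of
    factors for which the Jacobians are known to be positive.\<close>
  define T where "T = (\<lambda>i. 1 / real (Suc i)) ` {..DIM('a)}"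
  have cT: "card T = Suc DIM('a)" unfolding T_def by (subst card_image) (auto simp: inj_on_def)
  have T: "finite T" "\<And>u. u \<in> T \<Longrightarrow> 0 < u \<and> u < 2" by (auto simp: T_def field_simps)
  obtain l where l: "\<And>u. degree (l u) < card T"
    "\<And>P x. degree P \<le> DIM('a) \<Longrightarrow> poly P x = (\<Sum>u\<in>T. poly (l u) x * poly P u)"
    using lagrange_interpolation[OF T(1), of "DIM('a)"] cT by auto
  define Q where "Q = (\<Sum>u\<in>T. smult (m u) (l u))"
  have "m t = poly Q t" if t: "0 < t" "t < 2" for t
  proof -
    have "((\<lambda>y. \<Sum>u\<in>T. poly (l u) t * poly (P (of_cart y)) u) has_integral (\<Sum>u\<in>T. poly (l u) t * m u)) (to_cart ` E')"
      using T hint by (intro has_integral_sum has_integral_mult_right) auto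
    moreover have "(\<Sum>u\<in>T. poly (l u) t * poly (P (of_cart y)) u) = poly (P (of_cart y)) t" if "y \<in> to_cart ` E'" for y
      using l(2)[OF P(1), of "of_cart y" t] that by auto
    ultimately have "((\<lambda>y. poly (P (of_cart y)) t) has_integral (\<Sum>u\<in>T. poly (l u) t * m u)) (to_cart ` E')"
      using has_integral_eq by (metis (no_types, lifting))
    with hint[OF t] have "m t = (\<Sum>u\<in>T. poly (l u) t * m u)" by (rule has_integral_unique)
    then show ?thesis by (simp add: Q_def poly_sum mult.commute)
  qed
  moreover have "degree Q \<le> DIM('a)"
    unfolding Q_def using l(1) cT
    by (intro degree_sum_le order_trans[OF degree_smult_le] T) (auto simp: less_Suc_eq_le)
  ultimately show ?thesis using that img(3) by (simp add: s_def)
qed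

text \<open>The substitution t = 2 \<rho>/R turns the factor into a radius. The constant term
  vanishes because the local parallel sets, which exclude the points of \<open>X\<close> itself,
  shrink to the empty set.\<close>

lemma local_parallel_volume_poly:
  assumes "0 < R" and B: "B \<in> sets borel" "bounded B"
  obtains Q where "degree Q \<le> DIM('a)" "coeff Q 0 = 0"
    "\<And>\<rho>. 0 < \<rho> \<Longrightarrow> \<rho> < R \<Longrightarrow> measure lborel (local_parallel_set X \<rho> B) = poly Q \<rho>"
proof -
  obtain Q0 where Q0: "degree Q0 \<le> DIM('a)"
    "\<And>t. 0 < t \<Longrightarrow> t < 2 \<Longrightarrow> measure lborel (local_parallel_set X (t * (R / 2)) B) = poly Q0 t"
    using local_parallel_volume_dilate[OF assms] by metis
  define Q where "Q = pcompose Q0 [:0, 2 / R:]"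
  have V: "measure lborel (local_parallel_set X \<rho> B) = poly Q \<rho>" if "0 < \<rho>" "\<rho> < R" for \<rho>
    using Q0(2)[of "2 / R * \<rho>"] that by (simp add: Q_def poly_pcompose field_simps)
  have "degree Q \<le> DIM('a)"
    using Q0(1) \<open>0 < R\<close> by (simp add: Q_def degree_pcompose)
  moreover have "poly Q 0 = 0"
  proof -
    define e where "e n = R / real (Suc (Suc n))" for n
    have e: "0 < e n" "e n < R" for n using \<open>0 < R\<close> by (auto simp: e_def divide_less_eq)
    have e0: "e \<longlonglongrightarrow> 0"
      unfolding e_def by (intro LIMSEQ_Suc real_tendsto_divide_at_top[OF tendsto_const] filterlim_real_sequentially)
    have dec: "decseq (\<lambda>n. local_parallel_set X (e n) B)"
    proof (rule decseq_SucI)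
      fix n
      have "e (Suc n) \<le> e n" using \<open>0 < R\<close> by (simp add: e_def field_simps)
      then show "local_parallel_set X (e (Suc n)) B \<le> local_parallel_set X (e n) B"
        by (auto simp: local_parallel_set_def)
    qed
    have "(\<Inter>n. local_parallel_set X (e n) B) = {}"
    proof (intro equals0I)
      fix z assume z: "z \<in> (\<Inter>n. local_parallel_set X (e n) B)"
      then have "0 < infdist z X" "\<And>n. infdist z X \<le> e n" by (auto simp: local_parallel_set_def)
      then show False using LIMSEQ_le_const[OF e0, of "infdist z X"] by force
    qed
    moreover have "(\<lambda>n. measure lborel (local_parallel_set X (e n) B)) \<longlonglongrightarrow> measure lborel (\<Inter>n. local_parallel_set X (e n) B)"
      using e B dec emeasure_bounded_finite[OF bounded_local_parallel_set[OF B(2)]]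
      by (intro Lim_measure_decseq) (auto intro!: sets_local_parallel_set simp: less_top)
    ultimately have "(\<lambda>n. poly Q (e n)) \<longlonglongrightarrow> 0" using V e by simp
    moreover have "(\<lambda>n. poly Q (e n)) \<longlonglongrightarrow> poly Q 0" by (rule tendsto_poly[OF e0])
    ultimately show ?thesis using LIMSEQ_unique by blast
  qed
  ultimately show ?thesis using V by (intro that) (auto simp: poly_0_coeff_0)
qed

end

section \<open>Hausdorff measures\<close>

lemma hausdorff_pre_antimono:
  "\<delta>' \<le> \<delta> \<Longrightarrow> hausdorff_pre s \<delta> E \<le> hausdorff_pre s \<delta>' (E :: 'a::metric_space set)"
  unfolding hausdorff_pre_def by (rule INF_superset_mono) (auto intro: order_trans)

lemma hausdorff_pre_le_outer: "0 < \<delta> \<Longrightarrow> hausdorff_pre s \<delta> E \<le> hausdorff_outer s E"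
  unfolding hausdorff_outer_def by (rule SUP_upper) auto

lemma hausdorff_outer_eq_SUP_seq:
  "hausdorff_outer s (E :: 'a::metric_space set) = (SUP n. hausdorff_pre s (1 / real (Suc n)) E)"
proof (rule antisym)
  show "hausdorff_outer s E \<le> (SUP n. hausdorff_pre s (1 / real (Suc n)) E)"
    unfolding hausdorff_outer_def
  proof (rule SUP_least)
    fix \<delta> :: real assume "\<delta> \<in> {0<..}"
    then obtain n where "1 / real (Suc n) < \<delta>" using nat_approx_posE by (metis greaterThan_iff)
    then have "hausdorff_pre s \<delta> E \<le> hausdorff_pre s (1 / real (Suc n)) E"
      by (intro hausdorff_pre_antimono) simp
    then show "hausdorff_pre s \<delta> E \<le> (SUP n. hausdorff_pre s (1 / real (Suc n)) E)"
      by (rule order_trans) (rule SUP_upper, simp)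
  qed
  show "(SUP n. hausdorff_pre s (1 / real (Suc n)) E) \<le> hausdorff_outer s E"
    by (intro SUP_least hausdorff_pre_le_outer) simp
qed

lemma incseq_hausdorff_pre: "incseq (\<lambda>n. hausdorff_pre s (1 / real (Suc n)) (E :: 'a::metric_space set))"
  by (intro incseq_SucI hausdorff_pre_antimono) (simp add: field_simps)

lemma hausdorff_outer_mono: "A \<subseteq> B \<Longrightarrow> hausdorff_outer s A \<le> hausdorff_outer s (B :: 'a::metric_space set)"
  unfolding hausdorff_outer_def by (auto intro!: SUP_mono' hausdorff_pre_mono)

lemma hausdorff_outer_UN: "hausdorff_outer s (\<Union>i. A i) \<le> (\<Sum>i. hausdorff_outer s (A i :: 'a::metric_space set))"
  unfolding hausdorff_outer_def[of s "\<Union>i. A i"]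
  by (rule SUP_least) (auto intro!: order_trans[OF hausdorff_pre_UN] suminf_le hausdorff_pre_le_outer)

lemma hausdorff_outer_empty [simp]: "hausdorff_outer s ({} :: 'a::metric_space set) = 0"
  by (simp add: hausdorff_outer_def hausdorff_pre_empty)

section \<open>Additivity on separated sets and measurability of closed sets\<close>

lemma hausdorff_pre_Un:
  "0 < \<delta> \<Longrightarrow> hausdorff_pre s \<delta> (A \<union> B) \<le> hausdorff_pre s \<delta> A + hausdorff_pre s \<delta> (B :: 'a::metric_space set)"
proof -
  assume "0 < \<delta>"
  define C where "C i = (if i = 0 then A else if i = 1 then B else {})" for i :: nat
  have "A \<union> B = (\<Union>i. C i)"
    using UN_upper[of 0 UNIV C] UN_upper[of 1 UNIV C] by (auto simp: C_def split: if_splits)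
  then have "hausdorff_pre s \<delta> (A \<union> B) \<le> (\<Sum>i. hausdorff_pre s \<delta> (C i))" by (simp add: hausdorff_pre_UN)
  also have "\<dots> = (\<Sum>i\<in>{0, 1}. hausdorff_pre s \<delta> (C i))"
    using \<open>0 < \<delta>\<close> by (intro suminf_finite) (auto simp: C_def hausdorff_pre_empty)
  finally show ?thesis by (simp add: C_def)
qed

lemma hausdorff_outer_Un:
  "hausdorff_outer s (A \<union> B) \<le> hausdorff_outer s A + hausdorff_outer s (B :: 'a::metric_space set)"
  unfolding hausdorff_outer_def
  by (rule SUP_least) (auto intro!: order_trans[OF hausdorff_pre_Un] add_mono SUP_upper)

lemma hausdorff_pre_finite_cover:
  fixes E :: "'a::metric_space set"
  assumes "finite I" and "E \<subseteq> (\<Union>i\<in>I. U i)" and "\<And>i. i \<in> I \<Longrightarrow> bounded (U i) \<and> diameter (U i) \<le> \<delta>" and "0 \<le> \<delta>"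
  shows "hausdorff_pre s \<delta> E \<le> (\<Sum>i\<in>I. hausdorff_weight s (U i))"
proof -
  obtain h where h: "bij_betw h {..<card I} I" using ex_bij_betw_nat_finite[OF assms(1)] by (auto simp: atLeast0LessThan)
  define V where "V n = (if n < card I then U (h n) else {})" for n
  have "E \<subseteq> (\<Union>n. V n)"
  proof
    fix x assume "x \<in> E"
    then obtain i where "i \<in> I" "x \<in> U i" using assms(2) by blast
    moreover then have "i \<in> h ` {..<card I}" using h by (auto simp: bij_betw_def)
    then obtain n where "n < card I" "h n = i" by blast
    ultimately show "x \<in> (\<Union>n. V n)" by (auto simp: V_def intro!: exI[of _ n])
  qed
  moreover have "bounded (V n) \<and> diameter (V n) \<le> \<delta>" for n
    using assms(3,4) h by (auto simp: V_def bij_betw_def)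
  ultimately have "hausdorff_pre s \<delta> E \<le> (\<Sum>n. hausdorff_weight s (V n))"
    unfolding hausdorff_pre_def by (intro INF_lower) auto
  also have "\<dots> = (\<Sum>n<card I. hausdorff_weight s (V n))"
    by (intro suminf_finite) (auto simp: V_def hausdorff_weight_def)
  also have "\<dots> = (\<Sum>n<card I. hausdorff_weight s (U (h n)))" by (simp add: V_def)
  also have "\<dots> = (\<Sum>i\<in>I. hausdorff_weight s (U i))" by (rule sum.reindex_bij_betw[OF h])
  finally show ?thesis .
qed

text \<open>A covering set of diameter less than \<eta> cannot meet both \<open>A\<close> and
  \<open>B\<close>, so a fine cover of the union splits into a cover of each; sets missing the part
  in question are replaced by the empty set, of weight 0.\<close>

lemma hausdorff_outer_separated:
  fixes A B :: "'a::metric_space set"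
  assumes "0 < \<eta>" and sep: "\<And>x y. x \<in> A \<Longrightarrow> y \<in> B \<Longrightarrow> \<eta> \<le> dist x y"
  shows "hausdorff_outer s A + hausdorff_outer s B \<le> hausdorff_outer s (A \<union> B)"
proof -
  have pre: "hausdorff_pre s \<delta> A + hausdorff_pre s \<delta> B \<le> hausdorff_pre s \<delta> (A \<union> B)" if "\<delta> < \<eta>" for \<delta>
    unfolding hausdorff_pre_def[of s \<delta> "A \<union> B"]
  proof (rule INF_greatest, clarify)
    fix U :: "nat \<Rightarrow> 'a set"
    assume U: "A \<union> B \<subseteq> (\<Union>i. U i)" "\<forall>i. bounded (U i) \<and> diameter (U i) \<le> \<delta>"
    define V where "V C i = (if U i \<inter> C = {} then {} else U i)" for C i
    have V: "hausdorff_pre s \<delta> C \<le> (\<Sum>i. hausdorff_weight s (V C i))" if "C \<subseteq> A \<union> B" "C \<noteq> {}" for C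
      unfolding hausdorff_pre_def
    proof (rule INF_lower, intro CollectI conjI allI)
      show "C \<subseteq> (\<Union>i. V C i)" using that U(1) by (fastforce simp: V_def)
      have "0 \<le> \<delta>" using U(2) diameter_ge_0 order_trans by blast
      then show "bounded (V C i)" "diameter (V C i) \<le> \<delta>" for i using U(2) by (auto simp: V_def)
    qed
    have "hausdorff_weight s (V A i) + hausdorff_weight s (V B i) \<le> hausdorff_weight s (U i)" for i
    proof (cases "U i \<inter> A = {} \<or> U i \<inter> B = {}")
      case False
      then obtain x y where "x \<in> U i" "x \<in> A" "y \<in> U i" "y \<in> B" by blast
      then have "\<eta> \<le> \<delta>" using sep[of x y] diameter_bounded_bound[of "U i" x y] U(2) by (meson order_trans)
      with that show ?thesis by simp
    qed (auto simp: V_def hausdorff_weight_def)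
    then have "(\<Sum>i. hausdorff_weight s (V A i) + hausdorff_weight s (V B i)) \<le> (\<Sum>i. hausdorff_weight s (U i))"
      by (intro suminf_le) auto
    then have le: "(\<Sum>i. hausdorff_weight s (V A i)) + (\<Sum>i. hausdorff_weight s (V B i)) \<le> (\<Sum>i. hausdorff_weight s (U i))"
      by (subst suminf_add) auto
    have "0 \<le> \<delta>" using U(2) diameter_ge_0 order_trans by blast
    then have "hausdorff_pre s \<delta> ({} :: 'a set) = 0"
      unfolding hausdorff_pre_def
      by (intro antisym INF_lower2[of "\<lambda>_. {}"]) (auto simp: hausdorff_weight_def)
    then have V': "hausdorff_pre s \<delta> C \<le> (\<Sum>i. hausdorff_weight s (V C i))" if "C \<subseteq> A \<union> B" for C
      using V[OF that] by (cases "C = {}") auto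
    from add_mono[OF V'[of A] V'[of B]]
    have "hausdorff_pre s \<delta> A + hausdorff_pre s \<delta> B \<le>
       (\<Sum>i. hausdorff_weight s (V A i)) + (\<Sum>i. hausdorff_weight s (V B i))" by simp
    also note le
    finally show "hausdorff_pre s \<delta> A + hausdorff_pre s \<delta> B \<le> (\<Sum>i. hausdorff_weight s (U i))" .
  qed
  obtain N where N: "1 / real (Suc N) < \<eta>" using nat_approx_posE[OF \<open>0 < \<eta>\<close>] by blast
  have "hausdorff_outer s A + hausdorff_outer s B =
      (SUP n. hausdorff_pre s (1 / real (Suc n)) A + hausdorff_pre s (1 / real (Suc n)) B)"
    unfolding hausdorff_outer_eq_SUP_seq by (rule ennreal_SUP_add[symmetric]) (rule incseq_hausdorff_pre)+
  also have "\<dots> \<le> hausdorff_outer s (A \<union> B)"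
  proof (rule SUP_least)
    fix n
    let ?m = "max n N"
    have le: "1 / real (Suc ?m) \<le> 1 / real (Suc n)" "1 / real (Suc ?m) \<le> 1 / real (Suc N)"
      by (auto simp: frac_le)
    have "hausdorff_pre s (1 / real (Suc n)) A + hausdorff_pre s (1 / real (Suc n)) B
        \<le> hausdorff_pre s (1 / real (Suc ?m)) A + hausdorff_pre s (1 / real (Suc ?m)) B"
      by (intro add_mono hausdorff_pre_antimono le)
    also have "\<dots> \<le> hausdorff_pre s (1 / real (Suc ?m)) (A \<union> B)" by (rule pre) (use le N in linarith)
    also have "\<dots> \<le> hausdorff_outer s (A \<union> B)" by (rule hausdorff_pre_le_outer) simp
    finally show "hausdorff_pre s (1 / real (Suc n)) A + hausdorff_pre s (1 / real (Suc n)) B \<le> hausdorff_outer s (A \<union> B)" .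
  qed
  finally show ?thesis .
qed

lemma sum_hausdorff_outer_separated:
  fixes R :: "nat \<Rightarrow> 'a::metric_space set"
  assumes "\<And>n. 0 < \<eta> n" and "\<And>m n x y. m < n \<Longrightarrow> x \<in> R m \<Longrightarrow> y \<in> R n \<Longrightarrow> \<eta> m \<le> dist x y" and "\<And>n. R n \<subseteq> A"
  shows "(\<Sum>n. hausdorff_outer s (R n)) \<le> hausdorff_outer s A"
proof -
  have "(\<Sum>n<N. hausdorff_outer s (R n)) \<le> hausdorff_outer s (\<Union>n<N. R n)" for N
  proof (induction N)
    case (Suc N)
    define e where "e = Min (insert 1 (\<eta> ` {..<N}))"
    have e: "0 < e" "\<And>m. m < N \<Longrightarrow> e \<le> \<eta> m" using assms(1) by (auto simp: e_def)
    have "(\<Sum>n<Suc N. hausdorff_outer s (R n)) \<le> hausdorff_outer s (\<Union>n<N. R n) + hausdorff_outer s (R N)"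
      using Suc by (simp add: add_mono)
    also have "\<dots> \<le> hausdorff_outer s ((\<Union>n<N. R n) \<union> R N)"
      by (rule hausdorff_outer_separated[OF e(1)]) (use e(2) assms(2) in \<open>fastforce intro: order_trans\<close>)
    also have "(\<Union>n<N. R n) \<union> R N = (\<Union>n<Suc N. R n)" by (auto simp: lessThan_Suc)
    finally show ?case .
  qed simp
  also have "hausdorff_outer s (\<Union>n<N. R n) \<le> hausdorff_outer s A" for N
    using assms(3) by (intro hausdorff_outer_mono) auto
  finally have "(\<Sum>n<N. hausdorff_outer s (R n)) \<le> hausdorff_outer s A" for N .
  then show ?thesis by (intro suminf_le_const) auto
qed

text \<open>Caratheodory's criterion for metric outer measures. The part of \<open>A\<close> outside
  \<open>K\<close> is exhausted by the sets \<open>An\<close> at positive distance from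
  \<open>K\<close>. The shells \<open>R\<close> between them are separated once their indices differ
  by two, so the even and the odd shells have summable measures and the tails, which bound the
  error, tend to 0.\<close>

lemma hausdorff_outer_lambda_closed:
  fixes K :: "'a::metric_space set"
  assumes "closed K" "K \<noteq> {}"
  shows "hausdorff_outer s (A \<inter> K) + hausdorff_outer s (A - K) \<le> hausdorff_outer s A"
proof (cases "hausdorff_outer s A = top")
  case False
  define An where "An n = {x \<in> A. 1 / real (Suc n) \<le> infdist x K}" for n
  define R where "R n = An (Suc n) - An n" for n
  have An: "hausdorff_outer s (A \<inter> K) + hausdorff_outer s (An n) \<le> hausdorff_outer s A" for n
  proof -
    have "hausdorff_outer s (A \<inter> K) + hausdorff_outer s (An n) \<le> hausdorff_outer s ((A \<inter> K) \<union> An n)"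
    proof (rule hausdorff_outer_separated[of "1 / real (Suc n)"])
      fix x y assume "x \<in> A \<inter> K" "y \<in> An n"
      then show "1 / real (Suc n) \<le> dist x y"
        using infdist_le[of x K y] by (auto simp: An_def dist_commute)
    qed simp
    also have "\<dots> \<le> hausdorff_outer s A" by (intro hausdorff_outer_mono) (auto simp: An_def)
    finally show ?thesis .
  qed
  have RA: "R n \<subseteq> A" for n by (auto simp: R_def An_def)
  have sep: "1 / real (Suc (Suc m)) - 1 / real (Suc n) \<le> dist x y" if "x \<in> R m" "y \<in> R n" for m n x y
  proof -
    have "1 / real (Suc (Suc m)) \<le> infdist x K" "infdist y K < 1 / real (Suc n)"
      using that by (auto simp: R_def An_def)
    then show ?thesis using infdist_triangle[of x K y] by linarith
  qed
  have less: "1 / real (Suc (Suc n)) < 1 / real (Suc n)" for n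
    by (rule divide_strict_left_mono) auto
  have half: "(\<Sum>n. hausdorff_outer s (R (2 * n + j))) \<le> hausdorff_outer s A" for j
  proof (rule sum_hausdorff_outer_separated)
    fix m n x y assume mn: "m < n" "x \<in> R (2 * m + j)" "y \<in> R (2 * n + j)"
    have "1 / real (Suc (2 * n + j)) \<le> 1 / real (Suc (Suc (Suc (2 * m + j))))"
      using mn(1) by (intro frac_le) auto
    then show "1 / real (Suc (Suc (2 * m + j))) - 1 / real (Suc (Suc (Suc (2 * m + j)))) \<le> dist x y"
      using sep[OF mn(2,3)] by linarith
    next
    fix n
    show "0 < 1 / real (Suc (Suc (2 * n + j))) - 1 / real (Suc (Suc (Suc (2 * n + j))))"
      using less[of "Suc (2 * n + j)"] by linarith
  qed (rule RA)
  define h where "h n = hausdorff_outer s (R n)" for n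
  have "(\<Sum>n<2 * N. h n) \<le> (\<Sum>n<N. h (2 * n)) + (\<Sum>n<N. h (2 * n + 1))" for N
    by (induction N) (auto simp: algebra_simps)
  also have "(\<Sum>n<N. h (2 * n)) + (\<Sum>n<N. h (2 * n + 1)) \<le> hausdorff_outer s A + hausdorff_outer s A" for N
    using half[of 0] half[of 1] unfolding h_def[symmetric]
    by (intro add_mono order_trans[OF sum_le_suminf]) auto
  finally have h2: "(\<Sum>n<2 * N. h n) \<le> hausdorff_outer s A + hausdorff_outer s A" for N .
  have "(\<Sum>n. h n) \<le> hausdorff_outer s A + hausdorff_outer s A"
  proof (rule suminf_le_const)
    fix N show "(\<Sum>n<N. h n) \<le> hausdorff_outer s A + hausdorff_outer s A"
      by (rule order_trans[OF _ h2[of N]]) (rule sum_mono2, auto)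
  qed simp
  also have "\<dots> < top" using False by (simp add: less_top)
  finally have fin: "(\<Sum>n. h n) \<noteq> top" by simp
  have tail: "(\<lambda>n. \<Sum>k. h (k + n)) \<longlonglongrightarrow> 0"
  proof -
    have "summable (\<lambda>n. enn2real (h n))" and e: "\<And>n. ennreal (enn2real (h n)) = h n"
    proof -
      have ht: "h n < top" for n using sum_le_suminf[of h "{n}"] fin by (auto simp: top.not_eq_extremum intro: le_less_trans)
      then show e: "ennreal (enn2real (h n)) = h n" for n by (simp add: less_top)
      show "summable (\<lambda>n. enn2real (h n))"
        using fin by (intro summable_suminf_not_top) (auto simp: e)
    qed
    from suminf_exist_split2[OF this(1)] have "(\<lambda>n. \<Sum>k. enn2real (h (k + n))) \<longlonglongrightarrow> 0" .
    then have "(\<lambda>n. ennreal (\<Sum>k. enn2real (h (k + n)))) \<longlonglongrightarrow> ennreal 0" by (rule tendsto_ennrealI)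
    moreover have "ennreal (\<Sum>k. enn2real (h (k + n))) = (\<Sum>k. h (k + n))" for n
      using \<open>summable (\<lambda>n. enn2real (h n))\<close> e
      by (subst suminf_ennreal2[symmetric]) (auto intro: summable_ignore_initial_segment)
    ultimately show ?thesis by simp
  qed
  have cover: "hausdorff_outer s (A - K) \<le> hausdorff_outer s (An n) + (\<Sum>k. h (k + n))" for n
  proof -
    have "A - K \<subseteq> An n \<union> (\<Union>k. R (k + n))"
    proof
      fix x assume x: "x \<in> A - K"
      then have "infdist x K > 0" using assms by (simp add: infdist_pos_not_in_closed)
      then obtain m where m: "1 / real (Suc m) < infdist x K" using nat_approx_posE by blast
      show "x \<in> An n \<union> (\<Union>k. R (k + n))"
      proof (cases "x \<in> An n")
        case False
        define l where "l = (LEAST l. x \<in> An l)"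
        have "x \<in> An m" using x m by (simp add: An_def)
        then have l: "x \<in> An l" unfolding l_def by (rule LeastI)
        have mono: "An i \<subseteq> An j" if "i \<le> j" for i j
          using that frac_le[of 1 1 "real (Suc i)" "real (Suc j)"] by (force simp: An_def)
        have "n < l" using False l mono[of l n] by (meson not_less subsetD)
        then obtain k where k: "l = Suc (k + n)" by (metis add.commute less_iff_Suc_add)
        have "x \<notin> An (k + n)" using not_less_Least[of "k + n" "\<lambda>l. x \<in> An l"] k by (simp add: l_def)
        then have "x \<in> R (k + n)" using l k by (simp add: R_def)
        then show ?thesis by blast
      qed simp
    qed
    then have "hausdorff_outer s (A - K) \<le> hausdorff_outer s (An n) + hausdorff_outer s (\<Union>k. R (k + n))"
      by (intro order_trans[OF hausdorff_outer_mono hausdorff_outer_Un])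
    also have "\<dots> \<le> hausdorff_outer s (An n) + (\<Sum>k. h (k + n))"
      unfolding h_def by (intro add_left_mono hausdorff_outer_UN)
    finally show ?thesis .
  qed
  have "hausdorff_outer s (A \<inter> K) + hausdorff_outer s (A - K) \<le> hausdorff_outer s A + (\<Sum>k. h (k + n))" for n
  proof -
    have "hausdorff_outer s (A \<inter> K) + hausdorff_outer s (A - K)
      \<le> hausdorff_outer s (A \<inter> K) + (hausdorff_outer s (An n) + (\<Sum>k. h (k + n)))"
      by (intro add_left_mono cover)
    also have "\<dots> \<le> hausdorff_outer s A + (\<Sum>k. h (k + n))"
      using An[of n] by (simp add: add_right_mono flip: add.assoc)
    finally show ?thesis .
  qed
  moreover have "(\<lambda>n. hausdorff_outer s A + (\<Sum>k. h (k + n))) \<longlonglongrightarrow> hausdorff_outer s A + 0"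
    by (intro tendsto_add tail tendsto_const)
  ultimately show ?thesis
    using LIMSEQ_le_const[of "\<lambda>n. hausdorff_outer s A + (\<Sum>k. h (k + n))" "hausdorff_outer s A"] by auto
qed simp

lemma in_sets_hausdorff_iff:
  "E \<in> sets (hausdorff_measure s) \<longleftrightarrow>
    (\<forall>X. hausdorff_outer s (X \<inter> E) + hausdorff_outer s (X - E) \<le> hausdorff_outer s (X :: 'a::metric_space set))"
proof -
  have "hausdorff_outer s X \<le> hausdorff_outer s (X \<inter> E) + hausdorff_outer s (X - E)" for X
    using hausdorff_outer_Un[of s "X \<inter> E" "X - E"] by (simp add: Un_Diff_Int Un_commute)
  moreover have e: "(UNIV - E) \<inter> X = X - E" for X by auto
  ultimately show ?thesis
    unfolding sets_hausdorff_measure lambda_system_def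
    by (auto simp: e Int_commute[of E] intro: antisym)
qed

lemma space_hausdorff_measure [simp]: "space (hausdorff_measure s) = UNIV"
  unfolding hausdorff_measure_def using measure_space_hausdorff[where s=s]
  by (intro space_measure_of) (auto simp: measure_space_def)

lemma borel_subset_sets_hausdorff:
  assumes "E \<in> sets (borel :: 'a::metric_space measure)"
  shows "E \<in> sets (hausdorff_measure s)"
proof -
  have "sigma_sets UNIV {S. closed S} \<subseteq> sets (hausdorff_measure s :: 'a measure)"
  proof -
    have "K \<in> sets (hausdorff_measure s)" if "closed K" for K :: "'a set"
      using hausdorff_outer_lambda_closed[OF that] by (cases "K = {}") (auto simp: in_sets_hausdorff_iff)
    then show ?thesis using sets.sigma_sets_subset[of "{S. closed S}" "hausdorff_measure s :: 'a measure"] by auto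
  qed
  then show ?thesis using assms by (auto simp: borel_eq_closed)
qed

lemma null_set_hausdorff: "hausdorff_outer s E = 0 \<Longrightarrow> E \<in> null_sets (hausdorff_measure s)"
  for E :: "'a::metric_space set"
proof -
  assume 0: "hausdorff_outer s E = 0"
  have "E \<in> sets (hausdorff_measure s)"
    unfolding in_sets_hausdorff_iff
    using hausdorff_outer_mono[of "_ \<inter> E" E s] 0 by (auto intro!: hausdorff_outer_mono)
  with 0 show ?thesis by (auto simp: null_sets_def emeasure_hausdorff_measure)
qed

text \<open>Taking closures in an almost optimal cover changes neither diameters nor weights and
  makes the sets Borel; \<open>G\<close> is the intersection over finer and finer such
  covers.\<close>

lemma borel_hull:
  fixes E :: "'a::metric_space set"
  assumes fin: "hausdorff_outer s E < top"
  obtains G where "G \<in> sets borel" "E \<subseteq> G" "hausdorff_outer s G = hausdorff_outer s E"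
proof -
  have "\<exists>U. E \<subseteq> (\<Union>i. U i) \<and> (\<forall>i. bounded (U i) \<and> diameter (U i) \<le> 1 / real (Suc n)) \<and>
      (\<Sum>i. hausdorff_weight s (U i)) < hausdorff_outer s E + ennreal (1 / real (Suc n))" for n
  proof -
    have "hausdorff_pre s (1 / real (Suc n)) E \<le> hausdorff_outer s E" by (rule hausdorff_pre_le_outer) simp
    also have "\<dots> < hausdorff_outer s E + ennreal (1 / real (Suc n))" 
    proof -
      have "hausdorff_outer s E + 0 < hausdorff_outer s E + ennreal (1 / real (Suc n))"
        unfolding ennreal_add_left_cancel_less using fin by auto
      then show ?thesis by simp
    qed
    finally show ?thesis unfolding hausdorff_pre_def INF_less_iff by auto
  qed
  then obtain U where U: "\<And>n. E \<subseteq> (\<Union>i. U n i)" "\<And>n i. bounded (U n i) \<and> diameter (U n i) \<le> 1 / real (Suc n)"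
     "\<And>n. (\<Sum>i. hausdorff_weight s (U n i)) < hausdorff_outer s E + ennreal (1 / real (Suc n))" by metis
  define G where "G = (\<Inter>n. \<Union>i. closure (U n i :: 'a set))"
  have "G \<in> sets borel" unfolding G_def by (intro sets.countable_INT'' sets.countable_UN') auto
  moreover have EG: "E \<subseteq> G" unfolding G_def using U(1) closure_subset by blast
  moreover have "hausdorff_outer s G \<le> hausdorff_outer s E"
  proof -
    have wcl: "hausdorff_weight s (closure (U n i)) = hausdorff_weight s (U n i)" for n i
      using U(2) by (simp add: hausdorff_weight_def diameter_closure)
    have pre: "hausdorff_pre s (1 / real (Suc n)) G \<le> hausdorff_outer s E + ennreal (1 / real (Suc n))" for n
    proof -
      have "hausdorff_pre s (1 / real (Suc n)) G \<le> (\<Sum>i. hausdorff_weight s (closure (U n i)))"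
        unfolding hausdorff_pre_def
        by (rule INF_lower) (use U(2) in \<open>auto simp: G_def diameter_closure bounded_closure\<close>)
      also have "\<dots> \<le> hausdorff_outer s E + ennreal (1 / real (Suc n))" using U(3)[of n] by (simp add: wcl)
      finally show ?thesis .
    qed
    have lim: "(\<lambda>n. hausdorff_pre s (1 / real (Suc n)) G) \<longlonglongrightarrow> hausdorff_outer s G"
      unfolding hausdorff_outer_eq_SUP_seq[of s G] by (rule LIMSEQ_SUP[OF incseq_hausdorff_pre])
    have "(\<lambda>n. ennreal (1 / real (Suc n))) \<longlonglongrightarrow> ennreal 0"
      by (intro tendsto_ennrealI LIMSEQ_Suc[OF lim_1_over_n])
    then have lim2: "(\<lambda>n. hausdorff_outer s E + ennreal (1 / real (Suc n))) \<longlonglongrightarrow> hausdorff_outer s E + 0"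
      by (intro tendsto_add tendsto_const) simp
    show ?thesis using LIMSEQ_le[OF lim lim2] pre by auto
  qed
  moreover have "hausdorff_outer s E \<le> hausdorff_outer s G" by (rule hausdorff_outer_mono[OF EG])
  ultimately show ?thesis by (intro that[of G]) auto
qed

section \<open>Similarities\<close>

lemma ennreal_le_cmult_INF:
  fixes X :: ennreal and c :: real
  assumes "0 < c" and le: "\<And>i. i \<in> I \<Longrightarrow> X \<le> ennreal c * f i"
  shows "X \<le> ennreal c * (INF i\<in>I. f i)"
proof -
  have inv: "ennreal (1 / c) * (ennreal c * y) = y" "ennreal c * (ennreal (1 / c) * y) = y" for y
    using \<open>0 < c\<close> by (simp_all add: mult.assoc[symmetric] ennreal_mult[symmetric])
  have "ennreal (1 / c) * X \<le> (INF i\<in>I. f i)"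
  proof (rule INF_greatest)
    fix i assume "i \<in> I"
    from mult_left_mono[OF le[OF this], of "ennreal (1 / c)"]
    show "ennreal (1 / c) * X \<le> f i" by (simp add: inv)
  qed
  from mult_left_mono[OF this, of "ennreal c"] show ?thesis by (simp add: inv)
qed

text \<open>Every positive ratio is allowed and surjectivity included, so that the class is closed
  under inverses.\<close>

definition similarity :: "real \<Rightarrow> ('a::metric_space \<Rightarrow> 'a) \<Rightarrow> bool" where
  "similarity \<rho> f \<longleftrightarrow> 0 < \<rho> \<and> surj f \<and> (\<forall>x y. dist (f x) (f y) = \<rho> * dist x y)"

text \<open>Normalised to ratio 1 and to fix 0, the map is an isometry and therefore
  orthogonal.\<close>

lemma contracting_similarity_affine:
  fixes f :: "'a::euclidean_space \<Rightarrow> 'a"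
  assumes "contracting_similarity \<rho> f"
  obtains g where "orthogonal_transformation g" "\<And>x. f x = f 0 + \<rho> *\<^sub>R g x"
proof -
  have r: "0 < \<rho>" "\<And>x y. dist (f x) (f y) = \<rho> * dist x y"
    using assms by (auto simp: contracting_similarity_def)
  define g where "g x = (1 / \<rho>) *\<^sub>R (f x - f 0)" for x
  have "dist (g x) (g y) = dist x y" for x y
  proof -
    have "g x - g y = (1 / \<rho>) *\<^sub>R (f x - f y)" by (simp add: g_def algebra_simps)
    then show ?thesis using r(1) r(2)[of x y] by (simp add: dist_norm)
  qed
  then have "orthogonal_transformation g"
    unfolding orthogonal_transformation_isometry by (auto simp: g_def)
  then show ?thesis by (rule that) (use r(1) in \<open>simp add: g_def\<close>)
qed

lemma similarity_if_contracting:
  fixes f :: "'a::euclidean_space \<Rightarrow> 'a"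
  assumes "contracting_similarity \<rho> f"
  shows "similarity \<rho> f"
proof -
  obtain g where g: "orthogonal_transformation g" "\<And>x. f x = f 0 + \<rho> *\<^sub>R g x"
    by (rule contracting_similarity_affine[OF assms]) blast
  have "0 < \<rho>" using assms by (simp add: contracting_similarity_def)
  have "\<exists>x. y = f x" for y
  proof -
    obtain x where "g x = (1 / \<rho>) *\<^sub>R (y - f 0)" using orthogonal_transformation_surj[OF g(1)] by (metis surjD)
    then show ?thesis using g(2)[of x] \<open>0 < \<rho>\<close> by (intro exI[of _ x]) simp
  qed
  then show ?thesis using assms by (auto simp: similarity_def contracting_similarity_def surj_def)
qed

lemma similarityD:
  assumes "similarity \<rho> f"
  shows "0 < \<rho>" "\<And>x y. dist (f x) (f y) = \<rho> * dist x y" "bij f" "inj f" "surj f"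
proof -
  show 1: "0 < \<rho>" "\<And>x y. dist (f x) (f y) = \<rho> * dist x y" "surj f" using assms by (auto simp: similarity_def)
  show "inj f" using 1 by (intro injI) (metis dist_eq_0_iff mult_eq_0_iff less_irrefl)
  with 1 show "bij f" by (simp add: bij_def)
qed

lemma similarity_inv:
  assumes "similarity \<rho> f"
  shows "similarity (1 / \<rho>) (inv f)"
proof -
  note f = similarityD[OF assms]
  have "dist (inv f x) (inv f y) = 1 / \<rho> * dist x y" for x y
    using f(2)[of "inv f x" "inv f y"] f(1,5) by (simp add: surj_f_inv_f field_simps)
  then show ?thesis using f bij_imp_bij_inv[OF f(3)] by (simp add: similarity_def bij_is_surj)
qed

lemma similarity_continuous: "similarity \<rho> f \<Longrightarrow> continuous_on A f"
  using similarityD[of \<rho> f] by (intro lipschitz_on_continuous_on[of \<rho>] lipschitz_onI) auto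

lemma similarity_measurable: "similarity \<rho> (f :: 'a::euclidean_space \<Rightarrow> 'a) \<Longrightarrow> f \<in> borel_measurable borel"
  by (intro borel_measurable_continuous_onI similarity_continuous)

lemma similarity_image_eq_vimage: "similarity \<rho> f \<Longrightarrow> f ` A = inv f -` A"
  using similarityD(3)[of \<rho> f] by (simp add: bij_vimage_eq_inv_image bij_imp_bij_inv inv_inv_eq)

lemma similarity_image_borel:
  "similarity \<rho> (f :: 'a::euclidean_space \<Rightarrow> 'a) \<Longrightarrow> A \<in> sets borel \<Longrightarrow> f ` A \<in> sets borel"
  using measurable_sets[OF similarity_measurable[OF similarity_inv[of \<rho> f]], of A]
  by (simp add: similarity_image_eq_vimage)

lemma similarity_infdist:
  assumes "similarity \<rho> f"
  shows "infdist (f x) (f ` A) = \<rho> * infdist x A"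
proof (cases "A = {}")
  case False
  note f = similarityD[OF assms]
  have "infdist (f x) (f ` A) = (INF a\<in>A. \<rho> * dist x a)"
    using False by (simp add: infdist_def image_image f(2))
  also have "\<dots> = \<rho> * infdist x A"
  proof (rule antisym)
    have bdd: "bdd_below ((\<lambda>a. \<rho> * dist x a) ` A)" using f(1) by (intro bdd_belowI2[of _ 0]) auto
    have "(INF a\<in>A. \<rho> * dist x a) / \<rho> \<le> dist x a" if "a \<in> A" for a
      using cINF_lower[OF bdd that] f(1) by (simp add: divide_le_eq mult.commute)
    then have "(INF a\<in>A. \<rho> * dist x a) / \<rho> \<le> infdist x A"
      unfolding infdist_notempty[OF False] by (intro cINF_greatest False)
    then show "(INF a\<in>A. \<rho> * dist x a) \<le> \<rho> * infdist x A" using f(1) by (simp add: field_simps)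
    show "\<rho> * infdist x A \<le> (INF a\<in>A. \<rho> * dist x a)"
      using False f(1) by (intro cINF_greatest) (auto intro: infdist_le)
  qed
  finally show ?thesis .
qed (simp add: infdist_def)

lemma similarity_image_Compl: "similarity \<rho> f \<Longrightarrow> f ` (- A) = - (f ` A)"
  by (rule bij_image_Compl_eq[OF similarityD(3)])

lemma similarity_open: "similarity \<rho> f \<Longrightarrow> open A \<Longrightarrow> open (f ` A)"
  using open_vimage[of A "inv f"] similarity_continuous[OF similarity_inv[of \<rho> f], of UNIV]
  by (simp add: similarity_image_eq_vimage)

lemma similarity_closure: "similarity \<rho> f \<Longrightarrow> f ` closure A = closure (f ` A)"
  for f :: "'a::euclidean_space \<Rightarrow> 'a"
proof (rule equalityI)
  assume f: "similarity \<rho> f"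
  show "f ` closure A \<subseteq> closure (f ` A)"
    by (intro image_closure_subset similarity_continuous[OF f] closure_subset) auto
  have "closed (f ` closure A)"
    using closed_vimage[OF closed_closure similarity_continuous[OF similarity_inv[OF f], of UNIV], of A]
    by (simp add: similarity_image_eq_vimage[OF f])
  then show "closure (f ` A) \<subseteq> f ` closure A"
    by (intro closure_minimal image_mono closure_subset)
qed

lemma hausdorff_outer_lipschitz_image:
  fixes f :: "'a::metric_space \<Rightarrow> 'b::metric_space"
  assumes "0 \<le> s" "0 < L" and lip: "\<And>x y. x \<in> E \<Longrightarrow> y \<in> E \<Longrightarrow> dist (f x) (f y) \<le> L * dist x y"
  shows "hausdorff_pre s (L * \<delta>) (f ` E) \<le> ennreal (L powr s) * hausdorff_pre s \<delta> E"
    and "hausdorff_outer s (f ` E) \<le> ennreal (L powr s) * hausdorff_outer s E"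
proof -
  have diam: "diameter W \<le> d" if "0 \<le> d" "\<And>x y. x \<in> W \<Longrightarrow> y \<in> W \<Longrightarrow> dist x y \<le> d" for W :: "'b set" and d
    using that by (auto simp: diameter_def intro!: cSUP_least)
  have pre: "hausdorff_pre s (L * \<delta>) (f ` E) \<le> ennreal (L powr s) * hausdorff_pre s \<delta> E" for \<delta>
  proof -
    have "hausdorff_pre s (L * \<delta>) (f ` E) \<le> ennreal (L powr s) * (\<Sum>i. hausdorff_weight s (U i))"
      if U: "E \<subseteq> (\<Union>i. U i)" "\<forall>i. bounded (U i) \<and> diameter (U i) \<le> \<delta>" for U
    proof -
      \<comment> \<open>The covering sets are intersected with \<open>E\<close> because
        \<open>f\<close> is Lipschitz only there.\<close>
      define V where "V i = f ` (E \<inter> U i)" for i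
      have d: "bounded (V i) \<and> diameter (V i) \<le> L * diameter (U i)" for i
      proof
        have le: "dist x y \<le> L * diameter (U i)" if xy: "x \<in> V i" "y \<in> V i" for x y
        proof -
          obtain a b where ab: "a \<in> E" "a \<in> U i" "b \<in> E" "b \<in> U i" "x = f a" "y = f b" using xy by (auto simp: V_def)
          then have "dist x y \<le> L * dist a b" using lip by simp
          also have "\<dots> \<le> L * diameter (U i)"
            using diameter_bounded_bound[of "U i" a b] U(2) ab \<open>0 < L\<close> by (intro mult_left_mono) auto
          finally show ?thesis .
        qed
        then show "bounded (V i)" unfolding bounded_two_points by blast
        have "0 \<le> L * diameter (U i)" using diameter_ge_0[of "U i"] U(2) \<open>0 < L\<close> by simp
        then show "diameter (V i) \<le> L * diameter (U i)" using le by (rule diam)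
      qed
      have w: "hausdorff_weight s (V i) \<le> ennreal (L powr s) * hausdorff_weight s (U i)" for i
      proof (cases "V i = {}")
        case False
        then have ne: "U i \<noteq> {}" by (auto simp: V_def)
        have "0 \<le> diameter (U i)" "0 \<le> diameter (V i)" using U(2) d by (auto intro: diameter_ge_0)
        then have "(if s = 0 then 1 else (diameter (V i) / 2) powr s)
            \<le> L powr s * (if s = 0 then 1 else (diameter (U i) / 2) powr s)"
          using d[of i] \<open>0 \<le> s\<close> \<open>0 < L\<close>
          by (auto simp flip: powr_mult intro!: powr_mono2)
        then have "ennreal (unit_ball_vol s * (if s = 0 then 1 else (diameter (V i) / 2) powr s)) \<le>
           ennreal (L powr s * (unit_ball_vol s * (if s = 0 then 1 else (diameter (U i) / 2) powr s)))"
          using mult_left_mono[of _ _ "unit_ball_vol s"] unit_ball_vol_nonneg[OF \<open>0 \<le> s\<close>]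
          by (intro ennreal_leI) (simp add: mult.left_commute)
        then show ?thesis using False ne by (simp add: hausdorff_weight_def ennreal_mult')
      qed (simp add: hausdorff_weight_def)
      have "hausdorff_pre s (L * \<delta>) (f ` E) \<le> (\<Sum>i. hausdorff_weight s (V i))"
        unfolding hausdorff_pre_def
      proof (rule INF_lower, intro CollectI conjI allI)
        show "f ` E \<subseteq> (\<Union>i. V i)"
        proof
          fix y assume "y \<in> f ` E"
          then obtain x where "x \<in> E" "y = f x" by blast
          moreover then obtain i where "x \<in> U i" using U(1) by blast
          ultimately show "y \<in> (\<Union>i. V i)" by (auto simp: V_def)
        qed
        show "bounded (V i)" "diameter (V i) \<le> L * \<delta>" for i
          using d[of i] U(2) \<open>0 < L\<close> by (auto intro: order_trans mult_left_mono)
      qed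
      also have "\<dots> \<le> (\<Sum>i. ennreal (L powr s) * hausdorff_weight s (U i))" by (intro suminf_le w) auto
      finally show ?thesis by simp
    qed
    then show ?thesis
      unfolding hausdorff_pre_def[of s \<delta> E] using \<open>0 < L\<close> by (intro ennreal_le_cmult_INF) auto
  qed
  then show "hausdorff_pre s (L * \<delta>) (f ` E) \<le> ennreal (L powr s) * hausdorff_pre s \<delta> E" .
  show "hausdorff_outer s (f ` E) \<le> ennreal (L powr s) * hausdorff_outer s E"
    unfolding hausdorff_outer_def[of s "f ` E"]
  proof (rule SUP_least)
    fix \<delta> :: real assume "\<delta> \<in> {0<..}"
    then have "hausdorff_pre s \<delta> (f ` E) \<le> ennreal (L powr s) * hausdorff_pre s (\<delta> / L) E"
      using pre[of "\<delta> / L"] \<open>0 < L\<close> by simp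
    also have "\<dots> \<le> ennreal (L powr s) * hausdorff_outer s E"
      using \<open>\<delta> \<in> {0<..}\<close> \<open>0 < L\<close> by (intro mult_left_mono hausdorff_pre_le_outer) auto
    finally show "hausdorff_pre s \<delta> (f ` E) \<le> ennreal (L powr s) * hausdorff_outer s E" .
  qed
qed

lemma hausdorff_outer_similarity_image:
  assumes f: "similarity \<rho> f" and "0 \<le> s"
  shows "hausdorff_outer s (f ` E) = ennreal (\<rho> powr s) * hausdorff_outer s E"
proof (rule antisym)
  note f' = similarityD[OF f] and i = similarityD[OF similarity_inv[OF f]]
  show "hausdorff_outer s (f ` E) \<le> ennreal (\<rho> powr s) * hausdorff_outer s E"
    by (rule hausdorff_outer_lipschitz_image) (use f' \<open>0 \<le> s\<close> in auto)
  have "hausdorff_outer s (inv f ` (f ` E)) \<le> ennreal ((1 / \<rho>) powr s) * hausdorff_outer s (f ` E)"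
    by (rule hausdorff_outer_lipschitz_image) (use i \<open>0 \<le> s\<close> in auto)
  then have "ennreal (\<rho> powr s) * hausdorff_outer s E
      \<le> ennreal (\<rho> powr s) * (ennreal ((1 / \<rho>) powr s) * hausdorff_outer s (f ` E))"
    using f'(4) by (intro mult_left_mono) (auto simp: image_comp inv_o_cancel)
  also have "\<dots> = ennreal (\<rho> powr s * (1 / \<rho>) powr s) * hausdorff_outer s (f ` E)"
    by (simp add: ennreal_mult mult.assoc)
  also have "\<rho> powr s * (1 / \<rho>) powr s = 1" using f'(1) by (simp flip: powr_mult)
  finally show "ennreal (\<rho> powr s) * hausdorff_outer s E \<le> hausdorff_outer s (f ` E)" by simp
qed

lemma sets_hausdorff_similarity_image:
  assumes f: "similarity \<rho> f" and "0 \<le> s" and E: "E \<in> sets (hausdorff_measure s)"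
  shows "f ` E \<in> sets (hausdorff_measure s)"
  unfolding in_sets_hausdorff_iff
proof
  fix X
  note f' = similarityD[OF f]
  define Y where "Y = inv f ` X"
  have X: "X = f ` Y" using f'(5) by (simp add: Y_def image_f_inv_f)
  have "X \<inter> f ` E = f ` (Y \<inter> E)" "X - f ` E = f ` (Y - E)"
    unfolding X using f'(4) by (auto simp: image_Int image_set_diff)
  then show "hausdorff_outer s (X \<inter> f ` E) + hausdorff_outer s (X - f ` E) \<le> hausdorff_outer s X"
    using E[unfolded in_sets_hausdorff_iff, rule_format, of Y]
    unfolding X by (simp add: hausdorff_outer_similarity_image[OF f \<open>0 \<le> s\<close>] mult_left_mono flip: distrib_left)
qed

lemma measure_hausdorff_similarity_image:
  assumes f: "similarity \<rho> (f :: 'a::euclidean_space \<Rightarrow> 'a)" and "0 \<le> s" and E: "E \<in> sets borel"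
  shows "measure (hausdorff_measure s) (f ` E) = \<rho> powr s * measure (hausdorff_measure s) E"
  using borel_subset_sets_hausdorff[OF E] borel_subset_sets_hausdorff[OF similarity_image_borel[OF f E]]
  by (simp add: measure_def emeasure_hausdorff_measure hausdorff_outer_similarity_image[OF f \<open>0 \<le> s\<close>] enn2real_mult)

text \<open>On sets of diameter at most \<delta> the t-dimensional weight is at most a constant
  times \<delta>^(t - s) times the s-dimensional one, and this factor tends to 0.\<close>

lemma hausdorff_outer_zero_higher:
  fixes E :: "'a::metric_space set"
  assumes "0 \<le> s" "s < t" and fin: "hausdorff_outer s E < top"
  shows "hausdorff_outer t E = 0"
proof -
  define C where "C = unit_ball_vol t / unit_ball_vol s"
  have ub: "unit_ball_vol s > 0" "unit_ball_vol t > 0" using assms by (auto intro: unit_ball_vol_pos)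
  then have "C > 0" by (simp add: C_def)
  then have "C \<ge> 0" by simp
  have w: "hausdorff_weight t U \<le> ennreal (C * \<delta> powr (t - s)) * hausdorff_weight s (U :: 'a set)"
    if U: "bounded U" "diameter U \<le> \<delta>" for U \<delta>
  proof (cases "U = {}")
    case False
    let ?d = "diameter U / 2"
    have d: "0 \<le> ?d" "?d \<le> \<delta>" "0 \<le> \<delta>" using diameter_ge_0[OF U(1)] U(2) by linarith+
    have "?d powr t \<le> \<delta> powr (t - s) * (if s = 0 then 1 else ?d powr s)"
    proof (cases "s = 0")
      case True then show ?thesis using d assms by (auto intro: powr_mono2)
    next
      case False
      then have "?d powr t = ?d powr (t - s) * ?d powr s" by (simp flip: powr_add)
      then show ?thesis using False d assms by (auto intro!: mult_right_mono powr_mono2)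
    qed
    then have "unit_ball_vol t * ?d powr t \<le> unit_ball_vol t * (\<delta> powr (t - s) * (if s = 0 then 1 else ?d powr s))"
      using ub by (intro mult_left_mono) auto
    also have "\<dots> = (C * \<delta> powr (t - s)) * (unit_ball_vol s * (if s = 0 then 1 else ?d powr s))"
      using ub by (simp add: C_def)
    finally have "ennreal (unit_ball_vol t * ?d powr t) \<le> ennreal ((C * \<delta> powr (t - s)) * (unit_ball_vol s * (if s = 0 then 1 else ?d powr s)))"
      by (rule ennreal_leI)
    also have "\<dots> = ennreal (C * \<delta> powr (t - s)) * ennreal (unit_ball_vol s * (if s = 0 then 1 else ?d powr s))"
      using \<open>C \<ge> 0\<close> by (intro ennreal_mult') auto
    finally show ?thesis using False assms by (simp add: hausdorff_weight_def)
  qed (simp add: hausdorff_weight_def)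
  have pre: "hausdorff_pre t \<delta> E \<le> ennreal (C * \<delta> powr (t - s)) * hausdorff_outer s E" if "0 < \<delta>" for \<delta>
  proof -
    have "hausdorff_pre t \<delta> E \<le> ennreal (C * \<delta> powr (t - s)) * (\<Sum>i. hausdorff_weight s (U i))"
      if U: "E \<subseteq> (\<Union>i. U i)" "\<forall>i. bounded (U i) \<and> diameter (U i) \<le> \<delta>" for U
    proof -
      have "hausdorff_pre t \<delta> E \<le> (\<Sum>i. hausdorff_weight t (U i))"
        unfolding hausdorff_pre_def by (rule INF_lower) (use U in auto)
      also have "\<dots> \<le> (\<Sum>i. ennreal (C * \<delta> powr (t - s)) * hausdorff_weight s (U i))"
        by (intro suminf_le w) (use U in auto)
      finally show ?thesis by simp
    qed
    then have "hausdorff_pre t \<delta> E \<le> ennreal (C * \<delta> powr (t - s)) * hausdorff_pre s \<delta> E"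
      unfolding hausdorff_pre_def[of s \<delta> E] using \<open>C > 0\<close> that by (intro ennreal_le_cmult_INF) auto
    also have "\<dots> \<le> ennreal (C * \<delta> powr (t - s)) * hausdorff_outer s E"
      by (intro mult_left_mono hausdorff_pre_le_outer that) auto
    finally show ?thesis .
  qed
  obtain h where h: "hausdorff_outer s E = ennreal h" "0 \<le> h" using fin by (cases "hausdorff_outer s E") auto
  have "hausdorff_pre t \<delta> E = 0" if "0 < \<delta>" for \<delta>
  proof -
    have "((\<lambda>\<eta>::real. \<eta> powr (t - s)) \<longlongrightarrow> 0 powr (t - s)) (at_right 0)"
      by (rule tendsto_powr'[OF tendsto_ident_at tendsto_const])
        (use assms in \<open>auto simp: eventually_at_filter\<close>)
    then have "((\<lambda>\<eta>. ennreal (C * \<eta> powr (t - s) * h)) \<longlongrightarrow> ennreal (C * 0 * h)) (at_right 0)"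
      by (intro tendsto_ennrealI tendsto_mult tendsto_const) simp
    moreover have "\<forall>\<^sub>F \<eta> in at_right 0. hausdorff_pre t \<delta> E \<le> ennreal (C * \<eta> powr (t - s) * h)"
      using eventually_at_right_real[OF \<open>0 < \<delta>\<close>]
    proof eventually_elim
      case (elim \<eta>)
      then show ?case
        using order_trans[OF hausdorff_pre_antimono[of \<eta> \<delta> t E] pre[of \<eta>]] h \<open>C \<ge> 0\<close>
        by (simp add: ennreal_mult')
    qed
    ultimately have "hausdorff_pre t \<delta> E \<le> ennreal (C * 0 * h)"
      by (intro tendsto_lowerbound[where F = "at_right (0::real)"]) auto
    then show ?thesis by simp
  qed
  then show ?thesis unfolding hausdorff_outer_def by (intro antisym SUP_least) auto
qed

section \<open>Hausdorff measure and Lebesgue measure\<close>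

text \<open>Cells of a cubic grid in the directions \<open>B\<close> cover \<open>E\<close>, and the
  hypothesis on distances lets these coordinates control the diameter of a cell. With
  \<open>B\<close> an orthonormal basis this bounds sets of full dimension; with one vector removed
  it bounds nearly flat hypersurfaces.\<close>

lemma hausdorff_outer_grid:
  fixes E :: "'a::euclidean_space set"
  assumes B: "finite B" and "0 < \<kappa>" "0 < \<rho>"
    and dist: "\<And>x y. x \<in> E \<Longrightarrow> y \<in> E \<Longrightarrow> dist x y \<le> \<kappa> * (\<Sum>b\<in>B. \<bar>(x - y) \<bullet> b\<bar>)"
    and E: "\<And>x b. x \<in> E \<Longrightarrow> b \<in> B \<Longrightarrow> \<bar>(x - z) \<bullet> b\<bar> \<le> \<rho>"
  shows "hausdorff_outer (real (card B)) E
    \<le> ennreal (unit_ball_vol (real (card B)) * (2 * \<kappa> * real (card B) * \<rho>) ^ card B)"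
proof -
  define m where "m = card B"
  let ?C = "unit_ball_vol (real m) * (2 * \<kappa> * real m * \<rho>) ^ m"
  have pre: "hausdorff_pre (real m) (\<kappa> * real m * (2 * \<rho> / real N)) E \<le> ennreal ?C" if N: "0 < N" for N
  proof -
    define \<delta> where "\<delta> = \<kappa> * real m * (2 * \<rho> / real N)"
    have "0 \<le> \<delta>" using \<open>0 < \<kappa>\<close> \<open>0 < \<rho>\<close> by (simp add: \<delta>_def)
    define cell where "cell x = restrict (\<lambda>b. nat \<lfloor>((x - z) \<bullet> b + \<rho>) * real N / (2 * \<rho>)\<rfloor>) B" for x
    define U where "U i = {x \<in> E. cell x = i}" for i
    \<comment> \<open>The index N occurs at the upper end of the range, which makes N + 1 values per
      direction; the bound (N + 1)/N \<le> 2 accounts for the factor 2 inside the power.\<close>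
    define I where "I = (B \<rightarrow>\<^sub>E {..N})"
    have "cell x \<in> I" if "x \<in> E" for x
    proof -
      have "nat \<lfloor>((x - z) \<bullet> b + \<rho>) * real N / (2 * \<rho>)\<rfloor> \<le> N" if "b \<in> B" for b
      proof -
        have "((x - z) \<bullet> b + \<rho>) * real N \<le> (2 * \<rho>) * real N"
          using E[OF \<open>x \<in> E\<close> that] by (intro mult_right_mono) (auto simp: abs_le_iff)
        then have "((x - z) \<bullet> b + \<rho>) * real N / (2 * \<rho>) \<le> real N" using \<open>0 < \<rho>\<close> by (simp add: divide_le_eq ac_simps)
        then show ?thesis by linarith
      qed
      then show ?thesis by (simp add: I_def cell_def)
    qed
    then have cover: "E \<subseteq> (\<Union>i\<in>I. U i)" by (auto simp: U_def)
    have d: "dist x y \<le> \<delta>" if "x \<in> U i" "y \<in> U i" for x y i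
    proof -
      have xy: "x \<in> E" "y \<in> E" "cell x = cell y" using that by (auto simp: U_def)
      have "\<bar>(x - y) \<bullet> b\<bar> \<le> 2 * \<rho> / real N" if "b \<in> B" for b
      proof -
        let ?u = "((x - z) \<bullet> b + \<rho>) * real N / (2 * \<rho>)" and ?v = "((y - z) \<bullet> b + \<rho>) * real N / (2 * \<rho>)"
        have "0 \<le> (x - z) \<bullet> b + \<rho>" "0 \<le> (y - z) \<bullet> b + \<rho>"
          using E[OF xy(1) that] E[OF xy(2) that] by linarith+
        then have "0 \<le> ?u" "0 \<le> ?v" using \<open>0 < \<rho>\<close> by simp_all
        then have "0 \<le> \<lfloor>?u\<rfloor>" "0 \<le> \<lfloor>?v\<rfloor>" by (simp_all only: zero_le_floor)
        moreover have "cell x b = cell y b" using xy(3) by simp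
        then have "nat \<lfloor>?u\<rfloor> = nat \<lfloor>?v\<rfloor>" by (simp only: cell_def restrict_apply'[OF that])
        ultimately have "\<lfloor>?u\<rfloor> = \<lfloor>?v\<rfloor>" by (simp only: eq_nat_nat_iff)
        then have "\<bar>?u - ?v\<bar> \<le> 1" by linarith
        moreover have "?u - ?v = (x - y) \<bullet> b * (real N / (2 * \<rho>))"
        proof -
          have "?u - ?v = (((x - z) \<bullet> b + \<rho>) - ((y - z) \<bullet> b + \<rho>)) * (real N / (2 * \<rho>))"
            unfolding left_diff_distrib by simp
          moreover have "((x - z) \<bullet> b + \<rho>) - ((y - z) \<bullet> b + \<rho>) = (x - y) \<bullet> b" by (simp add: inner_diff_left)
          ultimately show ?thesis by simp
        qed
        ultimately have "\<bar>(x - y) \<bullet> b\<bar> * (real N / (2 * \<rho>)) \<le> 1" using \<open>0 < \<rho>\<close> by (simp add: abs_mult)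
        then show ?thesis using \<open>0 < \<rho>\<close> N by (simp add: field_simps)
      qed
      then have "(\<Sum>b\<in>B. \<bar>(x - y) \<bullet> b\<bar>) \<le> real m * (2 * \<rho> / real N)"
        unfolding m_def by (intro sum_bounded_above)
      then have "\<kappa> * (\<Sum>b\<in>B. \<bar>(x - y) \<bullet> b\<bar>) \<le> \<kappa> * (real m * (2 * \<rho> / real N))"
        using \<open>0 < \<kappa>\<close> by (intro mult_left_mono) auto
      then show ?thesis using dist[OF xy(1,2)] by (simp add: \<delta>_def mult.assoc)
    qed
    then have bd: "bounded (U i)" "diameter (U i) \<le> \<delta>" for i
      unfolding bounded_two_points
      by blast (use d \<open>0 \<le> \<delta>\<close> in \<open>auto intro!: diameter_le simp: dist_norm\<close>)
    have w: "hausdorff_weight (real m) (U i) \<le> ennreal (unit_ball_vol (real m) * (\<delta> / 2) ^ m)" for i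
    proof (cases "U i = {}")
      case False
      have "(if real m = 0 then 1 else (diameter (U i) / 2) powr real m) \<le> (\<delta> / 2) ^ m"
      proof (cases "m = 0")
        case False
        then have "\<delta> > 0" using \<open>0 < \<kappa>\<close> \<open>0 < \<rho>\<close> N by (simp add: \<delta>_def)
        have "(diameter (U i) / 2) powr real m \<le> (\<delta> / 2) powr real m"
          using bd[of i] diameter_ge_0[OF bd(1)] by (intro powr_mono2) auto
        then show ?thesis using False \<open>\<delta> > 0\<close> by (simp add: powr_realpow)
      qed simp
      then show ?thesis
        using False unit_ball_vol_nonneg[of "real m"]
        by (auto simp: hausdorff_weight_def intro!: ennreal_leI mult_left_mono)
    qed (simp add: hausdorff_weight_def)
    have "finite I" unfolding I_def using B by (intro finite_PiE) auto
    have "hausdorff_pre (real m) \<delta> E \<le> (\<Sum>i\<in>I. hausdorff_weight (real m) (U i))"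
      by (rule hausdorff_pre_finite_cover[OF \<open>finite I\<close> cover _ \<open>0 \<le> \<delta>\<close>]) (use bd in auto)
    also have "\<dots> \<le> of_nat (card I) * ennreal (unit_ball_vol (real m) * (\<delta> / 2) ^ m)"
      by (rule sum_bounded_above) (rule w)
    also have "card I = (N + 1) ^ m" unfolding I_def m_def using B by (simp add: card_PiE)
    also have "of_nat ((N + 1) ^ m) * ennreal (unit_ball_vol (real m) * (\<delta> / 2) ^ m) =
      ennreal ((real N + 1) ^ m * (unit_ball_vol (real m) * (\<delta> / 2) ^ m))"
      using \<open>0 \<le> \<delta>\<close> by (subst ennreal_mult) (auto simp: ennreal_of_nat_eq_real_of_nat add.commute)
    also have "\<dots> \<le> ennreal ?C"
    proof (rule ennreal_leI)
      have "(real N + 1) * (\<delta> / 2) \<le> 2 * \<kappa> * real m * \<rho>"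
      proof -
        have "(real N + 1) * (\<delta> / 2) = (\<kappa> * real m * \<rho>) * ((real N + 1) / real N)" by (simp add: \<delta>_def)
        also have "\<dots> \<le> (\<kappa> * real m * \<rho>) * 2"
          using N \<open>0 < \<kappa>\<close> \<open>0 < \<rho>\<close> by (intro mult_left_mono) (auto simp: field_simps)
        finally show ?thesis by simp
      qed
      then have "((real N + 1) * (\<delta> / 2)) ^ m \<le> (2 * \<kappa> * real m * \<rho>) ^ m"
        using \<open>0 \<le> \<delta>\<close> by (intro power_mono) auto
      then have "unit_ball_vol (real m) * ((real N + 1) * (\<delta> / 2)) ^ m \<le> ?C"
        by (intro mult_left_mono) auto
      then show "(real N + 1) ^ m * (unit_ball_vol (real m) * (\<delta> / 2) ^ m) \<le> ?C"
        unfolding power_mult_distrib[of "real N + 1" "\<delta> / 2"] by (simp only: mult.left_commute)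
    qed
    finally show ?thesis by (simp add: \<delta>_def)
  qed
  have "hausdorff_outer (real m) E \<le> ennreal ?C"
    unfolding hausdorff_outer_def
  proof (rule SUP_least)
    fix \<delta> :: real assume "\<delta> \<in> {0<..}"
    then obtain N where N: "\<kappa> * real m * (2 * \<rho>) / \<delta> < real N" "0 < N"
      using reals_Archimedean2[of "max 0 (\<kappa> * real m * (2 * \<rho>) / \<delta>)"] by auto
    then have "\<kappa> * real m * (2 * \<rho> / real N) \<le> \<delta>"
      using \<open>\<delta> \<in> {0<..}\<close> by (simp add: field_simps)
    then show "hausdorff_pre (real m) \<delta> E \<le> ennreal ?C"
      using hausdorff_pre_antimono pre[OF N(2)] order_trans by blast
  qed
  then show ?thesis by (simp add: m_def)
qed

lemma hausdorff_outer_DIM_finite: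
  fixes E :: "'a::euclidean_space set"
  assumes "bounded E"
  shows "hausdorff_outer (real DIM('a)) E < top"
proof -
  obtain \<rho> where \<rho>: "0 < \<rho>" "\<And>x. x \<in> E \<Longrightarrow> norm x \<le> \<rho>" using assms by (auto simp: bounded_pos)
  have "hausdorff_outer (real DIM('a)) E
     \<le> ennreal (unit_ball_vol (real DIM('a)) * (2 * 1 * real DIM('a) * \<rho>) ^ DIM('a))"
    by (rule hausdorff_outer_grid[where z = 0])
      (use \<rho> in \<open>auto simp: dist_norm norm_le_l1 intro: order_trans[OF Basis_le_norm]\<close>)
  then show ?thesis by (rule le_less_trans) simp
qed

text \<open>The Hausdorff measure is translation invariant and, by the grid estimate, finite on
  bounded sets, hence a multiple of Lebesgue measure. The multiple enters the Steiner coefficients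
  as a common factor.\<close>

lemma hausdorff_DIM_eq_lborel:
  obtains c where "0 \<le> c" "\<And>A :: 'a::euclidean_space set. A \<in> sets borel \<Longrightarrow>
      emeasure (hausdorff_measure (real DIM('a))) A = ennreal c * emeasure lborel A"
proof -
  let ?H = "hausdorff_measure (real DIM('a)) :: 'a measure"
  define M where "M = distr ?H borel (\<lambda>x. x)"
  have id: "(\<lambda>x. x) \<in> measurable ?H borel"
    by (rule measurableI) (auto simp: borel_subset_sets_hausdorff)
  have M: "emeasure M A = hausdorff_outer (real DIM('a)) A" if "A \<in> sets borel" for A
    using that id by (simp add: M_def emeasure_distr emeasure_hausdorff_measure borel_subset_sets_hausdorff)
  have sM: "sets M = sets borel" by (simp add: M_def)
  have tr: "similarity 1 ((+) c)" for c :: 'a by (simp add: similarity_def surj_plus)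
  have "distr M borel ((+) c) = M" for c
  proof (rule measure_eqI)
    fix A assume "A \<in> sets (distr M borel ((+) c))"
    then have A: "A \<in> sets borel" by simp
    have m: "(+) c \<in> borel_measurable M" by (subst measurable_cong_sets[OF sM refl]) measurable
    have v: "(+) c -` A = (+) (- c) ` A" by (auto intro!: image_eqI[of _ _ "c + _"])
    have h: "hausdorff_outer (real DIM('a)) ((+) c -` A) = hausdorff_outer (real DIM('a)) A"
      unfolding v by (subst hausdorff_outer_similarity_image[OF tr]) auto
    have "(+) c -` A \<in> sets borel" using measurable_sets[of "(+) c" borel borel A] A by simp
    then show "emeasure (distr M borel ((+) c)) A = emeasure M A"
      using A m by (simp add: emeasure_distr M sets_eq_imp_space_eq[OF sM] h del: vimage_eq)
  qed (simp add: sM)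
  moreover have "emeasure M A < \<infinity>" if "bounded A" "A \<in> sets borel" for A
    using hausdorff_outer_DIM_finite[OF that(1)] M[OF that(2)] by simp
  ultimately have eq: "emeasure M A = emeasure M (box 0 One) * emeasure lborel A" if "A \<in> sets borel" for A
    using translation_invariant_measure_eq[OF sM _ _ that] by blast
  have "emeasure M (box 0 One) < top" using hausdorff_outer_DIM_finite[OF bounded_box] M[of "box 0 One"] by simp
  then have c: "emeasure M (box 0 One) = ennreal (measure M (box 0 One))"
    by (intro emeasure_eq_ennreal_measure) auto
  show ?thesis
  proof (rule that[of "measure M (box 0 One)"])
    fix A :: "'a set" assume A: "A \<in> sets borel"
    then show "emeasure ?H A = ennreal (measure M (box 0 One)) * emeasure lborel A"
      using eq[OF A] c M[OF A] by (simp add: emeasure_hausdorff_measure borel_subset_sets_hausdorff)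
  qed simp
qed

text \<open>The pushforward of Lebesgue measure under the inverse is translation invariant because
  \<open>f\<close> is affine, hence a multiple of Lebesgue measure; the factor is read off the unit
  ball, whose image is a ball of radius \<rho>.\<close>

lemma emeasure_lborel_similarity_image:
  fixes f :: "'a::euclidean_space \<Rightarrow> 'a"
  assumes f: "similarity \<rho> f" and A: "A \<in> sets borel"
    and aff: "\<And>x y. f (x + y) = f x + f y - f 0"
  shows "emeasure lborel (f ` A) = ennreal (\<rho> ^ DIM('a)) * emeasure lborel A"
proof -
  note f' = similarityD[OF f]
  have i[measurable]: "inv f \<in> borel_measurable borel" by (rule similarity_measurable[OF similarity_inv[OF f]])
  define M where "M = distr lborel borel (inv f)"
  have sM: "sets M = sets borel" by (simp add: M_def)
  have M: "emeasure M X = emeasure lborel (f ` X)" if "X \<in> sets borel" for X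
    using that by (simp add: M_def emeasure_distr similarity_image_eq_vimage[OF f])
  have "distr M borel ((+) c) = M" for c
  proof (rule measure_eqI)
    fix X assume "X \<in> sets (distr M borel ((+) c))"
    then have X: "X \<in> sets borel" by simp
    have m: "(+) c \<in> borel_measurable M" by (subst measurable_cong_sets[OF sM refl]) measurable
    have v: "(+) c -` X \<in> sets borel" using measurable_sets[of "(+) c" borel borel X] X by simp
    have "f ` X = (+) (f c - f 0) ` (f ` ((+) c -` X))"
    proof (intro equalityI subsetI)
      fix y assume "y \<in> f ` X"
      then obtain x where "x \<in> X" "y = f x" by auto
      moreover have "f x = f c - f 0 + f (x - c)" using aff[of c "x - c"] by simp
      ultimately show "y \<in> (+) (f c - f 0) ` (f ` ((+) c -` X))" by (auto intro!: imageI)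
    next
      fix y assume "y \<in> (+) (f c - f 0) ` (f ` ((+) c -` X))"
      then obtain x where "c + x \<in> X" "y = f c - f 0 + f x" by auto
      moreover have "f (c + x) = f c - f 0 + f x" using aff[of c x] by simp
      ultimately show "y \<in> f ` X" by (metis imageI)
    qed
    then have "emeasure lborel (f ` X) = emeasure lborel (f ` ((+) c -` X))"
      using similarity_image_borel[OF f X]
      by (subst lborel_distr_plus[of "f c - f 0", symmetric]) (simp add: emeasure_distr inj_vimage_image_eq)
    then show "emeasure (distr M borel ((+) c)) X = emeasure M X"
      using X m v by (simp add: emeasure_distr M sets_eq_imp_space_eq[OF sM])
  qed (simp add: sM)
  moreover have bd: "bounded (f ` X)" if bX: "bounded X" for X
  proof -
    obtain e where e: "\<And>x. x \<in> X \<Longrightarrow> norm x \<le> e"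
      using bX unfolding bounded_iff by metis
    show ?thesis
      unfolding bounded_def by (rule exI[of _ "f 0"], rule exI[of _ "\<rho> * e"]) (use e f'(1,2) in auto)
  qed
  then have "emeasure M X < \<infinity>" if "bounded X" "X \<in> sets borel" for X
    using that emeasure_bounded_finite[OF bd] M by auto
  ultimately have eq: "emeasure M X = emeasure M (box 0 One) * emeasure lborel X" if "X \<in> sets borel" for X
    using translation_invariant_measure_eq[OF sM _ _ that] by blast
  have "f ` cball 0 1 = cball (f 0) \<rho>"
  proof (intro equalityI subsetI)
    fix y assume "y \<in> cball (f 0) \<rho>"
    moreover obtain x where "y = f x" using f'(5) by blast
    ultimately show "y \<in> f ` cball 0 1" using f'(1) f'(2)[of 0 x] by auto
  qed (use f'(1,2) in auto)
  moreover have "cball (f 0) \<rho> = (\<lambda>x. \<rho> *\<^sub>R x + f 0) ` cball 0 1"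
  proof (intro equalityI subsetI)
    fix y assume "y \<in> cball (f 0) \<rho>"
    then have "(1 / \<rho>) *\<^sub>R (y - f 0) \<in> cball 0 1" "y = \<rho> *\<^sub>R ((1 / \<rho>) *\<^sub>R (y - f 0)) + f 0"
      using f'(1) by (auto simp: dist_norm norm_minus_commute)
    then show "y \<in> (\<lambda>x. \<rho> *\<^sub>R x + f 0) ` cball 0 1" by blast
  next
    fix y assume "y \<in> (\<lambda>x. \<rho> *\<^sub>R x + f 0) ` cball 0 1"
    then show "y \<in> cball (f 0) \<rho>"
      using f'(1) by (auto simp: dist_norm mult_left_le)
  qed
  moreover have "emeasure lebesgue (cball (f 0) \<rho>) = emeasure lborel (cball (f 0) \<rho>)" by simp
  ultimately have "emeasure M (cball 0 1) = ennreal (\<rho> ^ DIM('a)) * emeasure lborel (cball (0::'a) 1)"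
    using emeasure_lebesgue_affine[of \<rho> "f 0" "cball 0 1"] f'(1) M[of "cball 0 1"] by simp
  moreover have "emeasure M (cball 0 1) = emeasure M (box 0 One) * emeasure lborel (cball (0::'a) 1)" by (rule eq) simp
  moreover have "unit_ball_vol (real DIM('a)) \<noteq> 0"
    using unit_ball_vol_pos[of "real DIM('a)"] by (metis less_irrefl of_nat_0_le_iff)
  then have "emeasure lborel (cball (0::'a) 1) \<noteq> 0" "emeasure lborel (cball (0::'a) 1) \<noteq> top"
    using emeasure_bounded_finite[OF bounded_cball[of "0::'a" 1]]
    by (auto simp: emeasure_cball)
  ultimately have "emeasure M (box 0 One) = ennreal (\<rho> ^ DIM('a))"
    using ennreal_mult_cancel_left[of "emeasure lborel (cball (0::'a) 1)" "emeasure M (box 0 One)" "ennreal (\<rho> ^ DIM('a))"]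
    by (simp add: mult.commute)
  then show ?thesis using eq[OF A] M[OF A] by simp
qed

section \<open>Self-similar sets\<close>

lemma hausdorff_pre_UN_finite:
  assumes "finite I" "0 < \<delta>"
  shows "hausdorff_pre s \<delta> (\<Union>i\<in>I. A i) \<le> (\<Sum>i\<in>I. hausdorff_pre s \<delta> (A i :: 'a::metric_space set))"
  using assms(1)
proof (induction I rule: finite_induct)
  case (insert i I)
  then show ?case
    using hausdorff_pre_Un[OF assms(2), of s "A i" "\<Union>i\<in>I. A i"] by (simp add: add_left_mono order_trans)
qed (simp add: hausdorff_pre_empty assms(2))

locale iterated_function_system =
  fixes N :: nat and S :: "nat \<Rightarrow> 'a::euclidean_space \<Rightarrow> 'a" and r :: "nat \<Rightarrow> real" and F :: "'a set"
  assumes N2: "2 \<le> N"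
    and contr: "\<And>j. j \<in> {1..N} \<Longrightarrow> contracting_similarity (r j) (S j)"
    and self: "self_similar_set N S F"
begin

definition rmax :: real where "rmax = Max (r ` {1..N})"
definition rmin :: real where "rmin = Min (r ` {1..N})"

lemma r01: "j \<in> {1..N} \<Longrightarrow> 0 < r j" "j \<in> {1..N} \<Longrightarrow> r j < 1"
  using contr by (auto simp: contracting_similarity_def)

lemma sim: "j \<in> {1..N} \<Longrightarrow> similarity (r j) (S j)"
  by (rule similarity_if_contracting[OF contr])

lemma rmax: "0 < rmax" "rmax < 1" "\<And>j. j \<in> {1..N} \<Longrightarrow> r j \<le> rmax"
proof -
  have "rmax \<in> r ` {1..N}" unfolding rmax_def using N2 by (intro Max_in) auto
  then show "0 < rmax" "rmax < 1" using r01 by auto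
  show "r j \<le> rmax" if "j \<in> {1..N}" for j unfolding rmax_def using that by (intro Max_ge) auto
qed

lemma rmin: "0 < rmin" "rmin < 1" "\<And>j. j \<in> {1..N} \<Longrightarrow> rmin \<le> r j"
proof -
  have "rmin \<in> r ` {1..N}" unfolding rmin_def using N2 by (intro Min_in) auto
  then show "0 < rmin" "rmin < 1" using r01 by auto
  show "rmin \<le> r j" if "j \<in> {1..N}" for j unfolding rmin_def using that by (intro Min_le) auto
qed

lemma F_compact: "compact F" and F_nonempty: "F \<noteq> {}" and F_eq: "F = (\<Union>j\<in>{1..N}. S j ` F)"
  using self by (auto simp: self_similar_set_def)

lemma S_F_subset: "j \<in> {1..N} \<Longrightarrow> S j ` F \<subseteq> F"
  using F_eq by blast

lemma rmax_power_less:
  assumes "0 < e"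
  obtains n where "rmax ^ n * c \<le> e"
proof -
  have "(\<lambda>n. rmax ^ n * c) \<longlonglongrightarrow> 0 * c"
    by (intro tendsto_mult LIMSEQ_power_zero tendsto_const) (use rmax in auto)
  then have "\<forall>\<^sub>F n in sequentially. rmax ^ n * c < e" using assms by (intro order_tendstoD) auto
  then show ?thesis using that by (auto simp: eventually_sequentially intro: less_imp_le)
qed

text \<open>The similarity dimension, a solution of Moran's equation whose existence comes from the
  intermediate value theorem; \<open>hausdorff_dim_F\<close> identifies it with the Hausdorff
  dimension.\<close>

definition sim_dim :: real where
  "sim_dim = (SOME s. 0 < s \<and> (\<Sum>j=1..N. r j powr s) = 1)"

lemma sim_dim: "0 < sim_dim" "(\<Sum>j=1..N. r j powr sim_dim) = 1"
proof -
  define g where "g s = (\<Sum>j=1..N. r j powr s)" for s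
  have g0: "1 < g 0"
  proof -
    have "r j powr 0 = 1" if "j \<in> {1..N}" for j using r01(1)[OF that] by simp
    then have "g 0 = (\<Sum>j=1..N. 1)" unfolding g_def by (intro sum.cong) auto
    then show ?thesis using N2 by simp
  qed
  obtain n where n: "rmax ^ n * real N \<le> 1" using rmax_power_less[of 1 "real N"] by auto
  have "g (real n) \<le> (\<Sum>j=1..N. rmax ^ n)"
    unfolding g_def using rmax r01
    by (intro sum_mono) (auto simp: powr_realpow intro: power_mono less_imp_le)
  then have gn: "g (real n) \<le> 1" using n by (simp add: mult.commute)
  have "continuous_on {0..real n} g"
    unfolding g_def using r01 by (intro continuous_intros) force+
  then obtain s where s: "0 \<le> s" "s \<le> real n" "g s = 1"
    using IVT2'[of g "real n" 1 0] g0 gn by auto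
  moreover have "s \<noteq> 0" using s g0 by auto
  ultimately have "0 < s \<and> (\<Sum>j=1..N. r j powr s) = 1" by (auto simp: g_def)
  then have "0 < sim_dim \<and> (\<Sum>j=1..N. r j powr sim_dim) = 1" unfolding sim_dim_def by (rule someI)
  then show "0 < sim_dim" "(\<Sum>j=1..N. r j powr sim_dim) = 1" by auto
qed

text \<open>Applying all N maps to a cover multiplies its total weight by the sum of the r_j^s,
  which is 1, and its mesh by at most \<open>rmax\<close>. Starting from \<open>F\<close> as the
  only covering set, arbitrarily fine covers keep the weight of \<open>F\<close>.\<close>

lemma hausdorff_outer_F_finite: "hausdorff_outer sim_dim F < top"
proof -
  have step: "hausdorff_pre sim_dim (rmax * \<delta>) F \<le> hausdorff_pre sim_dim \<delta> F" if "0 < \<delta>" for \<delta>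
  proof -
    have "hausdorff_pre sim_dim (rmax * \<delta>) F = hausdorff_pre sim_dim (rmax * \<delta>) (\<Union>j\<in>{1..N}. S j ` F)"
      by (rule arg_cong[OF F_eq])
    also have "\<dots>
        \<le> (\<Sum>j\<in>{1..N}. hausdorff_pre sim_dim (rmax * \<delta>) (S j ` F))"
      using rmax that by (intro hausdorff_pre_UN_finite) auto
    also have "\<dots> \<le> (\<Sum>j\<in>{1..N}. ennreal (r j powr sim_dim) * hausdorff_pre sim_dim \<delta> F)"
    proof (rule sum_mono)
      fix j assume j: "j \<in> {1..N}"
      have "hausdorff_pre sim_dim (rmax * \<delta>) (S j ` F) \<le> hausdorff_pre sim_dim (r j * \<delta>) (S j ` F)"
        using rmax(3)[OF j] that by (intro hausdorff_pre_antimono mult_right_mono) auto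
      also have "\<dots> \<le> ennreal (r j powr sim_dim) * hausdorff_pre sim_dim \<delta> F"
        using sim_dim r01[OF j] similarityD(2)[OF sim[OF j]] by (intro hausdorff_outer_lipschitz_image) auto
      finally show "hausdorff_pre sim_dim (rmax * \<delta>) (S j ` F) \<le> ennreal (r j powr sim_dim) * hausdorff_pre sim_dim \<delta> F" .
    qed
    also have "\<dots> = ennreal (\<Sum>j\<in>{1..N}. r j powr sim_dim) * hausdorff_pre sim_dim \<delta> F"
      unfolding sum_distrib_right[symmetric] by (subst sum_ennreal) auto
    also have "\<dots> = hausdorff_pre sim_dim \<delta> F" using sim_dim(2) by simp
    finally show ?thesis .
  qed
  define \<delta>0 where "\<delta>0 = diameter F + 1"
  have \<delta>0: "0 < \<delta>0" using diameter_ge_0[OF compact_imp_bounded[OF F_compact]] by (simp add: \<delta>0_def)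
  have "hausdorff_pre sim_dim (rmax ^ n * \<delta>0) F \<le> hausdorff_pre sim_dim \<delta>0 F" for n
  proof (induction n)
    case (Suc n)
    have "hausdorff_pre sim_dim (rmax * (rmax ^ n * \<delta>0)) F \<le> hausdorff_pre sim_dim (rmax ^ n * \<delta>0) F"
      using rmax \<delta>0 by (intro step) auto
    with Suc show ?case by (simp add: mult.assoc)
  qed simp
  moreover have "hausdorff_pre sim_dim \<delta>0 F \<le> hausdorff_weight sim_dim F"
    using hausdorff_pre_finite_cover[of "{()}" F "\<lambda>_. F" \<delta>0 sim_dim] compact_imp_bounded[OF F_compact] \<delta>0
    by (simp add: \<delta>0_def)
  ultimately have *: "hausdorff_pre sim_dim (rmax ^ n * \<delta>0) F \<le> hausdorff_weight sim_dim F" for n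
    using order_trans by blast
  have "hausdorff_outer sim_dim F \<le> hausdorff_weight sim_dim F"
    unfolding hausdorff_outer_def
  proof (rule SUP_least)
    fix \<delta> :: real assume "\<delta> \<in> {0<..}"
    then obtain n where "rmax ^ n * \<delta>0 \<le> \<delta>" using rmax_power_less[of \<delta> \<delta>0] by auto
    then show "hausdorff_pre sim_dim \<delta> F \<le> hausdorff_weight sim_dim F"
      using hausdorff_pre_antimono * order_trans by blast
  qed
  then show ?thesis by (rule le_less_trans) (simp add: hausdorff_weight_def)
qed

text \<open>The proportion of the level-\<open>n\<close> cylinders meeting \<open>U\<close>, weighted by the \<open>sim_dim\<close>-th powers of
  their ratios, in recursive form.\<close>

fun cylinder_weight :: "nat \<Rightarrow> 'a set \<Rightarrow> real" where
  "cylinder_weight 0 U = (if F \<inter> U = {} then 0 else 1)"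
| "cylinder_weight (Suc n) U = (\<Sum>j=1..N. r j powr sim_dim * cylinder_weight n (S j -` U))"

section \<open>Cylinder weights as a finite substitute for the self-similar measure\<close>

lemma cylinder_weight_nonneg: "0 \<le> cylinder_weight n U"
  by (induction n arbitrary: U) (auto intro!: sum_nonneg)

lemma cylinder_weight_le: "cylinder_weight n U \<le> (if F \<inter> U = {} then 0 else 1)"
proof (induction n arbitrary: U)
  case (Suc n)
  show ?case
  proof (cases "F \<inter> U = {}")
    case True
    then have "F \<inter> S j -` U = {}" if "j \<in> {1..N}" for j using S_F_subset[OF that] by auto
    then have "cylinder_weight n (S j -` U) = 0" if "j \<in> {1..N}" for j
      using Suc[of "S j -` U"] cylinder_weight_nonneg[of n "S j -` U"] that by auto
    then show ?thesis using True by simp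
  next
    case False
    have "cylinder_weight n V \<le> 1" for V using Suc[of V] by (auto split: if_splits)
    then have "cylinder_weight (Suc n) U \<le> (\<Sum>j=1..N. r j powr sim_dim * 1)"
      unfolding cylinder_weight.simps by (intro sum_mono mult_left_mono) auto
    then show ?thesis using False sim_dim(2) by simp
  qed
qed simp

lemma cylinder_weight_UN:
  assumes "finite I"
  shows "cylinder_weight n (\<Union>i\<in>I. U i) \<le> (\<Sum>i\<in>I. cylinder_weight n (U i))"
proof (induction n arbitrary: U)
  case 0
  show ?case
  proof (cases "F \<inter> (\<Union>i\<in>I. U i) = {}")
    case True
    then show ?thesis by (simp add: sum_nonneg)
  next
    case False
    then obtain i where i: "i \<in> I" "F \<inter> U i \<noteq> {}" by blast
    have "cylinder_weight 0 (U i) \<le> (\<Sum>i\<in>I. cylinder_weight 0 (U i))"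
      using assms i by (intro member_le_sum cylinder_weight_nonneg) auto
    then show ?thesis using i False by simp
  qed
next
  case (Suc n)
  have "cylinder_weight (Suc n) (\<Union>i\<in>I. U i) = (\<Sum>j=1..N. r j powr sim_dim * cylinder_weight n (\<Union>i\<in>I. S j -` U i))"
    by (simp add: vimage_UN)
  also have "\<dots> \<le> (\<Sum>j=1..N. r j powr sim_dim * (\<Sum>i\<in>I. cylinder_weight n (S j -` U i)))"
    by (intro sum_mono mult_left_mono Suc) auto
  also have "\<dots> = (\<Sum>i\<in>I. cylinder_weight (Suc n) (U i))"
    unfolding sum_distrib_left cylinder_weight.simps by (rule sum.swap)
  finally show ?case .
qed

lemma cylinder_weight_cover: "F \<subseteq> U \<Longrightarrow> cylinder_weight n U = 1"
proof (induction n arbitrary: U)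
  case 0
  then show ?case using F_nonempty by auto
next
  case (Suc n)
  have "cylinder_weight n (S j -` U) = 1" if "j \<in> {1..N}" for j
    using Suc.prems S_F_subset[OF that] by (intro Suc.IH) auto
  then show ?case using sim_dim(2) by simp
qed

end

locale iterated_function_system_osc = iterated_function_system N S r F
  for N :: nat and S :: "nat \<Rightarrow> 'a::euclidean_space \<Rightarrow> 'a" and r F +
  fixes J :: "'a set"
  assumes osc: "strong_open_set_condition N S F J"
begin

lemma J_compact: "compact J" and J_closure: "J = closure (interior J)"
  and S_J_subset: "j \<in> {1..N} \<Longrightarrow> S j ` J \<subseteq> J"
  and S_J_disjoint: "j \<in> {1..N} \<Longrightarrow> l \<in> {1..N} \<Longrightarrow> j \<noteq> l \<Longrightarrow> S j ` interior J \<inter> S l ` interior J = {}"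
  and F_int_J: "F \<inter> interior J \<noteq> {}"
  using osc unfolding strong_open_set_condition_def by blast+

text \<open>At a point of \<open>F\<close> farthest from \<open>J\<close> the distance is at most
  r_j times that of a preimage in \<open>F\<close>, hence at most r_j times itself.\<close>

lemma F_subset_J: "F \<subseteq> J"
proof -
  have J: "J \<noteq> {}" "closed J" using F_int_J J_compact by (auto simp: compact_imp_closed dest: interior_subset[THEN subsetD])
  have "continuous_on F (\<lambda>x. infdist x J)" by (intro continuous_intros)
  then obtain x where x: "x \<in> F" "\<And>y. y \<in> F \<Longrightarrow> infdist y J \<le> infdist x J"
    using continuous_attains_sup[OF F_compact F_nonempty] by blast
  obtain j y where jy: "j \<in> {1..N}" "y \<in> F" "x = S j y" using x(1) F_eq by blast
  have "infdist (S j y) J \<le> infdist (S j y) (S j ` J)"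
    using S_J_subset[OF jy(1)] J(1) by (intro infdist_mono) auto
  also have "\<dots> = r j * infdist y J" by (rule similarity_infdist[OF sim[OF jy(1)]])
  also have "\<dots> \<le> r j * infdist x J" using x(2)[OF jy(2)] r01[OF jy(1)] by (intro mult_left_mono) auto
  finally have "(1 - r j) * infdist x J \<le> 0" using jy(3) by (simp add: algebra_simps)
  then have "infdist x J \<le> 0" using r01[OF jy(1)] by (simp add: mult_le_0_iff)
  then have "infdist y J = 0" if "y \<in> F" for y using x(2)[OF that] infdist_nonneg[of y J] by linarith
  then show ?thesis using in_closed_iff_infdist_zero[OF J(2,1)] by blast
qed

lemma S_int_J_subset: "j \<in> {1..N} \<Longrightarrow> S j ` interior J \<subseteq> interior J"
  using S_J_subset[of j] interior_subset[of J] similarity_open[OF sim[of j] open_interior[of J]]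
  by (intro interior_maximal) auto

text \<open>The radius contains the diameter of \<open>J\<close>, so that a copy of the interior of
  \<open>J\<close> of ratio \<rho> whose part of \<open>F\<close> meets \<open>U\<close> is counted
  in full; the summand 1 makes the open ball of scale 1 around a point of \<open>J\<close> contain
  all of \<open>J\<close>.\<close>

definition near_volume :: "'a set \<Rightarrow> real \<Rightarrow> real" where
  "near_volume U \<rho> = measure lborel (interior J \<inter> (\<Union>u\<in>U. ball u (\<rho> * (diameter J + 1))))"

lemma bounded_int_J: "bounded (interior J)"
  using J_compact compact_imp_bounded bounded_interior by blast

lemma near_volume_sets: "interior J \<inter> (\<Union>u\<in>U. ball u e) \<in> sets borel"
  by (intro borel_open open_Int open_interior open_UN) auto

lemma near_volume_fmeasurable: "interior J \<inter> (\<Union>u\<in>U. ball u e) \<in> fmeasurable lborel"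
  using near_volume_sets[where U = U and e = e] bounded_subset[OF bounded_int_J, of "interior J \<inter> (\<Union>u\<in>U. ball u e)"]
  by (intro fmeasurableI) (auto intro: emeasure_bounded_finite[unfolded infinity_ennreal_def])

lemma S_affine: "j \<in> {1..N} \<Longrightarrow> S j (x + y) = S j x + S j y - S j 0"
proof -
  assume j: "j \<in> {1..N}"
  obtain g where g: "orthogonal_transformation g" "\<And>x. S j x = S j 0 + r j *\<^sub>R g x"
    using contracting_similarity_affine[OF contr[OF j]] by metis
  have "linear g" using g(1) by (rule orthogonal_transformation_linear)
  have "S j (x + y) = S j 0 + r j *\<^sub>R (g x + g y)" using g(2)[of "x + y"] by (simp add: linear_add[OF \<open>linear g\<close>])
  also have "\<dots> = (S j 0 + r j *\<^sub>R g x) + (S j 0 + r j *\<^sub>R g y) - S j 0" by (simp add: algebra_simps)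
  also have "\<dots> = S j x + S j y - S j 0" by (simp flip: g(2))
  finally show ?thesis .
qed

lemma measure_lborel_S_image:
  assumes "j \<in> {1..N}" "A \<in> sets borel"
  shows "measure lborel (S j ` A) = r j ^ DIM('a) * measure lborel A"
  using emeasure_lborel_similarity_image[OF sim[OF assms(1)] assms(2) S_affine[OF assms(1)]] r01[OF assms(1)]
  by (simp add: measure_def enn2real_mult)

text \<open>By the open set condition the images of the interior of \<open>J\<close> are disjoint
  subsets of it, and \<open>S j\<close> multiplies radii by r_j and volumes by r_j^d.\<close>

lemma near_volume_recursion:
  "(\<Sum>j=1..N. r j ^ DIM('a) * near_volume (S j -` U) (\<rho> / r j)) \<le> near_volume U \<rho>"
proof -
  let ?e = "diameter J + 1"
  define V where "V j = interior J \<inter> (\<Union>u\<in>S j -` U. ball u (\<rho> / r j * ?e))" for j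
  have Vb: "V j \<in> sets borel" for j unfolding V_def by (rule near_volume_sets)
  have sub: "S j ` V j \<subseteq> interior J \<inter> (\<Union>u\<in>U. ball u (\<rho> * ?e))" if j: "j \<in> {1..N}" for j
  proof
    fix y assume "y \<in> S j ` V j"
    then obtain x u where x: "y = S j x" "x \<in> interior J" "S j u \<in> U" "dist u x < \<rho> / r j * ?e" by (auto simp: V_def)
    then have "dist (S j u) y < \<rho> * ?e"
      using similarityD(2)[OF sim[OF j], of u x] r01[OF j] by (simp add: field_simps)
    then show "y \<in> interior J \<inter> (\<Union>u\<in>U. ball u (\<rho> * ?e))" using x S_int_J_subset[OF j] by auto
  qed
  have disj: "disjoint_family_on (\<lambda>j. S j ` V j) {1..N}"
    unfolding disjoint_family_on_def using S_J_disjoint by (fastforce simp: V_def)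
  have bor: "S j ` V j \<in> sets borel" if "j \<in> {1..N}" for j by (rule similarity_image_borel[OF sim[OF that] Vb])
  have fm: "S j ` V j \<in> fmeasurable lborel" if "j \<in> {1..N}" for j
    using near_volume_fmeasurable bor[OF that] sub[OF that] fmeasurableI2 by (metis sets_lborel)
  have "(\<Sum>j=1..N. r j ^ DIM('a) * near_volume (S j -` U) (\<rho> / r j)) = (\<Sum>j\<in>{1..N}. measure lborel (S j ` V j))"
    using measure_lborel_S_image Vb by (intro sum.cong) (auto simp: near_volume_def V_def)
  also have "\<dots> = measure lborel (\<Union>j\<in>{1..N}. S j ` V j)"
  proof -
    have "emeasure lborel (S j ` V j) \<noteq> \<infinity>" if "j \<in> {1..N}" for j
      using fm[OF that] by (auto simp: fmeasurable_def)
    then show ?thesis using disj bor by (intro measure_finite_Union[symmetric]) auto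
  qed
  also have "\<dots> \<le> measure lborel (interior J \<inter> (\<Union>u\<in>U. ball u (\<rho> * ?e)))"
  proof (rule measure_mono_fmeasurable[OF UN_least[OF sub] _ near_volume_fmeasurable])
    show "(\<Union>j\<in>{1..N}. S j ` V j) \<in> sets lborel" using bor by (intro sets.finite_UN) auto
  qed
  finally show ?thesis by (simp add: near_volume_def)
qed

text \<open>The recursion replaces \<rho> by \<rho>/r_j until the scale reaches [1, 1/rmin], where
  the whole interior of \<open>J\<close> is near any \<open>U\<close> that meets \<open>F\<close>.
  Along the way the weights r_j^s are matched with the volumes r_j^d through the factor \<rho>^(s -
  d). In effect, cylinders of size \<rho> near \<open>U\<close> are counted by the disjoint volumes
  they occupy.\<close>

lemma cylinder_weight_le_near_volume:
  obtains K where "0 < K" "\<And>n U \<rho>. rmax ^ n \<le> \<rho> \<Longrightarrow> \<rho> \<le> 1 / rmin \<Longrightarrow>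
    cylinder_weight n U \<le> K * \<rho> powr (sim_dim - DIM('a)) * near_volume U \<rho>"
proof -
  let ?p = "sim_dim - DIM('a)"
  define v where "v = measure lborel (interior J)"
  have "\<not> negligible (interior J)" using open_not_negligible[OF open_interior] F_int_J by blast
  then have "emeasure lborel (interior J) \<noteq> 0"
    by (auto simp: negligible_iff_null_sets null_sets_def)
  moreover have "emeasure lborel (interior J) < \<infinity>" by (rule emeasure_bounded_finite[OF bounded_int_J])
  ultimately have v: "0 < v" unfolding v_def by (simp add: emeasure_eq_ennreal_measure zero_less_measure_iff)
  \<comment> \<open>A positive lower bound for \<rho>^(s - d) on [1, 1/rmin], whatever the sign of
    the exponent.\<close>
  define c where "c = min 1 ((1 / rmin) powr ?p)"
  have c: "0 < c" using rmin by (simp add: c_def)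
  have c_le: "c \<le> \<rho> powr ?p" if "1 \<le> \<rho>" "\<rho> \<le> 1 / rmin" for \<rho>
  proof (cases "0 \<le> ?p")
    case True
    then have "1 powr ?p \<le> \<rho> powr ?p" using that by (intro powr_mono2) auto
    then show ?thesis by (simp add: c_def)
  next
    case False
    then have "(1 / rmin) powr ?p \<le> \<rho> powr ?p" using that by (intro powr_mono2') auto
    then show ?thesis by (simp add: c_def)
  qed
  define K where "K = 1 / (c * v)"
  have K: "0 < K" using c v by (simp add: K_def)
  have big: "cylinder_weight n U \<le> K * \<rho> powr ?p * near_volume U \<rho>" if \<rho>: "1 \<le> \<rho>" "\<rho> \<le> 1 / rmin" for n U \<rho>
  proof (cases "F \<inter> U = {}")
    case True
    then have "cylinder_weight n U \<le> 0" using cylinder_weight_le[of n U] by simp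
    also have "0 \<le> K * \<rho> powr ?p * near_volume U \<rho>" using K by (simp add: near_volume_def)
    finally show ?thesis .
  next
    case False
    then obtain u where u: "u \<in> F" "u \<in> U" by auto
    have "interior J \<subseteq> ball u (\<rho> * (diameter J + 1))"
    proof
      fix x assume "x \<in> interior J"
      then have "dist u x \<le> diameter J"
        using diameter_bounded_bound[OF compact_imp_bounded[OF J_compact]] u F_subset_J interior_subset by blast
      also have "\<dots> < 1 * (diameter J + 1)" by simp
      also have "\<dots> \<le> \<rho> * (diameter J + 1)"
        using \<rho> diameter_ge_0[OF compact_imp_bounded[OF J_compact]] by (intro mult_right_mono) auto
      finally show "x \<in> ball u (\<rho> * (diameter J + 1))" by simp
    qed
    then have "interior J \<inter> (\<Union>u\<in>U. ball u (\<rho> * (diameter J + 1))) = interior J" using u by auto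
    then have nv: "near_volume U \<rho> = v" by (simp add: near_volume_def v_def)
    have "1 = K * c * v" using c v by (simp add: K_def)
    also have "\<dots> \<le> K * \<rho> powr ?p * v" using K v c_le[OF \<rho>] by (intro mult_right_mono mult_left_mono) auto
    finally show ?thesis using nv cylinder_weight_le[of n U] False by simp
  qed
  have "cylinder_weight n U \<le> K * \<rho> powr ?p * near_volume U \<rho>" if "rmax ^ n \<le> \<rho>" "\<rho> \<le> 1 / rmin" for n U \<rho>
    using that
  proof (induction n arbitrary: U \<rho>)
    case 0
    show ?case by (rule big) (use 0 in auto)
  next
    case (Suc n)
    show ?case
    proof (cases "1 \<le> \<rho>")
      case False
      have "0 < \<rho>" using Suc.prems(1) rmax by (metis less_le_trans zero_less_power)
      have "cylinder_weight (Suc n) U \<le> (\<Sum>j=1..N. r j powr sim_dim * (K * (\<rho> / r j) powr ?p * near_volume (S j -` U) (\<rho> / r j)))"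
        unfolding cylinder_weight.simps
      proof (intro sum_mono mult_left_mono Suc.IH)
        fix j assume j: "j \<in> {1..N}"
        have "rmax ^ n * r j \<le> rmax ^ n * rmax" using rmax j by (intro mult_left_mono) auto
        also have "\<dots> \<le> \<rho>" using Suc.prems(1) by (simp add: mult.commute)
        finally show "rmax ^ n \<le> \<rho> / r j" using r01[OF j] by (simp add: field_simps)
        have "\<rho> / r j \<le> 1 / rmin" using False rmin(1,3) j r01[OF j] \<open>0 < \<rho>\<close> by (intro frac_le) auto
        then show "\<rho> / r j \<le> 1 / rmin" .
      qed simp
      also have "\<dots> = K * \<rho> powr ?p * (\<Sum>j=1..N. r j ^ DIM('a) * near_volume (S j -` U) (\<rho> / r j))"
        unfolding sum_distrib_left
      proof (intro sum.cong refl)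
        fix j assume j: "j \<in> {1..N}"
        have "r j powr sim_dim * (\<rho> / r j) powr ?p = \<rho> powr ?p * r j ^ DIM('a)"
          using r01[OF j] \<open>0 < \<rho>\<close> by (simp add: powr_divide powr_diff powr_realpow)
        then show "r j powr sim_dim * (K * (\<rho> / r j) powr ?p * near_volume (S j -` U) (\<rho> / r j)) =
            K * \<rho> powr ?p * (r j ^ DIM('a) * near_volume (S j -` U) (\<rho> / r j))"
          by (metis mult.assoc mult.left_commute)
      qed
      also have "\<dots> \<le> K * \<rho> powr ?p * near_volume U \<rho>"
        using K by (intro mult_left_mono near_volume_recursion) auto
      finally show ?thesis .
    qed (rule big[OF _ Suc.prems(2)])
  qed
  with K show ?thesis by (rule that)
qed

text \<open>For a nonempty set of diameter at most \<rho>, the volume counted near it lies in one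
  ball of radius \<rho> (diameter J + 2), which is a multiple of \<rho>^d in volume and cancels the
  \<rho>^(-d) of the previous estimate.\<close>

lemma cylinder_weight_bound:
  obtains C where "0 < C" "\<And>n U \<rho>. bounded U \<Longrightarrow> diameter U \<le> \<rho> \<Longrightarrow> 0 < \<rho> \<Longrightarrow> \<rho> \<le> 1 \<Longrightarrow> rmax ^ n \<le> \<rho> \<Longrightarrow>
    cylinder_weight n U \<le> C * \<rho> powr sim_dim"
proof -
  obtain K where K: "0 < K" "\<And>n U \<rho>. rmax ^ n \<le> \<rho> \<Longrightarrow> \<rho> \<le> 1 / rmin \<Longrightarrow>
    cylinder_weight n U \<le> K * \<rho> powr (sim_dim - DIM('a)) * near_volume U \<rho>"
    by (rule cylinder_weight_le_near_volume) blast
  define h where "h = diameter J + 2"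
  have h: "0 < h" using diameter_ge_0[OF compact_imp_bounded[OF J_compact]] by (simp add: h_def)
  define C where "C = K * (unit_ball_vol (real DIM('a)) * h ^ DIM('a))"
  have "0 < C" using K h by (simp add: C_def)
  moreover have "cylinder_weight n U \<le> C * \<rho> powr sim_dim"
    if U: "bounded U" "diameter U \<le> \<rho>" "0 < \<rho>" "\<rho> \<le> 1" "rmax ^ n \<le> \<rho>" for n U \<rho>
  proof (cases "U = {}")
    case True
    then show ?thesis using cylinder_weight_le[of n U] \<open>0 < C\<close> by (auto intro: order_trans)
  next
    case False
    then obtain u where u: "u \<in> U" by auto
    have "interior J \<inter> (\<Union>u\<in>U. ball u (\<rho> * (diameter J + 1))) \<subseteq> ball u (\<rho> * h)"
    proof clarify
      fix x y assume "y \<in> U" "x \<in> ball y (\<rho> * (diameter J + 1))"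
      moreover then have "dist u y \<le> \<rho>" using diameter_bounded_bound[OF U(1) u] U(2) by (auto intro: order_trans)
      ultimately have "dist u x < \<rho> + \<rho> * (diameter J + 1)" using dist_triangle[of u x y] by (simp add: dist_commute)
      then show "x \<in> ball u (\<rho> * h)" by (simp add: h_def algebra_simps)
    qed
    then have "near_volume U \<rho> \<le> measure lborel (ball u (\<rho> * h))"
      unfolding near_volume_def using near_volume_sets
      by (intro measure_mono_fmeasurable) (auto simp: fmeasurable_def intro: emeasure_bounded_finite[unfolded infinity_ennreal_def])
    also have "\<dots> = unit_ball_vol (real DIM('a)) * (\<rho> * h) ^ DIM('a)" using U h by (intro content_ball) simp
    finally have nv: "near_volume U \<rho> \<le> unit_ball_vol (real DIM('a)) * (\<rho> * h) ^ DIM('a)" .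
    have "1 \<le> 1 / rmin" using rmin by simp
    then have "cylinder_weight n U \<le> K * \<rho> powr (sim_dim - DIM('a)) * near_volume U \<rho>" using U by (intro K(2)) auto
    also have "\<dots> \<le> K * \<rho> powr (sim_dim - DIM('a)) * (unit_ball_vol (real DIM('a)) * (\<rho> * h) ^ DIM('a))"
      using K by (intro mult_left_mono nv) auto
    also have "\<dots> = C * \<rho> powr sim_dim"
      using U by (simp add: C_def powr_diff powr_realpow power_mult_distrib)
    finally show ?thesis .
  qed
  ultimately show ?thesis by (rule that)
qed

text \<open>The mass distribution principle, with the cylinder weights of one sufficiently deep
  level in place of a limit measure. A countable cover is enlarged slightly to an open one,
  compactness leaves a finite subcover, and the level is chosen finer than all enlargements in
  it.\<close>

lemma hausdorff_outer_F_pos: "0 < hausdorff_outer sim_dim F"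
proof -
  obtain C where C: "0 < C" "\<And>n U \<rho>. bounded U \<Longrightarrow> diameter U \<le> \<rho> \<Longrightarrow> 0 < \<rho> \<Longrightarrow> \<rho> \<le> 1 \<Longrightarrow> rmax ^ n \<le> \<rho> \<Longrightarrow>
    cylinder_weight n U \<le> C * \<rho> powr sim_dim" by (rule cylinder_weight_bound) blast
  define s where "s = sim_dim"
  have s: "0 < s" using sim_dim by (simp add: s_def)
  define C' where "C' = C * 2 powr s / unit_ball_vol s"
  have ub: "unit_ball_vol s > 0" using s by (intro unit_ball_vol_pos) simp
  have C': "0 < C'" using C ub by (simp add: C'_def)
  \<comment> \<open>Diameters at most 1/2 leave room for enlargements up to 1/2, since the bound for
    cylinder weights is available for \<rho> \<le> 1.\<close>
  have "1 \<le> ennreal C' * (\<Sum>i. hausdorff_weight s (U i))"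
    if U: "F \<subseteq> (\<Union>i. U i)" "\<forall>i. bounded (U i) \<and> diameter (U i) \<le> 1 / 2" for U :: "nat \<Rightarrow> 'a set"
  proof (rule ennreal_le_epsilon)
    fix \<eta> :: real assume "0 < \<eta>"
    define \<eta>' where "\<eta>' = \<eta> / C"
    have "0 < \<eta>'" using \<open>0 < \<eta>\<close> C by (simp add: \<eta>'_def)
    have d: "0 \<le> diameter (U i)" "diameter (U i) \<le> 1 / 2" "bounded (U i)" for i using U(2) diameter_ge_0 by auto
    have "\<exists>e>0. e \<le> 1 / 2 \<and> (diameter (U i) + e) powr s \<le> diameter (U i) powr s + \<eta>' * (1 / 2) ^ Suc i" for i
    proof -
      have "((\<lambda>e. (diameter (U i) + e) powr s) \<longlongrightarrow> (diameter (U i) + 0) powr s) (at_right 0)"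
        using s d(1)[of i]
        by (intro tendsto_powr' tendsto_add tendsto_const tendsto_ident_at) (auto simp: eventually_at_filter)
      then have "((\<lambda>e. (diameter (U i) + e) powr s) \<longlongrightarrow> diameter (U i) powr s) (at_right 0)" by simp
      moreover have "diameter (U i) powr s < diameter (U i) powr s + \<eta>' * (1 / 2) ^ Suc i" using \<open>0 < \<eta>'\<close> by simp
      ultimately have "\<forall>\<^sub>F e in at_right 0. (diameter (U i) + e) powr s < diameter (U i) powr s + \<eta>' * (1 / 2) ^ Suc i"
        by (rule order_tendstoD)
      moreover have "\<forall>\<^sub>F e in at_right 0. e \<in> {0<..<1/2::real}" by (rule eventually_at_right_real) simp
      ultimately have "\<forall>\<^sub>F e in at_right (0::real). 0 < e \<and> e \<le> 1 / 2 \<and> (diameter (U i) + e) powr s \<le> diameter (U i) powr s + \<eta>' * (1 / 2) ^ Suc i"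
        by eventually_elim auto
      then show ?thesis using eventually_happens' trivial_limit_at_right_real by blast
    qed
    then obtain e where e: "\<And>i. 0 < e i" "\<And>i. e i \<le> 1 / 2"
      "\<And>i. (diameter (U i) + e i) powr s \<le> diameter (U i) powr s + \<eta>' * (1 / 2) ^ Suc i" by metis
    define V where "V i = (\<Union>u\<in>U i. ball u (e i / 2))" for i
    have Vd: "dist x y \<le> diameter (U i) + e i" if xy: "x \<in> V i" "y \<in> V i" for x y i
    proof -
      obtain u w where uw: "u \<in> U i" "dist u x < e i / 2" "w \<in> U i" "dist w y < e i / 2" using xy by (auto simp: V_def)
      then have "dist u w \<le> diameter (U i)" using diameter_bounded_bound[OF d(3)] by auto
      moreover have "dist x y \<le> dist u x + (dist u w + dist w y)"
        using dist_triangle[of x y u] dist_triangle[of u y w] by (simp add: dist_commute)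
      ultimately show ?thesis using uw by linarith
    qed
    have Vb: "bounded (V i)" "diameter (V i) \<le> diameter (U i) + e i" for i
    proof -
      show "bounded (V i)" unfolding bounded_two_points using Vd by blast
      show "diameter (V i) \<le> diameter (U i) + e i"
        using Vd d(1)[of i] e(1)[of i] by (intro diameter_le) (auto simp: dist_norm)
    qed
    have "F \<subseteq> (\<Union>i. V i)"
    proof
      fix x assume "x \<in> F"
      then obtain i where "x \<in> U i" using U(1) by blast
      then show "x \<in> (\<Union>i. V i)" using e(1)[of i] by (auto simp: V_def intro!: exI[of _ i] bexI[of _ x])
    qed
    moreover have "open (V i)" for i unfolding V_def by (intro open_UN) auto
    ultimately obtain I where I: "finite I" "F \<subseteq> (\<Union>i\<in>I. V i)"
      using compactE_image[OF F_compact, of UNIV V] by metis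
    have "I \<noteq> {}" using I F_nonempty by auto
    obtain n where n: "rmax ^ n * 1 \<le> Min (e ` I)"
      by (rule rmax_power_less[of "Min (e ` I)" 1]) (use I \<open>I \<noteq> {}\<close> e(1) in auto)
    have cw: "cylinder_weight n (V i) \<le> C * (diameter (U i) + e i) powr s" if "i \<in> I" for i
    proof -
      have "Min (e ` I) \<le> e i" using I that by simp
      then have "rmax ^ n \<le> diameter (U i) + e i" using n d(1)[of i] by linarith
      then show ?thesis unfolding s_def using Vb d[of i] e(1,2)[of i] by (intro C(2)) auto
    qed
    \<comment> \<open>Empty covering sets get the value 0: their Hausdorff weight and their
      enlargement are both trivial.\<close>
    let ?g = "\<lambda>i. if U i = {} then 0 else C * (diameter (U i) powr s + \<eta>' * (1 / 2) ^ Suc i)"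
    have "1 = cylinder_weight n (\<Union>i\<in>I. V i)" using cylinder_weight_cover[OF I(2)] by simp
    also have "\<dots> \<le> (\<Sum>i\<in>I. cylinder_weight n (V i))" by (rule cylinder_weight_UN[OF I(1)])
    also have "\<dots> \<le> (\<Sum>i\<in>I. ?g i)"
    proof (rule sum_mono)
      fix i assume "i \<in> I"
      show "cylinder_weight n (V i) \<le> ?g i"
      proof (cases "U i = {}")
        case True
        then show ?thesis using cylinder_weight_le[of n "V i"] by (simp add: V_def)
      next
        case False
        have "C * (diameter (U i) + e i) powr s \<le> C * (diameter (U i) powr s + \<eta>' * (1 / 2) ^ Suc i)"
          using C e(3) by (intro mult_left_mono) auto
        then show ?thesis using False cw[OF \<open>i \<in> I\<close>] by simp
      qed
    qed
    finally have "ennreal 1 \<le> ennreal (\<Sum>i\<in>I. ?g i)" by (rule ennreal_leI)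
    also have "\<dots> = (\<Sum>i\<in>I. ennreal (?g i))" using C \<open>0 < \<eta>'\<close> by (intro sum_ennreal[symmetric]) auto
    also have "\<dots> \<le> (\<Sum>i\<in>I. ennreal C' * hausdorff_weight s (U i) + ennreal (C * \<eta>') * ennreal ((1 / 2) ^ Suc i))"
    proof (rule sum_mono)
      fix i
      have "C * diameter (U i) powr s = C' * (unit_ball_vol s * (diameter (U i) / 2) powr s)"
        using ub d(1)[of i] by (simp add: C'_def powr_divide)
      then show "ennreal (?g i) \<le> ennreal C' * hausdorff_weight s (U i) + ennreal (C * \<eta>') * ennreal ((1 / 2) ^ Suc i)"
      proof (cases "U i = {}")
        case False
        let ?w = "unit_ball_vol s * (diameter (U i) / 2) powr s"
        have "0 \<le> ?w" using ub by simp
        have "?g i = C' * ?w + (C * \<eta>') * (1 / 2) ^ Suc i"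
          using False \<open>C * diameter (U i) powr s = C' * ?w\<close> by (simp add: distrib_left)
        also have "ennreal \<dots> = ennreal (C' * ?w) + ennreal ((C * \<eta>') * (1 / 2) ^ Suc i)"
          using C C' \<open>0 < \<eta>'\<close> \<open>0 \<le> ?w\<close> by (intro ennreal_plus) auto
        also have "ennreal (C' * ?w) = ennreal C' * ennreal ?w" using C' \<open>0 \<le> ?w\<close> by (intro ennreal_mult) auto
        also have "ennreal ((C * \<eta>') * (1 / 2) ^ Suc i) = ennreal (C * \<eta>') * ennreal ((1 / 2) ^ Suc i)"
          using C \<open>0 < \<eta>'\<close> by (intro ennreal_mult) auto
        also have "ennreal ?w = hausdorff_weight s (U i)" using False s by (simp add: hausdorff_weight_def)
        finally show ?thesis by simp
      qed simp
    qed
    also have "\<dots> \<le> (\<Sum>i. ennreal C' * hausdorff_weight s (U i) + ennreal (C * \<eta>') * ennreal ((1 / 2) ^ Suc i))"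
      by (intro sum_le_suminf I(1)) auto
    also have "\<dots> = ennreal C' * (\<Sum>i. hausdorff_weight s (U i)) + ennreal (C * \<eta>') * (\<Sum>i. ennreal ((1 / 2) ^ Suc i))"
      by (subst suminf_add[symmetric]) auto
    also have "(\<Sum>i. ennreal ((1 / 2) ^ Suc i)) = 1"
      by (subst suminf_ennreal_eq[OF zero_le_power power_half_series]) auto
    also have "C * \<eta>' = \<eta>" using C by (simp add: \<eta>'_def)
    finally show "1 \<le> ennreal C' * (\<Sum>i. hausdorff_weight s (U i)) + ennreal \<eta>" by simp
  qed
  then have "1 \<le> ennreal C' * hausdorff_pre s (1 / 2) F"
    unfolding hausdorff_pre_def using C' by (intro ennreal_le_cmult_INF) auto
  then have "0 < hausdorff_pre s (1 / 2) F" by (metis mult_zero_right not_gr_zero not_one_le_zero)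
  also have "\<dots> \<le> hausdorff_outer s F" by (rule hausdorff_pre_le_outer) simp
  finally show ?thesis by (simp add: s_def)
qed

lemma hausdorff_dim_F: "hausdorff_dim F = sim_dim"
proof -
  have "{s. 0 \<le> s \<and> hausdorff_outer s F = 0} = {sim_dim<..}"
  proof (intro equalityI subsetI)
    fix t assume "t \<in> {sim_dim<..}"
    then show "t \<in> {s. 0 \<le> s \<and> hausdorff_outer s F = 0}"
      using hausdorff_outer_zero_higher[of sim_dim t F] sim_dim hausdorff_outer_F_finite by auto
  next
    fix t assume t: "t \<in> {s. 0 \<le> s \<and> hausdorff_outer s F = 0}"
    show "t \<in> {sim_dim<..}"
    proof (rule ccontr)
      assume "t \<notin> {sim_dim<..}"
      then have "hausdorff_outer sim_dim F = 0"
        using t hausdorff_outer_zero_higher[of t sim_dim F] by (cases "t = sim_dim") auto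
      then show False using hausdorff_outer_F_pos by simp
    qed
  qed
  then show ?thesis by (simp add: hausdorff_dim_def)
qed

end

section \<open>Birkhoff's ergodic theorem\<close>

locale ergodic_system = finite_measure M for M :: "'a measure" +
  fixes T :: "'a \<Rightarrow> 'a"
  assumes T_measurable [measurable]: "T \<in> M \<rightarrow>\<^sub>M M"
    and T_preserves: "\<And>A. A \<in> sets M \<Longrightarrow> emeasure M (T -` A \<inter> space M) = emeasure M A"
    and ergodic: "\<And>A. A \<in> sets M \<Longrightarrow> T -` A \<inter> space M = A \<Longrightarrow>
       emeasure M A = 0 \<or> emeasure M (space M - A) = 0"
    and nontrivial: "emeasure M (space M) \<noteq> 0"
begin

lemma distr_T: "distr M M T = M"
  by (rule measure_eqI) (auto simp: emeasure_distr T_preserves)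

lemma integrable_T: "integrable M f \<Longrightarrow> integrable M (\<lambda>x. f (T x))" for f :: "'a \<Rightarrow> real"
  using integrable_distr_eq[OF T_measurable, of f] distr_T by simp

lemma integral_T: "f \<in> borel_measurable M \<Longrightarrow> (LINT x|M. f (T x)) = (LINT x|M. f x)" for f :: "'a \<Rightarrow> real"
  using integral_distr[OF T_measurable, of f] distr_T by simp

lemma AE_T: "AE x in M. P x \<Longrightarrow> AE x in M. P (T x)"
proof -
  assume "AE x in M. P x"
  then obtain N where N: "{x \<in> space M. \<not> P x} \<subseteq> N" "emeasure M N = 0" "N \<in> sets M" by (rule AE_E)
  show ?thesis
  proof (rule AE_I)
    show "{x \<in> space M. \<not> P (T x)} \<subseteq> T -` N \<inter> space M"
      using N(1) measurable_space[OF T_measurable] by auto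
    show "emeasure M (T -` N \<inter> space M) = 0" using T_preserves[OF N(3)] N(2) by simp
  qed (use N in measurable)
qed

lemma AE_iterates: "AE x in M. P x \<Longrightarrow> AE x in M. \<forall>n. P ((T ^^ n) x)"
proof -
  assume P: "AE x in M. P x"
  have "AE x in M. P ((T ^^ n) x)" for n
  proof (induction n)
    case (Suc n)
    from AE_T[OF this] show ?case by (simp add: funpow_Suc_right del: funpow.simps)
  qed (simp add: P)
  then show ?thesis by (simp add: AE_all_countable)
qed

definition birkhoff_sum :: "('a \<Rightarrow> real) \<Rightarrow> nat \<Rightarrow> 'a \<Rightarrow> real" where
  "birkhoff_sum f n x = (\<Sum>i<n. f ((T ^^ i) x))"

lemma birkhoff_sum_Suc: "birkhoff_sum f (Suc n) x = f x + birkhoff_sum f n (T x)"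
  unfolding birkhoff_sum_def by (subst sum.lessThan_Suc_shift) (simp add: funpow_swap1)

text \<open>The largest of the first \<open>n + 1\<close> nonempty Birkhoff sums.\<close>

primrec max_sum :: "('a \<Rightarrow> real) \<Rightarrow> nat \<Rightarrow> 'a \<Rightarrow> real" where
  "max_sum f 0 x = f x"
| "max_sum f (Suc n) x = f x + max 0 (max_sum f n (T x))"

lemma birkhoff_sum_le_max_sum: "birkhoff_sum f (Suc n) x \<le> max_sum f n x"
proof (induction n arbitrary: x)
  case (Suc n)
  then show ?case using birkhoff_sum_Suc[of f "Suc n" x] by (simp add: le_max_iff_disj)
qed (simp add: birkhoff_sum_def)

lemma max_sum_mono: "max_sum f n x \<le> max_sum f (Suc n) x"
proof (induction n arbitrary: x)
  case (Suc n)
  show ?case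
    by (subst (1 2) max_sum.simps(2)) (intro add_left_mono max.mono order_refl Suc.IH)
qed simp

lemma max_sum_incseq: "m \<le> n \<Longrightarrow> max_sum f m x \<le> max_sum f n x"
  by (rule lift_Suc_mono_le[of "\<lambda>n. max_sum f n x"]) (rule max_sum_mono)

lemma integrable_max_sum: "integrable M f \<Longrightarrow> integrable M (max_sum f n)"
proof (induction n)
  case (Suc n)
  then have "integrable M (\<lambda>x. max_sum f n (T x))" by (intro integrable_T)
  with Suc.prems show ?case by simp
next
  case 0
  have "max_sum f 0 = f" by (rule ext) simp
  with 0 show ?case by simp
qed

text \<open>On the invariant set where the sums are unbounded, the defect
  \<open>max_sum f (Suc n) - max_sum f n \<circ> T\<close> decreases to \<open>f\<close> and has nonnegative integral.\<close>

lemma birkhoff_sums_bounded: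
  assumes f: "integrable M f" and neg: "(LINT x|M. f x) < 0"
  shows "AE x in M. \<exists>C. \<forall>n. birkhoff_sum f (Suc n) x \<le> C"
proof -
  have [measurable]: "f \<in> borel_measurable M" using f by simp
  have mm[measurable]: "max_sum f n \<in> borel_measurable M" for n using integrable_max_sum[OF f] by simp
  \<comment> \<open>Unboundedness of the sums is unaffected by dropping the first term of the orbit,
    which makes this set invariant.\<close>
  define A where "A = {x \<in> space M. \<forall>k::nat. \<exists>n. real k < max_sum f n x}"
  have [measurable]: "A \<in> sets M" unfolding A_def by measurable
  have TA: "x \<in> A \<longleftrightarrow> T x \<in> A" if x: "x \<in> space M" for x
  proof
    assume "x \<in> A"
    have "\<exists>n. real k < max_sum f n (T x)" for k
    proof -
      obtain l :: nat where l: "real k + \<bar>f x\<bar> < real l" using reals_Archimedean2 by blast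
      obtain n where n: "real l < max_sum f n x" using \<open>x \<in> A\<close> by (auto simp: A_def)
      then have "real l < max_sum f (Suc n) x" using max_sum_mono[of f n x] by linarith
      then have "real k < max 0 (max_sum f n (T x))" using l by simp
      then show ?thesis by (intro exI[of _ n]) (auto simp: less_max_iff_disj)
    qed
    then show "T x \<in> A" using measurable_space[OF T_measurable x] by (simp add: A_def)
  next
    assume "T x \<in> A"
    have "\<exists>n. real k < max_sum f n x" for k
    proof -
      obtain l :: nat where l: "real k + \<bar>f x\<bar> < real l" using reals_Archimedean2 by blast
      obtain n where n: "real l < max_sum f n (T x)" using \<open>T x \<in> A\<close> by (auto simp: A_def)
      then have "real k < max_sum f (Suc n) x" using l by (simp add: max_def)
      then show ?thesis by blast
    qed
    then show "x \<in> A" using x by (simp add: A_def)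
  qed
  have invA: "T -` A \<inter> space M = A" using TA by (auto simp: A_def)
  have iA: "indicator A (T x) = (indicator A x :: real)" if "x \<in> space M" for x
    using TA[OF that] by (simp add: indicator_def)
  define g where "g n x = indicator A x * (max_sum f (Suc n) x - max_sum f n (T x))" for n x
  have "0 \<le> (LINT x|M. g n x)" for n
  proof -
    have i: "integrable M (\<lambda>x. indicator A x * max_sum f m x)" for m
      using integrable_mult_indicator[OF \<open>A \<in> sets M\<close> integrable_max_sum[OF f]] by simp
    have "integrable M (\<lambda>x. indicator A x * max_sum f n (T x))"
      using integrable_T[OF i[of n]] iA by (subst Bochner_Integration.integrable_cong) auto
    then have eq: "(LINT x|M. g n x) = (LINT x|M. indicator A x * max_sum f (Suc n) x) - (LINT x|M. indicator A x * max_sum f n (T x))"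
      unfolding g_def right_diff_distrib using i by (intro Bochner_Integration.integral_diff)
    have "(LINT x|M. indicator A x * max_sum f n (T x)) = (LINT x|M. indicator A (T x) * max_sum f n (T x))"
      using iA by (intro Bochner_Integration.integral_cong) auto
    also have "\<dots> = (LINT x|M. indicator A x * max_sum f n x)"
      by (rule integral_T[of "\<lambda>x. indicator A x * max_sum f n x"]) measurable
    also have "\<dots> \<le> (LINT x|M. indicator A x * max_sum f (Suc n) x)"
      by (intro integral_mono i mult_left_mono max_sum_mono) auto
    finally show ?thesis using eq by simp
  qed
  moreover have "(\<lambda>n. LINT x|M. g n x) \<longlonglongrightarrow> (LINT x|M. indicator A x * f x)"
  proof (rule integral_dominated_convergence[where w = "\<lambda>x. \<bar>f x\<bar> + \<bar>f (T x)\<bar>"])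
    have geq: "g n x = indicator A x * (f x + max 0 (- max_sum f n (T x)))" for n x
      by (auto simp: g_def max_def)
    show "AE x in M. (\<lambda>n. g n x) \<longlonglongrightarrow> indicator A x * f x"
    proof (rule AE_I2)
      fix x assume x: "x \<in> space M"
      show "(\<lambda>n. g n x) \<longlonglongrightarrow> indicator A x * f x"
      proof (cases "x \<in> A")
        case True
        then obtain n0 where "0 < max_sum f n0 (T x)" using TA[OF x] by (auto simp: A_def dest!: spec[of _ 0])
        then have "g n x = indicator A x * f x" if "n0 \<le> n" for n
          using max_sum_incseq[OF that, of f "T x"] by (simp add: geq)
        then show ?thesis by (intro tendsto_eventually eventually_sequentiallyI)
      qed (simp add: geq)
    qed
    show "AE x in M. norm (g n x) \<le> \<bar>f x\<bar> + \<bar>f (T x)\<bar>" for n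
    proof (rule AE_I2)
      fix x
      have "max 0 (- max_sum f n (T x)) \<le> \<bar>f (T x)\<bar>" "0 \<le> max 0 (- max_sum f n (T x))"
        using max_sum_incseq[of 0 n f "T x"] by auto
      then have "\<bar>f x + max 0 (- max_sum f n (T x))\<bar> \<le> \<bar>f x\<bar> + \<bar>f (T x)\<bar>" by linarith
      then show "norm (g n x) \<le> \<bar>f x\<bar> + \<bar>f (T x)\<bar>" by (auto simp: geq indicator_def)
    qed
    show "g n \<in> borel_measurable M" for n unfolding g_def by measurable
  qed (use f integrable_T[OF f] in auto)
  ultimately have A0: "0 \<le> (LINT x|M. indicator A x * f x)" by (intro LIMSEQ_le_const) auto
  have "emeasure M A = 0"
  proof (rule ccontr)
    assume "emeasure M A \<noteq> 0"
    then have "emeasure M (space M - A) = 0" using ergodic[OF _ invA] by auto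
    then have "AE x in M. x \<in> A" by (intro AE_I[of _ _ "space M - A"]) auto
    then have "(LINT x|M. indicator A x * f x) = (LINT x|M. f x)" by (intro integral_cong_AE) auto
    with A0 neg show False by simp
  qed
  then have "AE x in M. x \<notin> A" by (intro AE_I[of _ _ A]) auto
  then show ?thesis
  proof (rule AE_mp, intro AE_I2 impI)
    fix x assume "x \<in> space M" "x \<notin> A"
    then obtain k where "\<And>n. max_sum f n x \<le> real k" by (auto simp: A_def not_less)
    then show "\<exists>C. \<forall>n. birkhoff_sum f (Suc n) x \<le> C"
      using birkhoff_sum_le_max_sum order_trans by (intro exI[of _ "real k"]) blast
  qed
qed

text \<open>Lowering f by slightly more than its mean gives a function of negative integral, whose
  Birkhoff sums are bounded above almost everywhere. For large n the bound is below n e/2, the other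
  half of the allowance e.\<close>

lemma birkhoff_limsup:
  assumes f: "integrable M f" and "0 < e"
  shows "AE x in M. \<forall>\<^sub>F n in sequentially. birkhoff_sum f n x / real n \<le> (LINT x|M. f x) / measure M (space M) + e"
proof -
  define m where "m = measure M (space M)"
  have m: "0 < m" using nontrivial by (simp add: m_def zero_less_measure_iff measure_eq_emeasure_eq_ennreal emeasure_eq_measure)
  define c where "c = (LINT x|M. f x) / m"
  define g where "g x = f x - (c + e / 2)" for x
  have g: "integrable M g" unfolding g_def using f by simp
  have "(LINT x|M. g x) = (LINT x|M. f x) - (c + e / 2) * m"
    unfolding g_def using f by (simp add: m_def mult.commute)
  also have "\<dots> = - e / 2 * m" using m by (simp add: c_def field_simps)
  finally have "(LINT x|M. g x) < 0" using m \<open>0 < e\<close> by simp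
  from birkhoff_sums_bounded[OF g this] show ?thesis
  proof eventually_elim
    case (elim x)
    then obtain C where C: "\<And>n. birkhoff_sum g (Suc n) x \<le> C" by blast
    have eq: "birkhoff_sum g n x = birkhoff_sum f n x - real n * (c + e / 2)" for n
      by (simp add: birkhoff_sum_def g_def sum_subtractf)
    obtain n0 :: nat where n0: "2 * C / e < real n0" using reals_Archimedean2 by blast
    show ?case
    proof (rule eventually_sequentiallyI[of "Suc n0"])
      fix n assume n: "Suc n0 \<le> n"
      then obtain k where k: "n = Suc k" by (cases n) auto
      have "2 * C / e < real n" using n n0 by simp
      then have "C < real n * (e / 2)" using \<open>0 < e\<close> by (simp add: field_simps)
      moreover have "birkhoff_sum f n x = birkhoff_sum g n x + (real n * (c + e) - real n * (e / 2))"
        by (simp add: eq algebra_simps)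
      ultimately have "birkhoff_sum f n x \<le> real n * (c + e)" using C[of k] unfolding k by linarith
      then show "birkhoff_sum f n x / real n \<le> (LINT x|M. f x) / measure M (space M) + e"
        using k by (simp add: c_def m_def divide_le_eq mult.commute)
    qed
  qed
qed

theorem birkhoff:
  assumes f: "integrable M f"
  shows "AE x in M. (\<lambda>n. birkhoff_sum f n x / real n) \<longlonglongrightarrow> (LINT x|M. f x) / measure M (space M)"
proof -
  let ?c = "(LINT x|M. f x) / measure M (space M)"
  have "AE x in M. \<forall>k::nat. \<forall>\<^sub>F n in sequentially. birkhoff_sum f n x / real n \<le> ?c + 1 / real (Suc k)"
    unfolding AE_all_countable using birkhoff_limsup[OF f] by simp
  moreover have "AE x in M. \<forall>k::nat. \<forall>\<^sub>F n in sequentially. ?c - 1 / real (Suc k) \<le> birkhoff_sum f n x / real n"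
    unfolding AE_all_countable
  proof
    fix k :: nat
    have "AE x in M. \<forall>\<^sub>F n in sequentially. birkhoff_sum (\<lambda>x. - f x) n x / real n \<le> (LINT x|M. - f x) / measure M (space M) + 1 / real (Suc k)"
      using f by (intro birkhoff_limsup) auto
    then show "AE x in M. \<forall>\<^sub>F n in sequentially. ?c - 1 / real (Suc k) \<le> birkhoff_sum f n x / real n"
      by eventually_elim (auto simp: birkhoff_sum_def sum_negf elim!: eventually_mono)
  qed
  ultimately show ?thesis
  proof eventually_elim
    case (elim x)
    show ?case
    proof (rule LIMSEQ_I)
      fix e :: real assume "0 < e"
      then obtain k where k: "1 / real (Suc k) < e" using nat_approx_posE by blast
      have "\<forall>\<^sub>F n in sequentially. norm (birkhoff_sum f n x / real n - ?c) < e"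
        using elim(1)[rule_format, of k] elim(2)[rule_format, of k]
        by eventually_elim (use k in \<open>simp only: real_norm_def abs_less_iff, linarith\<close>)
      then show "\<exists>no. \<forall>n\<ge>no. norm (birkhoff_sum f n x / real n - ?c) < e"
        by (simp add: eventually_sequentially)
    qed
  qed
qed

end

section \<open>The shift on a self-similar set\<close>

context iterated_function_system_osc
begin

definition nat_measure :: "'a measure" where
  "nat_measure = restrict_space (hausdorff_measure sim_dim) F"

lemma F_borel: "F \<in> sets borel"
  by (intro borel_closed compact_imp_closed F_compact)

lemma F_sets: "F \<in> sets (hausdorff_measure sim_dim)"
  by (rule borel_subset_sets_hausdorff[OF F_borel])

lemma space_nat_measure [simp]: "space nat_measure = F"
  by (simp add: nat_measure_def space_restrict_space)

lemma sets_nat_measure: "A \<in> sets nat_measure \<longleftrightarrow> A \<subseteq> F \<and> A \<in> sets (hausdorff_measure sim_dim)"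
  using F_sets by (simp add: nat_measure_def sets_restrict_space_iff conj_commute)

lemma emeasure_nat_measure: "A \<in> sets nat_measure \<Longrightarrow> emeasure nat_measure A = hausdorff_outer sim_dim A"
  using F_sets sets_nat_measure[of A]
  by (simp add: nat_measure_def emeasure_restrict_space emeasure_hausdorff_measure)

sublocale nat: finite_measure nat_measure
proof
  have "F \<in> sets nat_measure" using F_sets by (simp add: sets_nat_measure)
  then show "emeasure nat_measure (space nat_measure) \<noteq> \<infinity>"
    using hausdorff_outer_F_finite by (simp add: emeasure_nat_measure)
qed

lemma measure_nat_measure: "A \<in> sets nat_measure \<Longrightarrow> measure nat_measure A = enn2real (hausdorff_outer sim_dim A)"
  by (simp add: measure_def emeasure_nat_measure)

lemma measure_F_pos: "0 < measure nat_measure F"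
proof -
  have "F \<in> sets nat_measure" using F_sets by (simp add: sets_nat_measure)
  then show ?thesis
    using hausdorff_outer_F_pos hausdorff_outer_F_finite by (simp add: measure_nat_measure enn2real_positive_iff)
qed

lemma borel_Int_F: "E \<in> sets borel \<Longrightarrow> E \<inter> F \<in> sets nat_measure"
  using F_borel by (simp add: sets_nat_measure borel_subset_sets_hausdorff)

lemma sets_nat_measure_Int_borel: "A \<in> sets nat_measure \<Longrightarrow> E \<in> sets borel \<Longrightarrow> A \<inter> E \<in> sets nat_measure"
  by (auto simp: sets_nat_measure borel_subset_sets_hausdorff)

lemma S_image_sets:
  assumes "j \<in> {1..N}" "A \<in> sets nat_measure"
  shows "S j ` A \<in> sets nat_measure"
  using sets_hausdorff_similarity_image[OF sim[OF assms(1)], of sim_dim A] assms sim_dim(1) S_F_subset[OF assms(1)]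
  by (auto simp: sets_nat_measure)

lemma measure_S_image:
  assumes "j \<in> {1..N}" "A \<in> sets nat_measure"
  shows "measure nat_measure (S j ` A) = r j powr sim_dim * measure nat_measure A"
  using hausdorff_outer_similarity_image[OF sim[OF assms(1)], of sim_dim A] sim_dim(1) S_image_sets[OF assms] assms(2)
  by (simp add: measure_nat_measure enn2real_mult)

text \<open>Taking the least index makes the coding total on \<open>F\<close>, including the
  overlaps of copies, where the description in \<open>first_index\<close> is not unique.\<close>

definition idx :: "'a \<Rightarrow> nat" where
  "idx x = (LEAST j. j \<in> {1..N} \<and> x \<in> S j ` F)"

definition piece :: "nat \<Rightarrow> 'a set" where
  "piece j = S j ` F - (\<Union>i\<in>{1..<j}. S i ` F)"

definition shift :: "'a \<Rightarrow> 'a" where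
  "shift x = inv (S (idx x)) x"

lemma idx: "x \<in> F \<Longrightarrow> idx x \<in> {1..N} \<and> x \<in> S (idx x) ` F"
  unfolding idx_def by (rule LeastI_ex) (use F_eq in blast)

lemma idx_le: "j \<in> {1..N} \<Longrightarrow> x \<in> S j ` F \<Longrightarrow> idx x \<le> j"
  unfolding idx_def by (rule Least_le) blast

lemma mem_piece: "j \<in> {1..N} \<Longrightarrow> x \<in> piece j \<longleftrightarrow> x \<in> F \<and> idx x = j"
proof
  assume j: "j \<in> {1..N}" and x: "x \<in> piece j"
  then have xF: "x \<in> F" using S_F_subset by (auto simp: piece_def)
  have "idx x \<le> j" using idx_le[OF j] x by (auto simp: piece_def)
  moreover have "\<not> idx x < j" using idx[OF xF] x by (auto simp: piece_def)
  ultimately show "x \<in> F \<and> idx x = j" using xF by simp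
next
  assume j: "j \<in> {1..N}" and "x \<in> F \<and> idx x = j"
  then show "x \<in> piece j" using idx[of x] idx_le[of _ x] by (force simp: piece_def)
qed

lemma piece_borel: "j \<in> {1..N} \<Longrightarrow> piece j \<in> sets borel"
  unfolding piece_def
  by (intro sets.Diff sets.finite_UN similarity_image_borel[OF sim] F_borel) auto

lemma piece_sets: "j \<in> {1..N} \<Longrightarrow> piece j \<in> sets nat_measure"
  using borel_Int_F[OF piece_borel[of j]] mem_piece[of j] by (metis Int_absorb2 subsetI)

lemma F_sets_nat: "F \<in> sets nat_measure"
  using F_sets by (simp add: sets_nat_measure)

lemma measure_split_pieces:
  assumes "A \<in> sets nat_measure"
  shows "measure nat_measure A = (\<Sum>j=1..N. measure nat_measure (A \<inter> piece j))"
proof -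
  have "A = (\<Union>j\<in>{1..N}. A \<inter> piece j)"
    using assms idx mem_piece by (auto simp: sets_nat_measure)
  then have "measure nat_measure A = measure nat_measure (\<Union>j\<in>{1..N}. A \<inter> piece j)" by simp
  also have "\<dots> = (\<Sum>j=1..N. measure nat_measure (A \<inter> piece j))"
  proof (rule measure_finite_Union)
    show "disjoint_family_on (\<lambda>j. A \<inter> piece j) {1..N}"
      unfolding disjoint_family_on_def by (auto simp: mem_piece)
  qed (use assms piece_sets in auto)
  finally show ?thesis .
qed

text \<open>By Moran's equation the masses of the copies add up to the mass of \<open>F\<close>, and
  so do the masses of the disjoint pieces. The differences are nonnegative and have sum 0.\<close>

lemma S_F_diff_piece_null:
  assumes "j \<in> {1..N}"
  shows "measure nat_measure (S j ` F - piece j) = 0"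
proof -
  have SF: "S j ` F \<in> sets nat_measure" if "j \<in> {1..N}" for j by (rule S_image_sets[OF that F_sets_nat])
  have d: "measure nat_measure (S j ` F - piece j) = measure nat_measure (S j ` F) - measure nat_measure (piece j)"
    if j: "j \<in> {1..N}" for j
    using SF[OF j] piece_sets[OF j] by (intro nat.finite_measure_Diff) (auto simp: piece_def)
  have "(\<Sum>j=1..N. measure nat_measure (S j ` F - piece j)) =
      (\<Sum>j=1..N. measure nat_measure (S j ` F)) - (\<Sum>j=1..N. measure nat_measure (piece j))"
    unfolding sum_subtractf[symmetric] using d by (intro sum.cong) auto
  also have "(\<Sum>j=1..N. measure nat_measure (S j ` F)) = (\<Sum>j=1..N. r j powr sim_dim) * measure nat_measure F"
    unfolding sum_distrib_right by (intro sum.cong measure_S_image[OF _ F_sets_nat]) auto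
  also have "\<dots> = measure nat_measure F" using sim_dim(2) by simp
  also have "(\<Sum>j=1..N. measure nat_measure (piece j)) = measure nat_measure F"
  proof -
    have "F \<inter> piece j = piece j" if "j \<in> {1..N}" for j using mem_piece[OF that] by blast
    then show ?thesis unfolding measure_split_pieces[OF F_sets_nat] by (intro sum.cong) auto
  qed
  finally show ?thesis using assms by (simp add: sum_nonneg_eq_0_iff)
qed

lemma measure_Int_piece:
  assumes j: "j \<in> {1..N}" and A: "A \<in> sets nat_measure" "A \<subseteq> S j ` F"
  shows "measure nat_measure (A \<inter> piece j) = measure nat_measure A"
proof -
  have "measure nat_measure A = measure nat_measure (A \<inter> piece j) + measure nat_measure (A - piece j)"
    using A piece_sets[OF j] nat.finite_measure_Union[of "A \<inter> piece j" "A - piece j"] by (simp add: Int_Diff_Un disjoint_iff)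
  moreover have "measure nat_measure (A - piece j) \<le> measure nat_measure (S j ` F - piece j)"
    using A piece_sets[OF j] S_image_sets[OF j F_sets_nat] by (intro nat.finite_measure_mono) auto
  ultimately show ?thesis using S_F_diff_piece_null[OF j] measure_nonneg[of nat_measure "A - piece j"] by linarith
qed

lemma AE_unique_index: "AE x in nat_measure. \<forall>j\<in>{1..N}. x \<in> S j ` F \<longrightarrow> j = idx x"
proof (subst AE_ball_countable)
  show "\<forall>j\<in>{1..N}. AE x in nat_measure. x \<in> S j ` F \<longrightarrow> j = idx x"
  proof
    fix j assume j: "j \<in> {1..N}"
    have "emeasure nat_measure (S j ` F - piece j) = 0"
      using S_F_diff_piece_null[OF j] by (simp add: nat.emeasure_eq_measure)
    then show "AE x in nat_measure. x \<in> S j ` F \<longrightarrow> j = idx x"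
      using piece_sets[OF j] S_image_sets[OF j F_sets_nat] mem_piece[OF j]
      by (intro AE_I[where N = "S j ` F - piece j"]) auto
  qed
qed (simp add: countable_finite)

lemma shift_eq: "x \<in> F \<Longrightarrow> S (idx x) (shift x) = x" and shift_in: "x \<in> F \<Longrightarrow> shift x \<in> F"
proof -
  assume x: "x \<in> F"
  then obtain y where y: "y \<in> F" "x = S (idx x) y" "idx x \<in> {1..N}" using idx by blast
  then have "shift x = y" unfolding shift_def using similarityD(4)[OF sim[OF y(3)]] by (metis inv_f_f)
  with y show "S (idx x) (shift x) = x" "shift x \<in> F" by auto
qed

lemma shift_vimage_Int_piece:
  assumes j: "j \<in> {1..N}" and "A \<subseteq> F"
  shows "shift -` A \<inter> piece j = S j ` A \<inter> piece j"
proof (intro equalityI subsetI)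
  fix x assume "x \<in> shift -` A \<inter> piece j"
  then show "x \<in> S j ` A \<inter> piece j" using shift_eq[of x] mem_piece[OF j, of x] by (metis IntD1 IntD2 IntI imageI vimageE)
next
  fix x assume x: "x \<in> S j ` A \<inter> piece j"
  then obtain y where y: "y \<in> A" "x = S j y" by auto
  have "x \<in> F" "idx x = j" using x mem_piece[OF j] by auto
  then have "S j (shift x) = S j y" using shift_eq[OF \<open>x \<in> F\<close>] y by metis
  then have "shift x = y" using similarityD(4)[OF sim[OF j]] by (simp add: inj_eq)
  then show "x \<in> shift -` A \<inter> piece j" using x y by simp
qed

lemma shift_vimage_sets:
  assumes "A \<in> sets nat_measure"
  shows "shift -` A \<inter> F \<in> sets nat_measure"
proof -
  have AF: "A \<subseteq> F" using assms by (simp add: sets_nat_measure)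
  have "shift -` A \<inter> F = (\<Union>j\<in>{1..N}. shift -` A \<inter> piece j)" using idx mem_piece by auto
  also have "\<dots> = (\<Union>j\<in>{1..N}. S j ` A \<inter> piece j)" using shift_vimage_Int_piece[OF _ AF] by simp
  also have "\<dots> \<in> sets nat_measure" using S_image_sets[OF _ assms] piece_sets by (intro sets.finite_UN sets.Int) auto
  finally show ?thesis .
qed

text \<open>On the j-th piece the preimage of \<open>A\<close> is, up to a null set, the image of
  \<open>A\<close> under \<open>S j\<close>, of mass r_j^s times that of \<open>A\<close>; Moran's
  equation sums these up.\<close>

lemma measure_shift_vimage:
  assumes A: "A \<in> sets nat_measure"
  shows "measure nat_measure (shift -` A \<inter> F) = measure nat_measure A"
proof -
  have AF: "A \<subseteq> F" using A by (simp add: sets_nat_measure)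
  have "measure nat_measure (shift -` A \<inter> F \<inter> piece j) = r j powr sim_dim * measure nat_measure A" if j: "j \<in> {1..N}" for j
  proof -
    have "shift -` A \<inter> F \<inter> piece j = S j ` A \<inter> piece j"
      using shift_vimage_Int_piece[OF j AF] mem_piece[OF j] by blast
    then show ?thesis
      using measure_Int_piece[OF j S_image_sets[OF j A]] measure_S_image[OF j A] AF by auto
  qed
  then have "measure nat_measure (shift -` A \<inter> F) = (\<Sum>j=1..N. r j powr sim_dim) * measure nat_measure A"
    using measure_split_pieces[OF shift_vimage_sets[OF A]] by (simp add: sum_distrib_right)
  then show ?thesis using sim_dim(2) by simp
qed

lemma shift_measurable: "shift \<in> nat_measure \<rightarrow>\<^sub>M nat_measure"
  by (rule measurableI) (auto simp: shift_in shift_vimage_sets)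

text \<open>Two set functions with the same self-similarity relation are compared by descending n
  levels. At the bottom, a set that meets \<open>F\<close> has a neighbourhood of radius \<eta>
  containing all of \<open>F\<close>, on which \<nu>2 takes its full value c, while \<nu>1 vanishes
  on sets missing \<open>F\<close>.\<close>

lemma self_similar_measure_le:
  fixes \<nu>1 \<nu>2 :: "'a set \<Rightarrow> real"
  assumes rec1: "\<And>E. E \<in> sets borel \<Longrightarrow> \<nu>1 E = (\<Sum>j=1..N. r j powr sim_dim * \<nu>1 (S j -` E))"
    and rec2: "\<And>E. E \<in> sets borel \<Longrightarrow> \<nu>2 E = (\<Sum>j=1..N. r j powr sim_dim * \<nu>2 (S j -` E))"
    and empty1: "\<And>E. E \<in> sets borel \<Longrightarrow> F \<inter> E = {} \<Longrightarrow> \<nu>1 E = 0" and nonneg2: "\<And>E. 0 \<le> \<nu>2 E"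
    and le1: "\<And>E. E \<in> sets borel \<Longrightarrow> \<nu>1 E \<le> c" and full2: "\<And>E. E \<in> sets borel \<Longrightarrow> F \<subseteq> E \<Longrightarrow> \<nu>2 E = c"
    and E: "E \<in> sets borel" "rmax ^ n * diameter F \<le> \<eta>"
  shows "\<nu>1 E \<le> \<nu>2 {x. infdist x E \<le> \<eta>}"
  using E
proof (induction n arbitrary: E \<eta>)
  case (0 E)
  show ?case
  proof (cases "F \<inter> E = {}")
    case True
    then show ?thesis using empty1[OF 0(1)] nonneg2 by simp
  next
    case False
    then obtain u where u: "u \<in> F" "u \<in> E" by auto
    have "infdist x E \<le> \<eta>" if "x \<in> F" for x
      using infdist_le[OF u(2), of x] diameter_bounded_bound[OF compact_imp_bounded[OF F_compact] that u(1)] 0(2) by simp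
    moreover have "closed {x. infdist x E \<le> \<eta>}" by (intro closed_Collect_le continuous_intros)
    ultimately have "\<nu>2 {x. infdist x E \<le> \<eta>} = c" by (intro full2) auto
    then show ?thesis using le1[OF 0(1)] by simp
  qed
next
  case (Suc n E)
  have cl: "closed {x. infdist x E \<le> \<eta>}" by (intro closed_Collect_le continuous_intros)
  have "\<nu>1 E = (\<Sum>j=1..N. r j powr sim_dim * \<nu>1 (S j -` E))" by (rule rec1[OF Suc.prems(1)])
  also have "\<dots> \<le> (\<Sum>j=1..N. r j powr sim_dim * \<nu>2 (S j -` {x. infdist x E \<le> \<eta>}))"
  proof (intro sum_mono mult_left_mono)
    fix j assume j: "j \<in> {1..N}"
    have b: "S j -` E \<in> sets borel"
      using measurable_sets[OF similarity_measurable[OF sim[OF j]] Suc.prems(1)] by simp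
    have "r j * (rmax ^ n * diameter F) \<le> rmax * (rmax ^ n * diameter F)"
      using rmax(1,3) j diameter_ge_0[OF compact_imp_bounded[OF F_compact]] by (intro mult_right_mono) auto
    then have "rmax ^ n * diameter F \<le> \<eta> / r j" using Suc.prems(2) r01[OF j] by (simp add: field_simps)
    then have "\<nu>1 (S j -` E) \<le> \<nu>2 {x. infdist x (S j -` E) \<le> \<eta> / r j}" by (rule Suc.IH[OF b])
    also have "{x. infdist x (S j -` E) \<le> \<eta> / r j} = S j -` {x. infdist x E \<le> \<eta>}"
    proof -
      have "S j ` (S j -` E) = E" using similarityD(5)[OF sim[OF j]] by (rule surj_image_vimage_eq)
      then have "infdist (S j x) E = r j * infdist x (S j -` E)" for x
        using similarity_infdist[OF sim[OF j], of x "S j -` E"] by simp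
      then show ?thesis using r01[OF j] by (auto simp: field_simps)
    qed
    finally show "\<nu>1 (S j -` E) \<le> \<nu>2 (S j -` {x. infdist x E \<le> \<eta>})" .
  qed simp
  also have "\<dots> = \<nu>2 {x. infdist x E \<le> \<eta>}" using cl by (intro rec2[symmetric]) auto
  finally show ?case .
qed

text \<open>Both sides, as functions of \<open>E\<close>, satisfy the relation of a self-similar
  measure and have the same total mass; for the left side the relation comes from the invariance of
  \<open>A\<close>. Such a measure is unique: two of them agree on closed sets by comparison with
  shrinking neighbourhoods, hence on Borel sets. So \<open>A\<close> is independent of every Borel
  set.\<close>

lemma invariant_set_splits:
  assumes A: "A \<in> sets nat_measure" "shift -` A \<inter> F = A" and E: "E \<in> sets borel"
  shows "measure nat_measure (A \<inter> E) * measure nat_measure F = measure nat_measure A * measure nat_measure (E \<inter> F)"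
proof -
  have AF: "A \<subseteq> F" using A by (simp add: sets_nat_measure)
  have rec: "measure nat_measure (B \<inter> E) = (\<Sum>j=1..N. r j powr sim_dim * measure nat_measure (B \<inter> S j -` E))"
    if B: "B \<in> sets nat_measure" "shift -` B \<inter> F = B" and E: "E \<in> sets borel" for B E
  proof -
    have BF: "B \<subseteq> F" using B by (simp add: sets_nat_measure)
    have "measure nat_measure (B \<inter> E) = (\<Sum>j=1..N. measure nat_measure (B \<inter> E \<inter> piece j))"
      by (rule measure_split_pieces[OF sets_nat_measure_Int_borel[OF B(1) E]])
    also have "\<dots> = (\<Sum>j=1..N. r j powr sim_dim * measure nat_measure (B \<inter> S j -` E))"
    proof (rule sum.cong[OF refl])
      fix j assume j: "j \<in> {1..N}"
      have b: "S j -` E \<in> sets borel"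
        using measurable_sets[OF similarity_measurable[OF sim[OF j]] E] by simp
      have "B \<inter> piece j = S j ` B \<inter> piece j"
        using shift_vimage_Int_piece[OF j BF] B(2) mem_piece[OF j] by blast
      moreover have "S j ` (B \<inter> S j -` E) = S j ` B \<inter> E" by auto
      ultimately have "B \<inter> E \<inter> piece j = S j ` (B \<inter> S j -` E) \<inter> piece j" by blast
      then show "measure nat_measure (B \<inter> E \<inter> piece j) = r j powr sim_dim * measure nat_measure (B \<inter> S j -` E)"
        using measure_Int_piece[OF j S_image_sets[OF j sets_nat_measure_Int_borel[OF B(1) b]]]
          measure_S_image[OF j sets_nat_measure_Int_borel[OF B(1) b]] BF by auto
    qed
    finally show ?thesis .
  qed
  have Finv: "shift -` F \<inter> F = F" using shift_in by auto
  define \<nu>1 where "\<nu>1 E = measure nat_measure (A \<inter> E) * measure nat_measure F" for E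
  define \<nu>2 where "\<nu>2 E = measure nat_measure A * measure nat_measure (F \<inter> E)" for E
  have rec1: "\<nu>1 E = (\<Sum>j=1..N. r j powr sim_dim * \<nu>1 (S j -` E))" if "E \<in> sets borel" for E
    unfolding \<nu>1_def using rec[OF A that] by (simp add: sum_distrib_right mult.assoc)
  have rec2: "\<nu>2 E = (\<Sum>j=1..N. r j powr sim_dim * \<nu>2 (S j -` E))" if "E \<in> sets borel" for E
    unfolding \<nu>2_def using rec[OF F_sets_nat Finv that] by (simp add: sum_distrib_left mult.left_commute)
  define c where "c = measure nat_measure A * measure nat_measure F"
  have e1: "\<nu>1 E = 0" if "F \<inter> E = {}" for E
  proof -
    have "A \<inter> E = {}" using that AF by blast
    then show ?thesis by (simp add: \<nu>1_def)
  qed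
  have e2: "\<nu>2 E = 0" if "F \<inter> E = {}" for E using that by (simp add: \<nu>2_def)
  have l1: "\<nu>1 E \<le> c" if "E \<in> sets borel" for E
    unfolding \<nu>1_def c_def using A sets_nat_measure_Int_borel[OF A(1) that]
    by (intro mult_right_mono nat.finite_measure_mono) auto
  have l2: "\<nu>2 E \<le> c" if "E \<in> sets borel" for E
    unfolding \<nu>2_def c_def using F_sets_nat sets_nat_measure_Int_borel[OF F_sets_nat that]
    by (intro mult_left_mono nat.finite_measure_mono) auto
  have f1: "\<nu>1 E = c" if "F \<subseteq> E" for E
  proof -
    have "A \<inter> E = A" using that AF by blast
    then show ?thesis by (simp add: \<nu>1_def c_def)
  qed
  have f2: "\<nu>2 E = c" if "F \<subseteq> E" for E using that by (simp add: \<nu>2_def c_def Int_absorb2)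
  have lim: "(\<lambda>n. measure nat_measure (B \<inter> {x. infdist x K \<le> rmax ^ n * diameter F})) \<longlonglongrightarrow> measure nat_measure (B \<inter> K)"
    if B: "B \<in> sets nat_measure" and K: "closed K" "K \<noteq> {}" for B K
  proof -
    let ?K = "\<lambda>n. {x. infdist x K \<le> rmax ^ n * diameter F}"
    have D: "0 \<le> diameter F" by (rule diameter_ge_0[OF compact_imp_bounded[OF F_compact]])
    have cl: "closed (?K n)" for n by (intro closed_Collect_le continuous_intros)
    have "decseq (\<lambda>n. B \<inter> ?K n)"
    proof (rule decseq_SucI)
      fix n
      have "rmax * (rmax ^ n * diameter F) \<le> 1 * (rmax ^ n * diameter F)"
        using rmax(1,2) D by (intro mult_right_mono) auto
      then show "B \<inter> ?K (Suc n) \<subseteq> B \<inter> ?K n" by (auto simp: mult.assoc)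
    qed
    then have "(\<lambda>n. measure nat_measure (B \<inter> ?K n)) \<longlonglongrightarrow> measure nat_measure (\<Inter>n. B \<inter> ?K n)"
      using sets_nat_measure_Int_borel[OF B borel_closed[OF cl]]
      by (intro nat.finite_Lim_measure_decseq) auto
    moreover have "(\<Inter>n. B \<inter> ?K n) = B \<inter> K"
    proof (intro equalityI subsetI)
      fix x assume x: "x \<in> (\<Inter>n. B \<inter> ?K n)"
      then have i: "infdist x K \<le> rmax ^ n * diameter F" for n by auto
      have "(\<lambda>n. rmax ^ n * diameter F) \<longlonglongrightarrow> 0 * diameter F"
        by (intro tendsto_mult LIMSEQ_power_zero tendsto_const) (use rmax in auto)
      then have "infdist x K \<le> 0 * diameter F" by (rule LIMSEQ_le_const) (use i in auto)
      then have "x \<in> K" using in_closed_iff_infdist_zero[OF K] infdist_nonneg[of x K] by auto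
      then show "x \<in> B \<inter> K" using x by auto
    next
      fix x assume "x \<in> B \<inter> K"
      then show "x \<in> (\<Inter>n. B \<inter> ?K n)" using D rmax(1) by simp
    qed
    ultimately show ?thesis by simp
  qed
  have closed_eq: "\<nu>1 K = \<nu>2 K" if K: "closed K" for K
  proof (cases "K = {}")
    case False
    have Kb: "K \<in> sets borel" using K by simp
    have lim1: "(\<lambda>n. \<nu>1 {x. infdist x K \<le> rmax ^ n * diameter F}) \<longlonglongrightarrow> \<nu>1 K"
      unfolding \<nu>1_def by (intro tendsto_mult_right lim A K False)
    have lim2: "(\<lambda>n. \<nu>2 {x. infdist x K \<le> rmax ^ n * diameter F}) \<longlonglongrightarrow> \<nu>2 K"
      unfolding \<nu>2_def by (intro tendsto_mult_left lim F_sets_nat K False)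
    have "\<nu>1 K \<le> \<nu>2 {x. infdist x K \<le> rmax ^ n * diameter F}" for n
      by (rule self_similar_measure_le[OF rec1 rec2 e1 _ l1 f2 Kb order_refl]) (auto simp: \<nu>2_def)
    moreover have "\<nu>2 K \<le> \<nu>1 {x. infdist x K \<le> rmax ^ n * diameter F}" for n
      by (rule self_similar_measure_le[OF rec2 rec1 e2 _ l2 f1 Kb order_refl]) (auto simp: \<nu>1_def)
    ultimately show ?thesis using LIMSEQ_le_const[OF lim2] LIMSEQ_le_const[OF lim1] by (meson antisym)
  qed (use e1 e2 in auto)
  have id: "(\<lambda>x. x) \<in> measurable (density nat_measure (indicator B)) borel" for B :: "'a set"
    by (rule measurableI) (use borel_Int_F in \<open>auto simp: vimage_def Int_def\<close>)
  \<comment> \<open>The set functions are realised as Borel measures in order to pass from closed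
    sets, a generator stable under intersections, to all Borel sets.\<close>
  define D where "D B = distr (density nat_measure (indicator B)) borel (\<lambda>x. x)" for B :: "'a set"
  have D: "emeasure (D B) E = ennreal (measure nat_measure (B \<inter> E))" if "B \<in> sets nat_measure" "E \<in> sets borel" for B E
  proof -
    have "emeasure (D B) E = emeasure (density nat_measure (indicator B)) (E \<inter> F)"
      unfolding D_def using id that(2) by (subst emeasure_distr) (auto simp: Int_commute)
    also have "\<dots> = emeasure nat_measure (B \<inter> (E \<inter> F))"
      using that borel_Int_F[OF that(2)] by (simp add: emeasure_density indicator_inter_arith[symmetric])
    also have "B \<inter> (E \<inter> F) = B \<inter> E" using that(1) by (auto simp: sets_nat_measure)
    finally show ?thesis by (simp add: nat.emeasure_eq_measure)
  qed
  have dens: "emeasure (density (D B) (\<lambda>_. ennreal k)) X = ennreal (measure nat_measure (B \<inter> X) * k)"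
    if "B \<in> sets nat_measure" "X \<in> sets borel" "0 \<le> k" for B k X
  proof -
    have "emeasure (density (D B) (\<lambda>_. ennreal k)) X = ennreal k * emeasure (D B) X"
      using that(2) by (subst emeasure_density) (auto simp: D_def nn_integral_cmult_indicator)
    also have "\<dots> = ennreal (k * measure nat_measure (B \<inter> X))"
      unfolding D[OF that(1,2)] using that(3) by (intro ennreal_mult[symmetric]) auto
    finally show ?thesis by (simp add: mult.commute)
  qed
  have d1: "emeasure (density (D A) (\<lambda>_. ennreal (measure nat_measure F))) X = ennreal (\<nu>1 X)"
    if "X \<in> sets borel" for X
    using dens[OF A(1) that, of "measure nat_measure F"] by (simp add: \<nu>1_def)
  have d2: "emeasure (density (D F) (\<lambda>_. ennreal (measure nat_measure A))) X = ennreal (\<nu>2 X)"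
    if "X \<in> sets borel" for X
    using dens[OF F_sets_nat that, of "measure nat_measure A"] by (simp add: \<nu>2_def mult.commute)
  have sD: "sets (density (D B) (\<lambda>_. ennreal k)) = sigma_sets UNIV {K. closed K}" for B k
    by (simp add: D_def borel_eq_closed)
  have "density (D A) (\<lambda>_. ennreal (measure nat_measure F)) = density (D F) (\<lambda>_. ennreal (measure nat_measure A))"
  proof (rule measure_eqI_generator_eq[OF _ _ _ sD sD, where A = "\<lambda>_. UNIV"])
    show "Int_stable {K :: 'a set. closed K}" by (auto simp: Int_stable_def)
    show "emeasure (density (D A) (\<lambda>_. ennreal (measure nat_measure F))) X =
        emeasure (density (D F) (\<lambda>_. ennreal (measure nat_measure A))) X" if "X \<in> {K. closed K}" for X
      using closed_eq[of X] that by (simp add: d1 d2)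
    show "emeasure (density (D A) (\<lambda>_. ennreal (measure nat_measure F))) UNIV \<noteq> \<infinity>"
      by (simp add: d1)
  qed auto
  then have "ennreal (\<nu>1 E) = ennreal (\<nu>2 E)"
    using d1[OF E] d2[OF E] by simp
  then have "\<nu>1 E = \<nu>2 E" by (subst (asm) ennreal_inj) (auto simp: \<nu>1_def \<nu>2_def)
  then show ?thesis by (simp add: \<nu>1_def \<nu>2_def Int_commute)
qed

sublocale ergodic: ergodic_system nat_measure shift
proof
  show "shift \<in> nat_measure \<rightarrow>\<^sub>M nat_measure" by (rule shift_measurable)
  show "emeasure nat_measure (shift -` A \<inter> space nat_measure) = emeasure nat_measure A" if "A \<in> sets nat_measure" for A
    using measure_shift_vimage[OF that] by (simp add: nat.emeasure_eq_measure)
  show "emeasure nat_measure (space nat_measure) \<noteq> 0"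
    using measure_F_pos by (simp add: nat.emeasure_eq_measure)
  fix A assume A: "A \<in> sets nat_measure" "shift -` A \<inter> space nat_measure = A"
  have AF: "A \<subseteq> F" using A(1) by (simp add: sets_nat_measure)
  \<comment> \<open>\<open>A\<close> is only Caratheodory measurable, so the splitting is applied to
    a Borel hull \<open>G\<close> of the same measure, which gives \<mu>(A) \<mu>(F) =
    \<mu>(A)^2.\<close>
  have "hausdorff_outer sim_dim A < top"
    using hausdorff_outer_mono[OF AF] hausdorff_outer_F_finite by (rule le_less_trans)
  then obtain G where G: "G \<in> sets borel" "A \<subseteq> G" "hausdorff_outer sim_dim G = hausdorff_outer sim_dim A"
    by (rule borel_hull)
  have "hausdorff_outer sim_dim (G \<inter> F) = hausdorff_outer sim_dim A"
    using hausdorff_outer_mono[of "G \<inter> F" G sim_dim] hausdorff_outer_mono[of A "G \<inter> F" sim_dim] G AF by auto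
  then have "measure nat_measure (G \<inter> F) = measure nat_measure A"
    using borel_Int_F[OF G(1)] A(1) by (simp add: measure_nat_measure)
  moreover have "A \<inter> G = A" using G(2) by blast
  ultimately have "measure nat_measure A * measure nat_measure F = measure nat_measure A * measure nat_measure A"
    using invariant_set_splits[of A G] A G(1) by simp
  then have "measure nat_measure A = 0 \<or> measure nat_measure (F - A) = 0"
    using nat.finite_measure_Diff[OF F_sets_nat A(1) AF] by auto
  then show "emeasure nat_measure A = 0 \<or> emeasure nat_measure (space nat_measure - A) = 0"
    by (simp add: nat.emeasure_eq_measure)
qed

section \<open>Balls around points of \<open>F\<close> and the interior of \<open>J\<close> under
  the invariant measure\<close>

lemma measure_ball_pos:
  assumes "x \<in> F" "rmax ^ n * (diameter F + 1) \<le> \<eta>"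
  shows "0 < measure nat_measure (ball x \<eta> \<inter> F)"
  using assms
proof (induction n arbitrary: x \<eta>)
  case (0 x)
  have "F \<subseteq> ball x \<eta>"
    using diameter_bounded_bound[OF compact_imp_bounded[OF F_compact] 0(1)] 0(2) by fastforce
  then show ?case using measure_F_pos by (simp add: Int_absorb1)
next
  case (Suc n x)
  obtain j y where j: "j \<in> {1..N}" "y \<in> F" "x = S j y" using Suc.prems(1) F_eq by blast
  have "r j * (rmax ^ n * (diameter F + 1)) \<le> rmax * (rmax ^ n * (diameter F + 1))"
    using rmax(1,3) j(1) diameter_ge_0[OF compact_imp_bounded[OF F_compact]] by (intro mult_right_mono) auto
  then have "rmax ^ n * (diameter F + 1) \<le> \<eta> / r j" using Suc.prems(2) r01[OF j(1)] by (simp add: field_simps)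
  then have "0 < measure nat_measure (ball y (\<eta> / r j) \<inter> F)" by (rule Suc.IH[OF j(2)])
  moreover have b: "ball y (\<eta> / r j) \<inter> F \<in> sets nat_measure" by (rule borel_Int_F) simp
  ultimately have "0 < measure nat_measure (S j ` (ball y (\<eta> / r j) \<inter> F))"
    using measure_S_image[OF j(1) b] r01[OF j(1)] by simp
  also have "\<dots> \<le> measure nat_measure (ball x \<eta> \<inter> F)"
  proof (rule nat.finite_measure_mono)
    show "S j ` (ball y (\<eta> / r j) \<inter> F) \<subseteq> ball x \<eta> \<inter> F"
    proof clarify
      fix z assume "z \<in> ball y (\<eta> / r j)" "z \<in> F"
      then show "S j z \<in> ball x \<eta> \<inter> F"
        using similarityD(2)[OF sim[OF j(1)], of y z] S_F_subset[OF j(1)] r01[OF j(1)] j(3)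
        by (auto simp: field_simps)
    qed
    show "ball x \<eta> \<inter> F \<in> sets nat_measure" by (rule borel_Int_F) simp
  qed
  finally show ?case .
qed

text \<open>Each \<open>S j\<close> maps the interior of \<open>J\<close> into itself, so the
  preimages of \<open>W\<close> under the iterates of the shift decrease. They have equal mass,
  hence their intersection is an invariant set with the mass of \<open>W\<close>. This mass is
  positive because \<open>F\<close> meets the interior of \<open>J\<close>, and ergodicity makes it
  full.\<close>

lemma AE_in_interior: "AE x in nat_measure. x \<in> interior J"
proof -
  have bI: "interior J \<in> sets borel" by simp
  define W where "W = interior J \<inter> F"
  have W: "W \<in> sets nat_measure" unfolding W_def by (rule borel_Int_F[OF bI])
  have sub: "shift -` W \<inter> F \<subseteq> W"
  proof
    fix x assume "x \<in> shift -` W \<inter> F"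
    then have "x \<in> F" "shift x \<in> interior J" by (auto simp: W_def)
    then show "x \<in> W" using S_int_J_subset[of "idx x"] idx[of x] shift_eq[of x] by (force simp: W_def)
  qed
  define V where "V = (\<Inter>n. {x \<in> F. (shift ^^ n) x \<in> W})"
  have sW: "{x \<in> F. (shift ^^ n) x \<in> W} \<in> sets nat_measure \<and> measure nat_measure {x \<in> F. (shift ^^ n) x \<in> W} = measure nat_measure W" for n
  proof (induction n)
    case 0
    have "{x \<in> F. x \<in> W} = W" by (auto simp: W_def)
    then show ?case using W by simp
  next
    case (Suc n)
    have eq: "{x \<in> F. (shift ^^ Suc n) x \<in> W} = shift -` {x \<in> F. (shift ^^ n) x \<in> W} \<inter> F"
      using shift_in by (auto simp: funpow_Suc_right simp del: funpow.simps)
    note s = conjunct1[OF Suc] and m = conjunct2[OF Suc]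
    show ?case unfolding eq
      by (intro conjI shift_vimage_sets[OF s]) (rule trans[OF measure_shift_vimage[OF s] m])
  qed
  have step: "{x \<in> F. (shift ^^ Suc n) x \<in> W} \<subseteq> {x \<in> F. (shift ^^ n) x \<in> W}" for n
  proof clarify
    fix x assume x: "x \<in> F" "(shift ^^ Suc n) x \<in> W"
    have "(shift ^^ n) x \<in> F" using x(1) by (induction n) (auto simp: shift_in)
    then show "(shift ^^ n) x \<in> W" using x(2) sub by auto
  qed
  have Vs: "V \<in> sets nat_measure" unfolding V_def using sW by (intro sets.countable_INT) auto
  have "(\<lambda>n. measure nat_measure {x \<in> F. (shift ^^ n) x \<in> W}) \<longlonglongrightarrow> measure nat_measure V"
    unfolding V_def using sW step by (intro nat.finite_Lim_measure_decseq decseq_SucI) auto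
  then have "(\<lambda>n. measure nat_measure W) \<longlonglongrightarrow> measure nat_measure V" using sW by simp
  then have mV: "measure nat_measure V = measure nat_measure W"
    by (rule LIMSEQ_unique) (rule tendsto_const)
  have "shift -` V \<inter> F = V"
  proof (intro equalityI subsetI)
    fix x assume x: "x \<in> shift -` V \<inter> F"
    then have s: "(shift ^^ Suc n) x \<in> W" for n by (auto simp: V_def funpow_Suc_right simp del: funpow.simps)
    have "shift x \<in> W" using s[of 0] by simp
    then have "x \<in> W" using step[of 0] x by auto
    then have "(shift ^^ n) x \<in> W" for n using s[of "n - 1"] by (cases n) auto
    then show "x \<in> V" using x by (auto simp: V_def)
  next
    fix x assume x: "x \<in> V"
    then have "(shift ^^ Suc n) x \<in> W" for n unfolding V_def by blast
    then show "x \<in> shift -` V \<inter> F"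
      using x shift_in by (auto simp: V_def funpow_Suc_right simp del: funpow.simps)
  qed
  then have "emeasure nat_measure V = 0 \<or> emeasure nat_measure (F - V) = 0"
    using ergodic.ergodic[OF Vs] by simp
  moreover have "0 < measure nat_measure V"
  proof -
    obtain x where x: "x \<in> F" "x \<in> interior J" using F_int_J by auto
    obtain e where e: "e > 0" "ball x e \<subseteq> interior J" using open_contains_ball[of "interior J"] x by auto
    obtain n where "rmax ^ n * (diameter F + 1) \<le> e" using rmax_power_less[OF e(1)] by blast
    then have "0 < measure nat_measure (ball x e \<inter> F)" by (rule measure_ball_pos[OF x(1)])
    also have "\<dots> \<le> measure nat_measure W" using e W by (intro nat.finite_measure_mono) (auto simp: W_def)
    finally show ?thesis using mV by simp
  qed
  ultimately have "emeasure nat_measure (F - V) = 0" by (auto simp: nat.emeasure_eq_measure)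
  moreover have "V \<subseteq> W"
  proof
    fix x assume "x \<in> V"
    then have "(shift ^^ 0) x \<in> W" unfolding V_def by blast
    then show "x \<in> W" by simp
  qed
  ultimately show ?thesis
    using Vs F_sets_nat by (intro AE_I[where N = "F - V"]) (auto simp: W_def)
qed

end

section \<open>Area of level sets of the distance function\<close>

lemma hausdorff_outer_UN_finite:
  "finite I \<Longrightarrow> hausdorff_outer s (\<Union>i\<in>I. A i) \<le> (\<Sum>i\<in>I. hausdorff_outer s (A i :: 'a::metric_space set))"
proof (induction I rule: finite_induct)
  case (insert i I)
  then show ?case
    using hausdorff_outer_Un[of s "A i" "\<Union>i\<in>I. A i"] by (simp add: add_left_mono order_trans)
qed simp

lemma infdist_frontier_parallel_set:
  fixes F :: "'a::metric_space set"
  assumes "z \<in> frontier (parallel_set F \<epsilon>)"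
  shows "infdist z F = \<epsilon>"
proof (rule antisym)
  have "closed (parallel_set F \<epsilon>)"
    unfolding parallel_set_def by (intro closed_Collect_le continuous_intros)
  then have "z \<in> parallel_set F \<epsilon>" using assms by (simp add: frontier_def)
  then show "infdist z F \<le> \<epsilon>" by (simp add: parallel_set_def)
  have "open {x. infdist x F < \<epsilon>}" by (intro open_Collect_less continuous_intros)
  then have "{x. infdist x F < \<epsilon>} \<subseteq> interior (parallel_set F \<epsilon>)"
    by (intro interior_maximal) (auto simp: parallel_set_def)
  then show "\<epsilon> \<le> infdist z F" using assms by (force simp: frontier_def)
qed

text \<open>As z' lies outside the open ball of radius \<epsilon> about y, the vector z' - z points
  towards y only to second order: its product with the unit normal at z is at least -1/6 of its
  length when the points are at most \<epsilon>/3 apart. The deviation of the normal from q costs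
  another 1/3, and exchanging z and z' gives the other side.\<close>

lemma level_set_nearly_orthogonal:
  fixes z z' :: "'a::euclidean_space"
  assumes "0 < \<epsilon>" and y: "y \<in> F" "dist z y = \<epsilon>" and y': "y' \<in> F" "dist z' y' = \<epsilon>"
    and i: "infdist z F = \<epsilon>" "infdist z' F = \<epsilon>" and close: "dist z z' \<le> \<epsilon> / 3"
    and u: "norm ((1 / \<epsilon>) *\<^sub>R (z - y) - q) \<le> 1 / 3" "norm ((1 / \<epsilon>) *\<^sub>R (z' - y') - q) \<le> 1 / 3"
  shows "\<bar>(z' - z) \<bullet> q\<bar> \<le> 1 / 2 * norm (z' - z)"
proof -
  have half: "- (1 / 2 * norm (w' - w)) \<le> (w' - w) \<bullet> q"
    if "p \<in> F" "dist w p = \<epsilon>" "infdist w' F = \<epsilon>" "dist w w' \<le> \<epsilon> / 3" "norm ((1 / \<epsilon>) *\<^sub>R (w - p) - q) \<le> 1 / 3" for w w' p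
  proof -
    define u where "u = (1 / \<epsilon>) *\<^sub>R (w - p)"
    have wp: "w - p = \<epsilon> *\<^sub>R u" using \<open>0 < \<epsilon>\<close> by (simp add: u_def)
    have "\<epsilon> \<le> norm (w' - p)" using infdist_le[OF that(1), of w'] that(3) by (simp add: dist_norm)
    then have "\<epsilon>\<^sup>2 \<le> (norm (w' - p))\<^sup>2" using \<open>0 < \<epsilon>\<close> by (intro power_mono) auto
    also have "w' - p = (w' - w) + (w - p)" by simp
    also have "(norm \<dots>)\<^sup>2 = (norm (w' - w))\<^sup>2 + 2 * ((w' - w) \<bullet> (w - p)) + (norm (w - p))\<^sup>2"
      by (simp add: power2_norm_eq_inner algebra_simps inner_commute)
    also have "norm (w - p) = \<epsilon>" using that(2) by (simp add: dist_norm)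
    finally have "0 \<le> norm (w' - w) * norm (w' - w) + 2 * (\<epsilon> * ((w' - w) \<bullet> u))"
      by (simp add: wp power2_eq_square)
    also have "\<dots> \<le> norm (w' - w) * (\<epsilon> / 3) + 2 * (\<epsilon> * ((w' - w) \<bullet> u))"
      using that(4) by (intro add_right_mono mult_left_mono) (auto simp: dist_norm norm_minus_commute)
    also have "\<dots> = \<epsilon> * (norm (w' - w) / 3 + 2 * ((w' - w) \<bullet> u))" by (simp add: algebra_simps)
    finally have "0 \<le> norm (w' - w) / 3 + 2 * ((w' - w) \<bullet> u)" using \<open>0 < \<epsilon>\<close> by (simp add: zero_le_mult_iff)
    moreover have "(w' - w) \<bullet> u - (w' - w) \<bullet> q \<le> norm (w' - w) * (1 / 3)"
    proof -
      have "(w' - w) \<bullet> (u - q) \<le> norm (w' - w) * norm (u - q)" by (rule norm_cauchy_schwarz)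
      also have "\<dots> \<le> norm (w' - w) * (1 / 3)" using that(5) by (intro mult_left_mono) (auto simp: u_def)
      finally show ?thesis by (simp add: inner_diff_right)
    qed
    ultimately show ?thesis by simp
  qed
  have "- (1 / 2 * norm (z' - z)) \<le> (z' - z) \<bullet> q" by (rule half[of y]) (use assms in auto)
  moreover have "- (1 / 2 * norm (z - z')) \<le> (z - z') \<bullet> q"
    by (rule half[of y']) (use assms in \<open>auto simp: dist_commute\<close>)
  moreover have "(z - z') \<bullet> q = - ((z' - z) \<bullet> q)" by (simp add: inner_diff_left)
  ultimately show ?thesis using norm_minus_commute[of z z'] by linarith
qed

text \<open>Scaling by 1/\<epsilon> moves positions into a fixed ball and normals into the unit
  sphere, both covered by finitely many small balls independent of \<epsilon> and x. Within a piece
  the normals are nearly constant, so the piece is nearly orthogonal to a vector q, and the grid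
  estimate applies in the \<open>DIM('a) - 1\<close> remaining directions.\<close>

lemma level_set_area_bound:
  fixes F :: "'a::euclidean_space set"
  assumes F: "closed F" "F \<noteq> {}" and "0 < a"
  obtains C where "0 \<le> C" "\<And>x \<epsilon> E. 0 < \<epsilon> \<Longrightarrow> E \<subseteq> {z. infdist z F = \<epsilon>} \<inter> cball x (a * \<epsilon>) \<Longrightarrow>
     hausdorff_outer (real (DIM('a) - 1)) E \<le> ennreal (C * \<epsilon> ^ (DIM('a) - 1))"
proof -
  let ?m = "DIM('a) - 1"
  \<comment> \<open>Radius 1/6 for the scaled positions keeps two points of a piece at most
    \<epsilon>/3 apart; this and the radius 1/3 for the normals are the tolerances of
    \<open>level_set_nearly_orthogonal\<close>.\<close>
  have "cball (0::'a) a \<subseteq> (\<Union>p\<in>UNIV. ball p (1 / 6))"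
  proof
    fix x :: 'a
    have "x \<in> ball x (1 / 6)" by simp
    then show "x \<in> (\<Union>p\<in>UNIV. ball p (1 / 6))" by blast
  qed
  then obtain P where P: "finite P" "cball (0::'a) a \<subseteq> (\<Union>p\<in>P. ball p (1 / 6))"
    by (rule compactE_image[OF compact_cball, rotated]) auto
  have "sphere (0::'a) 1 \<subseteq> (\<Union>q\<in>sphere 0 1. ball q (1 / 3))"
  proof
    fix x :: 'a assume "x \<in> sphere 0 1"
    moreover have "x \<in> ball x (1 / 3)" by simp
    ultimately show "x \<in> (\<Union>q\<in>sphere 0 1. ball q (1 / 3))" by blast
  qed
  then obtain Q where Q: "finite Q" "Q \<subseteq> sphere (0::'a) 1" "sphere (0::'a) 1 \<subseteq> (\<Union>q\<in>Q. ball q (1 / 3))"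
    by (rule compactE_image[OF compact_sphere, rotated]) auto
  define c0 where "c0 = unit_ball_vol (real ?m) * (4 * real ?m * (1 / 3)) ^ ?m"
  define C where "C = real (card (P \<times> Q)) * c0"
  have "0 \<le> c0" by (simp add: c0_def)
  have "hausdorff_outer (real ?m) E \<le> ennreal (C * \<epsilon> ^ ?m)"
    if "0 < \<epsilon>" and E: "E \<subseteq> {z. infdist z F = \<epsilon>} \<inter> cball x (a * \<epsilon>)" for x \<epsilon> E
  proof -
    define y where "y z = closest_point F z" for z
    define u where "u z = (1 / \<epsilon>) *\<^sub>R (z - y z)" for z
    have y: "y z \<in> F" "dist z (y z) = \<epsilon>" if "z \<in> E" for z
    proof -
      show "y z \<in> F" unfolding y_def by (rule closest_point_in_set[OF F])
      obtain p where "p \<in> F" "infdist z F = dist z p" using infdist_attains_inf[OF F] by metis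
      then show "dist z (y z) = \<epsilon>"
        using closest_point_le[OF F(1), of p z] infdist_le[OF \<open>y z \<in> F\<close>, of z] that E by (auto simp: y_def)
    qed
    define piece where "piece i = {z \<in> E. (1 / \<epsilon>) *\<^sub>R (z - x) \<in> ball (fst i) (1 / 6) \<and> u z \<in> ball (snd i) (1 / 3)}" for i
    have "E \<subseteq> (\<Union>i\<in>P \<times> Q. piece i)"
    proof
      fix z assume z: "z \<in> E"
      have "norm (z - x) \<le> a * \<epsilon>" using z E by (auto simp: dist_norm norm_minus_commute)
      then have "(1 / \<epsilon>) *\<^sub>R (z - x) \<in> cball 0 a" using \<open>0 < \<epsilon>\<close>
        by (simp add: divide_le_eq del: scaleR_right_diff_distrib)
      moreover have "u z \<in> sphere 0 1" using y[OF z] \<open>0 < \<epsilon>\<close> by (simp add: u_def dist_norm)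
      ultimately obtain p q where "p \<in> P" "(1 / \<epsilon>) *\<^sub>R (z - x) \<in> ball p (1 / 6)" "q \<in> Q" "u z \<in> ball q (1 / 3)"
        using P(2) Q(3) by blast
      then show "z \<in> (\<Union>i\<in>P \<times> Q. piece i)" using z by (auto simp: piece_def intro!: bexI[of _ "(p, q)"])
    qed
    then have "hausdorff_outer (real ?m) E \<le> hausdorff_outer (real ?m) (\<Union>i\<in>P \<times> Q. piece i)"
      by (rule hausdorff_outer_mono)
    also have "\<dots> \<le> (\<Sum>i\<in>P \<times> Q. hausdorff_outer (real ?m) (piece i))"
      using P(1) Q(1) by (intro hausdorff_outer_UN_finite) auto
    also have "\<dots> \<le> of_nat (card (P \<times> Q)) * ennreal (c0 * \<epsilon> ^ ?m)"
    proof (rule sum_bounded_above)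
      fix i assume "i \<in> P \<times> Q"
      define q where "q = snd i"
      have q: "norm q = 1" using \<open>i \<in> P \<times> Q\<close> Q(2) by (auto simp: q_def)
      have near: "dist z z' \<le> \<epsilon> / 3" if "z \<in> piece i" "z' \<in> piece i" for z z'
      proof -
        have "dist ((1 / \<epsilon>) *\<^sub>R (z - x)) ((1 / \<epsilon>) *\<^sub>R (z' - x)) \<le> 1 / 3"
          using that dist_triangle_half_l[of "fst i" "(1 / \<epsilon>) *\<^sub>R (z - x)" "1 / 3" "(1 / \<epsilon>) *\<^sub>R (z' - x)"]
            dist_triangle2[of "(1 / \<epsilon>) *\<^sub>R (z - x)" "(1 / \<epsilon>) *\<^sub>R (z' - x)" "fst i"]
          by (auto simp: piece_def dist_commute)
        moreover have "(1 / \<epsilon>) *\<^sub>R (z - x) - (1 / \<epsilon>) *\<^sub>R (z' - x) = (1 / \<epsilon>) *\<^sub>R (z - z')" by (simp add: algebra_simps)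
        ultimately have "norm ((1 / \<epsilon>) *\<^sub>R (z - z')) \<le> 1 / 3" by (simp only: dist_norm)
        then show ?thesis using \<open>0 < \<epsilon>\<close> by (simp add: dist_norm divide_le_eq)
      qed
      obtain B where B: "q \<in> B" "pairwise orthogonal B" "\<And>b. b \<in> B \<Longrightarrow> norm b = 1" "independent B" "card B = DIM('a)" "span B = UNIV"
        using vector_in_orthonormal_basis[OF q] by metis
      have fB: "finite B" using B(4) by (rule independent_imp_finite)
      show "hausdorff_outer (real ?m) (piece i) \<le> ennreal (c0 * \<epsilon> ^ ?m)"
      proof (cases "piece i = {}")
        case False
        then obtain z0 where z0: "z0 \<in> piece i" by auto
        have "hausdorff_outer (real (card (B - {q}))) (piece i) \<le>
          ennreal (unit_ball_vol (real (card (B - {q}))) * (2 * 2 * real (card (B - {q})) * (\<epsilon> / 3)) ^ card (B - {q}))"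
        proof (rule hausdorff_outer_grid[where z = z0])
          fix z z' assume zz: "z \<in> piece i" "z' \<in> piece i"
          then have zE: "z \<in> E" "z' \<in> E" by (auto simp: piece_def)
          have "\<bar>(z - z') \<bullet> q\<bar> \<le> 1 / 2 * norm (z - z')"
            by (rule level_set_nearly_orthogonal[OF \<open>0 < \<epsilon>\<close> y[OF zE(2)] y[OF zE(1)]])
              (use zz zE E near in \<open>auto simp: piece_def u_def q_def dist_norm norm_minus_commute intro: less_imp_le\<close>)
          \<comment> \<open>The component along q is at most half of the length and can be absorbed,
            which gives the constant 2 in the grid estimate.\<close>
          moreover have "norm (z - z') \<le> \<bar>(z - z') \<bullet> q\<bar> + (\<Sum>b\<in>B - {q}. \<bar>(z - z') \<bullet> b\<bar>)"
          proof -
            have "z - z' = (\<Sum>b\<in>B. ((z - z') \<bullet> b) *\<^sub>R b)"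
              using orthonormal_basis_expand[OF B(2,3) _ fB, of "z - z'"] B(6) by simp
            then have "norm (z - z') \<le> (\<Sum>b\<in>B. norm (((z - z') \<bullet> b) *\<^sub>R b))" by (metis norm_sum)
            also have "\<dots> = (\<Sum>b\<in>B. \<bar>(z - z') \<bullet> b\<bar>)" using B(3) by simp
            also have "\<dots> = \<bar>(z - z') \<bullet> q\<bar> + (\<Sum>b\<in>B - {q}. \<bar>(z - z') \<bullet> b\<bar>)" using fB B(1) by (rule sum.remove)
            finally show ?thesis .
          qed
          ultimately show "dist z z' \<le> 2 * (\<Sum>b\<in>B - {q}. \<bar>(z - z') \<bullet> b\<bar>)" by (simp add: dist_norm)
        next
          fix z b assume z: "z \<in> piece i" and b: "b \<in> B - {q}"
          have "\<bar>(z - z0) \<bullet> b\<bar> \<le> norm (z - z0) * norm b" by (rule Cauchy_Schwarz_ineq2)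
          then show "\<bar>(z - z0) \<bullet> b\<bar> \<le> \<epsilon> / 3" using near[OF z z0] B(3) b by (simp add: dist_norm)
        qed (use fB \<open>0 < \<epsilon>\<close> in auto)
        moreover have "card (B - {q}) = ?m" using fB B(1,5) by simp
        moreover have "(2 * 2 * real ?m * (\<epsilon> / 3)) ^ ?m = (4 * real ?m * (1 / 3)) ^ ?m * \<epsilon> ^ ?m"
          by (subst power_mult_distrib[symmetric]) simp
        ultimately show ?thesis by (simp only: c0_def mult.assoc)
      qed simp
    qed
    also have "\<dots> = ennreal (C * \<epsilon> ^ ?m)"
      using \<open>0 \<le> c0\<close> \<open>0 < \<epsilon>\<close> by (simp only: C_def mult.assoc ennreal_of_nat_eq_real_of_nat) (subst ennreal_mult, auto)
    finally show ?thesis .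
  qed
  moreover have "0 \<le> C" using \<open>0 \<le> c0\<close> by (simp add: C_def)
  ultimately show ?thesis by (intro that) auto
qed

section \<open>Scaling of curvature measures\<close>

lemma unique_projection_if_less_reach:
  fixes X :: "'a::euclidean_space set"
  assumes "closed X" "X \<noteq> {}" "ereal R < reach X"
  shows "unique_projection X R"
proof
  fix p assume "p \<in> X"
  then have "ereal R < reach_at X p" using assms(3) by (simp add: reach_def less_INF_D)
  then obtain \<rho> where "ball p \<rho> \<subseteq> unique_nearest X" "R < \<rho>" by (auto simp: reach_at_def less_Sup_iff)
  then show "ball p R \<subseteq> unique_nearest X" using subset_ball[of R \<rho> p] by auto
qed (use assms in auto)

text \<open>Each R below the reach gives a polynomial for the volumes up to R. Two of these agree on
  an interval and hence coincide, so one polynomial serves all radii below the reach. The factor h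
  relates Hausdorff to Lebesgue measure.\<close>

lemma local_steiner_formula_exists:
  fixes X :: "'a::euclidean_space set"
  assumes X: "positive_reach X" and B: "B \<in> sets borel" "bounded B"
  shows "\<exists>c. local_steiner_formula X B c"
proof (cases "X = {}")
  case True
  then have "local_parallel_set X \<rho> B = {}" for \<rho> by (auto simp: local_parallel_set_def infdist_def)
  then show ?thesis by (intro exI[of _ "\<lambda>_. 0"]) (simp add: local_steiner_formula_def)
next
  case False
  have cl: "closed X" and pos: "0 < reach X" using X by (auto simp: positive_reach_def)
  define V where "V \<rho> = measure lborel (local_parallel_set X \<rho> B)" for \<rho>
  have poly: "\<exists>Q. degree Q \<le> DIM('a) \<and> coeff Q 0 = 0 \<and> (\<forall>\<rho>. 0 < \<rho> \<and> \<rho> < R \<longrightarrow> V \<rho> = poly Q \<rho>)"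
    if "0 < R" "ereal R < reach X" for R
  proof -
    interpret unique_projection X R by (rule unique_projection_if_less_reach[OF cl False that(2)])
    show ?thesis using local_parallel_volume_poly[OF that(1) B] unfolding V_def by metis
  qed
  obtain R0 where R0: "0 < R0" "ereal R0 < reach X"
    using ereal_dense2[OF pos] by auto
  obtain Q where Q: "degree Q \<le> DIM('a)" "coeff Q 0 = 0" "\<And>\<rho>. 0 < \<rho> \<Longrightarrow> \<rho> < R0 \<Longrightarrow> V \<rho> = poly Q \<rho>"
    using poly[OF R0] by blast
  have V: "V \<rho> = poly Q \<rho>" if \<rho>: "0 < \<rho>" "ereal \<rho> < reach X" for \<rho>
  proof -
    obtain R where R: "\<rho> < R" "ereal R < reach X" using ereal_dense2[OF \<rho>(2)] by auto
    obtain Q' where Q': "\<And>\<rho>. 0 < \<rho> \<Longrightarrow> \<rho> < R \<Longrightarrow> V \<rho> = poly Q' \<rho>" using poly[of R] R \<rho> by auto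
    have "Q' - Q = 0"
    proof (rule ccontr)
      assume "Q' - Q \<noteq> 0"
      then have "finite {x. poly (Q' - Q) x = 0}" by (rule poly_roots_finite)
      moreover have "{0<..<min R R0} \<subseteq> {x. poly (Q' - Q) x = 0}"
      proof
        fix x assume "x \<in> {0<..<min R R0}"
        then have "poly Q' x = poly Q x" using Q(3)[of x] Q'[of x] by auto
        then show "x \<in> {x. poly (Q' - Q) x = 0}" by simp
      qed
      ultimately have "finite {0<..<min R R0}" by (rule finite_subset[rotated])
      then show False using R0 R \<rho> by (simp add: infinite_Ioo)
    qed
    then show ?thesis using Q' R \<rho> by simp
  qed
  obtain h where h: "0 \<le> h" "\<And>A :: 'a set. A \<in> sets borel \<Longrightarrow>
      emeasure (hausdorff_measure (real DIM('a))) A = ennreal h * emeasure lborel A"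
    by (rule hausdorff_DIM_eq_lborel) blast
  define c where "c k = h * coeff Q (DIM('a) - k) / unit_ball_vol (real (DIM('a) - k))" for k
  have "local_steiner_formula X B c"
    unfolding local_steiner_formula_def
  proof (intro allI impI, elim conjE)
    fix \<rho> :: real assume \<rho>: "0 < \<rho>" "ereal \<rho> < reach X"
    obtain R where R: "\<rho> < R" "ereal R < reach X" using ereal_dense2[OF \<rho>(2)] by auto
    interpret unique_projection X R by (rule unique_projection_if_less_reach[OF cl False R(2)])
    have "local_parallel_set X \<rho> B \<in> sets borel" by (rule sets_local_parallel_set[OF R(1) B(1)])
    then have "measure (hausdorff_measure (real DIM('a))) (local_parallel_set X \<rho> B) = h * V \<rho>"
      using h by (simp add: measure_def enn2real_mult V_def)
    also have "V \<rho> = (\<Sum>i\<le>DIM('a). coeff Q i * \<rho> ^ i)"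
      unfolding V[OF \<rho>] poly_altdef using Q(1) by (intro sum.mono_neutral_left) (auto simp: coeff_eq_0)
    also have "\<dots> = (\<Sum>i=1..DIM('a). coeff Q i * \<rho> ^ i)"
      using Q(2) by (intro sum.mono_neutral_right) (auto simp: not_le)
    also have "h * \<dots> = (\<Sum>i=1..DIM('a). unit_ball_vol (real i) * \<rho> ^ i * c (DIM('a) - i))"
      unfolding sum_distrib_left
    proof (intro sum.cong refl)
      fix i assume i: "i \<in> {1..DIM('a)}"
      have "unit_ball_vol (real i) \<noteq> 0" using unit_ball_vol_pos[of "real i"] by linarith
      then show "h * (coeff Q i * \<rho> ^ i) = unit_ball_vol (real i) * \<rho> ^ i * c (DIM('a) - i)"
        using i by (simp add: c_def)
    qed
    finally show "measure (hausdorff_measure (real DIM('a))) (local_parallel_set X \<rho> B) =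
      (\<Sum>i=1..DIM('a). unit_ball_vol (real i) * \<rho> ^ i * c (DIM('a) - i))" .
  qed
  then show ?thesis by blast
qed

lemma steiner_coefficients_unique:
  fixes c c' :: "nat \<Rightarrow> real"
  assumes "0 < e" and eq: "\<And>\<rho>. 0 < \<rho> \<Longrightarrow> \<rho> < e \<Longrightarrow>
      (\<Sum>i=1..d. unit_ball_vol (real i) * \<rho> ^ i * c (d - i)) = (\<Sum>i=1..d. unit_ball_vol (real i) * \<rho> ^ i * c' (d - i))"
    and "k < d"
  shows "c k = c' k"
proof -
  define P where "P = (\<Sum>i=1..d. monom (unit_ball_vol (real i) * (c (d - i) - c' (d - i))) i)"
  have "poly P \<rho> = 0" if "0 < \<rho>" "\<rho> < e" for \<rho>
  proof -
    have "poly P \<rho> = (\<Sum>i=1..d. unit_ball_vol (real i) * \<rho> ^ i * c (d - i)) - (\<Sum>i=1..d. unit_ball_vol (real i) * \<rho> ^ i * c' (d - i))"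
      unfolding P_def poly_sum poly_monom sum_subtractf[symmetric] by (intro sum.cong) (auto simp: algebra_simps)
    then show ?thesis using eq[OF that] by simp
  qed
  then have sub: "{0<..<e} \<subseteq> {x. poly P x = 0}" by auto
  have "P = 0"
  proof (rule ccontr)
    assume "P \<noteq> 0"
    then have "finite {0<..<e}" using poly_roots_finite[of P] sub finite_subset by blast
    then show False using \<open>0 < e\<close> by (simp add: infinite_Ioo)
  qed
  then have "0 = coeff P (d - k)" by simp
  also have "coeff P (d - k) = (\<Sum>i=1..d. if i = d - k then unit_ball_vol (real i) * (c (d - i) - c' (d - i)) else 0)"
    unfolding P_def coeff_sum coeff_monom by simp
  also have "\<dots> = unit_ball_vol (real (d - k)) * (c k - c' k)" using \<open>k < d\<close> by (subst sum.delta) auto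
  finally have "unit_ball_vol (real (d - k)) * (c k - c' k) = 0" by simp
  moreover have "unit_ball_vol (real (d - k)) \<noteq> 0"
    using unit_ball_vol_pos[of "real (d - k)"] by (metis less_irrefl of_nat_0_le_iff)
  ultimately show ?thesis by simp
qed

lemma curvature_measure_eqI:
  fixes X :: "'a::euclidean_space set"
  assumes X: "positive_reach X" and c: "local_steiner_formula X B c" and "k < DIM('a)"
  shows "curvature_measure k X B = c k"
  unfolding curvature_measure_def
proof (rule the_equality)
  show "\<exists>c'. local_steiner_formula X B c' \<and> c' k = c k" using c by blast
  fix t assume "\<exists>c'. local_steiner_formula X B c' \<and> c' k = t"
  then obtain c' where c': "local_steiner_formula X B c'" "c' k = t" by blast
  have "0 < reach X" using X by (simp add: positive_reach_def)
  then obtain e where e: "0 < e" "ereal e < reach X" using ereal_dense2 by force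
  have "c' k = c k"
    by (rule steiner_coefficients_unique[OF e(1) _ \<open>k < DIM('a)\<close>])
      (use c c'(1) e in \<open>auto simp: local_steiner_formula_def dest!: spec intro: less_trans[of "ereal _" "ereal e"]\<close>)
  then show "t = c k" using c'(2) by simp
qed

text \<open>A point of \<open>Y\<close> closer to z than p would lie within 2 \<rho> < e of p, hence
  in \<open>X\<close>, where p is nearest.\<close>

lemma nearest_point_transfer:
  fixes X Y :: "'a::euclidean_space set"
  assumes p: "p \<in> X" "p \<in> Y" "dist z p = infdist z X" and "dist z p \<le> \<rho>" "2 * \<rho> < e"
    and XY: "\<And>q. dist p q < e \<Longrightarrow> q \<in> Y \<Longrightarrow> q \<in> X"
  shows "dist z p = infdist z Y"
proof (rule antisym)
  show "infdist z Y \<le> dist z p" by (rule infdist_le[OF p(2)])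
  show "dist z p \<le> infdist z Y"
  proof (rule ccontr)
    assume "\<not> dist z p \<le> infdist z Y"
    then have "infdist z Y < dist z p" by simp
    moreover have "infdist z Y = (INF y\<in>Y. dist z y)" using p(2) by (auto simp: infdist_def)
    ultimately obtain q where q: "q \<in> Y" "dist z q < dist z p"
      using cINF_less_iff[of Y "\<lambda>y. dist z y" "dist z p"] p(2) by (auto intro: bdd_belowI2[of _ 0])
    then have "dist p q < e" using dist_triangle3[of p q z] assms(4,5) by linarith
    then have "q \<in> X" using XY q(1) by blast
    then show False using infdist_le[of q X z] q(2) p(3) by simp
  qed
qed

text \<open>Near the image of \<open>B\<close> the set \<open>X\<close> coincides with the image of
  \<open>Y\<close>, so for small radii the local parallel sets correspond under \<open>f\<close> and
  their volumes differ by the factor r^d. A small range of radii already determines the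
  coefficients, and r^d (\<rho>/r)^i = r^(d - i) \<rho>^i leaves r^k at order k = d - i.\<close>

lemma curvature_measure_similarity:
  fixes X Y :: "'a::euclidean_space set"
  assumes f: "similarity r f" and X: "positive_reach X" and Y: "positive_reach Y"
    and B: "B \<in> sets borel" "bounded B" and "0 < e"
    and loc: "\<And>p q. p \<in> f ` B \<Longrightarrow> dist p q < e \<Longrightarrow> q \<in> X \<longleftrightarrow> q \<in> f ` Y"
    and k: "k < DIM('a)"
  shows "curvature_measure k X (f ` B) = r ^ k * curvature_measure k Y B"
proof -
  note f' = similarityD[OF f]
  have fb: "bounded (f ` B)"
  proof -
    obtain C where C: "\<forall>x\<in>B. \<forall>y\<in>B. dist x y \<le> C" using B(2) unfolding bounded_two_points by metis
    show ?thesis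
      unfolding bounded_two_points by (rule exI[of _ "r * C"]) (use C f'(1,2) in auto)
  qed
  obtain c where c: "local_steiner_formula X (f ` B) c"
    using local_steiner_formula_exists[OF X similarity_image_borel[OF f B(1)] fb] by blast
  obtain c' where c': "local_steiner_formula Y B c'"
    using local_steiner_formula_exists[OF Y B] by blast
  obtain R1 where R1: "0 < R1" "ereal R1 < reach X" using X ereal_dense2 by (force simp: positive_reach_def)
  obtain R2 where R2: "0 < R2" "ereal R2 < reach Y" using Y ereal_dense2 by (force simp: positive_reach_def)
  have clX: "closed X" and clY: "closed Y" using X Y by (auto simp: positive_reach_def)
  \<comment> \<open>The bound e/2 makes nearest points a local matter; R1 and r R2 keep the radii
    below the reach on both sides of \<open>f\<close>.\<close>
  define \<delta> where "\<delta> = min (e / 2) (min R1 (r * R2))"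
  have \<delta>: "0 < \<delta>" using R1 R2 f'(1) \<open>0 < e\<close> by (simp add: \<delta>_def)
  have locf: "f p' \<in> X \<longleftrightarrow> p' \<in> Y" if "p' \<in> B" for p'
    using loc[of "f p'" "f p'"] that \<open>0 < e\<close> f'(4) by (auto simp: inj_image_mem_iff)
  have img: "local_parallel_set X \<rho> (f ` B) = f ` local_parallel_set Y (\<rho> / r) B" if \<rho>: "0 < \<rho>" "\<rho> < \<delta>" for \<rho>
  proof (intro equalityI subsetI)
    fix z assume z: "z \<in> local_parallel_set X \<rho> (f ` B)"
    then have ne: "X \<noteq> {}" by (auto simp: local_parallel_set_def infdist_def)
    interpret UX: unique_projection X R1 by (rule unique_projection_if_less_reach[OF clX ne R1(2)])
    define p where "p = closest_point X z"
    have p: "p \<in> f ` B" "p \<in> X" "dist z p = infdist z X" "0 < infdist z X" "infdist z X \<le> \<rho>"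
      using z UX.proj_in UX.dist_proj by (auto simp: local_parallel_set_def p_def)
    obtain p' where p': "p' \<in> B" "p = f p'" using p(1) by blast
    obtain z' where z': "z = f z'" using f'(5) by blast
    have pY: "p \<in> f ` Y" using locf[OF p'(1)] p p' by auto
    have "dist z p = infdist z (f ` Y)"
      by (rule nearest_point_transfer[OF p(2) pY p(3), of \<rho> e]) (use p \<rho> loc[OF p(1)] in \<open>auto simp: \<delta>_def\<close>)
    then have "r * dist z' p' = r * infdist z' Y"
      unfolding z' p'(2) similarity_infdist[OF f] f'(2) .
    then have d: "dist z' p' = infdist z' Y" using f'(1) by simp
    have dz: "r * infdist z' Y = infdist z X" using d p(3) f'(2) z' p'(2) by simp
    have p'Y: "p' \<in> Y" using locf[OF p'(1)] p p' by auto
    then have neY: "Y \<noteq> {}" by auto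
    interpret UY: unique_projection Y R2 by (rule unique_projection_if_less_reach[OF clY neY R2(2)])
    have "r * infdist z' Y < r * R2" using dz p(5) \<rho> by (simp add: \<delta>_def)
    then have "infdist z' Y < R2" using f'(1) by simp
    then have "closest_point Y z' = p'" by (rule UY.proj_eqI[OF _ p'Y d])
    moreover have "infdist z' Y \<le> \<rho> / r" using dz p(5) f'(1) by (simp add: field_simps)
    moreover have "0 < infdist z' Y" using dz p(4) f'(1) by (metis zero_less_mult_pos)
    ultimately show "z \<in> f ` local_parallel_set Y (\<rho> / r) B"
      using z' p' by (auto simp: local_parallel_set_def)
  next
    fix z assume "z \<in> f ` local_parallel_set Y (\<rho> / r) B"
    then obtain z' where z': "z = f z'" "z' \<in> local_parallel_set Y (\<rho> / r) B" by blast
    then have neY: "Y \<noteq> {}" by (auto simp: local_parallel_set_def infdist_def)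
    interpret UY: unique_projection Y R2 by (rule unique_projection_if_less_reach[OF clY neY R2(2)])
    define p' where "p' = closest_point Y z'"
    have p': "p' \<in> B" "p' \<in> Y" "dist z' p' = infdist z' Y" "0 < infdist z' Y" "infdist z' Y \<le> \<rho> / r"
      using z'(2) UY.proj_in UY.dist_proj by (auto simp: local_parallel_set_def p'_def)
    have pX: "f p' \<in> X" and pY: "f p' \<in> f ` Y" using locf[OF p'(1)] p' by auto
    have dY: "dist z (f p') = infdist z (f ` Y)" unfolding z'(1) similarity_infdist[OF f] f'(2) p'(3) ..
    have dr: "dist z (f p') = r * infdist z' Y" unfolding z'(1) f'(2) p'(3) ..
    have le: "dist z (f p') \<le> \<rho>" using p'(5) f'(1) by (simp add: dr field_simps)
    have dX: "dist z (f p') = infdist z X"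
      by (rule nearest_point_transfer[OF pY pX dY le, of e]) (use \<rho> loc p'(1) in \<open>auto simp: \<delta>_def\<close>)
    have ne: "X \<noteq> {}" using pX by auto
    interpret UX: unique_projection X R1 by (rule unique_projection_if_less_reach[OF clX ne R1(2)])
    have "closest_point X z = f p'"
      by (rule UX.proj_eqI[OF _ pX dX]) (use le dX \<rho> in \<open>auto simp: \<delta>_def\<close>)
    moreover have "0 < infdist z X" using mult_pos_pos[OF f'(1) p'(4)] dX dr by simp
    ultimately show "z \<in> local_parallel_set X \<rho> (f ` B)"
      using p' le dX dr f'(1) by (auto simp: local_parallel_set_def)
  qed
  have "c k = r ^ k * c' k"
  proof (rule steiner_coefficients_unique[OF \<delta> _ k, of c "\<lambda>k. r ^ k * c' k"])
    fix \<rho> assume \<rho>: "0 < \<rho>" "\<rho> < \<delta>"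
    have rX: "ereal \<rho> < reach X" using \<rho> R1(2) by (auto simp: \<delta>_def intro: less_trans[of "ereal \<rho>" "ereal R1"])
    have "\<rho> / r < R2" using \<rho> f'(1) by (simp add: \<delta>_def field_simps)
    then have rY: "ereal (\<rho> / r) < reach Y" using R2(2) less_trans[of "ereal (\<rho> / r)" "ereal R2"] by auto
    have bL: "local_parallel_set Y (\<rho> / r) B \<in> sets borel"
    proof (cases "Y = {}")
      case True
      then show ?thesis by (simp add: local_parallel_set_def infdist_def)
    next
      case False
      interpret UY: unique_projection Y R2 by (rule unique_projection_if_less_reach[OF clY False R2(2)])
      show ?thesis by (rule UY.sets_local_parallel_set[OF \<open>\<rho> / r < R2\<close> B(1)])
    qed
    have "(\<Sum>i=1..DIM('a). unit_ball_vol (real i) * \<rho> ^ i * c (DIM('a) - i)) =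
        measure (hausdorff_measure (real DIM('a))) (local_parallel_set X \<rho> (f ` B))"
      using c \<rho>(1) rX by (simp add: local_steiner_formula_def)
    also have "\<dots> = r ^ DIM('a) * measure (hausdorff_measure (real DIM('a))) (local_parallel_set Y (\<rho> / r) B)"
      unfolding img[OF \<rho>] using measure_hausdorff_similarity_image[OF f _ bL, of "real DIM('a)"] f'(1)
      by (simp add: powr_realpow)
    also have "measure (hausdorff_measure (real DIM('a))) (local_parallel_set Y (\<rho> / r) B) =
        (\<Sum>i=1..DIM('a). unit_ball_vol (real i) * (\<rho> / r) ^ i * c' (DIM('a) - i))"
      using c' \<rho>(1) rY f'(1) by (simp add: local_steiner_formula_def)
    also have "r ^ DIM('a) * \<dots> = (\<Sum>i=1..DIM('a). unit_ball_vol (real i) * \<rho> ^ i * (r ^ (DIM('a) - i) * c' (DIM('a) - i)))"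
      unfolding sum_distrib_left
    proof (intro sum.cong refl)
      fix i assume "i \<in> {1..DIM('a)}"
      then have "r ^ DIM('a) = r ^ (DIM('a) - i) * r ^ i" by (simp flip: power_add)
      then show "r ^ DIM('a) * (unit_ball_vol (real i) * (\<rho> / r) ^ i * c' (DIM('a) - i)) =
         unit_ball_vol (real i) * \<rho> ^ i * (r ^ (DIM('a) - i) * c' (DIM('a) - i))"
        using f'(1) by (simp add: power_divide)
    qed
    finally show "(\<Sum>i=1..DIM('a). unit_ball_vol (real i) * \<rho> ^ i * c (DIM('a) - i)) =
       (\<Sum>i=1..DIM('a). unit_ball_vol (real i) * \<rho> ^ i * (r ^ (DIM('a) - i) * c' (DIM('a) - i)))" .
  qed
  then show ?thesis
    using curvature_measure_eqI[OF X c k] curvature_measure_eqI[OF Y c' k] by simp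
qed

section \<open>Homogeneous neighborhood nets\<close>

lemma closure_eq_locally:
  assumes "open U" "q \<in> U" and eq: "\<And>w. w \<in> U \<Longrightarrow> w \<in> P \<longleftrightarrow> w \<in> P'"
  shows "q \<in> closure P \<longleftrightarrow> q \<in> closure (P' :: 'a::topological_space set)"
proof -
  have *: "U \<inter> closure A \<subseteq> closure B" if "U \<inter> A \<subseteq> B" for A B :: "'a set"
    using open_Int_closure_subset[OF assms(1), of A] closure_mono[OF that] by blast
  have "U \<inter> P \<subseteq> P'" "U \<inter> P' \<subseteq> P" using eq by auto
  then show ?thesis using *[of P P'] *[of P' P] assms(2) by blast
qed

lemma mem_interior_iff_infdist_Compl:
  fixes J :: "'a::metric_space set"
  assumes "- J \<noteq> {}"
  shows "x \<in> interior J \<longleftrightarrow> 0 < infdist x (- J)"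
proof -
  have "x \<in> interior J \<longleftrightarrow> x \<notin> closure (- J)" by (simp add: interior_closure)
  also have "\<dots> \<longleftrightarrow> infdist x (- J) \<noteq> 0" using assms by (simp add: in_closure_iff_infdist_zero)
  finally show ?thesis using infdist_nonneg[of x "- J"] by linarith
qed

lemma ball_infdist_Compl_subset: "ball x (infdist x (- J)) \<subseteq> J"
proof
  fix y assume "y \<in> ball x (infdist x (- J))"
  then show "y \<in> J" using infdist_le[of y "- J" x] by (cases "y \<in> J") auto
qed

lemma parallel_curvature_hypersurface:
  fixes F :: "'a::euclidean_space set"
  assumes "k + 1 = DIM('a)"
  shows "parallel_curvature k F \<epsilon> B = measure (hausdorff_measure (real k)) (frontier (parallel_set F \<epsilon>) \<inter> B) / 2"
proof -
  have "DIM('a) - 1 = k" using assms by simp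
  then show ?thesis unfolding parallel_curvature_def using assms by simp
qed

locale curvature_net = iterated_function_system_osc N S r F J
  for N :: nat and S :: "nat \<Rightarrow> 'a::euclidean_space \<Rightarrow> 'a" and r F J +
  fixes k :: nat and a e0 :: real and A :: "'a \<Rightarrow> real \<Rightarrow> 'a set"
  assumes k_le: "k \<le> DIM('a)"
    and regular: "k + 2 \<le> DIM('a) \<Longrightarrow> neighborhood_regular F"
    and a1: "1 < a" and e0_pos: "0 < e0"
    and net: "locally_homogeneous_net N S r F J a e0 A"
    and measurable_net: "measurable_net k sim_dim F e0 A"
begin

definition b :: real where "b = net_const a e0 J"
definition upper :: "'a \<Rightarrow> real" where "upper x = inverse b * infdist x (- J)"
text \<open>Written through the shift so that consecutive intervals fit together along an orbit;
  \<open>lower_eq\<close> recovers the distance to the complement of the copy of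
  \<open>J\<close>.\<close>

definition lower :: "'a \<Rightarrow> real" where "lower x = r (idx x) * upper (shift x)"

abbreviation curv :: "'a \<Rightarrow> real \<Rightarrow> real" where "curv x \<epsilon> \<equiv> scaled_curvature k F A x \<epsilon>"

lemma b_ge: "2 * a \<le> b" "inverse e0 * diameter J \<le> b" and b_pos: "0 < b"
  using a1 by (auto simp: b_def net_const_def)

lemma Compl_J_nonempty: "- J \<noteq> {}"
proof
  assume "- J = {}"
  then have "J = UNIV" by auto
  then show False using compact_imp_bounded[OF J_compact] not_bounded_UNIV by simp
qed

lemma upper_nonneg: "0 \<le> upper x"
  using b_pos by (simp add: upper_def infdist_nonneg)

lemma upper_pos: "x \<in> interior J \<Longrightarrow> 0 < upper x"
  using b_pos mem_interior_iff_infdist_Compl[OF Compl_J_nonempty, of x] by (simp add: upper_def)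

text \<open>If \<rho> > 0 is the distance to the complement, the open ball of radius \<rho> lies in
  \<open>J\<close>, and two opposite points at distance 3 \<rho>/4 from its centre show that the
  diameter of \<open>J\<close> exceeds \<rho>. Strictness places \<open>upper\<close> inside the
  open range of parameters on which the net is given.\<close>

lemma upper_less: "upper x < e0"
proof (cases "infdist x (- J) = 0")
  case False
  define \<rho> where "\<rho> = infdist x (- J)"
  have \<rho>: "0 < \<rho>" using False infdist_nonneg[of x "- J"] by (simp add: \<rho>_def)
  obtain e :: 'a where e: "norm e = 1" using vector_choose_size[of 1] by auto
  have "x + (3 / 4 * \<rho>) *\<^sub>R e \<in> J" "x - (3 / 4 * \<rho>) *\<^sub>R e \<in> J"
    using ball_infdist_Compl_subset[of x J] \<rho> e by (auto simp: \<rho>_def[symmetric] dist_norm subset_iff)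
  then have "dist (x + (3 / 4 * \<rho>) *\<^sub>R e) (x - (3 / 4 * \<rho>) *\<^sub>R e) \<le> diameter J"
    using diameter_bounded_bound[OF compact_imp_bounded[OF J_compact]] by blast
  moreover have "x + (3 / 4 * \<rho>) *\<^sub>R e - (x - (3 / 4 * \<rho>) *\<^sub>R e) = (3 / 2 * \<rho>) *\<^sub>R e"
    by (simp add: scaleR_left_distrib[symmetric])
  ultimately have "3 / 2 * \<rho> \<le> diameter J" using \<rho> e by (simp add: dist_norm)
  also have "diameter J \<le> b * e0" using b_ge(2) e0_pos by (simp add: field_simps)
  finally have "\<rho> < b * e0" using \<rho> by linarith
  then show ?thesis using b_pos by (simp add: upper_def \<rho>_def[symmetric] field_simps)
qed (use e0_pos in \<open>simp add: upper_def\<close>)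

lemma infdist_Compl_S_J:
  assumes "x \<in> F"
  shows "infdist x (- (S (idx x) ` J)) = r (idx x) * infdist (shift x) (- J)"
proof -
  have j: "idx x \<in> {1..N}" using idx[OF assms] by simp
  have "infdist (S (idx x) (shift x)) (S (idx x) ` (- J)) = r (idx x) * infdist (shift x) (- J)"
    by (rule similarity_infdist[OF sim[OF j]])
  then show ?thesis using shift_eq[OF assms] by (simp add: similarity_image_Compl[OF sim[OF j]])
qed

lemma lower_eq: "x \<in> F \<Longrightarrow> lower x = inverse b * infdist x (- (S (idx x) ` J))"
  by (simp add: lower_def upper_def infdist_Compl_S_J)

lemma lower_le_upper: "x \<in> F \<Longrightarrow> lower x \<le> upper x"
proof -
  assume x: "x \<in> F"
  have "- J \<subseteq> - (S (idx x) ` J)" using S_J_subset[of "idx x"] idx[OF x] by auto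
  then have "infdist x (- (S (idx x) ` J)) \<le> infdist x (- J)" by (rule infdist_mono[OF _ Compl_J_nonempty])
  then show ?thesis using b_pos x by (simp add: lower_eq) (simp add: upper_def)
qed

lemma lower_nonneg: "x \<in> F \<Longrightarrow> 0 \<le> lower x"
  using b_pos by (simp add: lower_eq infdist_nonneg)

lemma net_subset: "x \<in> F \<Longrightarrow> 0 < \<epsilon> \<Longrightarrow> \<epsilon> < e0 \<Longrightarrow> A x \<epsilon> \<subseteq> frontier (parallel_set F \<epsilon>) \<inter> cball x (a * \<epsilon>)"
  using net unfolding locally_homogeneous_net_def by blast

lemma net_borel: "x \<in> F \<Longrightarrow> 0 < \<epsilon> \<Longrightarrow> \<epsilon> < e0 \<Longrightarrow> A x \<epsilon> \<in> sets borel"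
  using measurable_net unfolding measurable_net_def by blast

lemma net_homogeneous:
  assumes x: "x \<in> F" and \<epsilon>: "0 < \<epsilon>" "\<epsilon> < lower x"
  shows "A x \<epsilon> = S (idx x) ` A (shift x) (\<epsilon> / r (idx x))"
proof -
  have "idx x \<in> {1..N}" "x \<in> S (idx x) ` F" using idx[OF x] by auto
  moreover have "\<epsilon> < inverse (net_const a e0 J) * infdist x (- (S (idx x) ` J))"
    using \<epsilon> lower_eq[OF x] by (simp add: b_def)
  ultimately have "A x \<epsilon> = S (idx x) ` A (inv (S (idx x)) x) (inverse (r (idx x)) * \<epsilon>)"
    using net \<epsilon>(1) unfolding locally_homogeneous_net_def by blast
  then show ?thesis by (simp add: shift_def divide_inverse mult.commute)
qed

lemma scale_less_upper:
  assumes x: "x \<in> F" and \<epsilon>: "0 < \<epsilon>" "\<epsilon> < lower x"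
  shows "0 < \<epsilon> / r (idx x)" "\<epsilon> / r (idx x) < upper (shift x)" "\<epsilon> / r (idx x) < e0" "\<epsilon> < e0"
proof -
  have rj: "0 < r (idx x)" using r01 idx[OF x] by simp
  show "0 < \<epsilon> / r (idx x)" using rj \<epsilon> by simp
  show 1: "\<epsilon> / r (idx x) < upper (shift x)" using \<epsilon>(2) rj by (simp add: lower_def field_simps)
  then show "\<epsilon> / r (idx x) < e0" using upper_less[of "shift x"] by linarith
  show "\<epsilon> < e0" using \<epsilon>(2) lower_le_upper[OF x] upper_less[of x] by linarith
qed

text \<open>A point of \<open>F\<close> within \<open>\<epsilon>\<close> of \<open>w\<close> has distance less than \<open>2 a \<epsilon> \<le> b \<epsilon>\<close>, hence less than the
  distance to \<open>- S (idx x) ` J\<close>, from \<open>x\<close>; so it lies in \<open>S (idx x) ` interior J\<close> and, by the open set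
  condition, in no other copy of \<open>F\<close>.\<close>

lemma parallel_set_local:
  assumes x: "x \<in> F" and \<epsilon>: "0 < \<epsilon>" "\<epsilon> < lower x" and w: "dist x w < (2 * a - 1) * \<epsilon>"
  shows "w \<in> parallel_set F \<epsilon> \<longleftrightarrow> w \<in> S (idx x) ` parallel_set F (\<epsilon> / r (idx x))"
proof -
  define j where "j = idx x"
  have j: "j \<in> {1..N}" using idx[OF x] by (simp add: j_def)
  note sj = similarityD[OF sim[OF j]]
  have rj: "0 < r j" by (rule r01(1)[OF j])
  obtain w' where w': "w = S j w'" using sj(5) by blast
  have img: "w \<in> S j ` parallel_set F (\<epsilon> / r j) \<longleftrightarrow> infdist w (S j ` F) \<le> \<epsilon>"
  proof -
    have "infdist w (S j ` F) = r j * infdist w' F" unfolding w' by (rule similarity_infdist[OF sim[OF j]])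
    then show ?thesis using rj sj(4) by (simp add: w' inj_image_mem_iff parallel_set_def field_simps)
  qed
  have "infdist w (S j ` F) \<le> \<epsilon>" if "infdist w F \<le> \<epsilon>"
  proof -
    obtain y where y: "y \<in> F" "infdist w F = dist w y"
      using infdist_attains_inf[OF compact_imp_closed[OF F_compact] F_nonempty] by metis
    have "dist x y < 2 * a * \<epsilon>" using dist_triangle[of x y w] w y(2) that by (simp add: algebra_simps)
    also have "\<dots> \<le> b * \<epsilon>" using b_ge(1) \<epsilon>(1) by (intro mult_right_mono) auto
    also have "\<dots> < infdist x (- (S j ` J))"
      using \<epsilon>(2) b_pos lower_eq[OF x] by (simp add: j_def field_simps)
    finally have xy: "dist x y < infdist x (- (S j ` J))" .
    obtain y' where y': "y = S j y'" using sj(5) by blast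
    have "0 < infdist y (- (S j ` J))"
      using infdist_triangle[of x "- (S j ` J)" y] xy by linarith
    also have "infdist y (- (S j ` J)) = r j * infdist y' (- J)"
      unfolding y' similarity_image_Compl[OF sim[OF j], symmetric] by (rule similarity_infdist[OF sim[OF j]])
    finally have "0 < infdist y' (- J)" using rj by (simp add: zero_less_mult_iff)
    then have yj: "y \<in> S j ` interior J"
      using y' mem_interior_iff_infdist_Compl[OF Compl_J_nonempty] by blast
    obtain l where l: "l \<in> {1..N}" "y \<in> S l ` F" using y(1) F_eq by blast
    have "l = j"
    proof (rule ccontr)
      assume "l \<noteq> j"
      have "S l ` F \<subseteq> S l ` closure (interior J)" using F_subset_J J_closure by blast
      then have "y \<in> closure (S l ` interior J)"
        using l(2) similarity_closure[OF sim[OF l(1)], of "interior J"] by blast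
      moreover have "open (S j ` interior J)" by (rule similarity_open[OF sim[OF j] open_interior])
      ultimately have "S j ` interior J \<inter> S l ` interior J \<noteq> {}"
        using yj open_Int_closure_eq_empty[of "S j ` interior J" "S l ` interior J"] by blast
      then show False using S_J_disjoint[OF j l(1)] \<open>l \<noteq> j\<close> by blast
    qed
    then have "infdist w (S j ` F) \<le> dist w y" using l(2) by (intro infdist_le) auto
    then show ?thesis using y(2) that by simp
  qed
  moreover have "infdist w F \<le> infdist w (S j ` F)"
    using S_F_subset[OF j] F_nonempty by (intro infdist_mono) auto
  ultimately show ?thesis using img by (auto simp: parallel_set_def j_def[symmetric])
qed

text \<open>In orders d and d - 1 the curvature of the net is the volume or half the area of the net
  itself, which scales directly. In lower orders it depends on the parallel set near the net, where
  the parallel sets of \<open>F\<close> and of its copy agree.\<close>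

lemma parallel_curvature_homogeneous:
  assumes x: "x \<in> F" and \<epsilon>: "0 < \<epsilon>" "\<epsilon> < lower x"
    and reg: "k + 2 \<le> DIM('a) \<Longrightarrow> positive_reach (parallel_complement F \<epsilon>)"
      "k + 2 \<le> DIM('a) \<Longrightarrow> positive_reach (parallel_complement F (\<epsilon> / r (idx x)))"
  shows "parallel_curvature k F \<epsilon> (A x \<epsilon>) =
    r (idx x) ^ k * parallel_curvature k F (\<epsilon> / r (idx x)) (A (shift x) (\<epsilon> / r (idx x)))"
proof -
  define j where "j = idx x"
  define \<epsilon>' where "\<epsilon>' = \<epsilon> / r j"
  define B where "B = A (shift x) \<epsilon>'"
  have j: "j \<in> {1..N}" using idx[OF x] by (simp add: j_def)
  have rj: "0 < r j" by (rule r01(1)[OF j])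
  note sc = scale_less_upper[OF x \<epsilon>]
  have AB: "A x \<epsilon> = S j ` B" using net_homogeneous[OF x \<epsilon>] by (simp add: B_def \<epsilon>'_def j_def)
  have Tx: "shift x \<in> F" by (rule shift_in[OF x])
  have B: "B \<in> sets borel" "B \<subseteq> frontier (parallel_set F \<epsilon>')" "B \<subseteq> cball (shift x) (a * \<epsilon>')"
    using net_borel[OF Tx, of \<epsilon>'] net_subset[OF Tx, of \<epsilon>'] sc by (auto simp: B_def \<epsilon>'_def j_def)
  have A: "A x \<epsilon> \<subseteq> frontier (parallel_set F \<epsilon>)" "A x \<epsilon> \<subseteq> cball x (a * \<epsilon>)"
    using net_subset[OF x \<epsilon>(1) sc(4)] by auto
  have cl: "closed (parallel_set F e)" for e
    unfolding parallel_set_def by (intro closed_Collect_le continuous_intros)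
  have fr: "frontier (parallel_set F e) \<subseteq> parallel_set F e" for e by (rule frontier_subset_closed[OF cl])
  consider "k = DIM('a)" | "k + 1 = DIM('a)" | "k + 2 \<le> DIM('a)" using k_le by linarith
  then have "parallel_curvature k F \<epsilon> (S j ` B) = r j ^ k * parallel_curvature k F \<epsilon>' B"
  proof cases
    case 1
    have "parallel_set F \<epsilon> \<inter> S j ` B = S j ` B" "parallel_set F \<epsilon>' \<inter> B = B" using A B fr AB by blast+
    then show ?thesis
      using 1 measure_lborel_S_image[OF j B(1)] B(1) similarity_image_borel[OF sim[OF j] B(1)]
      by (simp add: parallel_curvature_def)
  next
    case 2
    have "frontier (parallel_set F \<epsilon>) \<inter> S j ` B = S j ` B" "frontier (parallel_set F \<epsilon>') \<inter> B = B" using A B AB by blast+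
    then show ?thesis
      using measure_hausdorff_similarity_image[OF sim[OF j] _ B(1), of "real k"] rj
      by (simp add: parallel_curvature_hypersurface[OF 2] powr_realpow)
  next
    case 3
    have "curvature_measure k (parallel_complement F \<epsilon>) (S j ` B) = r j ^ k * curvature_measure k (parallel_complement F \<epsilon>') B"
    proof (rule curvature_measure_similarity[OF sim[OF j] _ _ B(1) bounded_subset[OF bounded_cball B(3)]])
      show "positive_reach (parallel_complement F \<epsilon>)" "positive_reach (parallel_complement F \<epsilon>')"
        using reg 3 by (simp_all add: \<epsilon>'_def j_def)
      \<comment> \<open>The net lies within a \<epsilon> of x, and the parallel sets agree within (2
        a - 1) \<epsilon>; the difference is the locality radius, positive because a > 1.\<close>
      show "0 < (a - 1) * \<epsilon>" using a1 \<epsilon> by simp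
      fix p q assume p: "p \<in> S j ` B" and q: "dist p q < (a - 1) * \<epsilon>"
      have "dist x p \<le> a * \<epsilon>" using p A(2) AB by auto
      then have "dist x q < (2 * a - 1) * \<epsilon>" using q dist_triangle[of x q p] by (simp add: algebra_simps)
      then have qU: "q \<in> ball x ((2 * a - 1) * \<epsilon>)" by simp
      have "S j ` parallel_complement F \<epsilon>' = closure (- S j ` parallel_set F \<epsilon>')"
        unfolding parallel_complement_def similarity_closure[OF sim[OF j]] similarity_image_Compl[OF sim[OF j]] ..
      moreover have "q \<in> closure (- parallel_set F \<epsilon>) \<longleftrightarrow> q \<in> closure (- S j ` parallel_set F \<epsilon>')"
        by (rule closure_eq_locally[OF open_ball qU])
          (use parallel_set_local[OF x \<epsilon>] in \<open>auto simp: \<epsilon>'_def j_def\<close>)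
      ultimately show "q \<in> parallel_complement F \<epsilon> \<longleftrightarrow> q \<in> S j ` parallel_complement F \<epsilon>'"
        by (simp add: parallel_complement_def)
    qed (use 3 in simp)
    then show ?thesis using 3 by (simp add: parallel_curvature_def)
  qed
  then show ?thesis by (simp add: AB B_def \<epsilon>'_def j_def)
qed

text \<open>The weight \<epsilon>^(-k) absorbs the scaling r^k and \<epsilon>^(-1) leaves the factor
  1/r, so integrals over \<epsilon> are invariant under rescaling. Positive reach is needed at
  \<epsilon> and at \<epsilon>/r; the exceptional radii are a null set, and so are their
  multiples.\<close>

lemma AE_curv_homogeneous:
  assumes x: "x \<in> F"
  shows "AE \<epsilon> in lborel. 0 < \<epsilon> \<and> \<epsilon> < lower x \<longrightarrow>
    curv x \<epsilon> = 1 / r (idx x) * curv (shift x) (\<epsilon> / r (idx x))"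
proof -
  define j where "j = idx x"
  have rj: "0 < r j" using r01 idx[OF x] by (simp add: j_def)
  have reg: "AE \<epsilon> in lborel. k + 2 \<le> DIM('a) \<longrightarrow> 0 < \<epsilon> \<longrightarrow> positive_reach (parallel_complement F \<epsilon>)"
  proof (cases "k + 2 \<le> DIM('a)")
    case True
    have "AE \<epsilon> in lborel. 0 < \<epsilon> \<longrightarrow> positive_reach (parallel_complement F \<epsilon>) \<and>
        lipschitz_manifold (DIM('a) - 1) (frontier (parallel_set F \<epsilon>))"
      using regular[OF True] by (simp add: neighborhood_regular_def)
    then show ?thesis by eventually_elim auto
  qed simp
  then obtain N0 where N0: "{\<epsilon> \<in> space lborel. \<not> (k + 2 \<le> DIM('a) \<longrightarrow> 0 < \<epsilon> \<longrightarrow> positive_reach (parallel_complement F \<epsilon>))} \<subseteq> N0"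
    "emeasure lborel N0 = 0" "N0 \<in> sets lborel" by (rule AE_E)
  have "AE \<epsilon> in lborel. \<epsilon> \<notin> N0" using N0 by (intro AE_not_in) (simp add: null_sets_def)
  then have "AE \<epsilon> in lborel. 0 + (1 / r j) * \<epsilon> \<notin> N0"
    by (rule AE_borel_affine[rotated -1]) (use N0(3) rj in auto)
  with reg show ?thesis
  proof eventually_elim
    case (elim \<epsilon>)
    show ?case
    proof (intro impI)
      assume \<epsilon>: "0 < \<epsilon> \<and> \<epsilon> < lower x"
      have "positive_reach (parallel_complement F (\<epsilon> / r j))" if "k + 2 \<le> DIM('a)"
      proof (rule ccontr)
        assume "\<not> positive_reach (parallel_complement F (\<epsilon> / r j))"
        then have "\<epsilon> / r j \<in> N0" using N0(1) that rj \<epsilon> by (intro subsetD[OF N0(1)]) simp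
        then show False using elim(2) by simp
      qed
      then have "parallel_curvature k F \<epsilon> (A x \<epsilon>) = r j ^ k * parallel_curvature k F (\<epsilon> / r j) (A (shift x) (\<epsilon> / r j))"
        using elim(1) \<epsilon> parallel_curvature_homogeneous[OF x, of \<epsilon>] by (simp add: j_def)
      then have "curv x \<epsilon> = 1 / r j * curv (shift x) (\<epsilon> / r j)"
        using rj \<epsilon> by (simp add: scaled_curvature_def power_divide field_simps)
      then show "curv x \<epsilon> = 1 / r (idx x) * curv (shift x) (\<epsilon> / r (idx x))" by (simp add: j_def)
    qed
  qed
qed

text \<open>Volume is bounded by that of the surrounding ball of radius a \<epsilon>, area by the
  level set estimate; both are of order \<epsilon>^k.\<close>

lemma curv_bound:
  assumes "DIM('a) \<le> k + 1"
  obtains C where "0 \<le> C" "\<And>x \<epsilon>. x \<in> F \<Longrightarrow> 0 < \<epsilon> \<Longrightarrow> \<epsilon> < e0 \<Longrightarrow> \<bar>curv x \<epsilon>\<bar> \<le> C / \<epsilon>"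
proof -
  have *: "\<exists>C\<ge>0. \<forall>x \<epsilon>. x \<in> F \<longrightarrow> 0 < \<epsilon> \<longrightarrow> \<epsilon> < e0 \<longrightarrow> \<bar>parallel_curvature k F \<epsilon> (A x \<epsilon>)\<bar> \<le> C * \<epsilon> ^ k"
  proof (cases "k = DIM('a)")
    case True
    show ?thesis
    proof (intro exI[of _ "unit_ball_vol (real DIM('a)) * a ^ DIM('a)"] conjI allI impI)
      show "0 \<le> unit_ball_vol (real DIM('a)) * a ^ DIM('a)" using a1 by simp
      fix x \<epsilon> assume x: "x \<in> F" "0 < \<epsilon>" "\<epsilon> < e0"
      have "measure lebesgue (parallel_set F \<epsilon> \<inter> A x \<epsilon>) \<le> measure lebesgue (cball x (a * \<epsilon>))"
      proof (rule measure_mono_fmeasurable)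
        show "parallel_set F \<epsilon> \<inter> A x \<epsilon> \<subseteq> cball x (a * \<epsilon>)" using net_subset[OF x] by blast
        have "closed (parallel_set F \<epsilon>)"
          unfolding parallel_set_def by (intro closed_Collect_le continuous_intros)
        then have "parallel_set F \<epsilon> \<inter> A x \<epsilon> \<in> sets borel" using net_borel[OF x] by simp
        then show "parallel_set F \<epsilon> \<inter> A x \<epsilon> \<in> sets lebesgue" by simp
      qed simp
      also have "\<dots> = unit_ball_vol (real DIM('a)) * (a * \<epsilon>) ^ DIM('a)"
        using x a1 by (simp add: content_cball)
      finally show "\<bar>parallel_curvature k F \<epsilon> (A x \<epsilon>)\<bar> \<le> unit_ball_vol (real DIM('a)) * a ^ DIM('a) * \<epsilon> ^ k"
        using True by (simp add: parallel_curvature_def power_mult_distrib mult.assoc)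
    qed
  next
    case False
    then have k: "k + 1 = DIM('a)" using assms k_le by simp
    have dk: "DIM('a) - 1 = k" using k by simp
    obtain C where C: "0 \<le> C" "\<And>x \<epsilon> E. 0 < \<epsilon> \<Longrightarrow> E \<subseteq> {z. infdist z F = \<epsilon>} \<inter> cball x (a * \<epsilon>) \<Longrightarrow>
       hausdorff_outer (real k) E \<le> ennreal (C * \<epsilon> ^ k)"
      using level_set_area_bound[OF compact_imp_closed[OF F_compact] F_nonempty, of a, unfolded dk] a1 by auto
    show ?thesis
    proof (intro exI[of _ C] conjI allI impI C(1))
      fix x \<epsilon> assume x: "x \<in> F" "0 < \<epsilon>" "\<epsilon> < e0"
      have fr: "frontier (parallel_set F \<epsilon>) \<inter> A x \<epsilon> \<in> sets borel"
        using net_borel[OF x] borel_closed[OF frontier_closed] by blast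
      have "frontier (parallel_set F \<epsilon>) \<inter> A x \<epsilon> \<subseteq> {z. infdist z F = \<epsilon>} \<inter> cball x (a * \<epsilon>)"
        using net_subset[OF x] infdist_frontier_parallel_set by blast
      then have "hausdorff_outer (real k) (frontier (parallel_set F \<epsilon>) \<inter> A x \<epsilon>) \<le> ennreal (C * \<epsilon> ^ k)"
        using C(2) x by blast
      then have "measure (hausdorff_measure (real k)) (frontier (parallel_set F \<epsilon>) \<inter> A x \<epsilon>) \<le> C * \<epsilon> ^ k"
        using C(1) x borel_subset_sets_hausdorff[OF fr]
        by (simp add: measure_def emeasure_hausdorff_measure enn2real_leI)
      then show "\<bar>parallel_curvature k F \<epsilon> (A x \<epsilon>)\<bar> \<le> C * \<epsilon> ^ k"
        unfolding parallel_curvature_hypersurface[OF k]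
        using measure_nonneg[of "hausdorff_measure (real k)" "frontier (parallel_set F \<epsilon>) \<inter> A x \<epsilon>"] by linarith
    qed
  qed
  then obtain C where C: "0 \<le> C" "\<And>x \<epsilon>. x \<in> F \<Longrightarrow> 0 < \<epsilon> \<Longrightarrow> \<epsilon> < e0 \<Longrightarrow> \<bar>parallel_curvature k F \<epsilon> (A x \<epsilon>)\<bar> \<le> C * \<epsilon> ^ k" by blast
  show ?thesis
  proof (rule that[OF C(1)])
    fix x \<epsilon> assume x: "x \<in> F" "0 < \<epsilon>" "\<epsilon> < e0"
    have "\<bar>curv x \<epsilon>\<bar> = \<bar>parallel_curvature k F \<epsilon> (A x \<epsilon>)\<bar> / (\<epsilon> ^ k * \<epsilon>)"
      using x by (simp add: scaled_curvature_def abs_mult field_simps)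
    also have "\<dots> \<le> (C * \<epsilon> ^ k) / (\<epsilon> ^ k * \<epsilon>)" using C(2)[OF x] x by (intro divide_right_mono) auto
    also have "\<dots> = C / \<epsilon>" using x by simp
    finally show "\<bar>curv x \<epsilon>\<bar> \<le> C / \<epsilon>" .
  qed
qed

end

section \<open>Averages along orbits\<close>

text \<open>For small t an index \<nu> t with \<delta> (Suc (\<nu> t)) \<le> t \<le> \<delta> (\<nu>
  t) reduces the continuous limit to the sequences. Both endpoints have logarithms asymptotic to
  -\<Lambda> \<nu> t, so numerator and denominator are divided by \<nu> t.\<close>

lemma tendsto_average_at_right:
  fixes \<delta> s g :: "nat \<Rightarrow> real" and H :: "real \<Rightarrow> real"
  assumes pos: "\<And>n. 0 < \<delta> n" and dec: "\<And>n. \<delta> (Suc n) \<le> \<delta> n"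
    and L: "(\<lambda>n. - ln (\<delta> n) / real n) \<longlonglongrightarrow> \<Lambda>" "0 < \<Lambda>"
    and s: "(\<lambda>n. s n / real n) \<longlonglongrightarrow> m" and g: "(\<lambda>n. g n / real n) \<longlonglongrightarrow> 0"
    and H: "\<And>n t. \<delta> (Suc n) \<le> t \<Longrightarrow> t \<le> \<delta> n \<Longrightarrow> \<bar>H t - s n\<bar> \<le> g n"
  shows "\<And>t. 0 < t \<Longrightarrow> \<exists>n. \<delta> n \<le> t"
    and "((\<lambda>t. 1 / \<bar>ln t\<bar> * H t) \<longlongrightarrow> m / \<Lambda>) (at_right 0)"
proof -
  have lnd: "filterlim (\<lambda>n. - ln (\<delta> n)) at_top sequentially"
  proof (rule filterlim_cong[THEN iffD1])
    show "filterlim (\<lambda>n. - ln (\<delta> n) / real n * real n) at_top sequentially"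
      by (rule filterlim_tendsto_pos_mult_at_top[OF L filterlim_real_sequentially])
    show "\<forall>\<^sub>F n in sequentially. - ln (\<delta> n) / real n * real n = - ln (\<delta> n)"
      using eventually_gt_at_top[of 0] by eventually_elim simp
  qed auto
  show small: "\<exists>n. \<delta> n \<le> t" if t: "0 < t" for t
  proof -
    have "\<forall>\<^sub>F n in sequentially. - ln t \<le> - ln (\<delta> n)" using lnd unfolding filterlim_at_top by blast
    then obtain n where "- ln t \<le> - ln (\<delta> n)" unfolding eventually_sequentially by blast
    then have "ln (\<delta> n) \<le> ln t" by simp
    then show ?thesis using t pos[of n] by auto
  qed
  have anti: "n \<le> n' \<Longrightarrow> \<delta> n' \<le> \<delta> n" for n n' using lift_Suc_antimono_le[of \<delta>] dec by blast
  define \<nu> where "\<nu> t = (LEAST n. \<delta> (Suc n) \<le> t)" for t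
  have \<nu>: "\<delta> (Suc (\<nu> t)) \<le> t" if t: "0 < t" for t
    unfolding \<nu>_def
  proof (rule LeastI_ex)
    obtain n where n: "\<delta> n \<le> t" using small[OF t] by blast
    show "\<exists>n. \<delta> (Suc n) \<le> t" by (rule exI[of _ n]) (use n dec[of n] in linarith)
  qed
  have \<nu>': "t \<le> \<delta> (\<nu> t)" if t: "0 < t" "t < \<delta> 0" for t
  proof (cases "\<nu> t")
    case 0
    then show ?thesis using t by simp
  next
    case (Suc l)
    then have "\<not> \<delta> (Suc l) \<le> t" unfolding \<nu>_def by (intro not_less_Least) simp
    then show ?thesis by (simp add: Suc)
  qed
  have near: "\<forall>\<^sub>F t in at_right 0. 0 < t \<and> t < c" if "0 < c" for c :: real
    using eventually_at_right_real[OF that] by (rule eventually_mono) auto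
  have \<nu>_top: "filterlim \<nu> at_top (at_right 0)"
    unfolding filterlim_at_top
  proof
    fix Z :: nat
    show "\<forall>\<^sub>F t in at_right 0. Z \<le> \<nu> t"
      using near[OF pos[of Z]]
    proof eventually_elim
      case (elim t)
      show ?case
      proof (rule ccontr)
        assume "\<not> Z \<le> \<nu> t"
        then have "\<delta> Z \<le> \<delta> (Suc (\<nu> t))" by (intro anti) simp
        then show False using \<nu>[of t] elim by linarith
      qed
    qed
  qed
  have via: "((\<lambda>t. f (\<nu> t)) \<longlongrightarrow> l) (at_right 0)" if "f \<longlonglongrightarrow> l" for f :: "nat \<Rightarrow> real" and l
    by (rule filterlim_compose[OF that \<nu>_top])
  have L': "(\<lambda>n. - ln (\<delta> (Suc n)) / real n) \<longlonglongrightarrow> \<Lambda>"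
  proof -
    have "(\<lambda>n. - ln (\<delta> (Suc n)) / real (Suc n) * (real (Suc n) / real n)) \<longlonglongrightarrow> \<Lambda> * 1"
      by (intro tendsto_mult LIMSEQ_Suc[OF L(1)] LIMSEQ_Suc_n_over_n)
    moreover have "\<forall>\<^sub>F n in sequentially. - ln (\<delta> (Suc n)) / real (Suc n) * (real (Suc n) / real n) = - ln (\<delta> (Suc n)) / real n"
      using eventually_gt_at_top[of 0] by eventually_elim simp
    ultimately show ?thesis by (simp add: tendsto_cong)
  qed
  have nz: "\<forall>\<^sub>F t in at_right 0. 0 < \<nu> t"
    using \<nu>_top[unfolded filterlim_at_top, rule_format, of 1] by eventually_elim simp
  have lim_ln: "((\<lambda>t. - ln t / real (\<nu> t)) \<longlongrightarrow> \<Lambda>) (at_right 0)"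
  proof (rule tendsto_sandwich[OF _ _ via[OF L(1)] via[OF L']])
    show "\<forall>\<^sub>F t in at_right 0. - ln (\<delta> (\<nu> t)) / real (\<nu> t) \<le> - ln t / real (\<nu> t)"
      using near[OF pos[of 0]]
      by eventually_elim (intro divide_right_mono, use \<nu>' pos in auto)
    show "\<forall>\<^sub>F t in at_right 0. - ln t / real (\<nu> t) \<le> - ln (\<delta> (Suc (\<nu> t))) / real (\<nu> t)"
      using near[OF pos[of 0]]
      by eventually_elim (intro divide_right_mono, use \<nu> pos in auto)
  qed
  have "((\<lambda>t. H t / real (\<nu> t) - s (\<nu> t) / real (\<nu> t)) \<longlongrightarrow> 0) (at_right 0)"
  proof (rule Lim_null_comparison[OF _ via[OF g]])
    show "\<forall>\<^sub>F t in at_right 0. norm (H t / real (\<nu> t) - s (\<nu> t) / real (\<nu> t)) \<le> g (\<nu> t) / real (\<nu> t)"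
      using near[OF pos[of 0]]
    proof eventually_elim
      case (elim t)
      have "\<bar>H t - s (\<nu> t)\<bar> / real (\<nu> t) \<le> g (\<nu> t) / real (\<nu> t)"
        using H[OF \<nu> \<nu>'] elim by (intro divide_right_mono) auto
      then show ?case by (simp add: diff_divide_distrib[symmetric])
    qed
  qed
  then have lim_H: "((\<lambda>t. H t / real (\<nu> t)) \<longlongrightarrow> m) (at_right 0)"
    using tendsto_add[OF _ via[OF s]] by fastforce
  have "((\<lambda>t. H t / real (\<nu> t) / (- ln t / real (\<nu> t))) \<longlongrightarrow> m / \<Lambda>) (at_right 0)"
    using L(2) by (intro tendsto_divide lim_H lim_ln) simp
  moreover have "\<forall>\<^sub>F t in at_right 0. H t / real (\<nu> t) / (- ln t / real (\<nu> t)) = 1 / \<bar>ln t\<bar> * H t"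
    using nz near[of 1, OF zero_less_one]
    by eventually_elim simp
  ultimately show "((\<lambda>t. 1 / \<bar>ln t\<bar> * H t) \<longlongrightarrow> m / \<Lambda>) (at_right 0)"
    using tendsto_cong by fastforce
qed

context ergodic_system
begin

text \<open>A single term is the difference of two consecutive Birkhoff sums, whose averages have
  the same limit.\<close>

lemma AE_orbit_over_n_tendsto_zero:
  assumes f: "integrable M f"
  shows "AE x in M. (\<lambda>n. f ((T ^^ n) x) / real n) \<longlonglongrightarrow> 0"
  using birkhoff[OF f]
proof eventually_elim
  case (elim x)
  let ?c = "(LINT x|M. f x) / measure M (space M)"
  have "(\<lambda>n. birkhoff_sum f (Suc n) x / real (Suc n) * (real (Suc n) / real n) - birkhoff_sum f n x / real n) \<longlonglongrightarrow> ?c * 1 - ?c"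
    by (intro tendsto_diff tendsto_mult LIMSEQ_Suc[OF elim] elim LIMSEQ_Suc_n_over_n)
  moreover have "\<forall>\<^sub>F n in sequentially. birkhoff_sum f (Suc n) x / real (Suc n) * (real (Suc n) / real n) - birkhoff_sum f n x / real n
      = f ((T ^^ n) x) / real n"
    using eventually_gt_at_top[of 0]
    by eventually_elim (simp add: birkhoff_sum_def diff_divide_distrib[symmetric] del: of_nat_Suc)
  ultimately show ?case by (simp add: tendsto_cong)
qed

text \<open>Truncating \<open>h\<close> from below makes the coboundary integrable with integral zero; Fatou's
  lemma then passes to the limit.  The mean of \<open>h - h \<circ> T\<close> is at most zero by Fatou's lemma and at
  least zero since \<open>h\<close> is bounded above.\<close>

lemma coboundary_bounded_above:
  fixes h c :: "'a \<Rightarrow> real"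
  assumes h [measurable]: "h \<in> borel_measurable M" and hB: "\<And>x. x \<in> space M \<Longrightarrow> h x \<le> B"
    and c: "integrable M c" "\<And>x. x \<in> space M \<Longrightarrow> 0 \<le> c x"
    and le: "AE x in M. h (T x) \<le> h x + c x"
  shows "integrable M (\<lambda>x. h x - h (T x) + c x)"
    and "AE x in M. (\<lambda>n. h ((T ^^ n) x) / real n) \<longlonglongrightarrow> 0"
proof -
  have cm [measurable]: "c \<in> borel_measurable M" using c(1) by simp
  define t where "t m x = max (h x) (- real m)" for m :: nat and x
  have tm [measurable]: "t m \<in> borel_measurable M" for m unfolding t_def by measurable
  have int_t: "integrable M (t m)" for m
  proof (rule integrable_const_bound[where B = "max \<bar>B\<bar> (real m)"])
    show "AE x in M. norm (t m x) \<le> max \<bar>B\<bar> (real m)"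
    proof (rule AE_I2)
      fix x assume "x \<in> space M"
      from hB[OF this] show "norm (t m x) \<le> max \<bar>B\<bar> (real m)" unfolding t_def by auto
    qed
  qed simp
  let ?\<phi> = "\<lambda>x. h x - h (T x) + c x"
  have lim: "(\<lambda>m. ennreal (t m x - t m (T x) + c x)) \<longlonglongrightarrow> ennreal (?\<phi> x)" for x
  proof (rule tendsto_eventually)
    obtain m0 :: nat where m0: "max (- h x) (- h (T x)) \<le> real m0" using real_arch_simple by blast
    show "\<forall>\<^sub>F m in sequentially. ennreal (t m x - t m (T x) + c x) = ennreal (?\<phi> x)"
      using eventually_ge_at_top[of m0]
    proof eventually_elim
      case (elim m)
      then have "- h x \<le> real m" "- h (T x) \<le> real m" using m0 by auto
      then have "t m x = h x" "t m (T x) = h (T x)" unfolding t_def by (auto intro!: max_absorb1)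
      then show ?case by simp
    qed
  qed
  have mean: "(\<integral>\<^sup>+ x. ennreal (t m x - t m (T x) + c x) \<partial>M) = ennreal (LINT x|M. c x)" for m
  proof -
    have "AE x in M. 0 \<le> t m x - t m (T x) + c x"
      using le AE_space
    proof eventually_elim
      case (elim x)
      then show ?case using c(2)[of x] by (auto simp: t_def max_def)
    qed
    moreover have "integrable M (\<lambda>x. t m x - t m (T x) + c x)"
      by (intro Bochner_Integration.integrable_add Bochner_Integration.integrable_diff int_t integrable_T c(1))
    moreover have "(LINT x|M. t m x - t m (T x) + c x) = (LINT x|M. c x)"
      using int_t[of m] integrable_T[OF int_t[of m]] c(1) integral_T[OF tm, of m] by simp
    ultimately show ?thesis by (simp add: nn_integral_eq_integral)
  qed
  have nn: "(\<integral>\<^sup>+ x. ennreal (?\<phi> x) \<partial>M) \<le> ennreal (LINT x|M. c x)"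
  proof -
    have "(\<integral>\<^sup>+ x. ennreal (?\<phi> x) \<partial>M) = (\<integral>\<^sup>+ x. liminf (\<lambda>m. ennreal (t m x - t m (T x) + c x)) \<partial>M)"
      by (intro nn_integral_cong) (use lim_imp_Liminf[OF _ lim] in simp)
    also have "\<dots> \<le> liminf (\<lambda>m. \<integral>\<^sup>+ x. ennreal (t m x - t m (T x) + c x) \<partial>M)"
      by (rule nn_integral_liminf) measurable
    also have "\<dots> = ennreal (LINT x|M. c x)" by (simp add: mean Liminf_const)
    finally show ?thesis .
  qed
  have nonneg: "AE x in M. 0 \<le> ?\<phi> x" using le by eventually_elim simp
  show int: "integrable M ?\<phi>"
  proof (rule integrableI_nonneg[OF _ nonneg])
    show "(\<integral>\<^sup>+ x. ennreal (?\<phi> x) \<partial>M) < \<infinity>" by (rule le_less_trans[OF nn]) simp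
  qed measurable
  have int_d: "integrable M (\<lambda>x. h x - h (T x))" using Bochner_Integration.integrable_diff[OF int c(1)] by simp
  let ?\<kappa> = "(LINT x|M. h x - h (T x)) / measure M (space M)"
  have \<kappa>_le: "?\<kappa> \<le> 0"
  proof -
    have "ennreal (LINT x|M. ?\<phi> x) \<le> ennreal (LINT x|M. c x)"
      using nn nn_integral_eq_integral[OF int nonneg] by simp
    moreover have "0 \<le> (LINT x|M. c x)" using c(2) by (intro integral_nonneg_AE AE_I2)
    ultimately have "(LINT x|M. ?\<phi> x) \<le> (LINT x|M. c x)" by (auto simp: ennreal_le_iff2)
    moreover have "(LINT x|M. ?\<phi> x) = (LINT x|M. h x - h (T x)) + (LINT x|M. c x)"
      by (rule Bochner_Integration.integral_add[OF int_d c(1)])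
    ultimately show ?thesis by (simp add: divide_le_0_iff measure_nonneg)
  qed
  have orbit: "(T ^^ n) x \<in> space M" if "x \<in> space M" for x n
    using that by (induction n) (auto intro: measurable_space[OF T_measurable])
  have sum: "birkhoff_sum (\<lambda>x. h x - h (T x)) n x = h x - h ((T ^^ n) x)" for n x
    by (induction n) (simp_all add: birkhoff_sum_def)
  show "AE x in M. (\<lambda>n. h ((T ^^ n) x) / real n) \<longlonglongrightarrow> 0"
    using birkhoff[OF int_d] AE_space
  proof eventually_elim
    case (elim x)
    have l: "(\<lambda>n. (h x - h ((T ^^ n) x)) / real n) \<longlonglongrightarrow> ?\<kappa>" using elim(1) by (simp add: sum)
    have hx: "(\<lambda>n. h x / real n) \<longlonglongrightarrow> 0" "(\<lambda>n. (h x - B) / real n) \<longlonglongrightarrow> 0"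
      by (rule tendsto_divide_0[OF tendsto_const filterlim_real_at_infinity_sequentially])+
    have "0 \<le> ?\<kappa>"
    proof (rule LIMSEQ_le[OF hx(2) l])
      show "\<exists>N. \<forall>n\<ge>N. (h x - B) / real n \<le> (h x - h ((T ^^ n) x)) / real n"
        using hB[OF orbit[OF elim(2)]] by (intro exI[of _ 0] allI impI divide_right_mono) auto
    qed
    then have \<kappa>0: "?\<kappa> = 0" using \<kappa>_le by linarith
    have "(\<lambda>n. h x / real n - (h x - h ((T ^^ n) x)) / real n) \<longlonglongrightarrow> 0 - 0"
      by (rule tendsto_diff[OF hx(1) l[unfolded \<kappa>0]])
    then show ?case by (simp add: diff_divide_distrib[symmetric])
  qed
qed

end

section \<open>Telescoping integrals along a rescaled orbit\<close>

lemma AE_lborel_scale: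
  fixes P :: "real \<Rightarrow> bool"
  assumes "AE t in lborel. P t" "c \<noteq> 0"
  shows "AE t in lborel. P (c * t)"
proof -
  obtain N0 where N0: "{t \<in> space lborel. \<not> P t} \<subseteq> N0" "emeasure lborel N0 = 0" "N0 \<in> sets lborel"
    using assms(1) by (rule AE_E)
  have "AE t in lborel. t \<notin> N0" using N0 by (intro AE_not_in) (simp add: null_sets_def)
  then have "AE t in lborel. 0 + c * t \<notin> N0"
    by (rule AE_borel_affine[rotated -1]) (use N0(3) assms(2) in auto)
  then show ?thesis by eventually_elim (use N0(1) in auto)
qed

text \<open>Iterated homogeneity gives u 0 t = u n (t / \<rho> n) / \<rho> n below \<delta> n. The
  substitution t = \<rho> n s therefore carries the n-th interval of integration of
  \<open>u n\<close> to (\<delta> (Suc n), \<delta> n] without changing the integral.\<close>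

lemma orbit_integral_piece:
  fixes u :: "nat \<Rightarrow> real \<Rightarrow> real" and up q :: "nat \<Rightarrow> real"
  assumes u [measurable]: "\<And>n. u n \<in> borel_measurable borel" and up: "\<And>n. 0 < up n" and q: "\<And>n. 0 < q n"
    and le: "\<And>n. q n * up (Suc n) \<le> up n"
    and hom: "\<And>n. AE t in lborel. 0 < t \<and> t < q n * up (Suc n) \<longrightarrow> u n t = 1 / q n * u (Suc n) (t / q n)"
    and int: "\<And>n. set_integrable lborel {q n * up (Suc n)<..up n} (u n)"
  defines "\<delta> \<equiv> \<lambda>n. (\<Prod>i<n. q i) * up n"
  shows "set_integrable lborel {\<delta> (Suc n)<..\<delta> n} (u 0)"
    and "(LINT t:{\<delta> (Suc n)<..\<delta> n}|lborel. u 0 t) = (LINT t:{q n * up (Suc n)<..up n}|lborel. u n t)"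
proof -
  define \<rho> where "\<rho> n = (\<Prod>i<n. q i)" for n
  have \<rho>: "0 < \<rho> n" for n unfolding \<rho>_def using q by (simp add: prod_pos)
  have \<rho>_Suc: "\<rho> (Suc n) = \<rho> n * q n" for n by (simp add: \<rho>_def)
  have \<delta>: "\<delta> n = \<rho> n * up n" for n by (simp add: \<delta>_def \<rho>_def)
  have hom_n: "AE t in lborel. 0 < t \<and> t < \<rho> n * up n \<longrightarrow> u 0 t = 1 / \<rho> n * u n (t / \<rho> n)" for n
  proof (induction n)
    case 0
    then show ?case by (simp add: \<rho>_def)
  next
    case (Suc n)
    have "AE t in lborel. 0 < 1 / \<rho> n * t \<and> 1 / \<rho> n * t < q n * up (Suc n) \<longrightarrow>
        u n (1 / \<rho> n * t) = 1 / q n * u (Suc n) (1 / \<rho> n * t / q n)"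
      by (rule AE_lborel_scale[OF hom]) (use \<rho>[of n] in simp)
    with Suc show ?case
    proof eventually_elim
      case (elim t)
      note * = elim
      show ?case
      proof (intro impI)
        assume t: "0 < t \<and> t < \<rho> (Suc n) * up (Suc n)"
        have t1: "1 / \<rho> n * t < q n * up (Suc n)"
          using t \<rho>[of n] by (simp add: \<rho>_Suc field_simps)
        then have "t / \<rho> n < up n" using le[of n] by simp
        then have "t < \<rho> n * up n" using \<rho>[of n] by (simp add: field_simps)
        then have "u 0 t = 1 / \<rho> n * u n (t / \<rho> n)" using * t by blast
        also have "u n (t / \<rho> n) = 1 / q n * u (Suc n) (t / \<rho> (Suc n))"
          using * t1 t \<rho>[of n] by (simp add: \<rho>_Suc)
        finally show "u 0 t = 1 / \<rho> (Suc n) * u (Suc n) (t / \<rho> (Suc n))" by (simp add: \<rho>_Suc)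
      qed
    qed
  qed
  let ?lo = "q n * up (Suc n)"
  have \<delta>_Suc: "\<delta> (Suc n) = \<rho> n * ?lo" by (simp add: \<delta> \<rho>_Suc mult.assoc)
  let ?f = "\<lambda>t. indicator {?lo<..up n} t *\<^sub>R u n t"
  have "has_bochner_integral lborel ?f (integral\<^sup>L lborel ?f)"
    using int[of n] by (simp add: set_integrable_def has_bochner_integral_integrable)
  then have "has_bochner_integral lborel (\<lambda>t. ?f (0 + 1 / \<rho> n * t)) (integral\<^sup>L lborel ?f /\<^sub>R \<bar>1 / \<rho> n\<bar>)"
    by (subst lborel_has_bochner_integral_real_affine_iff[symmetric]) (use \<rho>[of n] in auto)
  from has_bochner_integral_mult_right[OF this, of "1 / \<rho> n"]
  have "has_bochner_integral lborel (\<lambda>t. 1 / \<rho> n * ?f (0 + 1 / \<rho> n * t)) (integral\<^sup>L lborel ?f)"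
    using \<rho>[of n] by simp
  also have "?this \<longleftrightarrow> has_bochner_integral lborel (\<lambda>t. indicator {\<delta> (Suc n)<..\<delta> n} t *\<^sub>R u 0 t) (integral\<^sup>L lborel ?f)"
  proof (rule has_bochner_integral_cong_AE)
    \<comment> \<open>Homogeneity holds only strictly below the upper endpoint, which is therefore
      discarded as a null set.\<close>
    have ne: "AE t in lborel. t \<noteq> \<delta> n" by (rule AE_lborel_singleton)
    from hom_n[of n] ne show "AE t in lborel. 1 / \<rho> n * ?f (0 + 1 / \<rho> n * t) = indicator {\<delta> (Suc n)<..\<delta> n} t *\<^sub>R u 0 t"
    proof eventually_elim
      case (elim t)
      have iff: "0 + 1 / \<rho> n * t \<in> {?lo<..up n} \<longleftrightarrow> t \<in> {\<delta> (Suc n)<..\<delta> n}"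
        using \<rho>[of n] by (simp add: \<delta> \<delta>_Suc[unfolded \<delta>] field_simps)
      show ?case
      proof (cases "t \<in> {\<delta> (Suc n)<..\<delta> n}")
        case True
        then have "0 < t" using \<rho>[of n] q[of n] up[of "Suc n"] \<delta>_Suc
          by (smt (verit) greaterThanAtMost_iff mult_pos_pos)
        moreover have "t < \<rho> n * up n" using True elim(2) by (simp add: \<delta>)
        ultimately have "u 0 t = 1 / \<rho> n * u n (t / \<rho> n)" using elim(1) by blast
        then show ?thesis using True iff by simp
      next
        case False
        then show ?thesis using iff by simp
      qed
    qed
  qed measurable
  finally show "set_integrable lborel {\<delta> (Suc n)<..\<delta> n} (u 0)"
    "(LINT t:{\<delta> (Suc n)<..\<delta> n}|lborel. u 0 t) = (LINT t:{?lo<..up n}|lborel. u n t)"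
    by (simp_all add: has_bochner_integral_iff set_integrable_def set_lebesgue_integral_def)
qed

text \<open>At \<delta> n the pieces add up exactly. For t in the next interval the remaining part
  is dominated by the whole piece of the absolute value, to which the rescaling applies as well
  because \<bar>u n\<bar> has the same homogeneity.\<close>

lemma orbit_integral:
  fixes u :: "nat \<Rightarrow> real \<Rightarrow> real" and up q :: "nat \<Rightarrow> real"
  assumes u [measurable]: "\<And>n. u n \<in> borel_measurable borel" and up: "\<And>n. 0 < up n" and q: "\<And>n. 0 < q n"
    and le: "\<And>n. q n * up (Suc n) \<le> up n"
    and hom: "\<And>n. AE t in lborel. 0 < t \<and> t < q n * up (Suc n) \<longrightarrow> u n t = 1 / q n * u (Suc n) (t / q n)"
    and int: "\<And>n. set_integrable lborel {q n * up (Suc n)<..up n} (u n)"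
  defines "\<delta> \<equiv> \<lambda>n. (\<Prod>i<n. q i) * up n"
  shows "set_integrable lborel {\<delta> n<..up 0} (u 0)"
    and "\<delta> (Suc n) \<le> t \<Longrightarrow> t \<le> \<delta> n \<Longrightarrow>
      \<bar>(LINT t:{t<..up 0}|lborel. u 0 t) - (\<Sum>i<n. LINT t:{q i * up (Suc i)<..up i}|lborel. u i t)\<bar>
        \<le> (LINT t:{q n * up (Suc n)<..up n}|lborel. \<bar>u n t\<bar>)"
proof -
  have piece: "set_integrable lborel {\<delta> (Suc n)<..\<delta> n} (u 0)"
      "(LINT t:{\<delta> (Suc n)<..\<delta> n}|lborel. u 0 t) = (LINT t:{q n * up (Suc n)<..up n}|lborel. u n t)" for n
    unfolding \<delta>_def
    by (rule orbit_integral_piece[where u = u and up = up and q = q, OF u up q le hom int])+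
  have dec: "\<delta> (Suc n) \<le> \<delta> n" for n
  proof -
    have "0 \<le> (\<Prod>i<n. q i)" using q by (intro prod_nonneg) (simp add: less_imp_le)
    from mult_left_mono[OF le this] show ?thesis by (simp add: \<delta>_def mult.assoc)
  qed
  have le0: "\<delta> n \<le> up 0" for n
  proof (induction n)
    case (Suc n)
    then show ?case using dec[of n] by linarith
  qed (simp add: \<delta>_def)
  have main: "set_integrable lborel {\<delta> n<..up 0} (u 0) \<and>
      (LINT t:{\<delta> n<..up 0}|lborel. u 0 t) = (\<Sum>i<n. LINT t:{q i * up (Suc i)<..up i}|lborel. u i t)" for n
  proof (induction n)
    case 0
    then show ?case by (simp add: \<delta>_def set_integrable_def set_lebesgue_integral_def)
  next
    case (Suc n)
    have split: "{\<delta> (Suc n)<..up 0} = {\<delta> (Suc n)<..\<delta> n} \<union> {\<delta> n<..up 0}"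
      by (rule ivl_disj_un_two(6)[symmetric, OF dec le0])
    have disj: "{\<delta> (Suc n)<..\<delta> n} \<inter> {\<delta> n<..up 0} = {}" by auto
    have "set_integrable lborel {\<delta> (Suc n)<..up 0} (u 0)"
      unfolding split using Suc piece(1) by (intro set_integrable_Un) auto
    moreover have "(LINT t:{\<delta> (Suc n)<..up 0}|lborel. u 0 t) =
        (LINT t:{\<delta> (Suc n)<..\<delta> n}|lborel. u 0 t) + (LINT t:{\<delta> n<..up 0}|lborel. u 0 t)"
      unfolding split using Suc piece(1) disj by (intro set_integral_Un) auto
    ultimately show ?case using Suc piece(2)[of n] by simp
  qed
  show "set_integrable lborel {\<delta> n<..up 0} (u 0)" using main by blast
  assume t: "\<delta> (Suc n) \<le> t" "t \<le> \<delta> n"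
  have abs_hom: "AE t in lborel. 0 < t \<and> t < q n * up (Suc n) \<longrightarrow> \<bar>u n t\<bar> = 1 / q n * \<bar>u (Suc n) (t / q n)\<bar>" for n
    using hom[of n] by eventually_elim (use q[of n] in \<open>simp add: abs_mult\<close>)
  have abs_int: "set_integrable lborel {q n * up (Suc n)<..up n} (\<lambda>t. \<bar>u n t\<bar>)" for n
    by (rule set_integrable_abs[OF int])
  have abs_m: "(\<lambda>t. \<bar>u n t\<bar>) \<in> borel_measurable borel" for n by measurable
  have abs_piece: "set_integrable lborel {\<delta> (Suc n)<..\<delta> n} (\<lambda>t. \<bar>u 0 t\<bar>)"
      "(LINT t:{\<delta> (Suc n)<..\<delta> n}|lborel. \<bar>u 0 t\<bar>) = (LINT t:{q n * up (Suc n)<..up n}|lborel. \<bar>u n t\<bar>)" for n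
    unfolding \<delta>_def
    by (rule orbit_integral_piece[where u = "\<lambda>n t. \<bar>u n t\<bar>" and up = up and q = q,
          OF abs_m up q le abs_hom abs_int])+
  have split: "{t<..up 0} = {t<..\<delta> n} \<union> {\<delta> n<..up 0}"
    by (rule ivl_disj_un_two(6)[symmetric, OF t(2) le0])
  have disj: "{t<..\<delta> n} \<inter> {\<delta> n<..up 0} = {}" by auto
  have int1: "set_integrable lborel {t<..\<delta> n} (u 0)"
    by (rule set_integrable_subset[OF piece(1)[of n]]) (use t in auto)
  have "(LINT t:{t<..up 0}|lborel. u 0 t) = (LINT t:{t<..\<delta> n}|lborel. u 0 t) + (LINT t:{\<delta> n<..up 0}|lborel. u 0 t)"
    unfolding split by (rule set_integral_Un[OF disj int1]) (use main in blast)
  moreover have "\<bar>LINT t:{t<..\<delta> n}|lborel. u 0 t\<bar> \<le> (LINT t:{t<..\<delta> n}|lborel. \<bar>u 0 t\<bar>)"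
    using set_integral_norm_bound[OF int1] by simp
  moreover have "(LINT t:{t<..\<delta> n}|lborel. \<bar>u 0 t\<bar>) \<le> (LINT t:{\<delta> (Suc n)<..\<delta> n}|lborel. \<bar>u 0 t\<bar>)"
    unfolding set_lebesgue_integral_def
    using set_integrable_abs[OF int1] abs_piece(1)[of n] t(1)
    by (intro integral_mono) (auto simp: set_integrable_def indicator_def)
  ultimately show "\<bar>(LINT t:{t<..up 0}|lborel. u 0 t) - (\<Sum>i<n. LINT t:{q i * up (Suc i)<..up i}|lborel. u i t)\<bar>
        \<le> (LINT t:{q n * up (Suc n)<..up n}|lborel. \<bar>u n t\<bar>)"
    using main[of n] abs_piece(2)[of n] by linarith
qed

section \<open>Average curvature densities\<close>

lemma lebesgue_AE_eq_borel:
  fixes f g :: "'a::euclidean_space \<Rightarrow> real"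
  assumes g: "g \<in> borel_measurable borel" and eq: "AE x in lborel. f x = g x"
  shows "integrable lebesgue f \<longleftrightarrow> integrable lborel g" "integral\<^sup>L lebesgue f = integral\<^sup>L lborel g"
proof -
  have gl: "g \<in> borel_measurable lebesgue" using g by (simp add: measurable_completion)
  have eq': "AE x in lebesgue. f x = g x" by (rule AE_completion[OF eq])
  have fl: "f \<in> borel_measurable lebesgue"
    by (rule borel_measurable_AE[OF gl]) (use eq' in eventually_elim, simp)
  show "integrable lebesgue f \<longleftrightarrow> integrable lborel g"
    using integrable_cong_AE[OF fl gl eq'] integrable_completion[of g lborel] g by simp
  show "integral\<^sup>L lebesgue f = integral\<^sup>L lborel g"
    using integral_cong_AE[OF fl gl eq'] integral_completion[of g lborel] g by simp
qed

context iterated_function_system_osc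
begin

text \<open>Every subset of a null set is Caratheodory measurable, so a change on a null set keeps a
  function measurable for any target space.\<close>

lemma measurable_nat_measure_AE:
  assumes g: "g \<in> measurable nat_measure M" and eq: "AE x in nat_measure. f x = g x"
    and f: "\<And>x. x \<in> F \<Longrightarrow> f x \<in> space M"
  shows "f \<in> measurable nat_measure M"
proof (rule measurableI)
  show "f x \<in> space M" if "x \<in> space nat_measure" for x using f that by simp
  fix B assume B: "B \<in> sets M"
  obtain Z where Z: "{x \<in> space nat_measure. f x \<noteq> g x} \<subseteq> Z" "emeasure nat_measure Z = 0" "Z \<in> sets nat_measure"
    using eq by (rule AE_E)
  have sub: "E \<in> sets nat_measure" if "E \<subseteq> Z" for E
  proof -
    have "hausdorff_outer sim_dim E = 0"
      using hausdorff_outer_mono[OF that, of sim_dim] Z(2,3) by (simp add: emeasure_nat_measure)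
    from null_set_hausdorff[OF this] show ?thesis
      using that Z(3) by (auto simp: sets_nat_measure null_sets_def)
  qed
  have "f -` B \<inter> space nat_measure = (g -` B \<inter> space nat_measure - Z) \<union> (f -` B \<inter> space nat_measure \<inter> Z)"
    using Z(1) by auto
  also have "\<dots> \<in> sets nat_measure"
    by (rule sets.Un[OF sets.Diff[OF measurable_sets[OF g B] Z(3)] sub]) blast
  finally show "f -` B \<inter> space nat_measure \<in> sets nat_measure" .
qed

lemma borel_measurable_nat_measure:
  assumes "f \<in> borel_measurable borel"
  shows "f \<in> borel_measurable nat_measure"
  by (rule measurableI) (use borel_Int_F measurable_sets[OF assms] in auto)

lemma measure_piece: "j \<in> {1..N} \<Longrightarrow> measure nat_measure (piece j) = r j powr sim_dim * measure nat_measure F"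
proof -
  assume j: "j \<in> {1..N}"
  have "S j ` F \<inter> piece j = piece j" by (auto simp: piece_def)
  then show ?thesis
    using measure_Int_piece[OF j S_image_sets[OF j F_sets_nat]] measure_S_image[OF j F_sets_nat] by simp
qed

lemma has_bochner_integral_idx:
  fixes g :: "nat \<Rightarrow> real"
  shows "has_bochner_integral nat_measure (\<lambda>x. g (idx x)) ((\<Sum>j=1..N. r j powr sim_dim * g j) * measure nat_measure F)"
proof -
  have "has_bochner_integral nat_measure (\<lambda>x. \<Sum>j=1..N. indicator (piece j) x *\<^sub>R g j)
      (\<Sum>j=1..N. measure nat_measure (piece j) *\<^sub>R g j)"
    by (intro has_bochner_integral_sum has_bochner_integral_indicator piece_sets) (auto simp: nat.emeasure_eq_measure)
  also have "(\<Sum>j=1..N. measure nat_measure (piece j) *\<^sub>R g j) = (\<Sum>j=1..N. r j powr sim_dim * g j) * measure nat_measure F"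
    unfolding sum_distrib_right by (rule sum.cong) (simp_all add: measure_piece)
  also have "has_bochner_integral nat_measure (\<lambda>x. \<Sum>j=1..N. indicator (piece j) x *\<^sub>R g j) y \<longleftrightarrow>
      has_bochner_integral nat_measure (\<lambda>x. g (idx x)) y" for y
  proof (rule has_bochner_integral_cong)
    fix x assume "x \<in> space nat_measure"
    then have x: "x \<in> F" by simp
    have "(\<Sum>j=1..N. indicator (piece j) x *\<^sub>R g j) = (\<Sum>j=1..N. if j = idx x then g j else 0)"
      by (rule sum.cong) (use mem_piece x in \<open>auto simp: indicator_def\<close>)
    also have "\<dots> = g (idx x)" using idx[OF x] by simp
    finally show "(\<Sum>j=1..N. indicator (piece j) x *\<^sub>R g j) = g (idx x)" .
  qed auto
  finally show ?thesis .
qed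

end

context curvature_net
begin

section \<open>Logarithmic ratios and the gap between the endpoints\<close>

lemma upper_measurable [measurable]: "upper \<in> borel_measurable nat_measure"
  unfolding upper_def
  by (intro borel_measurable_nat_measure borel_measurable_continuous_onI continuous_intros)

lemma ratio_measurable [measurable]: "(\<lambda>x. r (idx x)) \<in> borel_measurable nat_measure"
  using has_bochner_integral_idx[of r] by (auto simp: has_bochner_integral_iff)

lemma lower_measurable [measurable]: "lower \<in> borel_measurable nat_measure"
  using measurable_compose[OF shift_measurable upper_measurable] unfolding lower_def by measurable

abbreviation log_ratio :: "'a \<Rightarrow> real" where "log_ratio x \<equiv> \<bar>ln (r (idx x))\<bar>"

definition mean_log_ratio :: real where "mean_log_ratio = (\<Sum>j=1..N. r j powr sim_dim * \<bar>ln (r j)\<bar>)"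

lemma integral_log_ratio:
  "integrable nat_measure log_ratio" "(LINT x|nat_measure. log_ratio x) = mean_log_ratio * measure nat_measure F"
  using has_bochner_integral_idx[of "\<lambda>j. \<bar>ln (r j)\<bar>"] by (simp_all add: has_bochner_integral_iff mean_log_ratio_def)

lemma mean_log_ratio_pos: "0 < mean_log_ratio"
  unfolding mean_log_ratio_def
proof (rule sum_pos)
  show "{1..N} \<noteq> {}" using F_nonempty idx by blast
  fix j assume j: "j \<in> {1..N}"
  have "0 < \<bar>ln (r j)\<bar>" "0 < r j powr sim_dim" using r01[OF j] by simp_all
  then show "0 < r j powr sim_dim * \<bar>ln (r j)\<bar>" by (rule mult_pos_pos[rotated])
qed simp

text \<open>\<open>lower\<close> is positive because the shift of almost every point is again
  interior to \<open>J\<close>.\<close>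

lemma AE_pos: "AE x in nat_measure. 0 < upper x \<and> 0 < lower x"
  using AE_in_interior ergodic.AE_T[OF AE_in_interior] AE_space
proof eventually_elim
  case (elim x)
  then have "0 < r (idx x)" using idx r01 by simp
  then show ?case using elim upper_pos by (simp add: lower_def)
qed

lemma ln_lower: "x \<in> F \<Longrightarrow> 0 < lower x \<Longrightarrow> ln (lower x) = ln (upper (shift x)) - log_ratio x"
proof -
  assume x: "x \<in> F" and l: "0 < lower x"
  have r: "0 < r (idx x)" "r (idx x) < 1" using idx[OF x] r01 by auto
  then have "0 < upper (shift x)" using l by (simp add: lower_def zero_less_mult_iff)
  then show ?thesis using r by (simp add: lower_def ln_mult)
qed

text \<open>In logarithms, \<open>lower x \<le> upper x\<close> becomes
  \<open>ln (upper (shift x)) \<le> ln (upper x) + log_ratio x\<close>. With the upper bound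
  \<open>e0\<close> for \<open>upper\<close> these are the hypotheses of
  \<open>coboundary_bounded_above\<close> for \<open>ln \<circ> upper\<close>.\<close>

lemma log_gap:
  "integrable nat_measure (\<lambda>x. ln (upper x) - ln (upper (shift x)) + log_ratio x)"
  "AE x in nat_measure. (\<lambda>n. ln (upper ((shift ^^ n) x)) / real n) \<longlonglongrightarrow> 0"
proof -
  have m: "(\<lambda>x. ln (upper x)) \<in> borel_measurable nat_measure" by measurable
  \<comment> \<open>The 0 in the maximum covers points with \<open>upper x = 0\<close>, where
    \<open>ln\<close> has the value 0.\<close>
  have B: "ln (upper x) \<le> max 0 (ln e0)" for x
  proof (cases "upper x = 0")
    case False
    then have "0 < upper x" using upper_nonneg[of x] by simp
    then show ?thesis using upper_less[of x] by (simp add: le_max_iff_disj)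
  qed simp
  have le: "AE x in nat_measure. ln (upper (shift x)) \<le> ln (upper x) + log_ratio x"
    using AE_pos AE_space
  proof eventually_elim
    case (elim x)
    then have "ln (lower x) \<le> ln (upper x)" using lower_le_upper[of x] by simp
    moreover have "ln (lower x) = ln (upper (shift x)) - log_ratio x" using ln_lower[of x] elim by simp
    ultimately show ?case by linarith
  qed
  show "integrable nat_measure (\<lambda>x. ln (upper x) - ln (upper (shift x)) + log_ratio x)"
    "AE x in nat_measure. (\<lambda>n. ln (upper ((shift ^^ n) x)) / real n) \<longlonglongrightarrow> 0"
    by (rule ergodic.coboundary_bounded_above[OF m B integral_log_ratio(1) _ le]; simp)+
qed

text \<open>Interval integrals run over open intervals, whereas the tiling uses half-open ones with
  a Borel integrand; the two differ on a null set.\<close>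

lemma curv_integrals:
  assumes x: "x \<in> F" and v [measurable]: "v \<in> borel_measurable borel"
    and eq: "AE t in lborel. 0 < t \<and> t < e0 \<longrightarrow> curv x t = v t" and cd: "0 \<le> c" "c \<le> d" "d \<le> e0"
  shows "interval_lebesgue_integrable lebesgue c d (curv x) \<longleftrightarrow> set_integrable lborel {c<..d} v"
    and "(LINT t=c..d|lebesgue. curv x t) = (LINT t:{c<..d}|lborel. v t)"
    and "(\<integral>\<^sup>+ t\<in>{c<..<d}. ennreal \<bar>curv x t\<bar> \<partial>lebesgue) = (\<integral>\<^sup>+ t. ennreal \<bar>indicator {c<..d} t *\<^sub>R v t\<bar> \<partial>lborel)"
proof -
  have ne: "AE t in lborel. t \<noteq> d" by (rule AE_lborel_singleton)
  have ae: "AE t in lborel. indicator {c<..<d} t *\<^sub>R curv x t = indicator {c<..d} t *\<^sub>R v t"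
    using eq ne
  proof eventually_elim
    case (elim t)
    then show ?case using cd by (auto simp: indicator_def)
  qed
  have m: "(\<lambda>t. indicator {c<..d} t *\<^sub>R v t) \<in> borel_measurable borel" by measurable
  note e = lebesgue_AE_eq_borel[OF m ae]
  show "interval_lebesgue_integrable lebesgue c d (curv x) \<longleftrightarrow> set_integrable lborel {c<..d} v"
    using e(1) cd by (simp add: interval_lebesgue_integrable_def set_integrable_def)
  show "(LINT t=c..d|lebesgue. curv x t) = (LINT t:{c<..d}|lborel. v t)"
    using e(2) cd by (simp add: interval_lebesgue_integral_def set_lebesgue_integral_def)
  show "(\<integral>\<^sup>+ t\<in>{c<..<d}. ennreal \<bar>curv x t\<bar> \<partial>lebesgue) = (\<integral>\<^sup>+ t. ennreal \<bar>indicator {c<..d} t *\<^sub>R v t\<bar> \<partial>lborel)"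
    unfolding nn_integral_completion
  proof (rule nn_integral_cong_AE)
    show "AE t in lborel. ennreal \<bar>curv x t\<bar> * indicator {c<..<d} t = ennreal \<bar>indicator {c<..d} t *\<^sub>R v t\<bar>"
      using ae by eventually_elim (auto simp: indicator_def split: if_splits)
  qed
qed

text \<open>Composing with a retraction onto the parameter interval extends the representative to all
  parameters without leaving the product measure space.\<close>

lemma curv_joint_representative:
  obtains u :: "'a \<Rightarrow> real \<Rightarrow> real" where "case_prod u \<in> borel_measurable (nat_measure \<Otimes>\<^sub>M lborel)"
    "AE x in nat_measure. AE t in lborel. 0 < t \<and> t < e0 \<longrightarrow> curv x t = u x t"
proof -
  define L where "L = restrict_space lborel {0<..<e0}"
  have pm: "(\<lambda>(x, \<epsilon>). parallel_curvature k F \<epsilon> (A x \<epsilon>)) \<in> borel_measurable (completion (nat_measure \<Otimes>\<^sub>M L))"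
    using measurable_net by (simp add: measurable_net_def nat_measure_def L_def)
  obtain p where p: "p \<in> borel_measurable (nat_measure \<Otimes>\<^sub>M L)"
      "AE z in nat_measure \<Otimes>\<^sub>M L. (\<lambda>(x, \<epsilon>). parallel_curvature k F \<epsilon> (A x \<epsilon>)) z = p z"
    using completion_ex_borel_measurable_real[OF pm] by blast
  interpret L: sigma_finite_measure L
    unfolding L_def by (rule sigma_finite_measure_restrict_space[OF sigma_finite_lborel]) simp
  interpret NL: pair_sigma_finite nat_measure L ..
  have ae: "AE x in nat_measure. AE t in L. parallel_curvature k F t (A x t) = p (x, t)"
    using NL.AE_pair[OF p(2)] by simp
  \<comment> \<open>The value e0/2 outside the interval is an arbitrary admissible parameter; the
    representative is compared with the curvature only for 0 < t < e0.\<close>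
  define pr where "pr t = (if 0 < t \<and> t < e0 then t else e0 / 2)" for t
  have pr: "pr \<in> lborel \<rightarrow>\<^sub>M L"
    unfolding L_def
  proof (rule measurable_restrict_space2)
    show "pr \<in> space lborel \<rightarrow> {0<..<e0}" using e0_pos by (auto simp: pr_def)
    show "pr \<in> lborel \<rightarrow>\<^sub>M lborel" unfolding pr_def by measurable
  qed
  define u where "u x t = inverse (t ^ k) * p (x, pr t) * inverse t" for x t
  have "(\<lambda>z. (fst z, pr (snd z))) \<in> nat_measure \<Otimes>\<^sub>M lborel \<rightarrow>\<^sub>M nat_measure \<Otimes>\<^sub>M L"
    by (intro measurable_Pair measurable_fst measurable_compose[OF measurable_snd pr])
  from measurable_compose[OF this p(1)]
  have [measurable]: "(\<lambda>z. p (fst z, pr (snd z))) \<in> borel_measurable (nat_measure \<Otimes>\<^sub>M lborel)" .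
  have "case_prod u \<in> borel_measurable (nat_measure \<Otimes>\<^sub>M lborel)"
    unfolding u_def case_prod_beta' by measurable
  moreover have "AE x in nat_measure. AE t in lborel. 0 < t \<and> t < e0 \<longrightarrow> curv x t = u x t"
    using ae
  proof eventually_elim
    case (elim x)
    then have "AE t in lborel. t \<in> {0<..<e0} \<longrightarrow> parallel_curvature k F t (A x t) = p (x, t)"
      unfolding L_def by (subst (asm) AE_restrict_space_iff) auto
    then show ?case
      by eventually_elim (simp add: scaled_curvature_def u_def pr_def)
  qed
  ultimately show ?thesis by (rule that)
qed

section \<open>The inner integral of the constant and its absolute version\<close>

definition curv_integral :: "'a \<Rightarrow> real" where
  "curv_integral x = (LINT t=lower x..upper x|lebesgue. curv x t)"

definition curv_abs_integral :: "'a \<Rightarrow> ennreal" where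
  "curv_abs_integral x = (\<integral>\<^sup>+ t\<in>{lower x<..<upper x}. ennreal \<bar>curv x t\<bar> \<partial>lebesgue)"

lemma curv_integral_representative:
  assumes "x \<in> F" "v \<in> borel_measurable borel" "AE t in lborel. 0 < t \<and> t < e0 \<longrightarrow> curv x t = v t"
  shows "curv_integral x = (LINT t:{lower x<..upper x}|lborel. v t)"
    and "curv_abs_integral x = (\<integral>\<^sup>+ t. ennreal \<bar>indicator {lower x<..upper x} t *\<^sub>R v t\<bar> \<partial>lborel)"
  using curv_integrals[OF assms lower_nonneg[OF assms(1)] lower_le_upper[OF assms(1)] less_imp_le[OF upper_less]]
  by (simp_all only: curv_integral_def curv_abs_integral_def)

text \<open>Sections of the joint representative are Borel. Its parametrised integrals are
  measurable by Fubini, and completeness of \<open>nat_measure\<close> passes this on to the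
  integrals of \<open>curv\<close>, which agree with them almost everywhere.\<close>

lemma AE_curv_representative:
  "AE x in nat_measure. \<exists>v\<in>borel_measurable borel. AE t in lborel. 0 < t \<and> t < e0 \<longrightarrow> curv x t = v t"
  and curv_integral_measurable [measurable]: "curv_integral \<in> borel_measurable nat_measure"
  and curv_abs_integral_measurable [measurable]: "curv_abs_integral \<in> borel_measurable nat_measure"
proof -
  obtain u where u [measurable]: "case_prod u \<in> borel_measurable (nat_measure \<Otimes>\<^sub>M lborel)"
    and eq: "AE x in nat_measure. AE t in lborel. 0 < t \<and> t < e0 \<longrightarrow> curv x t = u x t"
    by (rule curv_joint_representative)
  have ux: "u x \<in> borel_measurable borel" if "x \<in> F" for x
  proof -
    have "(\<lambda>t. (x, t)) \<in> lborel \<rightarrow>\<^sub>M nat_measure \<Otimes>\<^sub>M lborel" using that by simp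
    from measurable_compose[OF this u] show ?thesis by simp
  qed
  show "AE x in nat_measure. \<exists>v\<in>borel_measurable borel. AE t in lborel. 0 < t \<and> t < e0 \<longrightarrow> curv x t = v t"
    using eq AE_space by eventually_elim (use ux in auto)
  have ind: "(\<lambda>(x, t). indicator {lower x<..upper x} t *\<^sub>R u x t) = (\<lambda>(x, t). if lower x < t \<and> t \<le> upper x then u x t else 0)"
    by (auto simp: indicator_def fun_eq_iff)
  have m [measurable]: "(\<lambda>(x, t). indicator {lower x<..upper x} t *\<^sub>R u x t) \<in> borel_measurable (nat_measure \<Otimes>\<^sub>M lborel)"
    unfolding ind by measurable
  show "curv_integral \<in> borel_measurable nat_measure"
  proof (rule measurable_nat_measure_AE)
    show "(\<lambda>x. LINT t|lborel. indicator {lower x<..upper x} t *\<^sub>R u x t) \<in> borel_measurable nat_measure" by measurable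
    show "AE x in nat_measure. curv_integral x = (LINT t|lborel. indicator {lower x<..upper x} t *\<^sub>R u x t)"
      using eq AE_space
    proof eventually_elim
      case (elim x)
      then show ?case using curv_integral_representative(1)[of x "u x"] ux[of x] by (simp add: set_lebesgue_integral_def)
    qed
  qed simp
  show "curv_abs_integral \<in> borel_measurable nat_measure"
  proof (rule measurable_nat_measure_AE)
    show "(\<lambda>x. \<integral>\<^sup>+ t. ennreal \<bar>indicator {lower x<..upper x} t *\<^sub>R u x t\<bar> \<partial>lborel) \<in> borel_measurable nat_measure" by measurable
    show "AE x in nat_measure. curv_abs_integral x = (\<integral>\<^sup>+ t. ennreal \<bar>indicator {lower x<..upper x} t *\<^sub>R u x t\<bar> \<partial>lborel)"
      using eq AE_space
    proof eventually_elim
      case (elim x)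
      then show ?case using curv_integral_representative(2)[of x "u x"] ux[of x] by simp
    qed
  qed simp
qed

lemma curv_abs_integral_finite:
  assumes "DIM('a) \<le> k + 1"
  shows "(\<integral>\<^sup>+ x. curv_abs_integral x \<partial>nat_measure) < \<infinity>"
proof -
  obtain C where C: "0 \<le> C" "\<And>x \<epsilon>. x \<in> F \<Longrightarrow> 0 < \<epsilon> \<Longrightarrow> \<epsilon> < e0 \<Longrightarrow> \<bar>curv x \<epsilon>\<bar> \<le> C / \<epsilon>"
    using curv_bound[OF assms] by blast
  let ?\<phi> = "\<lambda>x. ln (upper x) - ln (upper (shift x)) + log_ratio x"
  have "AE x in nat_measure. curv_abs_integral x \<le> ennreal (C * ?\<phi> x)"
    using AE_pos AE_space
  proof eventually_elim
    case (elim x)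
    then have x: "x \<in> F" by simp
    have "curv_abs_integral x \<le> (\<integral>\<^sup>+ t. ennreal (C / t) * indicator {lower x..upper x} t \<partial>lborel)"
      unfolding curv_abs_integral_def nn_integral_completion
    proof (rule nn_integral_mono)
      fix t
      show "ennreal \<bar>curv x t\<bar> * indicator {lower x<..<upper x} t \<le> ennreal (C / t) * indicator {lower x..upper x} t"
      proof (cases "t \<in> {lower x<..<upper x}")
        case True
        then have "0 < t" "t < e0" using lower_nonneg[OF x] upper_less[of x] by auto
        then show ?thesis using True C(2)[OF x] by (simp add: ennreal_leI)
      qed simp
    qed
    also have "\<dots> = ennreal (C * ln (upper x) - C * ln (lower x))"
    proof (rule nn_integral_FTC_Icc)
      show "((\<lambda>t. C * ln t) has_real_derivative C / t) (at t)" if "t \<in> {lower x..upper x}" for t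
        using that elim by (auto intro!: derivative_eq_intros)
    qed (use lower_le_upper[OF x] elim C(1) in auto)
    also have "C * ln (upper x) - C * ln (lower x) = C * ?\<phi> x"
    proof -
      have "ln (upper x) - ln (lower x) = ?\<phi> x" using ln_lower[OF x] elim by linarith
      then show ?thesis unfolding right_diff_distrib[symmetric] by (rule arg_cong)
    qed
    finally show ?case .
  qed
  then have "(\<integral>\<^sup>+ x. curv_abs_integral x \<partial>nat_measure) \<le> (\<integral>\<^sup>+ x. ennreal (C * ?\<phi> x) \<partial>nat_measure)"
    by (rule nn_integral_mono_AE)
  also have "\<dots> \<le> (\<integral>\<^sup>+ x. ennreal (norm (C * ?\<phi> x)) \<partial>nat_measure)"
    by (intro nn_integral_mono ennreal_leI) simp
  also have "\<dots> < \<infinity>"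
  proof -
    have "integrable nat_measure (\<lambda>x. C * ?\<phi> x)" using log_gap(1) by (rule integrable_mult_right)
    then show ?thesis unfolding integrable_iff_bounded by (rule conjunct2)
  qed
  finally show ?thesis .
qed

text \<open>For fixed x the comparison sequence \<delta> n is the product of the first n ratios
  along the orbit times \<open>upper\<close> at its n-th point. Between two consecutive members the
  error is at most the value of the integrable function \<open>G\<close> at that point, hence o(n).
  Integrability is part of the claim because the integral of a non-integrable function is 0 by
  default.\<close>

theorem average_curvature_limit:
  assumes fin: "(\<integral>\<^sup>+ x. curv_abs_integral x \<partial>nat_measure) < \<infinity>"
  shows "AE x in nat_measure.
    (\<forall>\<delta>. 0 < \<delta> \<and> \<delta> < upper x \<longrightarrow> interval_lebesgue_integrable lebesgue \<delta> (upper x) (curv x)) \<and>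
    ((\<lambda>\<delta>. 1 / \<bar>ln \<delta>\<bar> * (LINT t=\<delta>..upper x|lebesgue. curv x t)) \<longlongrightarrow>
      (LINT y|nat_measure. curv_integral y) / measure nat_measure F / mean_log_ratio) (at_right 0)"
proof -
  define G where "G x = enn2real (curv_abs_integral x)" for x
  have Gm [measurable]: "G \<in> borel_measurable nat_measure" unfolding G_def by measurable
  have ae_fin: "AE x in nat_measure. curv_abs_integral x \<noteq> \<infinity>"
    using fin by (intro nn_integral_PInf_AE) auto
  have G_int: "integrable nat_measure G"
  proof (rule integrableI_nonneg)
    have "(\<integral>\<^sup>+ x. ennreal (G x) \<partial>nat_measure) \<le> (\<integral>\<^sup>+ x. curv_abs_integral x \<partial>nat_measure)"
      unfolding G_def by (intro nn_integral_mono) (simp add: ennreal_enn2real_if)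
    then show "(\<integral>\<^sup>+ x. ennreal (G x) \<partial>nat_measure) < \<infinity>" using fin by (rule le_less_trans)
  qed (auto simp: G_def)
  have rep: "set_integrable lborel {lower x<..upper x} v" "G x = (LINT t:{lower x<..upper x}|lborel. \<bar>v t\<bar>)"
    if x: "x \<in> F" and v: "v \<in> borel_measurable borel"
      and eq: "AE t in lborel. 0 < t \<and> t < e0 \<longrightarrow> curv x t = v t" and ne: "curv_abs_integral x \<noteq> \<infinity>" for x v
  proof -
    note c = curv_integral_representative(2)[OF x v eq]
    have m [measurable]: "v \<in> borel_measurable borel" by (rule v)
    show i: "set_integrable lborel {lower x<..upper x} v"
      unfolding set_integrable_def integrable_iff_bounded using c ne by (auto simp: less_top)
    have "curv_abs_integral x = ennreal (LINT t|lborel. \<bar>indicator {lower x<..upper x} t *\<^sub>R v t\<bar>)"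
      unfolding c using i unfolding set_integrable_def by (intro nn_integral_eq_integral integrable_abs) auto
    then have "G x = (LINT t|lborel. \<bar>indicator {lower x<..upper x} t *\<^sub>R v t\<bar>)"
      by (simp add: G_def)
    also have "\<dots> = (LINT t:{lower x<..upper x}|lborel. \<bar>v t\<bar>)"
      unfolding set_lebesgue_integral_def by (intro Bochner_Integration.integral_cong) (auto simp: abs_mult)
    finally show "G x = (LINT t:{lower x<..upper x}|lborel. \<bar>v t\<bar>)" .
  qed
  have f_int: "integrable nat_measure curv_integral"
  proof (rule Bochner_Integration.integrable_bound[OF G_int])
    show "AE x in nat_measure. norm (curv_integral x) \<le> norm (G x)"
      using AE_curv_representative ae_fin AE_space
    proof eventually_elim
      case (elim x)
      then obtain v where v: "v \<in> borel_measurable borel" "AE t in lborel. 0 < t \<and> t < e0 \<longrightarrow> curv x t = v t" by blast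
      have x: "x \<in> F" using elim by simp
      show ?case
        using set_integral_norm_bound[OF rep(1)[OF x v elim(2)]] rep(2)[OF x v elim(2)]
          curv_integral_representative(1)[OF x v] by simp
    qed
  qed measurable
  show ?thesis
    using ergodic.AE_iterates[OF AE_pos] ergodic.AE_iterates[OF AE_curv_representative] ergodic.AE_iterates[OF ae_fin]
      ergodic.birkhoff[OF f_int] ergodic.birkhoff[OF integral_log_ratio(1)]
      ergodic.AE_orbit_over_n_tendsto_zero[OF G_int] log_gap(2) AE_space
  proof eventually_elim
    case (elim x)
    define y where "y n = (shift ^^ n) x" for n
    have y0: "y 0 = x" and y_Suc: "y (Suc n) = shift (y n)" for n by (simp_all add: y_def)
    have yF: "y n \<in> F" for n by (induction n) (use elim(8) shift_in in \<open>auto simp: y0 y_Suc\<close>)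
    have pos: "0 < upper (y n)" "0 < lower (y n)" and fin_n: "curv_abs_integral (y n) \<noteq> \<infinity>" for n
      using elim(1,3) by (simp_all add: y_def)
    have "\<forall>n. \<exists>v\<in>borel_measurable borel. AE t in lborel. 0 < t \<and> t < e0 \<longrightarrow> curv (y n) t = v t"
      using elim(2) by (simp add: y_def)
    \<comment> \<open>A representative is chosen for each iterate separately; homogeneity then
      relates consecutive ones outside a null set of parameters.\<close>
    then obtain v where v: "\<And>n. v n \<in> borel_measurable borel"
        "\<And>n. AE t in lborel. 0 < t \<and> t < e0 \<longrightarrow> curv (y n) t = v n t" by metis
    define q where "q n = r (idx (y n))" for n
    define up where "up n = upper (y n)" for n
    have q: "0 < q n" "q n < 1" for n using idx[OF yF[of n]] r01 by (auto simp: q_def)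
    have up: "0 < up n" for n using pos by (simp add: up_def)
    have lo: "lower (y n) = q n * up (Suc n)" for n by (simp add: lower_def q_def up_def y_Suc)
    have le: "q n * up (Suc n) \<le> up n" for n using lower_le_upper[OF yF[of n]] by (simp add: lo up_def)
    have hom: "AE t in lborel. 0 < t \<and> t < q n * up (Suc n) \<longrightarrow> v n t = 1 / q n * v (Suc n) (t / q n)" for n
    proof -
      have sc: "AE t in lborel. 0 < 1 / q n * t \<and> 1 / q n * t < e0 \<longrightarrow> curv (y (Suc n)) (1 / q n * t) = v (Suc n) (1 / q n * t)"
        by (rule AE_lborel_scale[OF v(2)]) (use q(1)[of n] in simp)
      show ?thesis
        using AE_curv_homogeneous[OF yF[of n]] v(2)[of n] sc
      proof eventually_elim
        case (elim t)
        show ?case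
        proof
          assume t: "0 < t \<and> t < q n * up (Suc n)"
          then have t1: "0 < t" "t < lower (y n)" by (simp_all add: lo)
          note sl = scale_less_upper[OF yF[of n] t1]
          have "v n t = curv (y n) t" using elim(2) t1(1) sl(4) by simp
          also have "\<dots> = 1 / q n * curv (y (Suc n)) (t / q n)" using elim(1) t1 by (simp add: q_def y_Suc)
          also have "curv (y (Suc n)) (t / q n) = v (Suc n) (t / q n)"
            using elim(3) sl(1,3) by (simp add: q_def)
          finally show "v n t = 1 / q n * v (Suc n) (t / q n)" .
        qed
      qed
    qed
    have int: "set_integrable lborel {q n * up (Suc n)<..up n} (v n)" for n
      using rep(1)[OF yF v fin_n, of n] by (simp add: lo up_def)
    have G: "G (y n) = (LINT t:{q n * up (Suc n)<..up n}|lborel. \<bar>v n t\<bar>)" for n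
      using rep(2)[OF yF v fin_n, of n] by (simp add: lo up_def)
    have f: "curv_integral (y n) = (LINT t:{q n * up (Suc n)<..up n}|lborel. v n t)" for n
      using curv_integral_representative(1)[OF yF v, of n] by (simp add: lo up_def)
    define \<delta> where "\<delta> n = (\<Prod>i<n. q i) * up n" for n
    define H where "H t = (LINT s:{t<..up 0}|lborel. v 0 s)" for t
    have int0: "set_integrable lborel {\<delta> n<..up 0} (v 0)" for n
      unfolding \<delta>_def by (rule orbit_integral(1)[where u = v and up = up and q = q, OF v(1) up q(1) le hom int])
    have H: "\<bar>H t - (\<Sum>i<n. curv_integral (y i))\<bar> \<le> G (y n)" if "\<delta> (Suc n) \<le> t" "t \<le> \<delta> n" for n t
      unfolding H_def f G
      by (rule orbit_integral(2)[where u = v and up = up and q = q, OF v(1) up q(1) le hom int])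
        (use that in \<open>simp_all only: \<delta>_def\<close>)
    have prod_pos: "0 < (\<Prod>i<n. q i)" for n using q(1) by (intro prod_pos) simp
    have \<delta>_pos: "0 < \<delta> n" for n using prod_pos up by (simp add: \<delta>_def)
    have \<delta>_dec: "\<delta> (Suc n) \<le> \<delta> n" for n
      using mult_left_mono[OF le[of n] less_imp_le[OF prod_pos[of n]]] by (simp add: \<delta>_def mult.assoc)
    \<comment> \<open>The logarithm splits into a Birkhoff sum of \<open>log_ratio\<close> and
      \<open>ln (up n)\<close>; the latter is o(n) by \<open>log_gap\<close>, which leaves the rate
      \<open>mean_log_ratio\<close>.\<close>
    have ln_\<delta>: "- ln (\<delta> n) = (\<Sum>i<n. log_ratio (y i)) - ln (up n)" for n
    proof -
      have "ln (\<Prod>i<n. q i) = (\<Sum>i<n. ln (q i))" using q(1) by (intro ln_prod) (auto simp: less_imp_neq[THEN not_sym])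
      also have "\<dots> = - (\<Sum>i<n. log_ratio (y i))"
        unfolding sum_negf[symmetric]
      proof (rule sum.cong)
        fix i
        have "ln (q i) < 0" using q[of i] by simp
        then show "ln (q i) = - log_ratio (y i)" by (simp add: q_def)
      qed simp
      finally have "ln (\<Prod>i<n. q i) = - (\<Sum>i<n. log_ratio (y i))" .
      moreover have "ln (\<delta> n) = ln (\<Prod>i<n. q i) + ln (up n)"
        unfolding \<delta>_def using prod_pos[of n] up[of n] by (metis ln_mult less_irrefl)
      ultimately show ?thesis by linarith
    qed
    have lim_\<delta>: "(\<lambda>n. - ln (\<delta> n) / real n) \<longlonglongrightarrow> mean_log_ratio"
    proof -
      have "(\<lambda>n. (\<Sum>i<n. log_ratio (y i)) / real n) \<longlonglongrightarrow> mean_log_ratio"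
        using elim(5) measure_F_pos by (simp add: ergodic.birkhoff_sum_def integral_log_ratio(2) y_def)
      moreover have "(\<lambda>n. ln (up n) / real n) \<longlonglongrightarrow> 0" using elim(7) by (simp add: up_def y_def)
      ultimately have "(\<lambda>n. (\<Sum>i<n. log_ratio (y i)) / real n - ln (up n) / real n) \<longlonglongrightarrow> mean_log_ratio - 0"
        by (rule tendsto_diff)
      then show ?thesis by (simp add: ln_\<delta> diff_divide_distrib)
    qed
    have lim_f: "(\<lambda>n. (\<Sum>i<n. curv_integral (y i)) / real n) \<longlonglongrightarrow> (LINT y|nat_measure. curv_integral y) / measure nat_measure F"
      using elim(4) by (simp add: ergodic.birkhoff_sum_def y_def)
    have lim_G: "(\<lambda>n. G (y n) / real n) \<longlonglongrightarrow> 0" using elim(6) by (simp add: y_def)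
    have \<delta>_small: "\<exists>n. \<delta> n \<le> t" if "0 < t" for t
      by (rule tendsto_average_at_right(1)[OF \<delta>_pos \<delta>_dec lim_\<delta> mean_log_ratio_pos lim_f lim_G H that])
    have avg: "((\<lambda>t. 1 / \<bar>ln t\<bar> * H t) \<longlongrightarrow>
        (LINT y|nat_measure. curv_integral y) / measure nat_measure F / mean_log_ratio) (at_right 0)"
      by (rule tendsto_average_at_right(2)[OF \<delta>_pos \<delta>_dec lim_\<delta> mean_log_ratio_pos lim_f lim_G H])
    have up0: "up 0 = upper x" by (simp add: up_def y0)
    have conv: "interval_lebesgue_integrable lebesgue t (upper x) (curv x) \<longleftrightarrow> set_integrable lborel {t<..up 0} (v 0)"
        "(LINT s=t..upper x|lebesgue. curv x s) = H t" if "0 < t" "t < upper x" for t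
      using curv_integrals[OF yF[of 0] v(1)[of 0] v(2)[of 0], of t "upper x"] that upper_less[of x]
      by (simp_all add: y0 up0 H_def)
    show ?case
    proof (intro conjI allI impI)
      fix t assume t: "0 < t \<and> t < upper x"
      obtain n where n: "\<delta> n \<le> t" using \<delta>_small[of t] t by blast
      have "set_integrable lborel {t<..up 0} (v 0)" by (rule set_integrable_subset[OF int0[of n]]) (use n in auto)
      then show "interval_lebesgue_integrable lebesgue t (upper x) (curv x)" using conv(1) t by blast
    next
      have "\<forall>\<^sub>F t in at_right 0. t \<in> {0<..<upper x}"
        using up[of 0] up0 by (intro eventually_at_right_real) simp
      then have "\<forall>\<^sub>F t in at_right 0. 1 / \<bar>ln t\<bar> * H t = 1 / \<bar>ln t\<bar> * (LINT s=t..upper x|lebesgue. curv x s)"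
        by eventually_elim (use conv(2) in auto)
      then show "((\<lambda>\<delta>. 1 / \<bar>ln \<delta>\<bar> * (LINT t=\<delta>..upper x|lebesgue. curv x t)) \<longlongrightarrow>
          (LINT y|nat_measure. curv_integral y) / measure nat_measure F / mean_log_ratio) (at_right 0)"
        by (rule Lim_transform_eventually[OF avg])
    qed
  qed
qed

end

context iterated_function_system_osc
begin

lemma AE_first_index: "AE x in nat_measure. first_index N S F x = idx x"
  using AE_unique_index AE_space
proof eventually_elim
  case (elim x)
  then show ?case
    unfolding first_index_def using idx[of x] by (intro the_equality) auto
qed

end

theorem theorem3p2p1:
  fixes N k :: nat
    and S :: "nat \<Rightarrow> 'a::euclidean_space \<Rightarrow> 'a"
    and r :: "nat \<Rightarrow> real"
    and F J :: "'a set"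
    and A :: "'a \<Rightarrow> real \<Rightarrow> 'a set"
    and D a \<epsilon>0 b :: real
  defines "b \<equiv> net_const a \<epsilon>0 J"
  defines "upper \<equiv> (\<lambda>x. inverse b * infdist x (- J))"
    and "lower \<equiv> (\<lambda>x. inverse b * infdist x (- (S (first_index N S F x) ` J)))"
    and "\<mu> \<equiv> restrict_space (hausdorff_measure D) F"
  defines "abs_conv \<equiv>
      (\<integral>\<^sup>+ y. (\<integral>\<^sup>+ \<epsilon>\<in>{lower y<..<upper y}.
        ennreal \<bar>scaled_curvature k F A y \<epsilon>\<bar> \<partial>lebesgue) \<partial>\<mu>) < \<infinity>"
  assumes "k \<le> DIM('a)"
    and "2 \<le> N"
    and "\<And>j. j \<in> {1..N} \<Longrightarrow> contracting_similarity (r j) (S j)"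
    and "self_similar_set N S F"
    and "hausdorff_dim F = D"
    and "strong_open_set_condition N S F J"
    and "k + 2 \<le> DIM('a) \<Longrightarrow> neighborhood_regular F"
    and "1 < a" and "0 < \<epsilon>0"
    and "locally_homogeneous_net N S r F J a \<epsilon>0 A"
    and "measurable_net k D F \<epsilon>0 A"
  shows "(DIM('a) \<le> k + 1 \<longrightarrow> abs_conv) \<and>
    ((k + 2 \<le> DIM('a) \<longrightarrow> abs_conv) \<longrightarrow>
      (AE x in \<mu>.
        (\<forall>\<delta>::real. 0 < \<delta> \<and> \<delta> < upper x \<longrightarrow>
          interval_lebesgue_integrable lebesgue \<delta> (upper x) (scaled_curvature k F A x)) \<and>
        ((\<lambda>\<delta>. 1 / \<bar>ln \<delta>\<bar> * (LINT \<epsilon>=\<delta>..upper x|lebesgue. scaled_curvature k F A x \<epsilon>))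
          \<longlongrightarrow>
          inverse (measure (hausdorff_measure D) F) *
          inverse (\<Sum>j=1..N. r j powr D * \<bar>ln (r j)\<bar>) *
          (LINT y|\<mu>. LINT \<epsilon>=lower y..upper y|lebesgue. scaled_curvature k F A y \<epsilon>))
          (at_right 0)))"
proof -
  interpret iterated_function_system_osc N S r F J
    by unfold_locales (use assms in auto)
  \<comment> \<open>From here on Moran's equation is available for the Hausdorff dimension
    \<open>D\<close> of the statement.\<close>
  have D: "D = sim_dim" using assms hausdorff_dim_F by simp
  interpret net: curvature_net N S r F J k a \<epsilon>0 A
    by unfold_locales (use assms D in auto)
  have \<mu>: "\<mu> = nat_measure" by (simp add: \<mu>_def D nat_measure_def)
  have up: "upper = net.upper" by (simp add: upper_def b_def net.upper_def[abs_def] net.b_def)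
  \<comment> \<open>The statement uses \<open>first_index\<close> and the proof the least index; the
    two differ only on overlaps of copies, a null set.\<close>
  have ae: "AE x in \<mu>. lower x = net.lower x"
    unfolding \<mu> using AE_first_index AE_space
  proof eventually_elim
    case (elim x)
    then show ?case by (simp add: lower_def b_def net.lower_eq net.b_def)
  qed
  have abs: "abs_conv \<longleftrightarrow> (\<integral>\<^sup>+ x. net.curv_abs_integral x \<partial>nat_measure) < \<infinity>"
  proof -
    have "(\<integral>\<^sup>+ y. (\<integral>\<^sup>+ \<epsilon>\<in>{lower y<..<upper y}. ennreal \<bar>scaled_curvature k F A y \<epsilon>\<bar> \<partial>lebesgue) \<partial>\<mu>)
        = (\<integral>\<^sup>+ x. net.curv_abs_integral x \<partial>\<mu>)"
      by (rule nn_integral_cong_AE) (use ae in eventually_elim, simp add: net.curv_abs_integral_def up)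
    then show ?thesis by (simp add: abs_conv_def \<mu>)
  qed
  have int: "(LINT y|\<mu>. LINT \<epsilon>=lower y..upper y|lebesgue. scaled_curvature k F A y \<epsilon>) =
      (LINT y|nat_measure. net.curv_integral y)"
  proof -
    have eq: "AE y in nat_measure. (LINT \<epsilon>=lower y..upper y|lebesgue. scaled_curvature k F A y \<epsilon>) = net.curv_integral y"
      using ae unfolding \<mu> by eventually_elim (simp add: net.curv_integral_def up)
    note m = net.curv_integral_measurable
    show ?thesis
      unfolding \<mu> by (rule integral_cong_AE[OF measurable_nat_measure_AE[OF m eq] m eq]) simp
  qed
  have mF: "measure (hausdorff_measure D) F = measure nat_measure F"
    using F_sets by (simp add: nat_measure_def D measure_restrict_space)
  have const: "inverse (measure (hausdorff_measure D) F) * inverse (\<Sum>j=1..N. r j powr D * \<bar>ln (r j)\<bar>) *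
      (LINT y|\<mu>. LINT \<epsilon>=lower y..upper y|lebesgue. scaled_curvature k F A y \<epsilon>) =
      (LINT y|nat_measure. net.curv_integral y) / measure nat_measure F / net.mean_log_ratio"
    unfolding int mF by (simp add: D net.mean_log_ratio_def divide_inverse mult.commute mult.left_commute)
  show ?thesis
  proof (intro conjI impI)
    show "abs_conv" if "DIM('a) \<le> k + 1"
      using net.curv_abs_integral_finite[OF that] by (simp add: abs)
    assume "k + 2 \<le> DIM('a) \<longrightarrow> abs_conv"
    then have "(\<integral>\<^sup>+ x. net.curv_abs_integral x \<partial>nat_measure) < \<infinity>"
      using net.curv_abs_integral_finite abs by (cases "k + 2 \<le> DIM('a)") auto
    from net.average_curvature_limit[OF this]
    show "AE x in \<mu>.
        (\<forall>\<delta>::real. 0 < \<delta> \<and> \<delta> < upper x \<longrightarrow>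
          interval_lebesgue_integrable lebesgue \<delta> (upper x) (scaled_curvature k F A x)) \<and>
        ((\<lambda>\<delta>. 1 / \<bar>ln \<delta>\<bar> * (LINT \<epsilon>=\<delta>..upper x|lebesgue. scaled_curvature k F A x \<epsilon>))
          \<longlongrightarrow>
          inverse (measure (hausdorff_measure D) F) *
          inverse (\<Sum>j=1..N. r j powr D * \<bar>ln (r j)\<bar>) *
          (LINT y|\<mu>. LINT \<epsilon>=lower y..upper y|lebesgue. scaled_curvature k F A y \<epsilon>))
          (at_right 0)"
      unfolding const by (simp only: \<mu> up)
  qed
qed

end
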